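(* Let $1<p\le n$ and suppose $E$ is a positive solution of $\mathcal L_{A,p}(E)=\mu$ in $\Omega$, where $d\mu=f\,dx$ with $0\le f\in C^\infty(\overline\Omega)$ nonzero. (i) Then $$\left(\frac{p-1}{p}\right)^p\int_\Omega\frac{|\nabla E|_A^p}{E^p}|u|^p\,dx+\left(\frac{p-1}{p}\right)^{p-1}\int_\Omega\frac{|u|^p}{E^{p-1}}\,d\mu\ \le\ \int_\Omega|\nabla u|_A^p\,dx\qquad\text{for all }u\in W_0^{1,p}(\Omega),$$ and consequently $$\left(\frac{p-1}{p}\right)^p\int_\Omega\frac{|\nabla E|_A^p}{E^p}|u|^p\,dx\ \le\ \int_\Omega|\nabla u|_A^p\,dx\qquad\text{for all }u\in W_0^{1,p}(\Omega).\tag{$*$}$$ (ii) Suppose $E=0$ on $\partial\Omega$. Then $( * )$ is optimal (the constant $\left(\frac{p-1}{p}\right)^p$ cannot be replaced by a larger one). (iii) Suppose $E=0$ on $\partial\Omega$. If one fixes the optimal constant from part (ii), then the other constant in the first inequality of (i) is also optimal, i.e. $$\inf\left\{\frac{\int_\Omega|\nabla u|_A^p\,dx-\left(\frac{p-1}{p}\right)^p\int_\Omega\frac{|\nabla E|_A^p}{E^p}|u|^p\,dx}{\int_\Omega\frac{|u|^p}{E^{p-1}}\,d\mu}:\ u\in W_0^{1,p}(\Omega),\ u\neq0\right\}=\left(\frac{p-1}{p}\right)^{p-1}.$$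
   Context: $\Omega\subset\mathbb{R}^n$ is a bounded connected domain with smooth boundary. $A(x)=(a^{i,j}(x))$ is an $n\times n$ symmetric, uniformly positive definite matrix with $a^{i,j}\in C^\infty(\overline\Omega)$. For $\xi\in\mathbb{R}^n$, $|\xi|_A^2:=A(x)\xi\cdot\xi$. For $1<p\le n$, $\mathcal L_{A,p}(E):=-\mathrm{div}(|\nabla E|_A^{p-2}A\nabla E)$ (in the distributional sense). In the infimum, quotients with zero denominator are disregarded. *)

theory Defs
  imports "HOL-Analysis.Analysis"
begin

section \<open>Smooth functions and smooth boundaries\<close>

definition partial :: "'n::finite \<Rightarrow> (real^'n \<Rightarrow> real) \<Rightarrow> real^'n \<Rightarrow> real" where
  "partial i f x = frechet_derivative f (at x) (axis i 1)"

definition grad :: "(real^'n::finite \<Rightarrow> real) \<Rightarrow> real^'n \<Rightarrow> real^'n" where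
  "grad f x = (\<chi> i. partial i f x)"

primrec iter_partial :: "'n::finite list \<Rightarrow> (real^'n \<Rightarrow> real) \<Rightarrow> real^'n \<Rightarrow> real" where
  "iter_partial [] f = f"
| "iter_partial (i # is) f = partial i (iter_partial is f)"

text \<open>The following is only used for open \<open>U\<close>. Every iterated partial derivative is required to be
  differentiable, hence all of them are continuous and \<open>f\<close> is of class \<open>C\<^sup>\<infinity>\<close> on \<open>U\<close>.\<close>

definition smooth_on :: "(real^'n::finite) set \<Rightarrow> (real^'n \<Rightarrow> real) \<Rightarrow> bool" where
  "smooth_on U f \<longleftrightarrow> (\<forall>is. \<forall>x\<in>U. iter_partial is f differentiable (at x))"

text \<open>The space of functions smooth up to the boundary: all derivatives extend continuously from
  \<open>\<Omega>\<close> to its closure. Only the values of \<open>f\<close> in \<open>\<Omega>\<close> matter.\<close>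

definition smooth_up_to_boundary :: "(real^'n::finite) set \<Rightarrow> (real^'n \<Rightarrow> real) \<Rightarrow> bool" where
  "smooth_up_to_boundary \<Omega> f \<longleftrightarrow>
     smooth_on \<Omega> f \<and>
     (\<forall>is. \<exists>g. continuous_on (closure \<Omega>) g \<and> (\<forall>x\<in>\<Omega>. g x = iter_partial is f x))"

text \<open>Near each boundary point, \<open>\<Omega>\<close> is the sublevel set of a smooth function without critical points.\<close>

definition smooth_boundary :: "(real^'n::finite) set \<Rightarrow> bool" where
  "smooth_boundary \<Omega> \<longleftrightarrow>
     (\<forall>z\<in>frontier \<Omega>. \<exists>U \<rho>. open U \<and> z \<in> U \<and> smooth_on U \<rho> \<and>
        (\<forall>x\<in>U. grad \<rho> x \<noteq> 0) \<and> \<Omega> \<inter> U = {x\<in>U. \<rho> x < 0})"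

definition test_functions :: "(real^'n::finite) set \<Rightarrow> (real^'n \<Rightarrow> real) set" where
  "test_functions \<Omega> =
     {\<phi>. smooth_on UNIV \<phi> \<and> (\<exists>K. compact K \<and> K \<subseteq> \<Omega> \<and> (\<forall>x. x \<notin> K \<longrightarrow> \<phi> x = 0))}"

section \<open>Sobolev spaces\<close>

text \<open>Elements of the spaces below are functions rather than almost-everywhere equivalence classes.\<close>

definition has_weak_gradient ::
    "(real^'n::finite) set \<Rightarrow> (real^'n \<Rightarrow> real) \<Rightarrow> (real^'n \<Rightarrow> real^'n) \<Rightarrow> bool" where
  "has_weak_gradient \<Omega> u G \<longleftrightarrow>
     (\<forall>K. compact K \<and> K \<subseteq> \<Omega> \<longrightarrow> u absolutely_integrable_on K \<and> G absolutely_integrable_on K) \<and>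
     (\<forall>\<phi>\<in>test_functions \<Omega>. \<forall>i.
        (LINT x|lebesgue_on \<Omega>. u x * partial i \<phi> x) = - (LINT x|lebesgue_on \<Omega>. G x $ i * \<phi> x))"

text \<open>The weak gradient is determined up to null sets; one representative is chosen.\<close>

definition weak_grad :: "(real^'n::finite) set \<Rightarrow> (real^'n \<Rightarrow> real) \<Rightarrow> real^'n \<Rightarrow> real^'n" where
  "weak_grad \<Omega> u = (SOME G. has_weak_gradient \<Omega> u G)"

definition Lp :: "real \<Rightarrow> (real^'n::finite) set \<Rightarrow> (real^'n \<Rightarrow> 'b::euclidean_space) set" where
  "Lp p S = {f. f \<in> borel_measurable (lebesgue_on S) \<and>
                integrable (lebesgue_on S) (\<lambda>x. norm (f x) powr p)}"

definition W1p :: "real \<Rightarrow> (real^'n::finite) set \<Rightarrow> (real^'n \<Rightarrow> real) set" where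
  "W1p p \<Omega> = {u. (\<exists>G. has_weak_gradient \<Omega> u G) \<and> u \<in> Lp p \<Omega> \<and> weak_grad \<Omega> u \<in> Lp p \<Omega>}"

definition W1p_loc :: "real \<Rightarrow> (real^'n::finite) set \<Rightarrow> (real^'n \<Rightarrow> real) set" where
  "W1p_loc p \<Omega> =
     {u. (\<exists>G. has_weak_gradient \<Omega> u G) \<and>
         (\<forall>K. compact K \<and> K \<subseteq> \<Omega> \<longrightarrow> u \<in> Lp p K \<and> weak_grad \<Omega> u \<in> Lp p K)}"

text \<open>The closure of the test functions in the Sobolev norm.\<close>

definition W01p :: "real \<Rightarrow> (real^'n::finite) set \<Rightarrow> (real^'n \<Rightarrow> real) set" where
  "W01p p \<Omega> =
     {u \<in> W1p p \<Omega>. \<forall>\<epsilon>>0. \<exists>\<phi>\<in>test_functions \<Omega>.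
        (LINT x|lebesgue_on \<Omega>. \<bar>u x - \<phi> x\<bar> powr p) +
        (LINT x|lebesgue_on \<Omega>. norm (weak_grad \<Omega> u x - grad \<phi> x) powr p) < \<epsilon>}"

section \<open>The quasilinear equation\<close>

definition A_norm :: "(real^'n::finite \<Rightarrow> real^'n^'n) \<Rightarrow> real^'n \<Rightarrow> real^'n \<Rightarrow> real" where
  "A_norm A x \<xi> = sqrt ((A x *v \<xi>) \<bullet> \<xi>)"

definition admissible_matrix :: "(real^'n::finite) set \<Rightarrow> (real^'n \<Rightarrow> real^'n^'n) \<Rightarrow> bool" where
  "admissible_matrix \<Omega> A \<longleftrightarrow>
     (\<forall>i j. smooth_up_to_boundary \<Omega> (\<lambda>x. A x $ i $ j)) \<and>
     (\<forall>x\<in>\<Omega>. transpose (A x) = A x) \<and>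
     (\<exists>c>0. \<forall>x\<in>\<Omega>. \<forall>\<xi>. (A x *v \<xi>) \<bullet> \<xi> \<ge> c * (norm \<xi>)\<^sup>2)"

text \<open>\<open>E\<close> solves \<open>- div (|\<nabla>E|\<^sub>A\<^sup>p\<^sup>-\<^sup>2 A \<nabla>E) = \<mu>\<close> in the distributional sense. Where \<open>\<nabla>E\<close> vanishes the flux
  is \<open>0\<close>, also for \<open>p < 2\<close>.\<close>

definition weak_solution ::
    "real \<Rightarrow> (real^'n::finite \<Rightarrow> real^'n^'n) \<Rightarrow> (real^'n) set \<Rightarrow> (real^'n) measure
      \<Rightarrow> (real^'n \<Rightarrow> real) \<Rightarrow> bool" where
  "weak_solution p A \<Omega> \<mu> E \<longleftrightarrow>
     E \<in> W1p_loc p \<Omega> \<and>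
     (\<forall>\<phi>\<in>test_functions \<Omega>.
        (LINT x|lebesgue_on \<Omega>.
           (A_norm A x (weak_grad \<Omega> E x) powr (p - 2) *\<^sub>R (A x *v weak_grad \<Omega> E x)) \<bullet> grad \<phi> x)
        = (LINT x|\<mu>. \<phi> x))"

text \<open>\<open>E = 0\<close> on the boundary, either in the Sobolev sense or in the classical pointwise sense;
  neither interior regularity nor finite energy is presupposed in the second case.\<close>

definition zero_on_boundary :: "real \<Rightarrow> (real^'n::finite) set \<Rightarrow> (real^'n \<Rightarrow> real) \<Rightarrow> bool" where
  "zero_on_boundary p \<Omega> E \<longleftrightarrow>
     E \<in> W01p p \<Omega> \<or> (\<forall>z\<in>frontier \<Omega>. (E \<longlongrightarrow> 0) (at z within \<Omega>))"

end

theory Submission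
  imports Defs
begin

text \<open>
  \<^bold>\<open>Part (i).\<close> For a test function \<open>\<phi>\<close> and \<open>\<epsilon> > 0\<close>, the equation is tested with \<open>|\<phi>|\<^sup>p (E + \<epsilon>)\<^sup>1\<^sup>-\<^sup>p\<close>. Its gradient
  contributes \<open>-(p - 1) |\<phi>|\<^sup>p |\<nabla>E|\<^sub>A\<^sup>p (E + \<epsilon>)\<^sup>-\<^sup>p\<close> and a mixed term, which Cauchy-Schwarz for \<open>A\<close> and Young's inequality with
  the weight \<open>(p - 1)/p\<close> bound by \<open>|\<nabla>\<phi>|\<^sub>A\<^sup>p\<close> and a multiple of the same expression (\<open>hardy_pointwise\<close>). This gives the
  inequality for \<open>\<phi>\<close> with \<open>E + \<epsilon>\<close> in place of \<open>E\<close> (\<open>hardy_test_function\<close>), and Fatou's lemma gives it for all of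
  \<open>W\<^sub>0\<^sup>1\<^sup>,\<^sup>p\<close> (\<open>hardy_inequality\<close>). Neither boundedness nor a local lower bound of \<open>E\<close> is used, hence no regularity theory and no
  Harnack inequality.

  \<^bold>\<open>Parts (ii) and (iii).\<close> If \<open>E\<close> vanishes on the boundary, then \<open>C\<^sup>1\<close> functions of \<open>E\<close> that are \<open>0\<close> for small values of \<open>E\<close> are
  admissible in the equation (\<open>cutoff_equation\<close>). By approximation so is \<open>E\<^sup>\<beta>\<close> for \<open>0 < \<beta> \<le> 1\<close>, which yields (\<open>power_identity\<close>)
  \<open>\<beta> T = \<integral> f E\<^sup>\<beta>\<close>, where \<open>T = \<integral> E\<^sup>\<beta>\<^sup>-\<^sup>1 |\<nabla>E|\<^sub>A\<^sup>p\<close>, and \<open>T\<close> is finite and positive. For \<open>u = E\<^sup>\<alpha>\<close> with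
  \<open>\<alpha> = (p - 1 + \<beta>)/p\<close> the energy of \<open>u\<close> is \<open>\<alpha>\<^sup>p T\<close>, the weighted integral with \<open>|\<nabla>E|\<^sub>A\<^sup>p / E\<^sup>p\<close> is \<open>T\<close>, and the one with
  \<open>f / E\<^sup>p\<^sup>-\<^sup>1\<close> is \<open>\<beta> T\<close> (\<open>near_optimal_function\<close>). Hence the Rayleigh quotient in (ii) is \<open>\<alpha>\<^sup>p\<close>, which tends to \<open>((p - 1)/p)\<^sup>p\<close>
  as \<open>\<beta> \<rightarrow> 0\<close>, and the quotient in (iii) is the difference quotient \<open>(\<alpha>\<^sup>p - ((p - 1)/p)\<^sup>p) / \<beta>\<close>, which tends to
  \<open>((p - 1)/p)\<^sup>p\<^sup>-\<^sup>1\<close>.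

  The tools from Sobolev space theory are derived by mollification: local approximation of weakly
  differentiable functions, uniqueness of the weak gradient (\<open>has_weak_gradient_unique\<close>), a chain and product rule
  (\<open>chain_product_weak_gradient\<close>) and the density of test functions among compactly supported Sobolev functions
  (\<open>compact_support_approximation\<close>).
\<close>

section \<open>Smooth bump functions and mollifiers\<close>

text \<open>The functions \<open>P(1/t) e\<^sup>-\<^sup>1\<^sup>/\<^sup>t\<close>, extended by \<open>0\<close> to \<open>t \<le> 0\<close>. The family is closed under differentiation,
  which is all that the smoothness of bump functions rests on.\<close>

definition flat :: "real poly \<Rightarrow> real \<Rightarrow> real" where
  "flat P t = (if t > 0 then poly P (1 / t) * exp (- (1 / t)) else 0)"

lemma poly_times_exp_tendsto_0:
  "((\<lambda>s. poly P s * exp (- s)) \<longlongrightarrow> (0::real)) at_top"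
proof -
  have "((\<lambda>s. coeff P i * (s ^ i / exp s)) \<longlongrightarrow> 0) at_top" for i
    using tendsto_mult_right_zero[OF tendsto_power_div_exp_0, of "coeff P i" i] by simp
  hence "((\<lambda>s. \<Sum>i\<le>degree P. coeff P i * (s ^ i / exp s)) \<longlongrightarrow> (\<Sum>i\<le>degree P. 0)) at_top"
    by (intro tendsto_sum)
  moreover have "(\<lambda>s. \<Sum>i\<le>degree P. coeff P i * (s ^ i / exp s)) = (\<lambda>s. poly P s * exp (- s))"
    by (auto simp: fun_eq_iff poly_altdef sum_distrib_right exp_minus divide_inverse mult.assoc)
  ultimately show ?thesis by simp
qed

lemma flat_has_real_derivative:
  "(flat P has_real_derivative flat ([:0, 0, 1:] * (P - pderiv P)) t) (at t)"
proof -
  consider "t > 0" | "t < 0" | "t = 0" by linarith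
  then show ?thesis
  proof cases
    case 1
    have "((\<lambda>t. poly P (1 / t) * exp (- (1 / t))) has_real_derivative
        flat ([:0, 0, 1:] * (P - pderiv P)) t) (at t)"
      using 1 by (auto intro!: derivative_eq_intros simp: flat_def field_simps power2_eq_square)
    moreover have "\<forall>\<^sub>F x in nhds t. flat P x = poly P (1 / x) * exp (- (1 / x))"
      using eventually_nhds_in_open[of "{0<..}" t] 1 by (auto elim!: eventually_mono simp: flat_def)
    ultimately show ?thesis by (subst DERIV_cong_ev[OF refl _ refl]) auto
  next
    case 2
    have "\<forall>\<^sub>F x in nhds t. flat P x = 0"
      using eventually_nhds_in_open[of "{..<0}" t] 2 by (auto elim!: eventually_mono simp: flat_def)
    then show ?thesis using 2 by (subst DERIV_cong_ev[OF refl _ refl]) (auto simp: flat_def)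
  next
    case 3
    have "((\<lambda>s. poly ([:0,1:] * P) s * exp (- s)) \<longlongrightarrow> (0::real)) at_top"
      by (rule poly_times_exp_tendsto_0)
    hence "((\<lambda>x. poly ([:0,1:] * P) (inverse x) * exp (- inverse x)) \<longlongrightarrow> (0::real)) (at_right 0)"
      by (rule filterlim_compose) (rule filterlim_inverse_at_top_right)
    hence R: "((\<lambda>x. flat P x / x) \<longlongrightarrow> 0) (at_right 0)"
      by (rule Lim_transform_eventually)
         (use eventually_at_right_less[of 0] in eventually_elim, simp add: flat_def field_simps)
    have L: "((\<lambda>x. flat P x / x) \<longlongrightarrow> 0) (at_left 0)"
    proof (rule tendsto_eventually)
      have "\<forall>\<^sub>F x::real in at_left 0. x < 0"
        by (simp add: eventually_at_filter)
      thus "\<forall>\<^sub>F x in at_left 0. flat P x / x = 0" by eventually_elim (simp add: flat_def)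
    qed
    have "((\<lambda>x. flat P x / x) \<longlongrightarrow> 0) (at 0)"
      using R L by (simp add: filterlim_at_split)
    thus ?thesis using 3 by (simp add: has_field_derivative_iff flat_def)
  qed
qed

text \<open>The algebra generated by the flat functions of single coordinates. It consists of differentiable functions
  and is closed under partial derivatives, so that all its members are smooth.\<close>

inductive flat_algebra :: "(real^'n::finite \<Rightarrow> real) \<Rightarrow> bool" where
  coord: "flat_algebra (\<lambda>x. flat P (a * x $ i + c))"
| const: "flat_algebra (\<lambda>x. c)"
| add: "flat_algebra f \<Longrightarrow> flat_algebra g \<Longrightarrow> flat_algebra (\<lambda>x. f x + g x)"
| mult: "flat_algebra f \<Longrightarrow> flat_algebra g \<Longrightarrow> flat_algebra (\<lambda>x. f x * g x)"

lemma flat_algebra_prod: 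
  "(\<And>i. i \<in> I \<Longrightarrow> flat_algebra (f i)) \<Longrightarrow> flat_algebra (\<lambda>x. \<Prod>i\<in>I. f i x)"
  by (induction I rule: infinite_finite_induct) (auto intro: flat_algebra.intros)

lemma partial_eqI:
  assumes "(f has_derivative f') (at x)" shows "partial i f x = f' (axis i 1)"
  unfolding partial_def using frechet_derivative_at[OF assms] by simp

lemma flat_coord_has_derivative:
  fixes x :: "real^'n::finite"
  shows "((\<lambda>x. flat P (a * x $ i + c)) has_derivative
     (\<lambda>h. flat ([:0, 0, 1:] * (P - pderiv P)) (a * x $ i + c) * (a * h $ i))) (at x)"
proof (rule has_derivative_compose[of "\<lambda>x. a * x $ i + c" "\<lambda>h. a * h $ i" x UNIV "flat P"
      "\<lambda>h. flat ([:0, 0, 1:] * (P - pderiv P)) (a * x $ i + c) * h"])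
  show "((\<lambda>x. a * x $ i + c) has_derivative (\<lambda>h. a * h $ i)) (at x)"
    by (auto intro!: derivative_eq_intros bounded_linear_imp_has_derivative bounded_linear_vec_nth)
  show "(flat P has_derivative (\<lambda>h. flat ([:0, 0, 1:] * (P - pderiv P)) (a * x $ i + c) * h))
      (at (a * x $ i + c))"
    using flat_has_real_derivative[of P "a * x $ i + c"] unfolding has_field_derivative_def .
qed

lemma flat_algebra_differentiable: "flat_algebra f \<Longrightarrow> f differentiable (at x)"
proof (induction rule: flat_algebra.induct)
  case (coord P a i c)
  show ?case using flat_coord_has_derivative by (rule differentiableI)
qed auto

lemma partial_add:
  assumes "f differentiable (at x)" "g differentiable (at x)"
  shows "partial i (\<lambda>x. f x + g x) x = partial i f x + partial i g x"
proof -
  from assms obtain f' g' where d: "(f has_derivative f') (at x)" "(g has_derivative g') (at x)"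
    by (auto simp: differentiable_def)
  show ?thesis using partial_eqI[OF has_derivative_add[OF d]] partial_eqI[OF d(1)] partial_eqI[OF d(2)]
    by simp
qed

lemma partial_mult: "f differentiable (at x) \<Longrightarrow> g differentiable (at x) \<Longrightarrow>
  partial i (\<lambda>x. f x * g x) x = f x * partial i g x + partial i f x * g x"
proof -
  assume "f differentiable (at x)" "g differentiable (at x)"
  then obtain f' g' where d: "(f has_derivative f') (at x)" "(g has_derivative g') (at x)"
    by (auto simp: differentiable_def)
  show ?thesis using partial_eqI[OF has_derivative_mult[OF d]] partial_eqI[OF d(1)] partial_eqI[OF d(2)]
    by simp
qed

lemma flat_algebra_partial: "flat_algebra (f :: real^'n::finite \<Rightarrow> real) \<Longrightarrow> flat_algebra (partial j f)"
proof (induction rule: flat_algebra.induct)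
  case (coord P a i c)
  have "partial j (\<lambda>x::real^'n. flat P (a * x $ i + c)) =
     (\<lambda>x. flat ([:0, 0, 1:] * (P - pderiv P)) (a * x $ i + c) * (a * (axis j 1::real^'n) $ i))"
    by (rule ext) (rule partial_eqI[OF flat_coord_has_derivative])
  then show ?case by (auto intro!: flat_algebra.intros simp del: mult_pCons_left)
next
  case (const c)
  have "partial j (\<lambda>x::real^'n. c) = (\<lambda>x. 0)" by (auto simp: partial_def)
  then show ?case by (auto intro: flat_algebra.intros)
next
  case (add f g)
  have "partial j (\<lambda>x. f x + g x) = (\<lambda>x. partial j f x + partial j g x)"
    using add by (auto simp: partial_add flat_algebra_differentiable)
  with add show ?case by (auto intro: flat_algebra.intros)
next
  case (mult f g)
  have "partial j (\<lambda>x. f x * g x) = (\<lambda>x. f x * partial j g x + partial j f x * g x)"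
    using mult by (auto simp: partial_mult flat_algebra_differentiable)
  with mult show ?case by (auto intro: flat_algebra.intros)
qed

lemma flat_algebra_smooth: assumes "flat_algebra f" shows "smooth_on U f"
proof -
  have "flat_algebra (iter_partial is f)" for "is"
    by (induction "is") (auto intro: assms flat_algebra_partial)
  thus ?thesis by (auto simp: smooth_on_def flat_algebra_differentiable)
qed

text \<open>A smooth function that is positive near \<open>0\<close>. The factor \<open>n\<close> in front of the coordinates confines its support
  to a cube inside the Euclidean unit ball.\<close>

definition bump :: "real^'n::finite \<Rightarrow> real" where
  "bump x = (\<Prod>i\<in>UNIV. flat 1 (1 - real CARD('n) * x $ i) * flat 1 (1 + real CARD('n) * x $ i))"

lemma bump_nonneg: "0 \<le> bump x"
  by (auto simp: bump_def flat_def intro!: prod_nonneg)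

lemma bump_support:
  fixes x :: "real^'n::finite"
  assumes "bump x \<noteq> 0" shows "norm x < 1"
proof -
  have "\<bar>x $ i\<bar> < 1 / real CARD('n)" for i
  proof -
    have "flat 1 (1 - real CARD('n) * x $ i) \<noteq> 0" "flat 1 (1 + real CARD('n) * x $ i) \<noteq> 0"
      using assms by (auto simp: bump_def)
    hence "1 - real CARD('n) * x $ i > 0" "1 + real CARD('n) * x $ i > 0"
      by (auto simp: flat_def split: if_splits)
    thus ?thesis by (auto simp: abs_less_iff field_simps)
  qed
  hence "(\<Sum>i\<in>UNIV. \<bar>x $ i\<bar>) < (\<Sum>i\<in>(UNIV::'n set). 1 / real CARD('n))"
    by (intro sum_strict_mono) auto
  thus ?thesis using norm_le_l1_cart[of x] by simp
qed

lemma bump_affine_flat_algebra: "flat_algebra (\<lambda>y. bump (a *\<^sub>R y + b))"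
proof -
  have "flat_algebra (\<lambda>y. \<Prod>i\<in>UNIV. flat 1 ((- real CARD('n) * a) * y $ i + (1 - real CARD('n) * b $ i))
     * flat 1 ((real CARD('n) * a) * y $ i + (1 + real CARD('n) * b $ i)))"
    by (intro flat_algebra_prod flat_algebra.intros)
  thus ?thesis by (simp add: bump_def algebra_simps)
qed

lemma smooth_on_imp_continuous: "smooth_on UNIV f \<Longrightarrow> continuous_on S f"
proof -
  assume "smooth_on UNIV f"
  hence "iter_partial [] f differentiable (at x)" for x unfolding smooth_on_def by blast
  thus ?thesis by (auto intro!: continuous_at_imp_continuous_on differentiable_imp_continuous_within)
qed

lemma continuous_bump: "continuous_on S (bump :: real^'n::finite \<Rightarrow> real)"
  using smooth_on_imp_continuous[OF flat_algebra_smooth[OF bump_affine_flat_algebra[of 1 0]]] by simp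

lemma borel_measurable_bump [measurable]: "(bump :: real^'n::finite \<Rightarrow> real) \<in> borel_measurable borel"
  using continuous_bump by (rule borel_measurable_continuous_onI)

lemma integrable_bump: "integrable lborel (bump :: real^'n::finite \<Rightarrow> real)"
proof -
  have "integrable lborel (\<lambda>x. indicator (cball 0 1) x *\<^sub>R bump (x::real^'n))"
    by (rule borel_integrable_compact) (auto intro: continuous_bump)
  moreover have "(\<lambda>x. indicator (cball 0 1) x *\<^sub>R bump x) = (bump :: real^'n \<Rightarrow> real)"
    using bump_support by (fastforce simp: fun_eq_iff indicator_def)
  ultimately show ?thesis by simp
qed

lemma integral_bump_pos: "0 < (LINT x|lborel. bump (x::real^'n::finite))"
proof -
  have "\<not> (AE x::real^'n in lborel. bump x = 0)"
  proof
    assume "AE x::real^'n in lborel. bump x = 0"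
    hence "AE x::real^'n in lebesgue. bump x = 0" by (rule AE_completion)
    hence "negligible {x::real^'n. bump x \<noteq> 0}"
      by (simp add: AE_iff_null_sets negligible_iff_null_sets eventually_ae_filter_negligible)
    moreover have "open {x::real^'n. bump x \<noteq> 0}"
      using open_Collect_neq[OF continuous_bump continuous_on_const, of 0] by simp
    moreover have "(0::real^'n) \<in> {x. bump x \<noteq> 0}" by (simp add: bump_def flat_def)
    ultimately show False using open_not_negligible by blast
  qed
  moreover have "0 \<le> (LINT x|lborel. bump (x::real^'n))" by (intro integral_nonneg_AE AE_I2 bump_nonneg)
  ultimately show ?thesis
    using integral_nonneg_eq_0_iff_AE[OF integrable_bump AE_I2[OF bump_nonneg]]
    by (metis (no_types) less_eq_real_def)
qed

text \<open>The standard mollifier: a smooth probability density supported in the closed ball of radius \<open>\<epsilon>\<close> about \<open>0\<close>.\<close>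

definition mollifier :: "real \<Rightarrow> real^'n::finite \<Rightarrow> real" where
  "mollifier \<epsilon> z = bump (z /\<^sub>R \<epsilon>) / (\<epsilon> ^ CARD('n) * (LINT x|lborel. bump (x::real^'n)))"

lemma mollifier_nonneg: "0 < \<epsilon> \<Longrightarrow> 0 \<le> mollifier \<epsilon> (z::real^'n::finite)"
  unfolding mollifier_def using integral_bump_pos[where 'n='n]
  by (intro divide_nonneg_nonneg mult_nonneg_nonneg bump_nonneg) auto

lemma mollifier_support: "0 < \<epsilon> \<Longrightarrow> \<epsilon> \<le> norm z \<Longrightarrow> mollifier \<epsilon> z = 0"
  using bump_support[of "z /\<^sub>R \<epsilon>"] by (fastforce simp: mollifier_def field_simps)

lemma mollifier_smooth:
  "smooth_on U (\<lambda>y. mollifier \<epsilon> (a *\<^sub>R y + b))"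
proof -
  have "flat_algebra (\<lambda>y. bump ((inverse \<epsilon> * a) *\<^sub>R y + inverse \<epsilon> *\<^sub>R b) * (inverse ((\<epsilon> ^ CARD('a) * (LINT x|lborel. bump (x::real^'a))))))"
    by (intro flat_algebra.intros bump_affine_flat_algebra)
  thus ?thesis by (intro flat_algebra_smooth) (simp add: mollifier_def divide_inverse algebra_simps)
qed

lemma borel_measurable_mollifier [measurable]: "mollifier \<epsilon> \<in> borel_measurable borel"
  unfolding mollifier_def by measurable

lemma lborel_integral_translate:
  fixes f :: "real^'n::finite \<Rightarrow> real"
  assumes [measurable]: "f \<in> borel_measurable borel"
  shows "(LINT x|lborel. f (t + x)) = (LINT x|lborel. f x)"
proof -
  have "(LINT x|lborel. f x) = (LINT x|distr lborel borel ((+) t). f x)"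
    by (simp only: lborel_distr_plus)
  thus ?thesis by (simp add: integral_distr)
qed

lemma lborel_nn_integral_translate:
  fixes f :: "real^'n::finite \<Rightarrow> ennreal"
  assumes [measurable]: "f \<in> borel_measurable borel"
  shows "(\<integral>\<^sup>+x. f (t + x) \<partial>lborel) = (\<integral>\<^sup>+x. f x \<partial>lborel)"
proof -
  have "(\<integral>\<^sup>+x. f x \<partial>lborel) = (\<integral>\<^sup>+x. f x \<partial>distr lborel borel ((+) t))"
    by (simp only: lborel_distr_plus)
  thus ?thesis by (simp add: nn_integral_distr)
qed

lemma nn_integral_mollifier:
  assumes \<epsilon>: "0 < \<epsilon>"
  shows "(\<integral>\<^sup>+z. ennreal (mollifier \<epsilon> (z::real^'n::finite)) \<partial>lborel) = 1"
proof -
  let ?I = "LINT x|lborel. bump (x::real^'n)"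
  have "(\<integral>\<^sup>+z. ennreal (mollifier \<epsilon> (z::real^'n)) \<partial>lborel) =
     (\<integral>\<^sup>+z. ennreal (mollifier \<epsilon> (z::real^'n)) \<partial>density (distr lborel borel (\<lambda>x. 0 + \<epsilon> *\<^sub>R x)) (\<lambda>_. \<bar>\<epsilon>\<bar>^DIM(real^'n)))"
    using lborel_affine[of \<epsilon> "0::real^'n"] \<epsilon> by simp
  also have "\<dots> = (\<integral>\<^sup>+z. ennreal (\<epsilon> ^ CARD('n)) * ennreal (mollifier \<epsilon> (\<epsilon> *\<^sub>R z :: real^'n)) \<partial>lborel)"
    using \<epsilon> by (simp add: nn_integral_density nn_integral_distr)
  also have "\<dots> = (\<integral>\<^sup>+z. ennreal (bump (z :: real^'n) / ?I) \<partial>lborel)"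
    using \<epsilon> integral_bump_pos[where 'n='n]
    by (intro nn_integral_cong) (auto simp: mollifier_def ennreal_mult'[symmetric])
  also have "\<dots> = ennreal (LINT z|lborel. bump (z :: real^'n) / ?I)"
    using integral_bump_pos[where 'n='n] 
    by (intro nn_integral_eq_integral AE_I2 divide_nonneg_pos bump_nonneg) (auto intro: integrable_bump)
  also have "\<dots> = 1" using integral_bump_pos[where 'n='n] by simp
  finally show ?thesis .
qed

lemma nn_integral_mollifier_diff:
  assumes "0 < \<epsilon>"
  shows "(\<integral>\<^sup>+y. ennreal (mollifier \<epsilon> (x - y::real^'n::finite)) \<partial>lborel) = 1"
    and "(\<integral>\<^sup>+y. ennreal (mollifier \<epsilon> (y - x::real^'n::finite)) \<partial>lborel) = 1"
proof -
  have e: "mollifier \<epsilon> (- z) = mollifier \<epsilon> z" for z :: "real^'n"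
    by (simp add: mollifier_def bump_def mult.commute)
  have "(\<integral>\<^sup>+y. ennreal (mollifier \<epsilon> (- x + y)) \<partial>lborel) = 1"
    using lborel_nn_integral_translate[of "\<lambda>y. ennreal (mollifier \<epsilon> y)" "- x"] nn_integral_mollifier[OF assms]
    by simp
  thus "(\<integral>\<^sup>+y. ennreal (mollifier \<epsilon> (y - x)) \<partial>lborel) = 1" by simp
  moreover have "mollifier \<epsilon> (x - y) = mollifier \<epsilon> (y - x)" for y using e[of "y - x"] by simp
  ultimately show "(\<integral>\<^sup>+y. ennreal (mollifier \<epsilon> (x - y)) \<partial>lborel) = 1" by simp
qed

section \<open>Continuously differentiable functions and convolution\<close>

text \<open>Continuously differentiable functions on the whole space.\<close>

definition C1 :: "(real^'n::finite \<Rightarrow> real) \<Rightarrow> bool" where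
  "C1 w \<longleftrightarrow> (\<forall>x. w differentiable (at x)) \<and> continuous_on UNIV (grad w)"

lemma grad_nth [simp]: "grad w x $ i = partial i w x"
  by (simp add: grad_def)

lemma has_derivative_grad:
  fixes w :: "real^'n::finite \<Rightarrow> real"
  assumes "w differentiable (at x)"
  shows "(w has_derivative (\<lambda>h. grad w x \<bullet> h)) (at x)"
proof -
  obtain D where D: "(w has_derivative D) (at x)" using assms by (auto simp: differentiable_def)
  then interpret D: bounded_linear D by (rule has_derivative_bounded_linear)
  have "D h = grad w x \<bullet> h" for h
  proof -
    have "D h = D (\<Sum>i\<in>UNIV. h $ i *s axis i 1)" by (simp only: basis_expansion)
    also have "\<dots> = (\<Sum>i\<in>UNIV. h $ i * D (axis i 1))"
      by (simp add: D.sum scalar_mult_eq_scaleR D.scaleR)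
    also have "\<dots> = grad w x \<bullet> h"
      by (simp add: inner_vec_def partial_eqI[OF D] mult.commute)
    finally show ?thesis .
  qed
  with D show ?thesis by (metis (no_types, lifting) ext)
qed

lemma grad_eqI:
  assumes "(w has_derivative (\<lambda>h. v \<bullet> h)) (at x)" shows "grad w x = v"
  by (auto simp: vec_eq_iff partial_eqI[OF assms] inner_axis)

lemma smooth_differentiable: "smooth_on UNIV w \<Longrightarrow> w differentiable (at x)"
  unfolding smooth_on_def by (drule spec[of _ "[]"]) simp

lemma smooth_partial_differentiable: "smooth_on UNIV w \<Longrightarrow> partial i w differentiable (at x)"
  unfolding smooth_on_def by (drule spec[of _ "[i]"]) simp

lemma smooth_imp_C1: "smooth_on UNIV w \<Longrightarrow> C1 w"
proof -
  assume w: "smooth_on UNIV w"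
  have "continuous_on UNIV (\<lambda>x. \<chi> i. partial i w x)"
  proof (rule continuous_on_vec_lambda)
    fix i show "continuous_on UNIV (partial i w)"
      by (intro continuous_at_imp_continuous_on ballI differentiable_imp_continuous_within
          smooth_partial_differentiable w)
  qed
  thus ?thesis using smooth_differentiable[OF w] by (simp add: C1_def grad_def[abs_def])
qed

lemma C1_differentiable: "C1 w \<Longrightarrow> w differentiable (at x)" by (simp add: C1_def)

lemma C1_continuous: "C1 w \<Longrightarrow> continuous_on S w"
  by (auto intro!: continuous_at_imp_continuous_on differentiable_imp_continuous_within simp: C1_def)

lemma C1_continuous_grad: "C1 w \<Longrightarrow> continuous_on S (grad w)"
  unfolding C1_def using continuous_on_subset by blast

lemma C1_continuous_partial: "C1 w \<Longrightarrow> continuous_on S (partial i w)"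
  using continuous_on_component[OF C1_continuous_grad, of w S i] by simp

lemma C1_measurable: "C1 w \<Longrightarrow> w \<in> borel_measurable borel"
  by (rule borel_measurable_continuous_onI) (rule C1_continuous)

lemma C1_partial_measurable: "C1 w \<Longrightarrow> partial i w \<in> borel_measurable borel"
  by (rule borel_measurable_continuous_onI) (rule C1_continuous_partial)

lemma C1_grad_measurable: "C1 w \<Longrightarrow> grad w \<in> borel_measurable borel"
  by (rule borel_measurable_continuous_onI) (rule C1_continuous_grad)

lemma C1_const: "C1 (\<lambda>x. c)"
proof -
  have "grad (\<lambda>x::real^'a. c) = (\<lambda>x. 0)" by (intro ext grad_eqI) auto
  thus ?thesis by (simp add: C1_def)
qed

lemma grad_mult:
  assumes "f differentiable (at x)" "g differentiable (at x)"
  shows "grad (\<lambda>x. f x * g x) x = f x *\<^sub>R grad g x + g x *\<^sub>R grad f x"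
  using assms by (simp add: vec_eq_iff partial_mult mult.commute)

lemma C1_mult: "C1 f \<Longrightarrow> C1 g \<Longrightarrow> C1 (\<lambda>x. f x * g x)"
proof -
  assume fg: "C1 f" "C1 g"
  have "grad (\<lambda>x. f x * g x) = (\<lambda>x. f x *\<^sub>R grad g x + g x *\<^sub>R grad f x)"
    by (intro ext grad_mult C1_differentiable fg)
  moreover have "continuous_on UNIV (\<lambda>x. f x *\<^sub>R grad g x + g x *\<^sub>R grad f x)"
    by (intro continuous_intros C1_continuous C1_continuous_grad fg)
  moreover have "(\<lambda>x. f x * g x) differentiable (at x)" for x
    by (intro differentiable_mult C1_differentiable fg)
  ultimately show ?thesis by (simp add: C1_def)
qed

lemma grad_compose:
  assumes "f differentiable (at x)" "(h has_real_derivative h') (at (f x))"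
  shows "grad (\<lambda>x. h (f x)) x = h' *\<^sub>R grad f x"
proof (rule grad_eqI)
  have "((\<lambda>x. h (f x)) has_derivative (\<lambda>y. h' * (grad f x \<bullet> y))) (at x)"
    by (rule has_derivative_compose[OF has_derivative_grad[OF assms(1)]])
       (use assms(2) in \<open>simp add: has_field_derivative_def\<close>)
  moreover have "(\<lambda>y. h' * (grad f x \<bullet> y)) = (\<bullet>) (h' *\<^sub>R grad f x)" by (simp add: fun_eq_iff)
  ultimately show "((\<lambda>x. h (f x)) has_derivative (\<bullet>) (h' *\<^sub>R grad f x)) (at x)" by simp
qed

lemma compose_differentiable:
  fixes f :: "real^'n::finite \<Rightarrow> real"
  assumes "f differentiable (at x)" "(h has_real_derivative h') (at (f x))"
  shows "(\<lambda>x. h (f x)) differentiable (at x)"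
proof -
  have "((\<lambda>x. h (f x)) has_derivative (\<lambda>y. h' * (grad f x \<bullet> y))) (at x)"
    by (rule has_derivative_compose[OF has_derivative_grad[OF assms(1)]])
       (use assms(2) in \<open>simp add: has_field_derivative_def\<close>)
  thus ?thesis by (rule differentiableI)
qed

lemma C1_compose:
  assumes w: "C1 w" and h: "\<And>x. (h has_real_derivative h' (w x)) (at (w x))"
    and c: "continuous_on S h'" and S: "\<And>x. w x \<in> S"
  shows "C1 (\<lambda>x. h (w x))"
proof -
  have "grad (\<lambda>x. h (w x)) = (\<lambda>x. h' (w x) *\<^sub>R grad w x)"
    by (intro ext grad_compose C1_differentiable w h)
  moreover have c: "continuous_on UNIV (\<lambda>x. h' (w x))"
    by (rule continuous_on_compose2[OF c C1_continuous[OF w]]) (use S in auto)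
  have "continuous_on UNIV (\<lambda>x. h' (w x) *\<^sub>R grad w x)"
    by (intro continuous_intros c C1_continuous_grad w)
  moreover have "(\<lambda>x. h (w x)) differentiable (at x)" for x
    by (rule compose_differentiable[OF C1_differentiable[OF w] h])
  ultimately show ?thesis by (simp add: C1_def)
qed

lemma grad_zero_off:
  assumes "closed K" "\<And>x. x \<notin> K \<Longrightarrow> w x = 0" "x \<notin> K"
  shows "grad w x = 0"
proof -
  have "(w has_derivative (\<lambda>h. 0)) (at x)"
    by (rule has_derivative_transform_within_open[of "\<lambda>x. 0" "\<lambda>h. 0" x UNIV "- K" w]) (use assms in auto)
  thus ?thesis by (intro grad_eqI) simp
qed

lemma partial_zero_off:
  assumes "closed K" "\<And>x. x \<notin> K \<Longrightarrow> w x = 0" "x \<notin> K"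
  shows "partial i w x = 0"
proof -
  have "grad w x $ i = 0" using grad_zero_off[OF assms] by simp
  thus ?thesis by simp
qed

lemma continuous_compact_support_bounded:
  fixes f :: "real^'n::finite \<Rightarrow> 'b::real_normed_vector"
  assumes "continuous_on UNIV f" "compact K" "\<And>x. x \<notin> K \<Longrightarrow> f x = 0"
  obtains B where "B > 0" "\<And>x. norm (f x) \<le> B"
proof -
  have "bounded (f ` K)"
    by (intro compact_imp_bounded compact_continuous_image) (auto intro: continuous_on_subset[OF assms(1)] assms(2))
  then obtain B where "\<And>x. x \<in> K \<Longrightarrow> norm (f x) \<le> B" by (auto simp: bounded_iff)
  hence "norm (f x) \<le> max B 1" for x using assms(3)[of x] by (cases "x \<in> K") force+
  with that[of "max B 1"] show ?thesis by auto
qed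

lemma continuous_compact_support_uniformly_continuous:
  fixes f :: "real^'n::finite \<Rightarrow> 'b::real_normed_vector"
  assumes c: "continuous_on UNIV f" and K: "compact K" "\<And>x. x \<notin> K \<Longrightarrow> f x = 0"
  shows "uniformly_continuous_on UNIV f"
proof -
  obtain R where R: "\<And>x. x \<in> K \<Longrightarrow> norm x \<le> R"
    using compact_imp_bounded[OF K(1)] by (auto simp: bounded_iff)
  have u: "uniformly_continuous_on (cball 0 (R+1)) f"
    by (intro compact_uniformly_continuous continuous_on_subset[OF c]) auto
  show ?thesis unfolding uniformly_continuous_on_def
  proof (intro allI impI)
    fix e :: real assume "e > 0"
    then obtain d where d: "d > 0" "\<And>x y. x \<in> cball 0 (R+1) \<Longrightarrow> y \<in> cball 0 (R+1) \<Longrightarrow> dist y x < d \<Longrightarrow> dist (f y) (f x) < e"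
      using u[unfolded uniformly_continuous_on_def, rule_format, OF \<open>e > 0\<close>] by blast
    have "dist (f y) (f x) < e" if "dist y x < min d 1" for x y
    proof (cases "x \<in> cball 0 (R+1) \<and> y \<in> cball 0 (R+1)")
      case True then show ?thesis using d(2)[of x y] that by simp
    next
      case False
      have "norm x \<le> norm y + dist y x" "norm y \<le> norm x + dist y x" 
        using norm_triangle_ineq[of y "x - y"] norm_triangle_ineq[of x "y - x"]
        by (simp_all add: dist_norm norm_minus_commute)
      hence "R < norm x \<and> R < norm y" using False that by (simp add: not_le) linarith
      hence "x \<notin> K" "y \<notin> K" using R[of x] R[of y] by auto
      then show ?thesis using K(2) \<open>e > 0\<close> by simp
    qed
    then show "\<exists>d>0. \<forall>x\<in>UNIV. \<forall>x'\<in>UNIV. dist x' x < d \<longrightarrow> dist (f x') (f x) < e"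
      using d(1) by (intro exI[of _ "min d 1"]) auto
  qed
qed

lemma onorm_inner_le: "onorm (\<lambda>h. v \<bullet> h) \<le> norm v"
  by (rule onorm_bound) (simp_all add: Cauchy_Schwarz_ineq2)

lemma C1_lipschitz:
  assumes "C1 w" "\<And>x. norm (grad w x) \<le> B"
  shows "\<bar>w x - w y\<bar> \<le> B * norm (x - y)"
proof -
  have "norm (w x - w y) \<le> B * norm (x - y)"
    by (rule differentiable_bound[of UNIV w "\<lambda>x h. grad w x \<bullet> h"])
       (use assms in \<open>auto intro!: has_derivative_grad C1_differentiable order_trans[OF onorm_inner_le]\<close>)
  thus ?thesis by simp
qed

lemma C1_compact_support_uniformly_differentiable:
  fixes g :: "real^'n::finite \<Rightarrow> real"
  assumes g: "C1 g" and K: "compact K" "\<And>x. x \<notin> K \<Longrightarrow> g x = 0" and e: "e > 0"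
  obtains d where "d > 0" "\<And>z h. norm h < d \<Longrightarrow> \<bar>g (z + h) - g z - grad g z \<bullet> h\<bar> \<le> e * norm h"
proof -
  have "uniformly_continuous_on UNIV (grad g)"
    by (rule continuous_compact_support_uniformly_continuous[OF C1_continuous_grad[OF g] K(1)])
       (rule grad_zero_off[OF compact_imp_closed[OF K(1)] K(2)])
  then obtain d where d: "d > 0" "\<And>x y. dist x y < d \<Longrightarrow> dist (grad g x) (grad g y) < e"
    unfolding uniformly_continuous_on_def using e by (metis UNIV_I)
  have "\<bar>g (z + h) - g z - grad g z \<bullet> h\<bar> \<le> e * norm h" if h: "norm h < d" for z h
  proof -
    have "norm ((g (z + h) - grad g z \<bullet> (z + h)) - (g z - grad g z \<bullet> z)) \<le> e * norm ((z + h) - z)"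
    proof (rule differentiable_bound[of "ball z d" "\<lambda>x. g x - grad g z \<bullet> x" "\<lambda>x h. (grad g x - grad g z) \<bullet> h"])
      fix x assume x: "x \<in> ball z d"
      show "((\<lambda>x. g x - grad g z \<bullet> x) has_derivative (\<bullet>) (grad g x - grad g z)) (at x within ball z d)"
      proof -
        have "((\<lambda>x. g x - grad g z \<bullet> x) has_derivative (\<lambda>h. grad g x \<bullet> h - grad g z \<bullet> h)) (at x within ball z d)"
          by (intro has_derivative_diff has_derivative_at_withinI[OF has_derivative_grad] C1_differentiable g
              bounded_linear_imp_has_derivative bounded_linear_inner_right)
        moreover have "(\<lambda>h. grad g x \<bullet> h - grad g z \<bullet> h) = (\<bullet>) (grad g x - grad g z)"
          by (simp add: fun_eq_iff inner_diff_left)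
        ultimately show ?thesis by simp
      qed
      have "norm (grad g x - grad g z) < e" using d(2)[of x z] x by (simp add: dist_norm norm_minus_commute)
      thus "onorm ((\<bullet>) (grad g x - grad g z)) \<le> e" using onorm_inner_le[of "grad g x - grad g z"] by simp
    qed (use h d in \<open>auto simp: dist_norm\<close>)
    thus ?thesis by (simp add: inner_add_right algebra_simps)
  qed
  with that d show ?thesis by blast
qed

lemma integrable_continuous_compact_support:
  fixes f :: "real^'n::finite \<Rightarrow> real"
  assumes "continuous_on UNIV f" "compact K" "\<And>x. x \<notin> K \<Longrightarrow> f x = 0"
  shows "integrable lborel f"
proof -
  have "integrable lborel (\<lambda>x. indicator K x *\<^sub>R f x)"
    by (rule borel_integrable_compact) (auto intro: continuous_on_subset[OF assms(1)] assms(2))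
  moreover have "(\<lambda>x. indicator K x *\<^sub>R f x) = f" using assms(3) by (auto simp: fun_eq_iff indicator_def)
  ultimately show ?thesis by metis
qed

text \<open>Difference quotients of a compactly supported function have integral \<open>0\<close> by translation invariance; they
  converge boundedly to the partial derivative.\<close>

lemma integral_partial_eq_0:
  fixes w :: "real^'n::finite \<Rightarrow> real"
  assumes w: "C1 w" and K: "compact K" "\<And>x. x \<notin> K \<Longrightarrow> w x = 0"
  shows "(LINT x|lborel. partial i w x) = 0"
proof -
  let ?e = "axis i 1 :: real^'n"
  have gz: "grad w x = 0" if "x \<notin> K" for x
    by (rule grad_zero_off[OF compact_imp_closed[OF K(1)] K(2) that])
  obtain B where B: "B > 0" "\<And>x. norm (grad w x) \<le> B"
    using continuous_compact_support_bounded[OF C1_continuous_grad[OF w] K(1) gz] by metis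
  define h where "h n = inverse (real (Suc n))" for n
  have h: "h n > 0" "h n \<le> 1" for n by (auto simp: h_def field_simps)
  have h0: "h \<longlonglongrightarrow> 0" unfolding h_def by (rule LIMSEQ_inverse_real_of_nat)
  define q where "q n x = (w (h n *\<^sub>R ?e + x) - w x) / h n" for n x
  define K' where "K' = (\<Union>x\<in>K. \<Union>y\<in>cball 0 1. {x + y})"
  have K': "compact K'" unfolding K'_def using compact_sums'[OF K(1) compact_cball[of 0 1]] by simp
  have [measurable]: "w \<in> borel_measurable borel" by (rule C1_measurable[OF w])
  have qb: "norm (q n x) \<le> indicator K' x *\<^sub>R B" for n x
  proof (cases "x \<in> K'")
    case True
    have "\<bar>w (h n *\<^sub>R ?e + x) - w x\<bar> \<le> B * norm ((h n *\<^sub>R ?e + x) - x)"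
      by (rule C1_lipschitz[OF w B(2)])
    hence "\<bar>w (h n *\<^sub>R ?e + x) - w x\<bar> \<le> B * h n" using h(1)[of n] by (simp add: norm_axis_1)
    thus ?thesis using True h(1)[of n] by (simp add: q_def field_simps)
  next
    case False
    have "x + 0 \<in> K'" if "x \<in> K" using that unfolding K'_def by (intro UN_I[of x] UN_I[of 0]) auto
    hence "x \<notin> K" using False by auto
    moreover have "h n *\<^sub>R ?e + x \<notin> K"
    proof
      assume "h n *\<^sub>R ?e + x \<in> K"
      hence "(h n *\<^sub>R ?e + x) + (- h n *\<^sub>R ?e) \<in> K'" unfolding K'_def
        using h[of n] by (intro UN_I[of "h n *\<^sub>R ?e + x"] UN_I[of "- h n *\<^sub>R ?e"]) (auto simp: norm_axis_1)
      with False show False by simp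
    qed
    ultimately show ?thesis using False K(2) by (simp add: q_def)
  qed
  have ib: "integrable lborel (\<lambda>x. indicator K' x *\<^sub>R B)"
    by (rule borel_integrable_compact[OF K']) auto
  have int0: "(LINT x|lborel. q n x) = 0" for n
  proof -
    have iw: "integrable lborel w" by (rule integrable_continuous_compact_support[OF C1_continuous[OF w] K])
    have "integrable (distr lborel borel ((+) (h n *\<^sub>R ?e))) w" using iw by (simp only: lborel_distr_plus)
    hence iw': "integrable lborel (\<lambda>x. w (h n *\<^sub>R ?e + x))" by (simp add: integrable_distr_eq)
    show ?thesis unfolding q_def using iw iw' lborel_integral_translate[of w "h n *\<^sub>R ?e"] by simp
  qed
  have lim: "(\<lambda>n. q n x) \<longlonglongrightarrow> partial i w x" for x
  proof -
    have "(w has_derivative (\<lambda>h. grad w x \<bullet> h)) (at x)" by (intro has_derivative_grad C1_differentiable w)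
    hence "((\<lambda>s. w (s *\<^sub>R ?e + x)) has_derivative (\<lambda>s. grad w x \<bullet> (s *\<^sub>R ?e))) (at 0)"
      by (intro has_derivative_compose[of "\<lambda>s. s *\<^sub>R ?e + x" "\<lambda>s. s *\<^sub>R ?e" 0 UNIV w])
         (auto intro!: derivative_eq_intros)
    hence "((\<lambda>s. w (s *\<^sub>R ?e + x)) has_real_derivative partial i w x) (at 0)"
    proof -
      have "(\<lambda>s. grad w x \<bullet> (s *\<^sub>R ?e)) = (*) (partial i w x)" by (simp add: fun_eq_iff inner_axis)
      with \<open>((\<lambda>s. w (s *\<^sub>R ?e + x)) has_derivative (\<lambda>s. grad w x \<bullet> (s *\<^sub>R ?e))) (at 0)\<close>
      show ?thesis unfolding has_field_derivative_def by simp
    qed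
    hence "((\<lambda>s. (w (s *\<^sub>R ?e + x) - w x) / s) \<longlongrightarrow> partial i w x) (at 0)"
      by (simp add: has_field_derivative_iff)
    moreover have "filterlim h (at 0) sequentially"
      using h0 h(1) by (simp add: filterlim_at less_imp_neq[symmetric])
    ultimately show ?thesis unfolding q_def by (rule filterlim_compose)
  qed
  have "(\<lambda>n. LINT x|lborel. q n x) \<longlonglongrightarrow> (LINT x|lborel. partial i w x)"
  proof (rule integral_dominated_convergence[where w = "\<lambda>x. indicator K' x *\<^sub>R B"])
    show "partial i w \<in> borel_measurable lborel" using C1_partial_measurable[OF w] by simp
    show "q n \<in> borel_measurable lborel" for n unfolding q_def by measurable
  qed (use lim qb ib in auto)
  thus ?thesis by (simp add: int0 LIMSEQ_const_iff)
qed

lemma C1_integration_by_parts: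
  fixes w :: "real^'n::finite \<Rightarrow> real"
  assumes w: "C1 w" "C1 \<phi>" and K: "compact K" "\<And>x. x \<notin> K \<Longrightarrow> \<phi> x = 0"
  shows "(LINT x|lborel. w x * partial i \<phi> x) = - (LINT x|lborel. partial i w x * \<phi> x)"
proof -
  have gz: "partial i \<phi> x = 0" if "x \<notin> K" for x
    by (rule partial_zero_off[OF compact_imp_closed[OF K(1)] K(2) that])
  have "integrable lborel (\<lambda>x. w x * partial i \<phi> x)"
    by (rule integrable_continuous_compact_support[OF continuous_on_mult K(1)])
       (simp_all add: w gz C1_continuous C1_continuous_partial)
  moreover have "integrable lborel (\<lambda>x. partial i w x * \<phi> x)"
    by (rule integrable_continuous_compact_support[OF continuous_on_mult K(1)])
       (simp_all add: w K C1_continuous C1_continuous_partial)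
  moreover have "(LINT x|lborel. w x * partial i \<phi> x + partial i w x * \<phi> x) = 0"
    using integral_partial_eq_0[OF C1_mult[OF w] K(1), of i] K(2)
    by (simp add: partial_mult w C1_differentiable)
  ultimately show ?thesis by simp
qed

text \<open>Convolution with respect to the Borel version of Lebesgue measure, which makes Fubini's theorem available.\<close>

definition conv :: "(real^'n::finite \<Rightarrow> real) \<Rightarrow> (real^'n \<Rightarrow> real) \<Rightarrow> real^'n \<Rightarrow> real" where
  "conv f g x = (LINT y|lborel. f y * g (x - y))"

lemma integrable_mult_bounded_on_space:
  fixes f g :: "'a \<Rightarrow> real"
  assumes "integrable M f" "g \<in> borel_measurable M" "\<And>x. x \<in> space M \<Longrightarrow> \<bar>g x\<bar> \<le> B"
  shows "integrable M (\<lambda>x. f x * g x)"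
proof (rule Bochner_Integration.integrable_bound[of M "\<lambda>x. f x * B"])
  show "integrable M (\<lambda>x. f x * B)" using assms(1) by simp
  show "(\<lambda>x. f x * g x) \<in> borel_measurable M" using assms by measurable
  have "\<bar>f x * g x\<bar> \<le> \<bar>f x * B\<bar>" if "x \<in> space M" for x
    using assms(3)[OF that] by (auto simp: abs_mult intro!: mult_left_mono)
  thus "AE x in M. norm (f x * g x) \<le> norm (f x * B)" by simp
qed

lemma integrable_mult_bounded:
  fixes f g :: "'a \<Rightarrow> real"
  assumes "integrable M f" "g \<in> borel_measurable M" "\<And>x. \<bar>g x\<bar> \<le> B"
  shows "integrable M (\<lambda>x. f x * g x)"
  by (rule integrable_mult_bounded_on_space[OF assms])

text \<open>Only integrability of the first factor is needed: the second factor is uniformly differentiable, so the remainder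
  of the difference quotient is uniformly small.\<close>

lemma conv_has_derivative:
  fixes f g :: "real^'n::finite \<Rightarrow> real"
  assumes f: "integrable lborel f" and g: "C1 g" and K: "compact K" "\<And>x. x \<notin> K \<Longrightarrow> g x = 0"
  shows "(conv f g has_derivative (\<lambda>h. \<Sum>i\<in>UNIV. h $ i * conv f (partial i g) x)) (at x)"
proof -
  have gz: "grad g x = 0" if "x \<notin> K" for x
    by (rule grad_zero_off[OF compact_imp_closed[OF K(1)] K(2) that])
  obtain B where B: "B > 0" "\<And>x. norm (grad g x) \<le> B"
    using continuous_compact_support_bounded[OF C1_continuous_grad[OF g] K(1) gz] by metis
  obtain B0 where B0: "B0 > 0" "\<And>x. norm (g x) \<le> B0"
    using continuous_compact_support_bounded[OF C1_continuous[OF g] K] by metis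
  have pB: "\<bar>partial i g x\<bar> \<le> B" for i x using B(2)[of x] component_le_norm_cart[of "grad g x" i] by simp
  have [measurable]: "g \<in> borel_measurable borel" "partial i g \<in> borel_measurable borel"
     "grad g \<in> borel_measurable borel" for i
    using C1_measurable[OF g] C1_partial_measurable[OF g] C1_grad_measurable[OF g] by auto
  have ig: "integrable lborel (\<lambda>y. f y * g (z - y))" for z
    by (rule integrable_mult_bounded[OF f, where B = B0]) (use B0 in auto)
  have ip: "integrable lborel (\<lambda>y. f y * partial i g (z - y))" for z i
    by (rule integrable_mult_bounded[OF f, where B = B]) (use pB in auto)
  have D: "(\<Sum>i\<in>UNIV. h $ i * conv f (partial i g) x) = (LINT y|lborel. f y * (grad g (x - y) \<bullet> h))" for h
  proof -
    have "(\<Sum>i\<in>UNIV. h $ i * conv f (partial i g) x) = (LINT y|lborel. (\<Sum>i\<in>UNIV. h $ i * (f y * partial i g (x - y))))"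
      unfolding conv_def by (subst Bochner_Integration.integral_sum) (use ip in auto)
    thus ?thesis by (simp add: inner_vec_def sum_distrib_left mult_ac)
  qed
  have igr: "integrable lborel (\<lambda>y. f y * (grad g (x - y) \<bullet> h))" for h
    by (rule integrable_mult_bounded[OF f, where B = "B * norm h"])
       (use B(2) in \<open>auto intro!: order_trans[OF Cauchy_Schwarz_ineq2] mult_right_mono\<close>)
  define L where "L = (LINT y|lborel. \<bar>f y\<bar>)"
  have L: "L \<ge> 0" by (simp add: L_def)
  show ?thesis unfolding has_derivative_at_alt
  proof (intro conjI allI impI)
    show "bounded_linear (\<lambda>h::real^'n. \<Sum>i\<in>UNIV. h $ i * conv f (partial i g) x)"
      by (intro bounded_linear_sum bounded_linear_compose[OF bounded_linear_mult_left bounded_linear_vec_nth])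
    fix e :: real assume "e > 0"
    then obtain d where d: "d > 0"
      "\<And>z h. norm h < d \<Longrightarrow> \<bar>g (z + h) - g z - grad g z \<bullet> h\<bar> \<le> (e / (L + 1)) * norm h"
      using C1_compact_support_uniformly_differentiable[OF g K, of "e / (L+1)"] L by (metis add_nonneg_pos divide_pos_pos zero_less_one)
    have "norm (conv f g z - conv f g x - (\<Sum>i\<in>UNIV. (z - x) $ i * conv f (partial i g) x)) \<le> e * norm (z - x)"
      if z: "norm (z - x) < d" for z
    proof -
      let ?h = "z - x"
      let ?r = "\<lambda>y. g (x - y + ?h) - g (x - y) - grad g (x - y) \<bullet> ?h"
      have r: "f y * g (z - y) - f y * g (x - y) - f y * (grad g (x - y) \<bullet> ?h) = f y * ?r y" for y
        by (simp add: algebra_simps)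
      have "conv f g z - conv f g x - (\<Sum>i\<in>UNIV. ?h $ i * conv f (partial i g) x) = (LINT y|lborel. f y * ?r y)"
        unfolding D unfolding conv_def r[symmetric] using ig igr by simp
      also have "norm \<dots> \<le> (LINT y|lborel. \<bar>f y\<bar> * (e / (L + 1) * norm ?h))"
      proof (rule order_trans[OF integral_norm_bound], rule integral_mono)
        have "integrable lborel (\<lambda>y. f y * ?r y)" unfolding r[symmetric] using ig igr by auto
        thus "integrable lborel (\<lambda>y. norm (f y * ?r y))" by (rule integrable_norm)
        show "integrable lborel (\<lambda>y. \<bar>f y\<bar> * (e / (L + 1) * norm ?h))" using f by simp
        show "norm (f y * ?r y) \<le> \<bar>f y\<bar> * (e / (L + 1) * norm ?h)" for y
          using d(2)[OF z, of "x - y"] unfolding real_norm_def abs_mult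
          by (intro mult_left_mono) auto
      qed
      also have "\<dots> = L / (L + 1) * (e * norm ?h)" by (simp add: L_def)
      also have "\<dots> \<le> 1 * (e * norm ?h)" using L \<open>e > 0\<close> by (intro mult_right_mono) auto
      finally show ?thesis by simp
    qed
    with d(1) show "\<exists>d>0. \<forall>z. norm (z - x) < d \<longrightarrow>
        norm (conv f g z - conv f g x - (\<Sum>i\<in>UNIV. (z - x) $ i * conv f (partial i g) x)) \<le> e * norm (z - x)" by blast
  qed
qed

lemma test_function_smooth: "\<phi> \<in> test_functions U \<Longrightarrow> smooth_on UNIV \<phi>"
  by (simp add: test_functions_def)

lemma test_functionE:
  assumes "\<phi> \<in> test_functions U"
  obtains K where "compact K" "K \<subseteq> U" "\<And>x. x \<notin> K \<Longrightarrow> \<phi> x = 0" "C1 \<phi>"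
  using assms by (auto simp: test_functions_def intro: smooth_imp_C1)

lemma iter_partial_append: "iter_partial (is @ js) f = iter_partial is (iter_partial js f)"
  by (induction "is") auto

lemma test_function_partial:
  assumes "\<phi> \<in> test_functions U" shows "partial i \<phi> \<in> test_functions U"
proof -
  obtain K where K: "compact K" "K \<subseteq> U" "\<And>x. x \<notin> K \<Longrightarrow> \<phi> x = 0"
    using test_functionE[OF assms] by metis
  have "partial i \<phi> x = 0" if "x \<notin> K" for x
    by (rule partial_zero_off[OF compact_imp_closed[OF K(1)] K(3) that])
  moreover have "smooth_on UNIV (partial i \<phi>)"
    unfolding smooth_on_def
  proof (intro allI ballI)
    fix "is" and x :: "real^'a"
    have "iter_partial (is @ [i]) \<phi> differentiable at x"
      using test_function_smooth[OF assms] unfolding smooth_on_def by blast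
    thus "iter_partial is (partial i \<phi>) differentiable at x" by (simp add: iter_partial_append)
  qed
  ultimately show ?thesis using K by (auto simp: test_functions_def)
qed

lemma partial_conv:
  assumes f: "integrable lborel f" and g: "g \<in> test_functions UNIV"
  shows "partial i (conv f g) = conv f (partial i g)" "conv f g differentiable (at x)"
proof -
  obtain K where K: "compact K" "\<And>x. x \<notin> K \<Longrightarrow> g x = 0" "C1 g" using test_functionE[OF g] by metis
  note D = conv_has_derivative[OF f K(3,1,2)]
  have "(\<Sum>j\<in>UNIV. (axis i 1::real^'a) $ j * conv f (partial j g) x) = conv f (partial i g) x" for x
    by (subst sum.remove[of _ i]) (auto simp: axis_def intro!: sum.neutral)
  thus "partial i (conv f g) = conv f (partial i g)" using partial_eqI[OF D] by (auto simp: fun_eq_iff)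
  show "conv f g differentiable (at x)" using D by (rule differentiableI)
qed

lemma smooth_conv:
  assumes f: "integrable lborel f" and g: "g \<in> test_functions UNIV"
  shows "smooth_on UNIV (conv f g)"
proof -
  have "iter_partial is (conv f g) = conv f (iter_partial is g) \<and> iter_partial is g \<in> test_functions UNIV" for "is"
    by (induction "is") (auto simp: g partial_conv[OF f] test_function_partial)
  thus ?thesis unfolding smooth_on_def using partial_conv(2)[OF f] by metis
qed

section \<open>Mollification in Lp\<close>

lemma powr_add_le:
  fixes a b :: "'a::real_normed_vector"
  assumes "0 \<le> p"
  shows "norm (a + b) powr p \<le> 2 powr p * (norm a powr p + norm b powr p)"
proof -
  have "norm (a + b) \<le> 2 * max (norm a) (norm b)" using norm_triangle_ineq[of a b] by linarith
  hence "norm (a + b) powr p \<le> (2 * max (norm a) (norm b)) powr p" using assms by (intro powr_mono2) auto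
  also have "\<dots> = 2 powr p * max (norm a) (norm b) powr p" by (simp add: powr_mult)
  also have "\<dots> \<le> 2 powr p * (norm a powr p + norm b powr p)" by (intro mult_left_mono) (auto simp: max_def)
  finally show ?thesis .
qed

text \<open>Young's inequality in the form in which it expresses the convexity of \<open>t \<mapsto> t\<^sup>p\<close>.\<close>

lemma young_powr:
  fixes a b p :: real
  assumes "1 \<le> p" "0 \<le> a" "0 \<le> b"
  shows "p * (a * b powr (p - 1)) \<le> a powr p + (p - 1) * b powr p"
proof (cases "p = 1")
  case True
  with assms show ?thesis by (cases "b = 0") auto
next
  case False
  hence p: "p > 1" using assms by simp
  have "a * b powr (p - 1) \<le> a powr p / p + (b powr (p - 1)) powr (p / (p - 1)) / (p / (p - 1))"
    by (rule Youngs_inequality) (use p assms in \<open>auto simp: field_simps\<close>)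
  also have "(b powr (p - 1)) powr (p / (p - 1)) = b powr p" using p by (simp add: powr_powr)
  finally have "p * (a * b powr (p - 1)) \<le> p * (a powr p / p + b powr p / (p / (p - 1)))"
    using p by (intro mult_left_mono) auto
  also have "\<dots> = a powr p + (p - 1) * b powr p" using p by (simp add: field_simps)
  finally show ?thesis .
qed

text \<open>Jensen's inequality for \<open>t \<mapsto> \<bar>t\<bar>\<^sup>p\<close> and a probability density \<open>k\<close>, obtained by integrating Young's inequality with
  \<open>b\<close> the modulus of the mean value.\<close>

lemma jensen_powr:
  fixes u k :: "'a \<Rightarrow> real"
  assumes p: "1 \<le> p" and [measurable]: "u \<in> borel_measurable M" "k \<in> borel_measurable M"
    and k: "\<And>x. 0 \<le> k x" "(\<integral>\<^sup>+x. ennreal (k x) \<partial>M) = 1"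
    and uk: "integrable M (\<lambda>x. u x * k x)"
  shows "ennreal (\<bar>LINT x|M. u x * k x\<bar> powr p) \<le> (\<integral>\<^sup>+x. ennreal (\<bar>u x\<bar> powr p * k x) \<partial>M)"
proof (cases "(\<integral>\<^sup>+x. ennreal (\<bar>u x\<bar> powr p * k x) \<partial>M) = \<infinity>")
  case False
  define b where "b = \<bar>LINT x|M. u x * k x\<bar>"
  have b: "b \<ge> 0" by (simp add: b_def)
  have ik: "integrable M k" and Ik: "(LINT x|M. k x) = 1"
  proof -
    show "integrable M k" by (rule integrableI_nonneg) (use k in auto)
    from nn_integral_eq_integral[OF this] k show "(LINT x|M. k x) = 1" by (simp add: ennreal_eq_1)
  qed
  have iu: "integrable M (\<lambda>x. \<bar>u x\<bar> powr p * k x)"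
    by (rule integrableI_nonneg) (use k False in \<open>auto simp: top.not_eq_extremum\<close>)
  have iuk: "integrable M (\<lambda>x. \<bar>u x\<bar> * k x)"
    using integrable_norm[OF uk] k by (simp add: abs_mult)
  have b_le: "b \<le> (LINT x|M. \<bar>u x\<bar> * k x)"
    unfolding b_def using integral_norm_bound[of M "\<lambda>x. u x * k x"] k by (simp add: abs_mult)
  have "p * b powr (p - 1) * (LINT x|M. \<bar>u x\<bar> * k x) = (LINT x|M. p * b powr (p - 1) * (\<bar>u x\<bar> * k x))"
    by simp
  also have "\<dots> \<le> (LINT x|M. \<bar>u x\<bar> powr p * k x + (p - 1) * b powr p * k x)"
  proof (rule integral_mono)
    show "p * b powr (p - 1) * (\<bar>u x\<bar> * k x) \<le> \<bar>u x\<bar> powr p * k x + (p - 1) * b powr p * k x" for x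
      using mult_right_mono[OF young_powr[OF p _ b, of "\<bar>u x\<bar>"] k(1)[of x]] by (simp add: algebra_simps)
  qed (use iu ik iuk in auto)
  also have "\<dots> = (LINT x|M. \<bar>u x\<bar> powr p * k x) + (p - 1) * b powr p"
    using iu ik Ik by simp
  finally have 1: "p * b powr (p - 1) * (LINT x|M. \<bar>u x\<bar> * k x) \<le> (LINT x|M. \<bar>u x\<bar> powr p * k x) + (p - 1) * b powr p" .
  have "p * b powr p = p * b powr (p - 1) * b"
    using b by (cases "b = 0") (auto simp: powr_diff)
  also have "\<dots> \<le> p * b powr (p - 1) * (LINT x|M. \<bar>u x\<bar> * k x)"
    using p b_le by (intro mult_left_mono) auto
  finally have "b powr p \<le> (LINT x|M. \<bar>u x\<bar> powr p * k x)" using 1 by (simp add: algebra_simps)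
  hence "ennreal (b powr p) \<le> ennreal (LINT x|M. \<bar>u x\<bar> powr p * k x)" by (rule ennreal_leI)
  also have "\<dots> = (\<integral>\<^sup>+x. ennreal (\<bar>u x\<bar> powr p * k x) \<partial>M)"
    by (rule nn_integral_eq_integral[symmetric]) (use iu k in auto)
  finally show ?thesis by (simp add: b_def)
qed simp

text \<open>Mollification of a function that is merely Lebesgue measurable. It agrees with the convolution of a Borel
  representative with the mollifier.\<close>

definition moll :: "real \<Rightarrow> (real^'n::finite \<Rightarrow> real) \<Rightarrow> real^'n \<Rightarrow> real" where
  "moll \<epsilon> u x = (LINT y|lebesgue. u y * mollifier \<epsilon> (x - y))"

lemma mollifier_smooth': "smooth_on U (mollifier \<epsilon>)"
  using mollifier_smooth[of U \<epsilon> 1 0] by simp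

lemma mollifier_C1: "C1 (mollifier \<epsilon>)" by (rule smooth_imp_C1) (rule mollifier_smooth')

lemma mollifier_zero: "0 < \<epsilon> \<Longrightarrow> z \<notin> cball 0 \<epsilon> \<Longrightarrow> mollifier \<epsilon> z = 0"
  using mollifier_support[of \<epsilon> z] by (simp add: not_le)

lemma mollifier_test: "0 < \<epsilon> \<Longrightarrow> mollifier \<epsilon> \<in> test_functions UNIV"
  unfolding test_functions_def
  by (auto intro!: mollifier_smooth' exI[of _ "cball 0 \<epsilon>"] mollifier_zero)

lemma partial_mollifier_zero: "0 < \<epsilon> \<Longrightarrow> z \<notin> cball 0 \<epsilon> \<Longrightarrow> partial i (mollifier \<epsilon>) z = 0"
  by (rule partial_zero_off[of "cball 0 \<epsilon>"]) (auto intro: mollifier_zero)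

lemma mollifier_bounded:
  assumes "0 < \<epsilon>" obtains B where "B > 0" "\<And>z. \<bar>mollifier \<epsilon> z\<bar> \<le> B"
proof -
  from continuous_compact_support_bounded[OF C1_continuous[OF mollifier_C1] compact_cball mollifier_zero[OF assms]]
  show ?thesis using that by (metis real_norm_def)
qed

lemma partial_mollifier_bounded:
  assumes "0 < \<epsilon>" obtains B where "B > 0" "\<And>z. \<bar>partial i (mollifier \<epsilon>) z\<bar> \<le> B"
proof -
  from continuous_compact_support_bounded[OF C1_continuous_partial[OF mollifier_C1] compact_cball partial_mollifier_zero[OF assms]]
  show ?thesis using that by (metis real_norm_def)
qed

lemma borel_measurable_partial_mollifier [measurable]: "partial i (mollifier \<epsilon>) \<in> borel_measurable borel"
  by (rule C1_partial_measurable[OF mollifier_C1])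

lemma borel_imp_lebesgue: "f \<in> borel_measurable borel \<Longrightarrow> f \<in> borel_measurable lebesgue"
  by (rule measurable_completion) simp

lemma integrable_moll:
  assumes "integrable lebesgue u" "0 < \<epsilon>"
  shows "integrable lebesgue (\<lambda>y. u y * mollifier \<epsilon> (x - y))"
    "integrable lebesgue (\<lambda>y. u y * partial i (mollifier \<epsilon>) (x - y))"
proof -
  obtain B where B: "\<And>z::real^'a. \<bar>mollifier \<epsilon> z\<bar> \<le> B" using mollifier_bounded[OF assms(2)] by metis
  show "integrable lebesgue (\<lambda>y. u y * mollifier \<epsilon> (x - y))"
    by (rule integrable_mult_bounded[OF assms(1) borel_imp_lebesgue B]) measurable
  obtain B where B: "\<And>z::real^'a. \<bar>partial i (mollifier \<epsilon>) z\<bar> \<le> B" using partial_mollifier_bounded[OF assms(2)] by metis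
  show "integrable lebesgue (\<lambda>y. u y * partial i (mollifier \<epsilon>) (x - y))"
    by (rule integrable_mult_bounded[OF assms(1) borel_imp_lebesgue B]) measurable
qed

lemma lebesgue_borel_representative:
  fixes u :: "real^'n::finite \<Rightarrow> real"
  assumes u: "integrable lebesgue u"
  obtains u' where "u' \<in> borel_measurable borel" "AE x in lebesgue. u x = u' x" "integrable lborel u'"
    "\<And>g. g \<in> borel_measurable borel \<Longrightarrow> (LINT y|lebesgue. u y * g y) = (LINT y|lborel. u' y * g y)"
proof -
  have um: "u \<in> borel_measurable lebesgue" using u by simp
  obtain u' where u': "u' \<in> borel_measurable lborel" "AE x in lborel. u x = u' x"
    using completion_ex_borel_measurable_real[OF um] by blast
  have [measurable]: "u' \<in> borel_measurable borel" using u'(1) by simp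
  have u'm: "u' \<in> borel_measurable lebesgue" by (rule borel_imp_lebesgue) simp
  have ae: "AE x in lebesgue. u x = u' x" using u'(2) by (rule AE_completion)
  have "integrable lebesgue u'" using integrable_cong_AE_imp[OF u u'm] ae by (auto elim: eventually_mono)
  hence i: "integrable lborel u'" using integrable_completion[of u' lborel] u'(1) by simp
  have "(LINT y|lebesgue. u y * g y) = (LINT y|lborel. u' y * g y)" if g[measurable]: "g \<in> borel_measurable borel" for g
  proof -
    have gl: "g \<in> borel_measurable lebesgue" by (rule borel_imp_lebesgue[OF g])
    have "(LINT y|lebesgue. u y * g y) = (LINT y|lebesgue. u' y * g y)"
      by (rule integral_cong_AE) (use um u'm gl ae in \<open>auto elim: eventually_mono\<close>)
    also have "\<dots> = (LINT y|lborel. u' y * g y)"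
      by (rule integral_completion) measurable
    finally show ?thesis .
  qed
  with that u'(1) ae i show ?thesis by simp
qed

lemma moll_eq_conv:
  fixes u :: "real^'n::finite \<Rightarrow> real"
  assumes u: "integrable lebesgue u"
  obtains u' where "u' \<in> borel_measurable borel" "AE x in lebesgue. u x = u' x" "integrable lborel u'"
    "moll \<epsilon> u = conv u' (mollifier \<epsilon>)"
    "\<And>i x. (LINT y|lebesgue. u y * partial i (mollifier \<epsilon>) (x - y)) = conv u' (partial i (mollifier \<epsilon>)) x"
proof (rule lebesgue_borel_representative[OF u])
  fix u'
  assume u': "u' \<in> borel_measurable borel" "AE x in lebesgue. u x = u' x" "integrable lborel u'"
    "\<And>g. g \<in> borel_measurable borel \<Longrightarrow> (LINT y|lebesgue. u y * g y) = (LINT y|lborel. u' y * g y)"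
  have "moll \<epsilon> u = conv u' (mollifier \<epsilon>)"
    unfolding moll_def conv_def by (rule ext, rule u'(4)) measurable
  moreover have "(LINT y|lebesgue. u y * partial i (mollifier \<epsilon>) (x - y)) = conv u' (partial i (mollifier \<epsilon>)) x" for i x
    unfolding conv_def by (rule u'(4)) measurable
  ultimately show ?thesis using that u' by blast
qed

lemma smooth_moll:
  assumes u: "integrable lebesgue u" and e: "0 < \<epsilon>"
  shows "smooth_on UNIV (moll \<epsilon> u)"
proof -
  obtain u' where u': "integrable lborel u'" "moll \<epsilon> u = conv u' (mollifier \<epsilon>)"
    using moll_eq_conv[OF u] by metis
  thus ?thesis using smooth_conv[OF u'(1) mollifier_test[OF e]] by simp
qed

lemma partial_moll:
  assumes u: "integrable lebesgue u" and e: "0 < \<epsilon>"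
  shows "partial i (moll \<epsilon> u) x = (LINT y|lebesgue. u y * partial i (mollifier \<epsilon>) (x - y))"
proof -
  obtain u' where u': "integrable lborel u'" "moll \<epsilon> u = conv u' (mollifier \<epsilon>)"
    "\<And>i x. (LINT y|lebesgue. u y * partial i (mollifier \<epsilon>) (x - y)) = conv u' (partial i (mollifier \<epsilon>)) x"
    using moll_eq_conv[OF u, of \<epsilon>] by metis
  thus ?thesis using partial_conv(1)[OF u'(1) mollifier_test[OF e]] by simp
qed

lemma borel_measurable_moll: 
  assumes u: "integrable lebesgue u" and e: "0 < \<epsilon>"
  shows "moll \<epsilon> u \<in> borel_measurable borel"
  by (rule C1_measurable[OF smooth_imp_C1[OF smooth_moll[OF assms]]])

text \<open>Mollification does not increase the \<open>L\<^sup>p\<close> norm: Jensen's inequality pointwise, then Fubini's theorem.\<close>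

lemma moll_contraction:
  fixes u :: "real^'n::finite \<Rightarrow> real"
  assumes u: "integrable lebesgue u" and e: "0 < \<epsilon>" and p: "1 \<le> p"
  shows "(\<integral>\<^sup>+x. ennreal (\<bar>moll \<epsilon> u x\<bar> powr p) \<partial>lebesgue) \<le> (\<integral>\<^sup>+x. ennreal (\<bar>u x\<bar> powr p) \<partial>lebesgue)"
proof -
  obtain u' where u': "u' \<in> borel_measurable borel" "AE x in lebesgue. u x = u' x" "integrable lborel u'"
    "moll \<epsilon> u = conv u' (mollifier \<epsilon>)"
    using moll_eq_conv[OF u, of \<epsilon>] by metis
  note [measurable] = u'(1) borel_measurable_moll[OF u e]
  obtain B where B: "\<And>z::real^'n. \<bar>mollifier \<epsilon> z\<bar> \<le> B" using mollifier_bounded[OF e] by metis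
  have "(\<integral>\<^sup>+x. ennreal (\<bar>moll \<epsilon> u x\<bar> powr p) \<partial>lebesgue) = (\<integral>\<^sup>+x. ennreal (\<bar>moll \<epsilon> u x\<bar> powr p) \<partial>lborel)"
    by (rule nn_integral_completion) measurable
  also have "\<dots> \<le> (\<integral>\<^sup>+x. (\<integral>\<^sup>+y. ennreal (\<bar>u' y\<bar> powr p * mollifier \<epsilon> (x - y)) \<partial>lborel) \<partial>lborel)"
  proof (rule nn_integral_mono)
    fix x :: "real^'n"
    show "ennreal (\<bar>moll \<epsilon> u x\<bar> powr p) \<le> (\<integral>\<^sup>+y. ennreal (\<bar>u' y\<bar> powr p * mollifier \<epsilon> (x - y)) \<partial>lborel)"
      unfolding u'(4) conv_def
    proof (rule jensen_powr[OF p])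
      show "integrable lborel (\<lambda>y. u' y * mollifier \<epsilon> (x - y))"
        by (rule integrable_mult_bounded[OF u'(3) _ B]) measurable
    qed (use e mollifier_nonneg nn_integral_mollifier_diff in auto)
  qed
  also have "\<dots> = (\<integral>\<^sup>+y. (\<integral>\<^sup>+x. ennreal (\<bar>u' y\<bar> powr p * mollifier \<epsilon> (x - y)) \<partial>lborel) \<partial>lborel)"
    by (rule lborel_pair.Fubini') measurable
  also have "\<dots> = (\<integral>\<^sup>+y. ennreal (\<bar>u' y\<bar> powr p) \<partial>lborel)"
  proof (rule nn_integral_cong)
    fix y :: "real^'n"
    have "(\<integral>\<^sup>+x. ennreal (\<bar>u' y\<bar> powr p * mollifier \<epsilon> (x - y)) \<partial>lborel) = ennreal (\<bar>u' y\<bar> powr p) * (\<integral>\<^sup>+x. ennreal (mollifier \<epsilon> (x - y)) \<partial>lborel)"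
      by (subst nn_integral_cmult[symmetric]) (auto simp: ennreal_mult' intro!: nn_integral_cong)
    thus "(\<integral>\<^sup>+x. ennreal (\<bar>u' y\<bar> powr p * mollifier \<epsilon> (x - y)) \<partial>lborel) = ennreal (\<bar>u' y\<bar> powr p)"
      by (simp add: nn_integral_mollifier_diff[OF e])
  qed
  also have "\<dots> = (\<integral>\<^sup>+y. ennreal (\<bar>u' y\<bar> powr p) \<partial>lebesgue)"
    by (rule nn_integral_completion[symmetric]) measurable
  also have "\<dots> = (\<integral>\<^sup>+y. ennreal (\<bar>u y\<bar> powr p) \<partial>lebesgue)"
    by (rule nn_integral_cong_AE) (use u'(2) in \<open>auto elim: eventually_mono\<close>)
  finally show ?thesis .
qed

lemma moll_diff:
  assumes "integrable lebesgue u" "integrable lebesgue v" "0 < \<epsilon>"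
  shows "moll \<epsilon> (\<lambda>x. u x - v x) x = moll \<epsilon> u x - moll \<epsilon> v x"
  unfolding moll_def left_diff_distrib
  using integrable_moll(1)[OF assms(1,3)] integrable_moll(1)[OF assms(2,3)] by simp

lemma moll_zero_off:
  assumes "0 < \<epsilon>" "\<And>y. dist x y \<le> \<epsilon> \<Longrightarrow> u y = 0"
  shows "moll \<epsilon> u x = 0"
proof -
  have "(\<lambda>y. u y * mollifier \<epsilon> (x - y)) = (\<lambda>y. 0)"
  proof
    fix y show "u y * mollifier \<epsilon> (x - y) = 0"
    proof (cases "dist x y \<le> \<epsilon>")
      case False
      then have "mollifier \<epsilon> (x - y) = 0" by (intro mollifier_support assms(1)) (simp add: dist_norm)
      then show ?thesis by simp
    qed (simp add: assms(2))
  qed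
  then show ?thesis by (simp only: moll_def integral_zero)
qed

lemma integral_mollifier_diff:
  assumes "0 < \<epsilon>"
  shows "integrable lebesgue (\<lambda>y. mollifier \<epsilon> (x - y::real^'n::finite))"
    "(LINT y|lebesgue. mollifier \<epsilon> (x - y::real^'n::finite)) = 1"
proof -
  have i: "integrable lborel (\<lambda>y. mollifier \<epsilon> (x - y))"
    by (rule integrableI_nonneg) (use nn_integral_mollifier_diff[OF assms, of x] mollifier_nonneg[OF assms] in auto)
  thus "integrable lebesgue (\<lambda>y. mollifier \<epsilon> (x - y::real^'n::finite))"
    by (subst integrable_completion) auto
  have "(LINT y|lborel. mollifier \<epsilon> (x - y)) = 1"
    using nn_integral_eq_integral[OF i AE_I2[OF mollifier_nonneg[OF assms]]] nn_integral_mollifier_diff(1)[OF assms, of x]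
    by (simp add: ennreal_eq_1)
  thus "(LINT y|lebesgue. mollifier \<epsilon> (x - y)) = 1" by (subst integral_completion) auto
qed

lemma moll_uniform:
  assumes e: "0 < \<epsilon>" and c: "integrable lebesgue c" and h: "\<And>y. dist x y \<le> \<epsilon> \<Longrightarrow> \<bar>c y - c x\<bar> \<le> h"
  shows "\<bar>moll \<epsilon> c x - c x\<bar> \<le> h"
proof -
  note im = integral_mollifier_diff[OF e, of x]
  have "moll \<epsilon> c x - c x = (LINT y|lebesgue. c y * mollifier \<epsilon> (x - y)) - (LINT y|lebesgue. c x * mollifier \<epsilon> (x - y))"
    using im by (simp add: moll_def)
  also have "\<dots> = (LINT y|lebesgue. (c y - c x) * mollifier \<epsilon> (x - y))"
    using im integrable_moll(1)[OF c e, of x] by (simp add: left_diff_distrib)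
  also have "\<bar>\<dots>\<bar> \<le> (LINT y|lebesgue. \<bar>(c y - c x) * mollifier \<epsilon> (x - y)\<bar>)"
    by (rule integral_abs_bound)
  also have "\<dots> \<le> (LINT y|lebesgue. h * mollifier \<epsilon> (x - y))"
  proof (rule integral_mono)
    show "integrable lebesgue (\<lambda>y. \<bar>(c y - c x) * mollifier \<epsilon> (x - y)\<bar>)"
      using im integrable_moll(1)[OF c e, of x] by (auto simp: left_diff_distrib)
    show "\<bar>(c y - c x) * mollifier \<epsilon> (x - y)\<bar> \<le> h * mollifier \<epsilon> (x - y)" for y
    proof (cases "dist x y \<le> \<epsilon>")
      case True
      then show ?thesis using h[of y] mollifier_nonneg[OF e, of "x - y"]
        by (auto simp: abs_mult intro!: mult_right_mono)
    next
      case False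
      then have "mollifier \<epsilon> (x - y) = 0" by (intro mollifier_support e) (simp add: dist_norm)
      then show ?thesis by simp
    qed
  qed (use im in auto)
  also have "\<dots> = h" using im by simp
  finally show ?thesis .
qed

lemma le_one_add_powr: 
  fixes t p :: real assumes "0 \<le> t" "1 \<le> p" shows "t \<le> 1 + t powr p"
proof (cases "t \<le> 1")
  case False
  hence "t powr 1 \<le> t powr p" using assms by (intro powr_mono) auto
  thus ?thesis using False by simp
qed (simp add: add_increasing2)

lemma emeasure_lborel_cball_less_top: "emeasure lborel (cball c r) < top"
  using emeasure_lborel_cball_finite[of c r] by (simp only: infinity_ennreal_def)

lemma integrable_of_Lp_bounded_support:
  fixes u :: "real^'n::finite \<Rightarrow> real"
  assumes u: "u \<in> borel_measurable lebesgue" and R: "\<And>x. x \<notin> cball 0 R \<Longrightarrow> u x = 0"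
    and p: "1 \<le> p" and fin: "(\<integral>\<^sup>+x. ennreal (\<bar>u x\<bar> powr p) \<partial>lebesgue) < \<infinity>"
  shows "integrable lebesgue u"
proof (rule Bochner_Integration.integrable_bound)
  have "integrable lebesgue (\<lambda>x. \<bar>u x\<bar> powr p)"
    by (rule integrableI_nonneg) (use u fin in auto)
  moreover have "integrable lebesgue (indicat_real (cball (0::real^'n) R))"
    by (intro integrable_real_indicator) (auto simp: emeasure_lborel_cball_less_top)
  ultimately show "integrable lebesgue (\<lambda>x. indicat_real (cball 0 R) x + \<bar>u x\<bar> powr p)" by simp
  have "\<bar>u x\<bar> \<le> indicat_real (cball 0 R) x + \<bar>u x\<bar> powr p" for x
    using le_one_add_powr[of "\<bar>u x\<bar>" p] p R[of x] by (cases "x \<in> cball 0 R") auto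
  thus "AE x in lebesgue. norm (u x) \<le> norm (indicat_real (cball 0 R) x + \<bar>u x\<bar> powr p)"
    by (auto intro!: AE_I2 order_trans[OF _ abs_ge_self])
qed (use u in auto)

lemma clip_approximates_Lp:
  fixes u :: "'a \<Rightarrow> real"
  assumes [measurable]: "u \<in> borel_measurable M" and p: "1 \<le> p"
    and fin: "(\<integral>\<^sup>+x. ennreal (\<bar>u x\<bar> powr p) \<partial>M) < \<infinity>" and e: "e > 0"
  obtains k :: nat where "k > 0" "(\<integral>\<^sup>+x. ennreal (\<bar>u x - max (- real k) (min (real k) (u x))\<bar> powr p) \<partial>M) < e"
proof -
  let ?c = "\<lambda>k x. \<bar>u x - max (- real k) (min (real k) (u x))\<bar>"
  have "(\<lambda>k. \<integral>\<^sup>+x. ennreal (?c k x powr p) \<partial>M) \<longlonglongrightarrow> (\<integral>\<^sup>+x. 0 \<partial>M)"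
  proof (rule nn_integral_dominated_convergence[where w = "\<lambda>x. ennreal (\<bar>u x\<bar> powr p)"])
    show "AE x in M. ennreal (?c j x powr p) \<le> ennreal (\<bar>u x\<bar> powr p)" for j
      using p by (intro AE_I2 ennreal_leI powr_mono2) (auto simp: max_def min_def)
    have "(\<lambda>k. ennreal (?c k x powr p)) \<longlonglongrightarrow> 0" for x
    proof (rule tendsto_eventually)
      have "\<forall>\<^sub>F k in sequentially. \<bar>u x\<bar> \<le> real k"
        using eventually_ge_at_top[of "nat \<lceil>\<bar>u x\<bar>\<rceil>"] by eventually_elim linarith
      thus "\<forall>\<^sub>F k in sequentially. ennreal (?c k x powr p) = 0"
        by eventually_elim (auto simp: max_def min_def)
    qed
    thus "AE x in M. (\<lambda>k. ennreal (?c k x powr p)) \<longlonglongrightarrow> 0" by simp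
  qed (use fin in auto)
  hence "\<forall>\<^sub>F k in sequentially. (\<integral>\<^sup>+x. ennreal (?c k x powr p) \<partial>M) < e"
    using e by (intro order_tendstoD) auto
  hence "\<forall>\<^sub>F k in sequentially. k > 0 \<and> (\<integral>\<^sup>+x. ennreal (?c k x powr p) \<partial>M) < e"
    using eventually_gt_at_top[of 0] by eventually_elim auto
  then obtain k where "k > 0 \<and> (\<integral>\<^sup>+x. ennreal (?c k x powr p) \<partial>M) < e"
    unfolding eventually_sequentially by blast
  with that show ?thesis by blast
qed

lemma nn_integral_powr_add_le:
  fixes a b :: "'a \<Rightarrow> 'b::{real_normed_vector, second_countable_topology}"
  assumes [measurable]: "a \<in> borel_measurable M" "b \<in> borel_measurable M" and p: "0 \<le> p"
  shows "(\<integral>\<^sup>+x. ennreal (norm (a x + b x) powr p) \<partial>M) \<le> ennreal (2 powr p) *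
    ((\<integral>\<^sup>+x. ennreal (norm (a x) powr p) \<partial>M) + (\<integral>\<^sup>+x. ennreal (norm (b x) powr p) \<partial>M))"
proof -
  have "(\<integral>\<^sup>+x. ennreal (norm (a x + b x) powr p) \<partial>M) \<le>
     (\<integral>\<^sup>+x. ennreal (2 powr p) * (ennreal (norm (a x) powr p) + ennreal (norm (b x) powr p)) \<partial>M)"
    using powr_add_le[OF p, of "a _" "b _"]
    by (intro nn_integral_mono) (auto simp flip: ennreal_plus ennreal_mult' intro!: ennreal_leI)
  also have "\<dots> = ennreal (2 powr p) *
    ((\<integral>\<^sup>+x. ennreal (norm (a x) powr p) \<partial>M) + (\<integral>\<^sup>+x. ennreal (norm (b x) powr p) \<partial>M))"
    by (simp add: nn_integral_cmult nn_integral_add)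
  finally show ?thesis .
qed

lemma bounded_approximated_by_continuous:
  fixes u :: "real^'n::finite \<Rightarrow> real"
  assumes u[measurable]: "u \<in> borel_measurable lebesgue" and R: "\<And>x. x \<notin> cball 0 R \<Longrightarrow> u x = 0"
    and p: "1 \<le> p" and k: "k > 0" "\<And>x. \<bar>u x\<bar> \<le> k" and e: "(e::real) > 0"
  obtains c where "continuous_on UNIV c" "\<And>x. x \<notin> cball 0 (R + 1) \<Longrightarrow> c x = 0"
    "(\<integral>\<^sup>+x. ennreal (\<bar>u x - c x\<bar> powr p) \<partial>lebesgue) < ennreal e"
proof -
  define S where "S = cball (0::real^'n) (R + 1)"
  have "u measurable_on UNIV"
    by (intro lebesgue_measurable_imp_measurable_on) (use u in auto)
  then obtain N g where N: "negligible N" and g: "\<And>n. continuous_on UNIV (g n)"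
    "\<And>x. x \<notin> N \<Longrightarrow> (\<lambda>n. g n x) \<longlonglongrightarrow> u x"
    unfolding measurable_on_def by auto
  define w where "w x = max 0 (min 1 (R + 1 - norm x))" for x :: "real^'n"
  define c where "c n x = max (- k) (min k (g n x)) * w x" for n :: nat and x
  have cont: "continuous_on UNIV (c n)" for n unfolding c_def w_def by (intro continuous_intros g(1))
  have [measurable]: "c n \<in> borel_measurable lebesgue" for n
    by (intro borel_imp_lebesgue borel_measurable_continuous_onI cont)
  have c0: "c n x = 0" if "x \<notin> cball 0 (R + 1)" for n x
    using that by (simp add: c_def w_def)
  have ck: "\<bar>c n x\<bar> \<le> k" for n x
  proof -
    have "\<bar>c n x\<bar> \<le> k * 1" unfolding c_def abs_mult using k(1)
      by (intro mult_mono) (auto simp: max_def min_def w_def)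
    thus ?thesis by simp
  qed
  have lim: "(\<lambda>n. c n x) \<longlonglongrightarrow> u x" if "x \<notin> N" for x
  proof -
    have "(\<lambda>n. c n x) \<longlonglongrightarrow> max (- k) (min k (u x)) * w x"
      unfolding c_def by (intro tendsto_intros g(2) that)
    moreover have "max (- k) (min k (u x)) * w x = u x"
    proof (cases "norm x \<le> R")
      case True
      hence "w x = 1" by (simp add: w_def)
      thus ?thesis using k(2)[of x] by (auto simp: max_def min_def)
    next
      case False
      thus ?thesis using R[of x] k(1) by simp
    qed
    ultimately show ?thesis by simp
  qed
  have "(\<lambda>n. \<integral>\<^sup>+x. ennreal (\<bar>u x - c n x\<bar> powr p) \<partial>lebesgue) \<longlonglongrightarrow> (\<integral>\<^sup>+x. 0 \<partial>(lebesgue :: (real^'n) measure))"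
  proof (rule nn_integral_dominated_convergence[where w = "\<lambda>x. ennreal ((2 * k) powr p) * indicator S x"])
    have "\<bar>u x - c n x\<bar> powr p \<le> (2 * k) powr p" for n x
      using k(2)[of x] ck[of n x] p by (intro powr_mono2) auto
    moreover have "\<bar>u x - c n x\<bar> powr p = 0" if "x \<notin> S" for n x
      using that R[of x] c0[of x n] by (auto simp: S_def)
    ultimately show "AE x in lebesgue. ennreal (\<bar>u x - c n x\<bar> powr p) \<le> ennreal ((2 * k) powr p) * indicator S x" for n
      by (intro AE_I2) (auto simp: indicator_def intro!: ennreal_leI)
    show "(\<integral>\<^sup>+x. ennreal ((2 * k) powr p) * indicator S x \<partial>lebesgue) < \<infinity>"
      by (simp add: S_def nn_integral_cmult_indicator ennreal_mult_less_top emeasure_lborel_cball_less_top)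
    have "(\<lambda>n. ennreal (\<bar>u x - c n x\<bar> powr p)) \<longlonglongrightarrow> 0" if "x \<notin> N" for x
    proof -
      have "(\<lambda>n. \<bar>u x - c n x\<bar>) \<longlonglongrightarrow> 0"
        using tendsto_rabs[OF tendsto_diff[OF tendsto_const lim[OF that], of "u x"]] by simp
      hence "(\<lambda>n. \<bar>u x - c n x\<bar> powr p) \<longlonglongrightarrow> 0 powr p"
        using p by (intro tendsto_powr') auto
      thus ?thesis using tendsto_ennrealI[of _ 0] by simp
    qed
    moreover have "AE x in lebesgue. x \<notin> N"
      using N by (simp add: negligible_iff_null_sets AE_not_in)
    ultimately show "AE x in lebesgue. (\<lambda>n. ennreal (\<bar>u x - c n x\<bar> powr p)) \<longlonglongrightarrow> 0" by auto
    show "(\<lambda>x. ennreal ((2 * k) powr p) * indicator S x) \<in> borel_measurable lebesgue"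
      by (intro borel_measurable_times_ennreal borel_measurable_const borel_measurable_indicator)
         (simp add: S_def)
    show "(\<lambda>x. ennreal (\<bar>u x - c n x\<bar> powr p)) \<in> borel_measurable lebesgue" for n by measurable
    show "(\<lambda>x. 0 :: ennreal) \<in> borel_measurable lebesgue" by measurable
  qed
  hence "\<forall>\<^sub>F n in sequentially. (\<integral>\<^sup>+x. ennreal (\<bar>u x - c n x\<bar> powr p) \<partial>lebesgue) < ennreal e"
    using e by (intro order_tendstoD) auto
  then obtain n where "(\<integral>\<^sup>+x. ennreal (\<bar>u x - c n x\<bar> powr p) \<partial>lebesgue) < ennreal e"
    unfolding eventually_sequentially by blast
  with that cont c0 show ?thesis by blast
qed

lemma Lp_approximated_by_continuous:
  fixes u :: "real^'n::finite \<Rightarrow> real"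
  assumes u[measurable]: "u \<in> borel_measurable lebesgue" and R: "\<And>x. x \<notin> cball 0 R \<Longrightarrow> u x = 0"
    and p: "1 \<le> p" and fin: "(\<integral>\<^sup>+x. ennreal (\<bar>u x\<bar> powr p) \<partial>lebesgue) < \<infinity>" and e: "(e::real) > 0"
  obtains c where "continuous_on UNIV c" "\<And>x. x \<notin> cball 0 (R + 1) \<Longrightarrow> c x = 0"
    "(\<integral>\<^sup>+x. ennreal (\<bar>u x - c x\<bar> powr p) \<partial>lebesgue) < ennreal e"
proof -
  define e1 where "e1 = e / (2 * 2 powr p)"
  have e1: "e1 > 0" using e by (simp add: e1_def)
  obtain k :: nat where k: "k > 0" "(\<integral>\<^sup>+x. ennreal (\<bar>u x - max (- real k) (min (real k) (u x))\<bar> powr p) \<partial>lebesgue) < ennreal e1"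
    using clip_approximates_Lp[OF u p fin, of "ennreal e1"] e1 by auto
  define v where "v x = max (- real k) (min (real k) (u x))" for x
  have [measurable]: "v \<in> borel_measurable lebesgue" unfolding v_def by measurable
  obtain c where c: "continuous_on UNIV c" "\<And>x. x \<notin> cball 0 (R + 1) \<Longrightarrow> c x = 0"
    "(\<integral>\<^sup>+x. ennreal (\<bar>v x - c x\<bar> powr p) \<partial>lebesgue) < ennreal e1"
  proof (rule bounded_approximated_by_continuous[of v R p "real k" e1])
    show "x \<notin> cball 0 R \<Longrightarrow> v x = 0" for x using R[of x] by (simp add: v_def)
    show "\<bar>v x\<bar> \<le> real k" for x by (auto simp: v_def)
  qed (use p k e1 in auto)
  have cm[measurable]: "c \<in> borel_measurable lebesgue"
    by (intro borel_imp_lebesgue borel_measurable_continuous_onI c(1))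
  have "(\<integral>\<^sup>+x. ennreal (\<bar>u x - c x\<bar> powr p) \<partial>lebesgue) = (\<integral>\<^sup>+x. ennreal (norm ((u x - v x) + (v x - c x)) powr p) \<partial>lebesgue)"
    by simp
  also have "\<dots> \<le> ennreal (2 powr p) *
    ((\<integral>\<^sup>+x. ennreal (norm (u x - v x) powr p) \<partial>lebesgue) + (\<integral>\<^sup>+x. ennreal (norm (v x - c x) powr p) \<partial>lebesgue))"
    by (rule nn_integral_powr_add_le) (use p in auto)
  also have "\<dots> < ennreal (2 powr p) * (ennreal e1 + ennreal e1)"
    using k(2) c(3) by (intro ennreal_mult_strict_left_mono add_strict_mono) (auto simp: v_def)
  also have "\<dots> = ennreal e" using e by (simp add: e1_def flip: ennreal_plus ennreal_mult')
  finally show ?thesis using that c by blast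
qed

text \<open>The function is split into a continuous function with compact support, on which mollification converges
  uniformly, and a remainder that is small in \<open>L\<^sup>p\<close> and remains so under mollification.\<close>

lemma moll_Lp_converges:
  fixes u :: "real^'n::finite \<Rightarrow> real"
  assumes u[measurable]: "u \<in> borel_measurable lebesgue" and R: "\<And>x. x \<notin> cball 0 R \<Longrightarrow> u x = 0"
    and p: "1 \<le> p" and fin: "(\<integral>\<^sup>+x. ennreal (\<bar>u x\<bar> powr p) \<partial>lebesgue) < \<infinity>" and e: "(e::real) > 0"
  obtains d where "d > 0" "\<And>\<epsilon>. 0 < \<epsilon> \<Longrightarrow> \<epsilon> < d \<Longrightarrow>
     (\<integral>\<^sup>+x. ennreal (\<bar>moll \<epsilon> u x - u x\<bar> powr p) \<partial>lebesgue) < ennreal e"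
proof -
  note iu = integrable_of_Lp_bounded_support[OF u R p fin]
  define e1 where "e1 = e / (4 * 2 powr p * 2 powr p)"
  have e1: "e1 > 0" using e by (simp add: e1_def)
  obtain c where c: "continuous_on UNIV c" "\<And>x. x \<notin> cball 0 (R + 1) \<Longrightarrow> c x = 0"
    "(\<integral>\<^sup>+x. ennreal (\<bar>u x - c x\<bar> powr p) \<partial>lebesgue) < ennreal e1"
    using Lp_approximated_by_continuous[OF u R p fin e1] by blast
  have cm[measurable]: "c \<in> borel_measurable lebesgue"
    by (intro borel_imp_lebesgue borel_measurable_continuous_onI c(1))
  have ic: "integrable lebesgue c"
    using integrable_continuous_compact_support[OF c(1) compact_cball[of 0 "R + 1"] c(2)]
    by (subst integrable_completion) (simp_all add: borel_measurable_continuous_onI[OF c(1)])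
  define V where "V = measure lebesgue (cball (0::real^'n) (R + 2))"
  have V: "V \<ge> 0" by (simp add: V_def)
  define h where "h = (e1 / (V + 1)) powr (1 / p)"
  have h: "h > 0" "h powr p = e1 / (V + 1)" using e1 V p by (auto simp: h_def powr_powr)
  have "uniformly_continuous_on UNIV c"
    by (rule continuous_compact_support_uniformly_continuous[OF c(1) compact_cball[of 0 "R + 1"] c(2)])
  then obtain d where d: "d > 0" "\<And>x y. dist y x < d \<Longrightarrow> dist (c y) (c x) < h"
    using h(1) unfolding uniformly_continuous_on_def by (metis UNIV_I)
  show ?thesis
  proof (rule that[of "min d 1"])
    fix \<epsilon> :: real assume \<epsilon>: "0 < \<epsilon>" "\<epsilon> < min d 1"
    note [measurable] = borel_imp_lebesgue[OF borel_measurable_moll[OF iu \<epsilon>(1)]]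
      borel_imp_lebesgue[OF borel_measurable_moll[OF ic \<epsilon>(1)]]
    have A: "(\<integral>\<^sup>+x. ennreal (norm (moll \<epsilon> u x - moll \<epsilon> c x) powr p) \<partial>lebesgue) < ennreal e1"
    proof -
      have "(\<integral>\<^sup>+x. ennreal (\<bar>moll \<epsilon> (\<lambda>x. u x - c x) x\<bar> powr p) \<partial>lebesgue) \<le> (\<integral>\<^sup>+x. ennreal (\<bar>u x - c x\<bar> powr p) \<partial>lebesgue)"
        by (rule moll_contraction) (use iu ic \<epsilon> p in auto)
      moreover have "moll \<epsilon> (\<lambda>x. u x - c x) = (\<lambda>x. moll \<epsilon> u x - moll \<epsilon> c x)"
        by (rule ext) (rule moll_diff[OF iu ic \<epsilon>(1)])
      ultimately show ?thesis using c(3) unfolding real_norm_def by (simp only: order_le_less_trans)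
    qed
    have B: "(\<integral>\<^sup>+x. ennreal (norm (moll \<epsilon> c x - c x) powr p) \<partial>lebesgue) \<le> ennreal e1"
    proof -
      have pt: "\<bar>moll \<epsilon> c x - c x\<bar> powr p \<le> h powr p * indicator (cball 0 (R + 2)) x" for x
      proof (cases "x \<in> cball 0 (R + 2)")
        case True
        have "\<bar>c y - c x\<bar> \<le> h" if "dist x y \<le> \<epsilon>" for y
          using d(2)[of y x] that \<epsilon> by (simp add: dist_real_def dist_commute)
        hence "\<bar>moll \<epsilon> c x - c x\<bar> \<le> h" by (rule moll_uniform[OF \<epsilon>(1) ic])
        thus ?thesis using True p by (auto intro: powr_mono2)
      next
        case False
        have far: "c y = 0" if "dist x y \<le> \<epsilon>" for y
        proof -
          have "norm x \<le> norm y + dist x y" using norm_triangle_ineq[of y "x - y"] by (simp add: dist_norm)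
          thus ?thesis using that \<epsilon> False by (intro c(2)) auto
        qed
        have "moll \<epsilon> c x = 0" by (rule moll_zero_off[OF \<epsilon>(1) far])
        moreover have "c x = 0" using far[of x] \<epsilon> by simp
        ultimately show ?thesis by simp
      qed
      have "(\<integral>\<^sup>+x. ennreal (norm (moll \<epsilon> c x - c x) powr p) \<partial>lebesgue) \<le> (\<integral>\<^sup>+x. ennreal (h powr p) * indicator (cball (0::real^'n) (R + 2)) x \<partial>lebesgue)"
      proof (intro nn_integral_mono)
        fix x :: "real^'n"
        have "ennreal (norm (moll \<epsilon> c x - c x) powr p) \<le> ennreal (h powr p * indicat_real (cball 0 (R + 2)) x)"
          using pt[of x] by (intro ennreal_leI) simp
        thus "ennreal (norm (moll \<epsilon> c x - c x) powr p) \<le> ennreal (h powr p) * indicator (cball 0 (R + 2)) x"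
          by (simp add: ennreal_mult'' ennreal_indicator)
      qed
      also have "\<dots> = ennreal (h powr p) * emeasure lebesgue (cball (0::real^'n) (R + 2))"
        by (simp add: nn_integral_cmult_indicator)
      also have "emeasure lebesgue (cball (0::real^'n) (R + 2)) = ennreal V"
        unfolding V_def by (intro emeasure_eq_measure2 fmeasurableD2 lmeasurable_cball)
      also have "ennreal (h powr p) * ennreal V = ennreal (e1 / (V + 1) * V)" 
        unfolding h(2) using V e1 by (intro ennreal_mult'[symmetric]) auto
      also have "\<dots> \<le> ennreal e1" using e1 V by (intro ennreal_leI) (simp add: field_simps)
      finally show ?thesis .
    qed
    have C: "(\<integral>\<^sup>+x. ennreal (norm (c x - u x) powr p) \<partial>lebesgue) \<le> ennreal e1"
      using c(3) by (simp add: abs_minus_commute)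
    have "(\<integral>\<^sup>+x. ennreal (\<bar>moll \<epsilon> u x - u x\<bar> powr p) \<partial>lebesgue)
      = (\<integral>\<^sup>+x. ennreal (norm ((moll \<epsilon> u x - moll \<epsilon> c x) + ((moll \<epsilon> c x - c x) + (c x - u x))) powr p) \<partial>lebesgue)"
      by simp
    also have "\<dots> \<le> ennreal (2 powr p) * ((\<integral>\<^sup>+x. ennreal (norm (moll \<epsilon> u x - moll \<epsilon> c x) powr p) \<partial>lebesgue) +
       (\<integral>\<^sup>+x. ennreal (norm ((moll \<epsilon> c x - c x) + (c x - u x)) powr p) \<partial>lebesgue))"
      by (rule nn_integral_powr_add_le) (use p in auto)
    also have "\<dots> \<le> ennreal (2 powr p) * (ennreal e1 + ennreal (2 powr p) * (ennreal e1 + ennreal e1))"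
    proof (intro mult_left_mono add_mono order_refl less_imp_le[OF A])
      have "(\<integral>\<^sup>+x. ennreal (norm ((moll \<epsilon> c x - c x) + (c x - u x)) powr p) \<partial>lebesgue) \<le>
        ennreal (2 powr p) * ((\<integral>\<^sup>+x. ennreal (norm (moll \<epsilon> c x - c x) powr p) \<partial>lebesgue) +
       (\<integral>\<^sup>+x. ennreal (norm (c x - u x) powr p) \<partial>lebesgue))"
        by (rule nn_integral_powr_add_le) (use p in auto)
      also have "\<dots> \<le> ennreal (2 powr p) * (ennreal e1 + ennreal e1)"
        using B C by (intro mult_left_mono add_mono) auto
      finally show "(\<integral>\<^sup>+x. ennreal (norm ((moll \<epsilon> c x - c x) + (c x - u x)) powr p) \<partial>lebesgue) \<le> ennreal (2 powr p) * (ennreal e1 + ennreal e1)" .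
    qed auto
    also have "\<dots> = ennreal (2 powr p * (e1 + 2 powr p * (e1 + e1)))"
      using e1 by (simp flip: ennreal_plus ennreal_mult')
    also have "\<dots> < ennreal e"
    proof (rule ennreal_lessI[OF e])
      define c2 where "c2 = 2 powr p"
      have c2: "1 \<le> c2" unfolding c2_def using p by (intro ge_one_powr_ge_zero) auto
      have "1 * (c2 * e1) \<le> c2 * (c2 * e1)" using c2 e1 by (intro mult_right_mono) auto
      moreover have "0 < c2 * (c2 * e1)" using c2 e1 by simp
      moreover have "c2 * (e1 + c2 * (e1 + e1)) = c2 * e1 + 2 * (c2 * (c2 * e1))" by (simp add: algebra_simps)
      moreover have "e = 4 * (c2 * (c2 * e1))" using c2 by (simp add: e1_def c2_def[symmetric])
      ultimately show "2 powr p * (e1 + 2 powr p * (e1 + e1)) < e" unfolding c2_def[symmetric] by linarith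
    qed
    finally show "(\<integral>\<^sup>+x. ennreal (\<bar>moll \<epsilon> u x - u x\<bar> powr p) \<partial>lebesgue) < ennreal e" .
  qed (use d in auto)
qed

section \<open>Weak gradients and mollification\<close>

lemma lebesgue_on_supported:
  fixes f :: "'a::euclidean_space \<Rightarrow> 'b::euclidean_space"
  assumes "T \<in> sets lebesgue" "S \<in> sets lebesgue" "S \<subseteq> T" "\<And>x. x \<in> T \<Longrightarrow> x \<notin> S \<Longrightarrow> f x = 0"
  shows "(LINT x|lebesgue_on T. f x) = (LINT x|lebesgue_on S. f x)"
    "integrable (lebesgue_on T) f \<longleftrightarrow> integrable (lebesgue_on S) f"
proof -
  have "(LINT x|lebesgue_on T. f x) = (LINT x|lebesgue_on T. (if x \<in> S then f x else 0))"
    using assms by (intro Bochner_Integration.integral_cong) auto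
  thus "(LINT x|lebesgue_on T. f x) = (LINT x|lebesgue_on S. f x)"
    using integral_restrict[OF assms(3,2,1), of f] by simp
  have "(\<lambda>x. if x \<in> T then f x else 0) = (\<lambda>x. if x \<in> S then f x else 0)"
    using assms(3,4) by (auto simp: fun_eq_iff)
  thus "integrable (lebesgue_on T) f \<longleftrightarrow> integrable (lebesgue_on S) f"
    using Lebesgue_Measure.integrable_restrict_UNIV[OF assms(1), of f] Lebesgue_Measure.integrable_restrict_UNIV[OF assms(2), of f] by simp
qed

lemma absolutely_integrable_on_iff:
  fixes f :: "'a::euclidean_space \<Rightarrow> 'b::euclidean_space"
  assumes "S \<in> sets lebesgue"
  shows "f absolutely_integrable_on S \<longleftrightarrow> integrable (lebesgue_on S) f"
  using assms by (simp add: set_integrable_def integrable_restrict_space)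

lemma compact_imp_lebesgue: "compact K \<Longrightarrow> K \<in> sets (lebesgue :: 'a::euclidean_space measure)"
  by (simp add: borel_compact)

lemma open_imp_lebesgue: "open K \<Longrightarrow> K \<in> sets (lebesgue :: 'a::euclidean_space measure)"
  by (simp add: borel_open)

lemma integrable_lebesgue_on_compact:
  fixes f :: "real^'n::finite \<Rightarrow> 'b::euclidean_space"
  assumes K: "compact K" and f: "continuous_on K f"
  shows "integrable (lebesgue_on K) f"
proof -
  have "integrable lborel (\<lambda>x. indicator K x *\<^sub>R f x)" by (rule borel_integrable_compact[OF K f])
  hence "integrable lebesgue (\<lambda>x. indicator K x *\<^sub>R f x)"
    using integrable_completion[of "\<lambda>x. indicator K x *\<^sub>R f x" lborel] borel_measurable_integrable by blast
  thus ?thesis using compact_imp_lebesgue[OF K] by (simp add: integrable_restrict_space)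
qed

text \<open>The set \<open>K'\<close> is the closed \<open>d\<close>-neighbourhood of \<open>K\<close>.\<close>

lemma compact_neighbourhood:
  fixes K :: "'a::euclidean_space set"
  assumes "compact K" "open U" "K \<subseteq> U"
  obtains K' d where "d > 0" "compact K'" "K \<subseteq> K'" "K' \<subseteq> U" "\<And>x. x \<in> K \<Longrightarrow> cball x d \<subseteq> K'"
    "\<And>x y. x \<notin> K' \<Longrightarrow> dist x y \<le> d \<Longrightarrow> y \<notin> K"
proof -
  obtain d where d: "d > 0" "(\<Union>x\<in>K. cball x d) \<subseteq> U"
    using compact_subset_open_imp_cball_epsilon_subset[OF assms] by metis
  define K' where "K' = (\<Union>x\<in>K. \<Union>y\<in>cball 0 d. {x + y})"
  have mem: "y \<in> K'" if "x \<in> K" "dist x y \<le> d" for x y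
  proof -
    have "x + (y - x) \<in> K'" unfolding K'_def using that
      by (intro UN_I[of x] UN_I[of "y - x"]) (auto simp: dist_norm norm_minus_commute)
    thus ?thesis by simp
  qed
  show ?thesis
  proof
    show "compact K'" unfolding K'_def using compact_sums'[OF assms(1) compact_cball[of 0 d]] by simp
    show "K \<subseteq> K'" using mem[of x x for x] d(1) by auto
    show "K' \<subseteq> U"
    proof
      fix z assume "z \<in> K'"
      then obtain x y where "x \<in> K" "norm y \<le> d" "z = x + y" by (auto simp: K'_def)
      hence "z \<in> cball x d" by (simp add: dist_norm)
      with \<open>x \<in> K\<close> d(2) show "z \<in> U" by blast
    qed
    show "cball x d \<subseteq> K'" if "x \<in> K" for x using mem[OF that] by auto
    show "y \<notin> K" if "x \<notin> K'" "dist x y \<le> d" for x y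
      using mem[of y x] that by (auto simp: dist_commute)
  qed (use d in auto)
qed

lemma has_weak_gradient_integrable:
  assumes "has_weak_gradient \<Omega> u G" "compact K" "K \<subseteq> \<Omega>"
  shows "integrable (lebesgue_on K) u" "integrable (lebesgue_on K) G"
  using assms compact_imp_lebesgue[OF assms(2)] unfolding has_weak_gradient_def
  by (auto simp: absolutely_integrable_on_iff)

lemma has_weak_gradient_test:
  assumes "has_weak_gradient \<Omega> u G" "\<phi> \<in> test_functions \<Omega>"
  shows "(LINT x|lebesgue_on \<Omega>. u x * partial i \<phi> x) = - (LINT x|lebesgue_on \<Omega>. G x $ i * \<phi> x)"
  using assms by (auto simp: has_weak_gradient_def)

lemma integrable_component:
  fixes G :: "'a \<Rightarrow> real^'n::finite"
  assumes "integrable M G" shows "integrable M (\<lambda>x. G x $ i)"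
  using integrable_bounded_linear[OF bounded_linear_vec_nth assms] .

lemma measurable_component:
  fixes V :: "'a \<Rightarrow> real^'n::finite"
  assumes "V \<in> borel_measurable M" shows "(\<lambda>x. V x $ i) \<in> borel_measurable M"
  using measurable_compose[OF assms borel_measurable_continuous_onI[OF continuous_on_component[OF continuous_on_id]]] .

lemma reflected_mollifier_test:
  fixes x :: "real^'n::finite"
  assumes \<epsilon>: "0 < \<epsilon>" and sub: "cball x \<epsilon> \<subseteq> \<Omega>"
  shows "(\<lambda>y. mollifier \<epsilon> (x - y)) \<in> test_functions \<Omega>"
    "partial i (\<lambda>y. mollifier \<epsilon> (x - y)) y = - partial i (mollifier \<epsilon>) (x - y)"
proof -
  have "smooth_on UNIV (\<lambda>y. mollifier \<epsilon> (x - y))"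
    using mollifier_smooth[of UNIV \<epsilon> "- 1" x] by simp
  moreover have "mollifier \<epsilon> (x - y) = 0" if "y \<notin> cball x \<epsilon>" for y
    using that by (intro mollifier_support[OF \<epsilon>]) (simp add: dist_norm)
  ultimately show "(\<lambda>y. mollifier \<epsilon> (x - y)) \<in> test_functions \<Omega>"
    unfolding test_functions_def using sub by (auto intro!: exI[of _ "cball x \<epsilon>"])
  have "((\<lambda>y. mollifier \<epsilon> (x - y)) has_derivative (\<lambda>h. grad (mollifier \<epsilon>) (x - y) \<bullet> (- h))) (at y)"
    by (rule has_derivative_compose[OF _ has_derivative_grad[OF C1_differentiable[OF mollifier_C1]]])
       (auto intro!: derivative_eq_intros)
  from partial_eqI[OF this] show "partial i (\<lambda>y. mollifier \<epsilon> (x - y)) y = - partial i (mollifier \<epsilon>) (x - y)"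
    by (simp add: inner_axis)
qed

text \<open>Differentiation commutes with mollification for weak gradients, as the reflected and translated mollifier is
  an admissible test function. The function is extended by \<open>0\<close> outside a compact set that contains the
  support of that test function.\<close>

lemma partial_moll_weak:
  fixes u :: "real^'n::finite \<Rightarrow> real"
  assumes \<Omega>: "open \<Omega>" and G: "has_weak_gradient \<Omega> u G" and K: "compact K" "K \<subseteq> \<Omega>"
    and \<epsilon>: "0 < \<epsilon>" and sub: "cball x \<epsilon> \<subseteq> K"
  shows "partial i (moll \<epsilon> (\<lambda>y. if y \<in> K then u y else 0)) x = moll \<epsilon> (\<lambda>y. if y \<in> K then G y $ i else 0) x"
proof -
  note Kl = compact_imp_lebesgue[OF K(1)] and \<Omega>l = open_imp_lebesgue[OF \<Omega>]
  let ?\<psi> = "\<lambda>y. mollifier \<epsilon> (x - y)"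
  have sub': "cball x \<epsilon> \<subseteq> \<Omega>" using sub K by auto
  note \<psi> = reflected_mollifier_test[OF \<epsilon> sub']
  have far: "\<epsilon> < norm (x - y)" if "y \<notin> K" for y
    using that sub by (force simp flip: dist_norm)
  have z: "?\<psi> y = 0" if "y \<notin> K" for y
    using far[OF that] by (intro mollifier_support[OF \<epsilon>]) simp
  have pz: "partial i (mollifier \<epsilon>) (x - y) = 0" if "y \<notin> K" for y
    using far[OF that] by (intro partial_mollifier_zero[OF \<epsilon>]) simp
  have iu: "integrable lebesgue (\<lambda>y. if y \<in> K then u y else 0)"
    using has_weak_gradient_integrable(1)[OF G K] Lebesgue_Measure.integrable_restrict_UNIV[OF Kl, of u] by simp
  have "partial i (moll \<epsilon> (\<lambda>y. if y \<in> K then u y else 0)) x =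
     (LINT y|lebesgue. (if y \<in> K then u y else 0) * partial i (mollifier \<epsilon>) (x - y))"
    by (rule partial_moll[OF iu \<epsilon>])
  also have "\<dots> = (LINT y|lebesgue. (if y \<in> \<Omega> then - (u y * partial i ?\<psi> y) else 0))"
    using pz K(2) by (intro Bochner_Integration.integral_cong) (auto simp: \<psi>(2))
  also have "\<dots> = - (LINT y|lebesgue_on \<Omega>. u y * partial i ?\<psi> y)"
    by (subst Lebesgue_Measure.integral_restrict_UNIV[OF \<Omega>l]) simp
  also have "\<dots> = (LINT y|lebesgue_on \<Omega>. G y $ i * ?\<psi> y)"
    using has_weak_gradient_test[OF G \<psi>(1), of i] by simp
  also have "\<dots> = (LINT y|lebesgue. (if y \<in> \<Omega> then G y $ i * ?\<psi> y else 0))"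
    by (rule Lebesgue_Measure.integral_restrict_UNIV[OF \<Omega>l, symmetric])
  also have "\<dots> = moll \<epsilon> (\<lambda>y. if y \<in> K then G y $ i else 0) x"
    unfolding moll_def using z K(2) by (intro Bochner_Integration.integral_cong) auto
  finally show ?thesis .
qed

lemma norm_powr_le_sum_components:
  fixes v :: "real^'n::finite"
  assumes "0 \<le> p"
  shows "norm v powr p \<le> real CARD('n) powr p * (\<Sum>i\<in>UNIV. \<bar>v $ i\<bar> powr p)"
proof -
  have "Max (range (\<lambda>i. \<bar>v $ i\<bar>)) \<in> range (\<lambda>i. \<bar>v $ i\<bar>)" by (intro Max_in) auto
  then obtain m where m: "\<bar>v $ m\<bar> = Max (range (\<lambda>i. \<bar>v $ i\<bar>))" by force
  have "norm v \<le> (\<Sum>i\<in>UNIV. \<bar>v $ i\<bar>)" by (rule norm_le_l1_cart)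
  also have "\<dots> \<le> (\<Sum>i\<in>(UNIV::'n set). \<bar>v $ m\<bar>)" unfolding m by (intro sum_mono Max_ge) auto
  also have "\<dots> = real CARD('n) * \<bar>v $ m\<bar>" by simp
  finally have "norm v powr p \<le> (real CARD('n) * \<bar>v $ m\<bar>) powr p" using assms by (intro powr_mono2) auto
  also have "\<dots> = real CARD('n) powr p * \<bar>v $ m\<bar> powr p" by (simp add: powr_mult)
  also have "\<dots> \<le> real CARD('n) powr p * (\<Sum>i\<in>UNIV. \<bar>v $ i\<bar> powr p)"
    by (intro mult_left_mono member_le_sum) auto
  finally show ?thesis .
qed

lemma nn_integral_norm_powr_components:
  fixes V :: "'a \<Rightarrow> real^'n::finite"
  assumes p: "0 \<le> p" and [measurable]: "V \<in> borel_measurable M"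
  shows "(\<integral>\<^sup>+x. ennreal (norm (V x) powr p) \<partial>M)
    \<le> ennreal (real CARD('n) powr p) * (\<Sum>i\<in>UNIV. \<integral>\<^sup>+x. ennreal (\<bar>V x $ i\<bar> powr p) \<partial>M)"
proof -
  have [measurable]: "(\<lambda>x. V x $ i) \<in> borel_measurable M" for i by (intro measurable_component) measurable
  have "(\<integral>\<^sup>+x. ennreal (norm (V x) powr p) \<partial>M) \<le>
    (\<integral>\<^sup>+x. ennreal (real CARD('n) powr p) * (\<Sum>i\<in>UNIV. ennreal (\<bar>V x $ i\<bar> powr p)) \<partial>M)"
  proof (rule nn_integral_mono)
    fix x
    have "ennreal (norm (V x) powr p) \<le> ennreal (real CARD('n) powr p * (\<Sum>i\<in>UNIV. \<bar>V x $ i\<bar> powr p))"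
      by (intro ennreal_leI norm_powr_le_sum_components p)
    also have "\<dots> = ennreal (real CARD('n) powr p) * (\<Sum>i\<in>UNIV. ennreal (\<bar>V x $ i\<bar> powr p))"
      by (simp add: ennreal_mult' sum_ennreal)
    finally show "ennreal (norm (V x) powr p) \<le> ennreal (real CARD('n) powr p) * (\<Sum>i\<in>UNIV. ennreal (\<bar>V x $ i\<bar> powr p))" .
  qed
  also have "\<dots> = ennreal (real CARD('n) powr p) * (\<Sum>i\<in>UNIV. \<integral>\<^sup>+x. ennreal (\<bar>V x $ i\<bar> powr p) \<partial>M)"
    by (subst nn_integral_cmult) (simp_all add: nn_integral_sum del: sum_ennreal)
  finally show ?thesis .
qed

lemma measurable_lebesgue_on_iff:
  fixes f :: "'a::euclidean_space \<Rightarrow> 'b::euclidean_space"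
  assumes "S \<in> sets lebesgue"
  shows "(\<lambda>x. if x \<in> S then f x else 0) \<in> borel_measurable lebesgue \<longleftrightarrow> f \<in> borel_measurable (lebesgue_on S)"
  by (rule borel_measurable_if[OF assms])

lemma moll_converges_on_compact:
  fixes u :: "real^'n::finite \<Rightarrow> real"
  assumes K: "compact K" and u: "u \<in> borel_measurable (lebesgue_on K)" and p: "1 \<le> p"
    and fin: "(\<integral>\<^sup>+x. ennreal (\<bar>u x\<bar> powr p) \<partial>lebesgue_on K) < \<infinity>" and e: "(e::real) > 0"
  obtains d where "d > 0" "\<And>\<epsilon>. 0 < \<epsilon> \<Longrightarrow> \<epsilon> < d \<Longrightarrow>
     (\<integral>\<^sup>+x. ennreal (\<bar>moll \<epsilon> (\<lambda>y. if y \<in> K then u y else 0) x - (if x \<in> K then u x else 0)\<bar> powr p) \<partial>lebesgue) < ennreal e"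
proof -
  note Kl = compact_imp_lebesgue[OF K]
  let ?u = "\<lambda>y. if y \<in> K then u y else 0"
  obtain R where R: "\<And>x. x \<in> K \<Longrightarrow> norm x \<le> R" using compact_imp_bounded[OF K] by (auto simp: bounded_iff)
  have "?u \<in> borel_measurable lebesgue" using u measurable_lebesgue_on_iff[OF Kl] by blast
  moreover have "?u x = 0" if "x \<notin> cball 0 R" for x using R[of x] that by auto
  moreover have "(\<integral>\<^sup>+x. ennreal (\<bar>?u x\<bar> powr p) \<partial>lebesgue) < \<infinity>"
  proof -
    have "ennreal (\<bar>?u x\<bar> powr p) = ennreal (\<bar>u x\<bar> powr p) * indicator K x" for x by (auto simp: indicator_def)
    thus ?thesis using fin Kl by (simp add: nn_integral_restrict_space)
  qed
  ultimately show ?thesis using moll_Lp_converges[of ?u R p e] p e that by blast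
qed

lemma finite_positive_lower_bound:
  fixes f :: "'i::finite \<Rightarrow> real"
  assumes "\<And>i. 0 < f i"
  obtains m where "m > 0" "\<And>i. m \<le> f i"
proof (rule that[of "Min (range f)"])
  show "Min (range f) > 0" using assms by (subst Min_gr_iff) auto
qed (auto intro!: Min_le)

lemma has_weak_gradient_local_approximation:
  fixes u :: "real^'n::finite \<Rightarrow> real"
  assumes \<Omega>: "open \<Omega>" and G: "has_weak_gradient \<Omega> u G" and K: "compact K" "K \<subseteq> \<Omega>" and e: "(e::real) > 0"
  obtains w where "C1 w" "(\<integral>\<^sup>+x. ennreal \<bar>w x - u x\<bar> \<partial>lebesgue_on K) < ennreal e"
    "\<And>i. (\<integral>\<^sup>+x. ennreal \<bar>partial i w x - G x $ i\<bar> \<partial>lebesgue_on K) < ennreal e"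
    "(AE x in lebesgue_on \<Omega>. 0 \<le> u x) \<Longrightarrow> \<forall>x. 0 \<le> w x"
proof -
  obtain K' d where K': "d > 0" "compact K'" "K \<subseteq> K'" "K' \<subseteq> \<Omega>" "\<And>x. x \<in> K \<Longrightarrow> cball x d \<subseteq> K'"
    "\<And>x y. x \<notin> K' \<Longrightarrow> dist x y \<le> d \<Longrightarrow> y \<notin> K"
    by (rule compact_neighbourhood[OF K(1) \<Omega> K(2)]) (rule that)
  note Kl = compact_imp_lebesgue[OF K(1)] compact_imp_lebesgue[OF K'(2)]
  note iu = has_weak_gradient_integrable[OF G K'(2,4)]
  have conv: "\<exists>d>0. \<forall>\<epsilon>. 0 < \<epsilon> \<longrightarrow> \<epsilon> < d \<longrightarrow>
     (\<integral>\<^sup>+x. ennreal \<bar>moll \<epsilon> (\<lambda>y. if y \<in> K' then f y else 0) x - f x\<bar> \<partial>lebesgue_on K) < ennreal e"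
    if f: "integrable (lebesgue_on K') f" for f
  proof -
    have "(\<integral>\<^sup>+x. ennreal (\<bar>f x\<bar> powr 1) \<partial>lebesgue_on K') < \<infinity>"
      using f by (simp add: integrable_iff_bounded)
    then obtain d where d: "d > 0" "\<And>\<epsilon>. 0 < \<epsilon> \<Longrightarrow> \<epsilon> < d \<Longrightarrow>
     (\<integral>\<^sup>+x. ennreal (\<bar>moll \<epsilon> (\<lambda>y. if y \<in> K' then f y else 0) x - (if x \<in> K' then f x else 0)\<bar> powr 1) \<partial>lebesgue) < ennreal e"
      using moll_converges_on_compact[OF K'(2) borel_measurable_integrable[OF f] order_refl _ e] by blast
    have "(\<integral>\<^sup>+x. ennreal \<bar>moll \<epsilon> (\<lambda>y. if y \<in> K' then f y else 0) x - f x\<bar> \<partial>lebesgue_on K) < ennreal e"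
      if "0 < \<epsilon>" "\<epsilon> < d" for \<epsilon>
    proof (rule le_less_trans[OF _ d(2)[OF that]])
      show "(\<integral>\<^sup>+x. ennreal \<bar>moll \<epsilon> (\<lambda>y. if y \<in> K' then f y else 0) x - f x\<bar> \<partial>lebesgue_on K) \<le>
        (\<integral>\<^sup>+x. ennreal (\<bar>moll \<epsilon> (\<lambda>y. if y \<in> K' then f y else 0) x - (if x \<in> K' then f x else 0)\<bar> powr 1) \<partial>lebesgue)"
        using Kl K'(3) by (auto simp: nn_integral_restrict_space indicator_def intro!: nn_integral_mono)
    qed
    with d(1) show ?thesis by blast
  qed
  obtain d0 where d0: "d0 > 0" "\<And>\<epsilon>. 0 < \<epsilon> \<Longrightarrow> \<epsilon> < d0 \<Longrightarrow>
     (\<integral>\<^sup>+x. ennreal \<bar>moll \<epsilon> (\<lambda>y. if y \<in> K' then u y else 0) x - u x\<bar> \<partial>lebesgue_on K) < ennreal e"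
    using conv[OF iu(1)] by blast
  have "\<exists>d>0. \<forall>\<epsilon>. 0 < \<epsilon> \<longrightarrow> \<epsilon> < d \<longrightarrow>
     (\<integral>\<^sup>+x. ennreal \<bar>moll \<epsilon> (\<lambda>y. if y \<in> K' then G y $ i else 0) x - G x $ i\<bar> \<partial>lebesgue_on K) < ennreal e" for i
    by (rule conv[OF integrable_component[OF iu(2), of i]])
  hence "\<exists>d1. \<forall>i. d1 i > 0 \<and> (\<forall>\<epsilon>. 0 < \<epsilon> \<longrightarrow> \<epsilon> < d1 i \<longrightarrow>
     (\<integral>\<^sup>+x. ennreal \<bar>moll \<epsilon> (\<lambda>y. if y \<in> K' then G y $ i else 0) x - G x $ i\<bar> \<partial>lebesgue_on K) < ennreal e)"
    by (intro choice allI)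
  then obtain d1 where d1: "\<And>i. d1 i > 0" "\<And>i \<epsilon>. 0 < \<epsilon> \<Longrightarrow> \<epsilon> < d1 i \<Longrightarrow>
     (\<integral>\<^sup>+x. ennreal \<bar>moll \<epsilon> (\<lambda>y. if y \<in> K' then G y $ i else 0) x - G x $ i\<bar> \<partial>lebesgue_on K) < ennreal e"
    by blast
  obtain m where m: "m > 0" "\<And>i. m \<le> d1 i" by (rule finite_positive_lower_bound[of d1, OF d1(1)]) (rule that)
  define \<epsilon> where "\<epsilon> = min d (min d0 m) / 2"
  have \<epsilon>: "0 < \<epsilon>" and lt: "\<epsilon> < d" "\<epsilon> < d0" and ltm: "\<epsilon> < m"
    using K'(1) d0(1) m(1) by (auto simp: \<epsilon>_def min_def)
  have lt1: "\<epsilon> < d1 i" for i using ltm m(2)[of i] by linarith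
  define w where "w = moll \<epsilon> (\<lambda>y. if y \<in> K' then u y else 0)"
  have iu': "integrable lebesgue (\<lambda>y. if y \<in> K' then u y else 0)"
    using iu(1) Lebesgue_Measure.integrable_restrict_UNIV[OF Kl(2), of u] by simp
  show ?thesis
  proof (rule that[of w])
    show "C1 w" unfolding w_def by (intro smooth_imp_C1 smooth_moll iu' \<epsilon>)
    show "(\<integral>\<^sup>+x. ennreal \<bar>w x - u x\<bar> \<partial>lebesgue_on K) < ennreal e" unfolding w_def by (rule d0(2)[OF \<epsilon> lt(2)])
    show "(\<integral>\<^sup>+x. ennreal \<bar>partial i w x - G x $ i\<bar> \<partial>lebesgue_on K) < ennreal e" for i
    proof -
      have "(\<integral>\<^sup>+x. ennreal \<bar>partial i w x - G x $ i\<bar> \<partial>lebesgue_on K) =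
        (\<integral>\<^sup>+x. ennreal \<bar>moll \<epsilon> (\<lambda>y. if y \<in> K' then G y $ i else 0) x - G x $ i\<bar> \<partial>lebesgue_on K)"
      proof (rule nn_integral_cong)
        fix x assume "x \<in> space (lebesgue_on K)"
        hence "cball x \<epsilon> \<subseteq> K'" using K'(5)[of x] lt(1) by (auto simp: subset_iff)
        thus "ennreal \<bar>partial i w x - G x $ i\<bar> = ennreal \<bar>moll \<epsilon> (\<lambda>y. if y \<in> K' then G y $ i else 0) x - G x $ i\<bar>"
          unfolding w_def by (subst partial_moll_weak[OF \<Omega> G K'(2,4) \<epsilon>]) auto
      qed
      thus ?thesis using d1(2)[OF \<epsilon> lt1] by simp
    qed
    assume "AE x in lebesgue_on \<Omega>. 0 \<le> u x"
    hence ae: "AE x in lebesgue. x \<in> \<Omega> \<longrightarrow> 0 \<le> u x"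
      using open_imp_lebesgue[OF \<Omega>] by (simp add: AE_restrict_space_iff)
    show "\<forall>x. 0 \<le> w x" unfolding w_def moll_def
    proof (intro allI integral_nonneg_AE)
      fix x
      show "AE y in lebesgue. 0 \<le> (if y \<in> K' then u y else 0) * mollifier \<epsilon> (x - y)"
        using ae by eventually_elim (use K'(4) in \<open>auto intro!: mult_nonneg_nonneg mollifier_nonneg[OF \<epsilon>]\<close>)
    qed
  qed
qed

section \<open>Uniqueness of weak gradients and density of test functions\<close>

text \<open>On a compact set the difference of two weak gradients is the \<open>L\<^sup>1\<close> limit of its mollifications, which vanish there.\<close>

lemma has_weak_gradient_unique:
  fixes u :: "real^'n::finite \<Rightarrow> real"
  assumes \<Omega>: "open \<Omega>" and G: "has_weak_gradient \<Omega> u G" and H: "has_weak_gradient \<Omega> u H"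
  shows "AE x in lebesgue_on \<Omega>. G x = H x"
proof -
  have "AE x in lebesgue_on K. G x $ i = H x $ i" if K: "compact K" "K \<subseteq> \<Omega>" for K i
  proof -
    note Kl = compact_imp_lebesgue[OF K(1)]
    define g where "g x = G x $ i - H x $ i" for x
    obtain K' d where K': "d > 0" "compact K'" "K \<subseteq> K'" "K' \<subseteq> \<Omega>" "\<And>x. x \<in> K \<Longrightarrow> cball x d \<subseteq> K'"
      "\<And>x y. x \<notin> K' \<Longrightarrow> dist x y \<le> d \<Longrightarrow> y \<notin> K"
      by (rule compact_neighbourhood[OF K(1) \<Omega> K(2)]) (rule that)
    note Kl' = compact_imp_lebesgue[OF K'(2)]
    have iG: "integrable (lebesgue_on K') (\<lambda>x. G x $ i)" "integrable (lebesgue_on K') (\<lambda>x. H x $ i)"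
      using has_weak_gradient_integrable(2)[OF G K'(2,4)] has_weak_gradient_integrable(2)[OF H K'(2,4)]
      by (auto intro: integrable_component)
    have iG': "integrable lebesgue (\<lambda>x. if x \<in> K' then G x $ i else 0)" "integrable lebesgue (\<lambda>x. if x \<in> K' then H x $ i else 0)"
      using iG by (simp_all add: Lebesgue_Measure.integrable_restrict_UNIV[OF Kl'])
    have ig: "integrable (lebesgue_on K') g" unfolding g_def using iG by simp
    have z: "moll \<epsilon> (\<lambda>x. if x \<in> K' then g x else 0) x = 0" if "0 < \<epsilon>" "\<epsilon> \<le> d" "x \<in> K" for \<epsilon> x
    proof -
      have sub: "cball x \<epsilon> \<subseteq> K'" using K'(5)[OF that(3)] that(2) by (auto simp: subset_iff)
      have "moll \<epsilon> (\<lambda>x. (if x \<in> K' then G x $ i else 0) - (if x \<in> K' then H x $ i else 0)) x = 0"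
        unfolding moll_diff[OF iG' that(1)]
        using partial_moll_weak[OF \<Omega> G K'(2,4) that(1) sub, of i] partial_moll_weak[OF \<Omega> H K'(2,4) that(1) sub, of i]
        by simp
      moreover have "(\<lambda>x. (if x \<in> K' then G x $ i else 0) - (if x \<in> K' then H x $ i else 0)) = (\<lambda>x. if x \<in> K' then g x else 0)"
        by (auto simp: g_def fun_eq_iff)
      ultimately show ?thesis by simp
    qed
    have "(\<integral>\<^sup>+x. ennreal \<bar>g x\<bar> \<partial>lebesgue_on K) \<le> ennreal e" if e: "e > 0" for e
    proof -
      have "(\<integral>\<^sup>+x. ennreal (\<bar>g x\<bar> powr 1) \<partial>lebesgue_on K') < \<infinity>"
        using ig by (simp add: integrable_iff_bounded)
      then obtain d' where d': "d' > 0" "\<And>\<epsilon>. 0 < \<epsilon> \<Longrightarrow> \<epsilon> < d' \<Longrightarrow>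
         (\<integral>\<^sup>+x. ennreal (\<bar>moll \<epsilon> (\<lambda>y. if y \<in> K' then g y else 0) x - (if x \<in> K' then g x else 0)\<bar> powr 1) \<partial>lebesgue) < ennreal e"
        using moll_converges_on_compact[OF K'(2) borel_measurable_integrable[OF ig] order_refl _ e] by blast
      define \<epsilon> where "\<epsilon> = min d d' / 2"
      have \<epsilon>: "0 < \<epsilon>" "\<epsilon> \<le> d" "\<epsilon> < d'" using d'(1) K'(1) by (auto simp: \<epsilon>_def)
      have "(\<integral>\<^sup>+x. ennreal \<bar>g x\<bar> \<partial>lebesgue_on K) \<le>
        (\<integral>\<^sup>+x. ennreal (\<bar>moll \<epsilon> (\<lambda>y. if y \<in> K' then g y else 0) x - (if x \<in> K' then g x else 0)\<bar> powr 1) \<partial>lebesgue)"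
        using Kl K'(3) z[OF \<epsilon>(1,2)]
        by (auto simp: nn_integral_restrict_space indicator_def intro!: nn_integral_mono)
      with d'(2)[OF \<epsilon>(1,3)] show ?thesis by (simp add: less_imp_le)
    qed
    hence "(\<integral>\<^sup>+x. ennreal \<bar>g x\<bar> \<partial>lebesgue_on K) \<le> 0 + ennreal e" if "e > 0" for e using that by simp
    hence "(\<integral>\<^sup>+x. ennreal \<bar>g x\<bar> \<partial>lebesgue_on K) \<le> 0" by (rule ennreal_le_epsilon)
    hence "(\<integral>\<^sup>+x. ennreal \<bar>g x\<bar> \<partial>lebesgue_on K) = 0" by simp
    moreover have gm: "g \<in> borel_measurable (lebesgue_on K)"
    proof -
      have "integrable (lebesgue_on K) (\<lambda>x. G x $ i)" "integrable (lebesgue_on K) (\<lambda>x. H x $ i)"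
        using has_weak_gradient_integrable(2)[OF G K] has_weak_gradient_integrable(2)[OF H K]
        by (auto intro: integrable_component)
      thus ?thesis unfolding g_def by simp
    qed
    ultimately have "AE x in lebesgue_on K. ennreal \<bar>g x\<bar> = 0"
      by (subst (asm) nn_integral_0_iff_AE) auto
    thus ?thesis by eventually_elim (simp add: g_def)
  qed
  hence K: "AE x in lebesgue_on K. G x = H x" if "compact K" "K \<subseteq> \<Omega>" for K
    using that by (simp add: vec_eq_iff AE_all_countable)
  obtain C :: "nat \<Rightarrow> (real^'n) set" where C: "\<And>n. compact (C n)" "\<And>n. C n \<subseteq> \<Omega>" "\<Union>(range C) = \<Omega>"
    using open_Union_compact_subsets[OF \<Omega>] by metis
  have "AE x in lebesgue. x \<in> C n \<longrightarrow> G x = H x" for n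
    using K[OF C(1,2)[of n]] compact_imp_lebesgue[OF C(1)] by (simp add: AE_restrict_space_iff)
  hence "AE x in lebesgue. \<forall>n. x \<in> C n \<longrightarrow> G x = H x" unfolding AE_all_countable by blast
  hence "AE x in lebesgue. x \<in> \<Omega> \<longrightarrow> G x = H x"    by eventually_elim (use C(3) in blast)
  thus ?thesis using open_imp_lebesgue[OF \<Omega>] by (simp add: AE_restrict_space_iff)
qed

lemma C1_has_weak_gradient:
  fixes w :: "real^'n::finite \<Rightarrow> real"
  assumes \<Omega>: "open \<Omega>" and w: "C1 w"
  shows "has_weak_gradient \<Omega> w (grad w)"
  unfolding has_weak_gradient_def
proof (intro conjI allI impI ballI)
  fix K assume "compact K \<and> K \<subseteq> \<Omega>"
  hence K: "compact K" by blast
  show "w absolutely_integrable_on K" "grad w absolutely_integrable_on K"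
    using integrable_lebesgue_on_compact[OF K C1_continuous[OF w]] integrable_lebesgue_on_compact[OF K C1_continuous_grad[OF w]]
    by (simp_all add: absolutely_integrable_on_iff compact_imp_lebesgue[OF K])
next
  fix \<phi> :: "real^'n \<Rightarrow> real" and i assume "\<phi> \<in> test_functions \<Omega>"
  then obtain K where K: "compact K" "K \<subseteq> \<Omega>" "\<And>x. x \<notin> K \<Longrightarrow> \<phi> x = 0" "C1 \<phi>" by (rule test_functionE) (rule that)
  have pz: "partial i \<phi> x = 0" if "x \<notin> K" for x
    by (rule partial_zero_off[OF compact_imp_closed[OF K(1)] K(3) that])
  have off: "x \<in> UNIV \<Longrightarrow> x \<notin> \<Omega> \<Longrightarrow> w x * partial i \<phi> x = 0" "x \<in> UNIV \<Longrightarrow> x \<notin> \<Omega> \<Longrightarrow> partial i w x * \<phi> x = 0" for x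
    using K(2,3) pz by auto
  have m: "(\<lambda>x. w x * partial i \<phi> x) \<in> borel_measurable lborel" "(\<lambda>x. partial i w x * \<phi> x) \<in> borel_measurable lborel"
    using C1_measurable[OF w] C1_partial_measurable[OF w] C1_measurable[OF K(4)] C1_partial_measurable[OF K(4)]
    by (auto intro!: borel_measurable_times)
  have "(LINT x|lebesgue_on \<Omega>. w x * partial i \<phi> x) = (LINT x|lborel. w x * partial i \<phi> x)"
    using lebesgue_on_supported(1)[of UNIV \<Omega> "\<lambda>x. w x * partial i \<phi> x", OF _ open_imp_lebesgue[OF \<Omega>] _ off(1)]
      integral_completion[OF m(1)] by (simp add: lebesgue_on_UNIV_eq)
  also have "\<dots> = - (LINT x|lborel. partial i w x * \<phi> x)"
    by (rule C1_integration_by_parts[OF w K(4,1,3)])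
  also have "(LINT x|lborel. partial i w x * \<phi> x) = (LINT x|lebesgue_on \<Omega>. partial i w x * \<phi> x)"
    using lebesgue_on_supported(1)[of UNIV \<Omega> "\<lambda>x. partial i w x * \<phi> x", OF _ open_imp_lebesgue[OF \<Omega>] _ off(2)]
      integral_completion[OF m(2)] by (simp add: lebesgue_on_UNIV_eq)
  finally show "(LINT x|lebesgue_on \<Omega>. w x * partial i \<phi> x) = - (LINT x|lebesgue_on \<Omega>. grad w x $ i * \<phi> x)" by simp
qed

lemma partial_moll_zero_off:
  assumes "integrable lebesgue u" "0 < \<epsilon>" "\<And>y. dist x y \<le> \<epsilon> \<Longrightarrow> u y = 0"
  shows "partial i (moll \<epsilon> u) x = 0"
proof -
  have "(\<lambda>y. u y * partial i (mollifier \<epsilon>) (x - y)) = (\<lambda>y. 0)"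
  proof
    fix y show "u y * partial i (mollifier \<epsilon>) (x - y) = 0"
    proof (cases "dist x y \<le> \<epsilon>")
      case False
      then have "partial i (mollifier \<epsilon>) (x - y) = 0"
        by (intro partial_mollifier_zero assms(2)) (simp add: dist_norm norm_minus_commute)
      then show ?thesis by simp
    qed (simp add: assms(3))
  qed
  then show ?thesis using partial_moll[OF assms(1,2), of i x] by (simp only: integral_zero)
qed

text \<open>A Sobolev function with compact support is approximated by its mollifications. Their supports stay in one
  compact set \<open>S\<close>, which matters when the flux is only locally integrable.\<close>

lemma compact_support_approximation:
  fixes v :: "real^'n::finite \<Rightarrow> real"
  assumes \<Omega>: "open \<Omega>" and V: "has_weak_gradient \<Omega> v V" and K: "compact K" "K \<subseteq> \<Omega>"
    and off: "\<And>x. x \<in> \<Omega> \<Longrightarrow> x \<notin> K \<Longrightarrow> v x = 0" "\<And>x. x \<in> \<Omega> \<Longrightarrow> x \<notin> K \<Longrightarrow> V x = 0"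
    and p: "1 \<le> p" and vp: "v \<in> Lp p K" and Vp: "V \<in> Lp p K"
  obtains S where "compact S" "S \<subseteq> \<Omega>" "\<And>e. e > 0 \<Longrightarrow> \<exists>\<phi>\<in>test_functions \<Omega>. (\<forall>x. x \<notin> S \<longrightarrow> \<phi> x = 0) \<and>
     (\<integral>\<^sup>+x. ennreal (\<bar>v x - \<phi> x\<bar> powr p) \<partial>lebesgue_on \<Omega>) < ennreal e \<and>
     (\<integral>\<^sup>+x. ennreal (norm (V x - grad \<phi> x) powr p) \<partial>lebesgue_on \<Omega>) < ennreal e"
proof -
  note Kl = compact_imp_lebesgue[OF K(1)]
  note \<Omega>l = open_imp_lebesgue[OF \<Omega>]
  obtain K' d where K': "d > 0" "compact K'" "K \<subseteq> K'" "K' \<subseteq> \<Omega>" "\<And>x. x \<in> K \<Longrightarrow> cball x d \<subseteq> K'"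
    "\<And>x y. x \<notin> K' \<Longrightarrow> dist x y \<le> d \<Longrightarrow> y \<notin> K"
    by (rule compact_neighbourhood[OF K(1) \<Omega> K(2)]) (rule that)
  obtain K2 d2 where K2: "d2 > 0" "compact K2" "K' \<subseteq> K2" "K2 \<subseteq> \<Omega>" "\<And>x. x \<in> K' \<Longrightarrow> cball x d2 \<subseteq> K2"
    "\<And>x y. x \<notin> K2 \<Longrightarrow> dist x y \<le> d2 \<Longrightarrow> y \<notin> K'"
    by (rule compact_neighbourhood[OF K'(2) \<Omega> K'(4)]) (rule that)
  let ?v = "\<lambda>y. if y \<in> K then v y else 0"
  let ?V = "\<lambda>i y. if y \<in> K then V y $ i else 0"
  have v2: "(\<lambda>y. if y \<in> K2 then v y else 0) = ?v" "(\<lambda>y. if y \<in> K2 then V y $ i else 0) = ?V i" for i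
    using off K2(3,4) K'(3) by (auto simp: fun_eq_iff)
  have iv: "integrable lebesgue ?v"
    using has_weak_gradient_integrable(1)[OF V K] Lebesgue_Measure.integrable_restrict_UNIV[OF Kl, of v] by simp
  have Vm: "V \<in> borel_measurable (lebesgue_on K)" and vm: "v \<in> borel_measurable (lebesgue_on K)"
    using vp Vp by (auto simp: Lp_def)
  have vfin: "(\<integral>\<^sup>+x. ennreal (\<bar>v x\<bar> powr p) \<partial>lebesgue_on K) < \<infinity>"
    using vp by (simp add: Lp_def integrable_iff_bounded)
  have Vfin: "(\<integral>\<^sup>+x. ennreal (\<bar>V x $ i\<bar> powr p) \<partial>lebesgue_on K) < \<infinity>" for i
  proof -
    have "(\<integral>\<^sup>+x. ennreal (\<bar>V x $ i\<bar> powr p) \<partial>lebesgue_on K) \<le> (\<integral>\<^sup>+x. ennreal (norm (V x) powr p) \<partial>lebesgue_on K)"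
      using p by (intro nn_integral_mono ennreal_leI powr_mono2 component_le_norm_cart) auto
    also have "\<dots> < \<infinity>" using Vp by (simp add: Lp_def integrable_iff_bounded)
    finally show ?thesis .
  qed
  have pm: "partial i (moll \<epsilon> ?v) x = moll \<epsilon> (?V i) x" if \<epsilon>: "0 < \<epsilon>" "\<epsilon> \<le> d" "\<epsilon> \<le> d2" for \<epsilon> i x
  proof (cases "x \<in> K'")
    case True
    have "cball x \<epsilon> \<subseteq> K2" using K2(5)[OF True] \<epsilon>(3) by (auto simp: subset_iff)
    from partial_moll_weak[OF \<Omega> V K2(2,4) \<epsilon>(1) this, of i] show ?thesis by (simp only: v2)
  next
    case False
    have "y \<notin> K" if "dist x y \<le> \<epsilon>" for y using K'(6)[OF False, of y] that \<epsilon>(2) by simp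
    hence "partial i (moll \<epsilon> ?v) x = 0" "moll \<epsilon> (?V i) x = 0"
      by (intro partial_moll_zero_off iv \<epsilon>(1) moll_zero_off; simp)+
    thus ?thesis by simp
  qed
  show ?thesis
  proof (rule that[OF K'(2,4)])
    fix e :: real assume e: "e > 0"
    define N where "N = real CARD('n)"
    define e' where "e' = e / (2 * (N powr p * N))"
    have N: "N > 0" by (simp add: N_def)
    have e': "e' > 0" using e N by (simp add: e'_def)
    obtain d0 where d0: "d0 > 0" "\<And>\<epsilon>. 0 < \<epsilon> \<Longrightarrow> \<epsilon> < d0 \<Longrightarrow>
      (\<integral>\<^sup>+x. ennreal (\<bar>moll \<epsilon> ?v x - ?v x\<bar> powr p) \<partial>lebesgue) < ennreal e"
      using moll_converges_on_compact[OF K(1) vm p vfin e] by blast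
    have "\<exists>d. d > 0 \<and> (\<forall>\<epsilon>. 0 < \<epsilon> \<longrightarrow> \<epsilon> < d \<longrightarrow>
      (\<integral>\<^sup>+x. ennreal (\<bar>moll \<epsilon> (?V i) x - ?V i x\<bar> powr p) \<partial>lebesgue) < ennreal e')" for i
    proof (rule moll_converges_on_compact[OF K(1) measurable_component[OF Vm, of i] p Vfin[of i] e'])
      fix d assume "0 < d" "\<And>\<epsilon>. 0 < \<epsilon> \<Longrightarrow> \<epsilon> < d \<Longrightarrow>
        (\<integral>\<^sup>+x. ennreal (\<bar>moll \<epsilon> (?V i) x - ?V i x\<bar> powr p) \<partial>lebesgue) < ennreal e'"
      thus ?thesis by (intro exI[of _ d] conjI allI impI) 
    qed
    hence "\<exists>d1. \<forall>i. d1 i > 0 \<and> (\<forall>\<epsilon>. 0 < \<epsilon> \<longrightarrow> \<epsilon> < d1 i \<longrightarrow>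
      (\<integral>\<^sup>+x. ennreal (\<bar>moll \<epsilon> (?V i) x - ?V i x\<bar> powr p) \<partial>lebesgue) < ennreal e')"
      by (intro choice allI)
    then obtain d1 where d1: "\<And>i. d1 i > 0" "\<And>i \<epsilon>. 0 < \<epsilon> \<Longrightarrow> \<epsilon> < d1 i \<Longrightarrow>
      (\<integral>\<^sup>+x. ennreal (\<bar>moll \<epsilon> (?V i) x - ?V i x\<bar> powr p) \<partial>lebesgue) < ennreal e'" by blast
    obtain m where m: "m > 0" "\<And>i. m \<le> d1 i" by (rule finite_positive_lower_bound[of d1, OF d1(1)]) (rule that)
    define \<epsilon> where "\<epsilon> = min (min d d2) (min d0 m) / 2"
    have \<epsilon>: "0 < \<epsilon>" "\<epsilon> \<le> d" "\<epsilon> \<le> d2" and lt: "\<epsilon> < d0" and ltm: "\<epsilon> < m"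
      using K'(1) K2(1) d0(1) m(1) by (auto simp: \<epsilon>_def min_def)
    have lt1: "\<epsilon> < d1 i" for i using ltm m(2)[of i] by linarith
    define \<phi> where "\<phi> = moll \<epsilon> ?v"
    have \<phi>0: "\<phi> x = 0" if "x \<notin> K'" for x
    proof -
      have "y \<notin> K" if "dist x y \<le> \<epsilon>" for y using K'(6)[OF \<open>x \<notin> K'\<close>, of y] that \<epsilon>(2) by simp
      thus ?thesis unfolding \<phi>_def by (intro moll_zero_off \<epsilon>(1)) simp
    qed
    have \<phi>s: "smooth_on UNIV \<phi>" unfolding \<phi>_def by (intro smooth_moll iv \<epsilon>)
    hence \<phi>t: "\<phi> \<in> test_functions \<Omega>" using \<phi>0 K'(2,4) by (auto simp: test_functions_def)
    have A: "(\<integral>\<^sup>+x. ennreal (\<bar>v x - \<phi> x\<bar> powr p) \<partial>lebesgue_on \<Omega>) < ennreal e"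
    proof (rule le_less_trans[OF _ d0(2)[OF \<epsilon>(1) lt]])
      show "(\<integral>\<^sup>+x. ennreal (\<bar>v x - \<phi> x\<bar> powr p) \<partial>lebesgue_on \<Omega>) \<le> (\<integral>\<^sup>+x. ennreal (\<bar>moll \<epsilon> ?v x - ?v x\<bar> powr p) \<partial>lebesgue)"
        using \<Omega>l K(2) off(1) by (auto simp: nn_integral_restrict_space indicator_def \<phi>_def abs_minus_commute intro!: nn_integral_mono)
    qed
    have Vm': "(\<lambda>x. V x - grad \<phi> x) \<in> borel_measurable (lebesgue_on \<Omega>)"
    proof -
      have "V \<in> borel_measurable (lebesgue_on \<Omega>)"
      proof -
        have "(\<lambda>x. if x \<in> K then V x else 0) \<in> borel_measurable lebesgue"
          using Vm measurable_lebesgue_on_iff[OF Kl, of V] by simp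
        moreover have "(\<lambda>x. if x \<in> K then V x else 0) = (\<lambda>x. if x \<in> \<Omega> then V x else 0)"
          using off(2) K(2) by (auto simp: fun_eq_iff)
        ultimately show ?thesis using measurable_lebesgue_on_iff[OF \<Omega>l, of V] by simp
      qed
      moreover have "grad \<phi> \<in> borel_measurable (lebesgue_on \<Omega>)"
        by (intro measurable_restrict_space1 borel_imp_lebesgue C1_grad_measurable smooth_imp_C1 \<phi>s)
      ultimately show ?thesis by (rule borel_measurable_diff)
    qed
    have "(\<integral>\<^sup>+x. ennreal (norm (V x - grad \<phi> x) powr p) \<partial>lebesgue_on \<Omega>)
      \<le> ennreal (N powr p) * (\<Sum>i\<in>UNIV. \<integral>\<^sup>+x. ennreal (\<bar>(V x - grad \<phi> x) $ i\<bar> powr p) \<partial>lebesgue_on \<Omega>)"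
      unfolding N_def using p by (intro nn_integral_norm_powr_components Vm') auto
    also have "\<dots> \<le> ennreal (N powr p) * (\<Sum>i\<in>(UNIV::'n set). ennreal e')"
    proof (intro mult_left_mono sum_mono)
      fix i
      have "(\<integral>\<^sup>+x. ennreal (\<bar>(V x - grad \<phi> x) $ i\<bar> powr p) \<partial>lebesgue_on \<Omega>) \<le>
         (\<integral>\<^sup>+x. ennreal (\<bar>moll \<epsilon> (?V i) x - ?V i x\<bar> powr p) \<partial>lebesgue)"
        using \<Omega>l K(2) off(2) 
        by (auto simp: nn_integral_restrict_space indicator_def \<phi>_def pm[OF \<epsilon>] abs_minus_commute intro!: nn_integral_mono)
      also have "\<dots> \<le> ennreal e'" using d1(2)[OF \<epsilon>(1) lt1] by (rule less_imp_le)
      finally show "(\<integral>\<^sup>+x. ennreal (\<bar>(V x - grad \<phi> x) $ i\<bar> powr p) \<partial>lebesgue_on \<Omega>) \<le> ennreal e'" .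
    qed auto
    also have "\<dots> = ennreal (N powr p * (N * e'))"
      using e' N by (simp add: N_def ennreal_mult' ennreal_of_nat_eq_real_of_nat)
    also have "\<dots> < ennreal e" using e N by (intro ennreal_lessI) (auto simp: e'_def field_simps)
    finally have B: "(\<integral>\<^sup>+x. ennreal (norm (V x - grad \<phi> x) powr p) \<partial>lebesgue_on \<Omega>) < ennreal e" .
    show "\<exists>\<phi>\<in>test_functions \<Omega>. (\<forall>x. x \<notin> K' \<longrightarrow> \<phi> x = 0) \<and>
     (\<integral>\<^sup>+x. ennreal (\<bar>v x - \<phi> x\<bar> powr p) \<partial>lebesgue_on \<Omega>) < ennreal e \<and>
     (\<integral>\<^sup>+x. ennreal (norm (V x - grad \<phi> x) powr p) \<partial>lebesgue_on \<Omega>) < ennreal e"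
      using \<phi>t \<phi>0 A B by blast
  qed
qed

section \<open>Chain and product rule for weak gradients\<close>

lemma borel_imp_lebesgue_on: "f \<in> borel_measurable borel \<Longrightarrow> f \<in> borel_measurable (lebesgue_on S)"
  by (intro measurable_restrict_space1 borel_imp_lebesgue)

lemma tendsto_inverse_Suc_ennreal: "(\<lambda>n. ennreal C * ennreal (1 / real (Suc n))) \<longlonglongrightarrow> 0"
proof -
  have "(\<lambda>n. ennreal (1 / real (Suc n))) \<longlonglongrightarrow> ennreal 0"
    using LIMSEQ_inverse_real_of_nat by (intro tendsto_ennrealI) (simp add: inverse_eq_divide)
  hence "(\<lambda>n. ennreal C * ennreal (1 / real (Suc n))) \<longlonglongrightarrow> ennreal C * ennreal 0"
    by (rule ennreal_tendsto_cmult[rotated]) simp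
  thus ?thesis by simp
qed

text \<open>A subsequence that converges almost everywhere. Since \<open>r n \<ge> n\<close>, it keeps the rate of the original sequence.\<close>

lemma AE_subseq_of_Lp:
  fixes f :: "nat \<Rightarrow> 'a \<Rightarrow> 'b::{banach, second_countable_topology}"
  assumes [measurable]: "\<And>n. f n \<in> borel_measurable M" and p: "0 < p"
    and lt: "\<And>n. (\<integral>\<^sup>+x. ennreal (norm (f n x) powr p) \<partial>M) < ennreal (1 / real (Suc n))"
  obtains r :: "nat \<Rightarrow> nat" where "strict_mono r" "AE x in M. (\<lambda>n. f (r n) x) \<longlonglongrightarrow> 0"
    "\<And>n. (\<integral>\<^sup>+x. ennreal (norm (f (r n) x) powr p) \<partial>M) < ennreal (1 / real (Suc n))"
proof -
  have i: "integrable M (\<lambda>x. norm (f n x) powr p)" for n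
    by (rule integrableI_nonneg) (use lt[of n] in \<open>auto intro: less_le_trans\<close>)
  have eq: "(\<integral>\<^sup>+x. ennreal (norm (f n x) powr p) \<partial>M) = ennreal (LINT x|M. norm (f n x) powr p)" for n
    by (rule nn_integral_eq_integral[OF i]) simp
  have "(LINT x|M. norm (norm (f n x) powr p)) \<le> 1 / real (Suc n)" for n
    using lt[of n] unfolding eq by (simp add: ennreal_less_iff)
  hence "(\<lambda>n. LINT x|M. norm (norm (f n x) powr p)) \<longlonglongrightarrow> 0"
    by (intro tendsto_sandwich[OF _ _ tendsto_const LIMSEQ_inverse_real_of_nat])
       (auto simp: inverse_eq_divide intro!: always_eventually)
  from tendsto_L1_AE_subseq[OF i this] obtain r where r: "strict_mono r"
    "AE x in M. (\<lambda>n. norm (f (r n) x) powr p) \<longlonglongrightarrow> 0" by blast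
  have "AE x in M. (\<lambda>n. f (r n) x) \<longlonglongrightarrow> 0"
    using r(2)
  proof eventually_elim
    case (elim x)
    have "(\<lambda>n. (norm (f (r n) x) powr p) powr (1 / p)) \<longlonglongrightarrow> 0 powr (1 / p)"
      using p elim by (intro tendsto_powr') auto
    hence "(\<lambda>n. norm (f (r n) x)) \<longlonglongrightarrow> 0" using p by (simp add: powr_powr)
    thus ?case by (simp add: tendsto_norm_zero_iff)
  qed
  moreover have "(\<integral>\<^sup>+x. ennreal (norm (f (r n) x) powr p) \<partial>M) < ennreal (1 / real (Suc n))" for n
  proof (rule less_le_trans[OF lt])
    show "ennreal (1 / real (Suc (r n))) \<le> ennreal (1 / real (Suc n))"
      using seq_suble[OF r(1), of n] by (intro ennreal_leI) (simp add: frac_le)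
  qed
  ultimately show ?thesis using that r(1) by blast
qed

lemma lipschitz_half_line:
  fixes h h' :: "real \<Rightarrow> real"
  assumes "\<And>t. 0 \<le> t \<Longrightarrow> (h has_real_derivative h' t) (at t)" "\<And>t. 0 \<le> t \<Longrightarrow> \<bar>h' t\<bar> \<le> L" "0 \<le> s" "0 \<le> t"
  shows "\<bar>h s - h t\<bar> \<le> L * \<bar>s - t\<bar>"
  using field_differentiable_bound[of "{0..}" h h' L s t] assms
  by (auto intro: has_field_derivative_at_within)

lemma continuous_bounded_on_compact:
  fixes f :: "real^'n::finite \<Rightarrow> 'b::real_normed_vector"
  assumes "compact K" "continuous_on K f"
  obtains B where "B \<ge> 0" "\<And>x. x \<in> K \<Longrightarrow> norm (f x) \<le> B"
proof -
  obtain B where "\<And>x. x \<in> K \<Longrightarrow> norm (f x) \<le> B"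
    using compact_imp_bounded[OF compact_continuous_image[OF assms(2,1)]] by (auto simp: bounded_iff)
  hence "\<And>x. x \<in> K \<Longrightarrow> norm (f x) \<le> max B 0" by (meson max.coboundedI1)
  thus ?thesis using that[of "max B 0"] by auto
qed

lemma chain_product_integrable:
  fixes u :: "real^'n::finite \<Rightarrow> real"
  assumes \<Omega>: "open \<Omega>" and G: "has_weak_gradient \<Omega> u G" and pos: "AE x in lebesgue_on \<Omega>. 0 \<le> u x" and g: "C1 g"
    and h: "\<And>t. 0 \<le> t \<Longrightarrow> (h has_real_derivative h' t) (at t)" "\<And>t. 0 \<le> t \<Longrightarrow> \<bar>h' t\<bar> \<le> L"
    and hm: "h \<in> borel_measurable borel" "h' \<in> borel_measurable borel"
    and K: "compact K" "K \<subseteq> \<Omega>"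
  shows "integrable (lebesgue_on K) (\<lambda>x. g x * h (u x))"
    "integrable (lebesgue_on K) (\<lambda>x. h (u x) *\<^sub>R grad g x + (g x * h' (u x)) *\<^sub>R G x)"
    "AE x in lebesgue_on K. 0 \<le> u x"
proof -
  note Kl = compact_imp_lebesgue[OF K(1)]
  note \<Omega>l = open_imp_lebesgue[OF \<Omega>]
  note iu = has_weak_gradient_integrable[OF G K]
  show posK: "AE x in lebesgue_on K. 0 \<le> u x"
    using pos K(2) by (auto simp: AE_restrict_space_iff Kl \<Omega>l elim!: eventually_mono)
  have L: "L \<ge> 0" using h(2)[of 0] by simp
  have [measurable]: "u \<in> borel_measurable (lebesgue_on K)" "G \<in> borel_measurable (lebesgue_on K)"
    "g \<in> borel_measurable (lebesgue_on K)" "grad g \<in> borel_measurable (lebesgue_on K)"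
    using iu C1_measurable[OF g] C1_grad_measurable[OF g] by (auto intro: borel_imp_lebesgue_on)
  have [measurable]: "(\<lambda>x. h (u x)) \<in> borel_measurable (lebesgue_on K)" "(\<lambda>x. h' (u x)) \<in> borel_measurable (lebesgue_on K)"
    by (rule measurable_compose[OF _ hm(1)], measurable) (rule measurable_compose[OF _ hm(2)], measurable)
  obtain B1 where B1: "B1 \<ge> 0" "\<And>x. x \<in> K \<Longrightarrow> norm (g x) \<le> B1"
    using continuous_bounded_on_compact[OF K(1) C1_continuous[OF g]] by blast
  obtain B2 where B2: "B2 \<ge> 0" "\<And>x. x \<in> K \<Longrightarrow> norm (grad g x) \<le> B2"
    using continuous_bounded_on_compact[OF K(1) C1_continuous_grad[OF g]] by blast
  have hu: "AE x in lebesgue_on K. x \<in> K \<and> \<bar>h (u x)\<bar> \<le> \<bar>h 0\<bar> + L * \<bar>u x\<bar> \<and> \<bar>h' (u x)\<bar> \<le> L"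
    using posK AE_space
  proof eventually_elim
    case (elim x)
    thus ?case using lipschitz_half_line[OF h, of "u x" 0] h(2)[of "u x"] by auto
  qed
  have ci: "integrable (lebesgue_on K) (\<lambda>x. c::real)" for c by (rule integrable_lebesgue_on_compact[OF K(1)]) auto
  have bi: "integrable (lebesgue_on K) (\<lambda>x. B * (\<bar>h 0\<bar> + L * \<bar>u x\<bar>))" for B
    using iu(1) ci by auto
  show "integrable (lebesgue_on K) (\<lambda>x. g x * h (u x))"
  proof (rule Bochner_Integration.integrable_bound[OF bi[of B1]])
    show "AE x in lebesgue_on K. norm (g x * h (u x)) \<le> norm (B1 * (\<bar>h 0\<bar> + L * \<bar>u x\<bar>))"
      using hu by eventually_elim (use B1 L in \<open>auto simp: abs_mult intro!: mult_mono\<close>)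
  qed measurable
  have "integrable (lebesgue_on K) (\<lambda>x. h (u x) *\<^sub>R grad g x)"
  proof (rule Bochner_Integration.integrable_bound[OF bi[of B2]])
    show "AE x in lebesgue_on K. norm (h (u x) *\<^sub>R grad g x) \<le> norm (B2 * (\<bar>h 0\<bar> + L * \<bar>u x\<bar>))"
      using hu
    proof eventually_elim
      case (elim x)
      hence "\<bar>h (u x)\<bar> * norm (grad g x) \<le> (\<bar>h 0\<bar> + L * \<bar>u x\<bar>) * B2" using B2 L by (intro mult_mono) auto
      thus ?case using B2 L by (simp add: abs_mult mult.commute)
    qed
  qed measurable
  moreover have "integrable (lebesgue_on K) (\<lambda>x. (g x * h' (u x)) *\<^sub>R G x)"
  proof (rule Bochner_Integration.integrable_bound[OF integrable_mult_right[OF integrable_norm[OF iu(2)], of "B1 * L"]])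
    show "AE x in lebesgue_on K. norm ((g x * h' (u x)) *\<^sub>R G x) \<le> norm (B1 * L * norm (G x))"
      using hu by eventually_elim (use B1 L in \<open>auto simp: abs_mult intro!: mult_mono\<close>)
  qed measurable
  ultimately show "integrable (lebesgue_on K) (\<lambda>x. h (u x) *\<^sub>R grad g x + (g x * h' (u x)) *\<^sub>R G x)"
    by (rule Bochner_Integration.integrable_add)
qed

text \<open>Chain and product rule for \<open>g \<cdot> (h \<circ> u)\<close> with \<open>u \<ge> 0\<close>. The function \<open>h\<close> has to be regular only on the half line
  \<open>t \<ge> 0\<close>, because mollification preserves \<open>u \<ge> 0\<close>; this permits \<open>h(t) = (t + \<epsilon>)\<^sup>1\<^sup>-\<^sup>p\<close>. Measurability of \<open>h\<close> is
  required on the whole line since \<open>u\<close> may be negative on a null set.\<close>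

lemma chain_product_weak_gradient:
  fixes u :: "real^'n::finite \<Rightarrow> real"
  assumes \<Omega>: "open \<Omega>" and G: "has_weak_gradient \<Omega> u G" and pos: "AE x in lebesgue_on \<Omega>. 0 \<le> u x" and g: "C1 g"
    and h: "\<And>t. 0 \<le> t \<Longrightarrow> (h has_real_derivative h' t) (at t)" "\<And>t. 0 \<le> t \<Longrightarrow> \<bar>h' t\<bar> \<le> L"
    and h'_cont: "continuous_on {0..} h'"
    and hm: "h \<in> borel_measurable borel" "h' \<in> borel_measurable borel"
  shows "has_weak_gradient \<Omega> (\<lambda>x. g x * h (u x)) (\<lambda>x. h (u x) *\<^sub>R grad g x + (g x * h' (u x)) *\<^sub>R G x)"
  unfolding has_weak_gradient_def
proof (intro conjI allI impI ballI)
  fix K assume "compact K \<and> K \<subseteq> \<Omega>"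
  hence K: "compact K" "K \<subseteq> \<Omega>" by auto
  note int = chain_product_integrable[OF \<Omega> G pos g h hm K]
  show "(\<lambda>x. g x * h (u x)) absolutely_integrable_on K"
    unfolding absolutely_integrable_on_iff[OF compact_imp_lebesgue[OF K(1)]] by (rule int(1))
  show "(\<lambda>x. h (u x) *\<^sub>R grad g x + (g x * h' (u x)) *\<^sub>R G x) absolutely_integrable_on K"
    unfolding absolutely_integrable_on_iff[OF compact_imp_lebesgue[OF K(1)]] by (rule int(2))
next
  fix \<phi> :: "real^'n \<Rightarrow> real" and i assume "\<phi> \<in> test_functions \<Omega>"
  then obtain K where K: "compact K" "K \<subseteq> \<Omega>" "\<And>x. x \<notin> K \<Longrightarrow> \<phi> x = 0" "C1 \<phi>" by (rule test_functionE) (rule that)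
  note Kl = compact_imp_lebesgue[OF K(1)]
  note \<Omega>l = open_imp_lebesgue[OF \<Omega>]
  let ?M = "lebesgue_on K"
  have int: "integrable ?M (\<lambda>x. g x * h (u x))"
    "integrable ?M (\<lambda>x. h (u x) *\<^sub>R grad g x + (g x * h' (u x)) *\<^sub>R G x)" "AE x in ?M. 0 \<le> u x"
    by (rule chain_product_integrable[OF \<Omega> G pos g h hm K(1,2)]; assumption)+
  note iu = has_weak_gradient_integrable[OF G K(1,2)]
  have L: "L \<ge> 0" using h(2)[of 0] by simp
  have pz: "partial i \<phi> x = 0" if "x \<notin> K" for x
    by (rule partial_zero_off[OF compact_imp_closed[OF K(1)] K(3) that])
  obtain B1 where B1: "B1 \<ge> 0" "\<And>x. x \<in> K \<Longrightarrow> norm (g x) \<le> B1"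
    using continuous_bounded_on_compact[OF K(1) C1_continuous[OF g]] by blast
  obtain B2 where B2: "B2 \<ge> 0" "\<And>x. x \<in> K \<Longrightarrow> norm (partial i g x) \<le> B2"
    using continuous_bounded_on_compact[OF K(1) C1_continuous_partial[OF g]] by blast
  obtain B3 where B3: "B3 \<ge> 0" "\<And>x. x \<in> K \<Longrightarrow> norm (\<phi> x) \<le> B3"
    using continuous_bounded_on_compact[OF K(1) C1_continuous[OF K(4)]] by blast
  obtain B4 where B4: "B4 \<ge> 0" "\<And>x. x \<in> K \<Longrightarrow> norm (partial i \<phi> x) \<le> B4"
    using continuous_bounded_on_compact[OF K(1) C1_continuous_partial[OF K(4)]] by blast
  define B where "B = max (max B1 B2) (max B3 B4)"
  have B: "B \<ge> 0" "\<And>x. x \<in> K \<Longrightarrow> \<bar>g x\<bar> \<le> B" "\<And>x. x \<in> K \<Longrightarrow> \<bar>partial i g x\<bar> \<le> B"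
    "\<And>x. x \<in> K \<Longrightarrow> \<bar>\<phi> x\<bar> \<le> B" "\<And>x. x \<in> K \<Longrightarrow> \<bar>partial i \<phi> x\<bar> \<le> B"
    using B1 B2 B3 B4 unfolding B_def by (force simp: le_max_iff_disj)+
  have "\<exists>w. C1 w \<and> (\<integral>\<^sup>+x. ennreal \<bar>w x - u x\<bar> \<partial>?M) < ennreal (1 / real (Suc n)) \<and>
    (\<forall>i. (\<integral>\<^sup>+x. ennreal \<bar>partial i w x - G x $ i\<bar> \<partial>?M) < ennreal (1 / real (Suc n))) \<and> (\<forall>x. 0 \<le> w x)" for n
  proof (rule has_weak_gradient_local_approximation[OF \<Omega> G K(1,2), of "1 / real (Suc n)"])
    show "0 < 1 / real (Suc n)" by simp
    fix w assume "C1 w" "(\<integral>\<^sup>+x. ennreal \<bar>w x - u x\<bar> \<partial>?M) < ennreal (1 / real (Suc n))"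
      "\<And>i. (\<integral>\<^sup>+x. ennreal \<bar>partial i w x - G x $ i\<bar> \<partial>?M) < ennreal (1 / real (Suc n))"
      "(AE x in lebesgue_on \<Omega>. 0 \<le> u x) \<Longrightarrow> \<forall>x. 0 \<le> w x"
    with pos show ?thesis by (intro exI[of _ w] conjI allI) auto
  qed
  hence "\<exists>w. \<forall>n. C1 (w n) \<and> (\<integral>\<^sup>+x. ennreal \<bar>w n x - u x\<bar> \<partial>?M) < ennreal (1 / real (Suc n)) \<and>
    (\<forall>i. (\<integral>\<^sup>+x. ennreal \<bar>partial i (w n) x - G x $ i\<bar> \<partial>?M) < ennreal (1 / real (Suc n))) \<and> (\<forall>x. 0 \<le> w n x)"
    by (intro choice allI)
  then obtain w0 where w0: "\<And>n. C1 (w0 n)" "\<And>n. (\<integral>\<^sup>+x. ennreal \<bar>w0 n x - u x\<bar> \<partial>?M) < ennreal (1 / real (Suc n))"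
    "\<And>n i. (\<integral>\<^sup>+x. ennreal \<bar>partial i (w0 n) x - G x $ i\<bar> \<partial>?M) < ennreal (1 / real (Suc n))" "\<And>n x. 0 \<le> w0 n x"
    by blast
  have um[measurable]: "u \<in> borel_measurable ?M" and Gm[measurable]: "(\<lambda>x. G x $ i) \<in> borel_measurable ?M" for i
    using iu(1) integrable_component[OF iu(2), of i] by auto
  have w0m: "w0 n \<in> borel_measurable ?M" for n by (intro borel_imp_lebesgue_on C1_measurable w0(1))
  \<comment> \<open>Almost everywhere convergence is needed for the factor \<open>h' \<circ> u\<close>, as \<open>h'\<close> is merely continuous and bounded.\<close>
  obtain r :: "nat \<Rightarrow> nat" where r: "strict_mono r" "AE x in ?M. (\<lambda>n. w0 (r n) x - u x) \<longlonglongrightarrow> 0"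
    "\<And>n. (\<integral>\<^sup>+x. ennreal (norm (w0 (r n) x - u x) powr 1) \<partial>?M) < ennreal (1 / real (Suc n))"
    by (rule AE_subseq_of_Lp[of "\<lambda>n x. w0 n x - u x" ?M 1]) (use w0m w0(2) in auto)
  define w where "w n = w0 (r n)" for n
  have w: "C1 (w n)" "0 \<le> w n x" for n x using w0(1,4) by (auto simp: w_def)
  have le_Suc: "ennreal (1 / real (Suc (r n))) \<le> ennreal (1 / real (Suc n))" for n
    using seq_suble[OF r(1), of n] by (intro ennreal_leI) (simp add: frac_le)
  have wu: "(\<integral>\<^sup>+x. ennreal \<bar>w n x - u x\<bar> \<partial>?M) \<le> ennreal (1 / real (Suc n))" for n
    using r(3)[of n] by (simp add: w_def less_imp_le)
  have wG: "(\<integral>\<^sup>+x. ennreal \<bar>partial i (w n) x - G x $ i\<bar> \<partial>?M) \<le> ennreal (1 / real (Suc n))" for n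
    using less_imp_le[OF w0(3)[of i "r n"]] le_Suc[of n] unfolding w_def by (rule order_trans)
  have ae: "AE x in ?M. x \<in> K \<and> 0 \<le> u x \<and> (\<lambda>n. w n x) \<longlonglongrightarrow> u x"
    using r(2) int(3) AE_space by eventually_elim (auto simp: w_def LIM_zero_iff)
  have [measurable]: "\<phi> \<in> borel_measurable ?M" "partial i \<phi> \<in> borel_measurable ?M" "g \<in> borel_measurable ?M"
    "partial i g \<in> borel_measurable ?M" "w n \<in> borel_measurable ?M" "partial i (w n) \<in> borel_measurable ?M" for n
    using C1_measurable C1_partial_measurable g K(4) w(1) by (auto intro!: borel_imp_lebesgue_on)
  have [measurable]: "(\<lambda>x. h (u x)) \<in> borel_measurable ?M" "(\<lambda>x. h' (u x)) \<in> borel_measurable ?M"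
    "(\<lambda>x. h (w n x)) \<in> borel_measurable ?M" "(\<lambda>x. h' (w n x)) \<in> borel_measurable ?M" for n
    by (rule measurable_compose[OF _ hm(1)], measurable)
      (rule measurable_compose[OF _ hm(2)], measurable,
       rule measurable_compose[OF _ hm(1)], measurable, rule measurable_compose[OF _ hm(2)], measurable)
  have C1n: "C1 (\<lambda>x. g x * h (w n x))" for n
    by (intro C1_mult g C1_compose[OF w(1) h(1)[OF w(2)] h'_cont]) (use w in auto)
  have pn: "partial i (\<lambda>x. g x * h (w n x)) x = h (w n x) * partial i g x + g x * h' (w n x) * partial i (w n) x" for n x
  proof -
    have d: "(\<lambda>x. h (w n x)) differentiable (at x)" by (rule compose_differentiable[OF C1_differentiable[OF w(1)] h(1)[OF w(2)]])
    have "partial i (\<lambda>x. h (w n x)) x = h' (w n x) * partial i (w n) x"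
      using grad_compose[OF C1_differentiable[OF w(1)] h(1)[OF w(2)], of n x]
      by (metis grad_nth vector_scaleR_component real_scaleR_def)
    thus ?thesis using partial_mult[OF C1_differentiable[OF g] d] by simp
  qed
  define a where "a v x = g x * h (v x) * partial i \<phi> x" for v :: "real^'n \<Rightarrow> real" and x
  define b where "b v V x = (h (v x) * partial i g x + g x * h' (v x) * V x) * \<phi> x" for v V :: "real^'n \<Rightarrow> real" and x
  have ibp: "(LINT x|?M. a (w n) x) = - (LINT x|?M. b (w n) (partial i (w n)) x)" for n
  proof -
    have "(LINT x|lebesgue_on \<Omega>. g x * h (w n x) * partial i \<phi> x) = - (LINT x|lebesgue_on \<Omega>. grad (\<lambda>x. g x * h (w n x)) x $ i * \<phi> x)"
      by (rule has_weak_gradient_test[OF C1_has_weak_gradient[OF \<Omega> C1n] \<open>\<phi> \<in> test_functions \<Omega>\<close>])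
    moreover have "(LINT x|lebesgue_on \<Omega>. g x * h (w n x) * partial i \<phi> x) = (LINT x|?M. a (w n) x)"
      unfolding a_def by (rule lebesgue_on_supported(1)[OF \<Omega>l Kl K(2)]) (simp add: pz)
    moreover have "(LINT x|lebesgue_on \<Omega>. grad (\<lambda>x. g x * h (w n x)) x $ i * \<phi> x) = (LINT x|?M. b (w n) (partial i (w n)) x)"
      unfolding b_def grad_nth pn by (rule lebesgue_on_supported(1)[OF \<Omega>l Kl K(2)]) (simp add: K(3))
    ultimately show ?thesis by simp
  qed
  have cn: "continuous_on UNIV (\<lambda>x. h (w n x))" "continuous_on UNIV (\<lambda>x. h' (w n x))" for n
    by (rule C1_continuous[OF C1_compose[OF w(1) h(1)[OF w(2)] h'_cont]], use w(2) in auto)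
       (rule continuous_on_compose2[OF h'_cont C1_continuous[OF w(1)]], use w(2) in auto)
  have ia: "integrable ?M (a (w n))" "integrable ?M (b (w n) (partial i (w n)))" for n
    unfolding a_def b_def
    by (intro integrable_lebesgue_on_compact[OF K(1)] continuous_intros C1_continuous C1_continuous_partial g K(4) w(1)
        continuous_on_subset[OF cn(1)] continuous_on_subset[OF cn(2)] subset_UNIV)+
  have ia0: "integrable ?M (a u)" unfolding a_def
    by (rule integrable_mult_bounded_on_space[OF int(1), of _ B]) (use B in auto)
  have ib0: "integrable ?M (b u (\<lambda>x. G x $ i))"
  proof -
    have "integrable ?M (\<lambda>x. (h (u x) *\<^sub>R grad g x + (g x * h' (u x)) *\<^sub>R G x) $ i)"
      by (rule integrable_component[OF int(2)])
    from integrable_mult_bounded_on_space[OF this, of \<phi> B] show ?thesis unfolding b_def using B by simp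
  qed
  have lima: "(\<lambda>n. LINT x|?M. a (w n) x) \<longlonglongrightarrow> (LINT x|?M. a u x)"
  proof (rule tendsto_L1_int[OF ia(1) ia0])
    have "(\<integral>\<^sup>+x. norm (a (w n) x - a u x) \<partial>?M) \<le> ennreal (B * B * L) * ennreal (1 / real (Suc n))" for n
    proof -
      have "(\<integral>\<^sup>+x. norm (a (w n) x - a u x) \<partial>?M) \<le> (\<integral>\<^sup>+x. ennreal (B * B * L) * ennreal \<bar>w n x - u x\<bar> \<partial>?M)"
      proof (rule nn_integral_mono_AE)
        show "AE x in ?M. ennreal (norm (a (w n) x - a u x)) \<le> ennreal (B * B * L) * ennreal \<bar>w n x - u x\<bar>"
          using ae
        proof eventually_elim
          case (elim x)
          have "norm (a (w n) x - a u x) = \<bar>g x\<bar> * \<bar>h (w n x) - h (u x)\<bar> * \<bar>partial i \<phi> x\<bar>"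
            unfolding a_def real_norm_def abs_mult[symmetric] by (simp add: algebra_simps)
          also have "\<dots> \<le> B * (L * \<bar>w n x - u x\<bar>) * B"
            using elim B lipschitz_half_line[OF h w(2) , of "u x" n x] L by (intro mult_mono) auto
          finally show ?case using B L by (simp add: ennreal_mult'[symmetric] mult_ac ennreal_leI)
        qed
      qed
      also have "\<dots> = ennreal (B * B * L) * (\<integral>\<^sup>+x. ennreal \<bar>w n x - u x\<bar> \<partial>?M)" by (rule nn_integral_cmult) measurable
      also have "\<dots> \<le> ennreal (B * B * L) * ennreal (1 / real (Suc n))" by (intro mult_left_mono wu) simp
      finally show ?thesis .
    qed
    thus "(\<lambda>n. \<integral>\<^sup>+x. norm (a (w n) x - a u x) \<partial>?M) \<longlonglongrightarrow> 0"
      by (intro tendsto_sandwich[OF _ _ tendsto_const tendsto_inverse_Suc_ennreal[of "B * B * L"]]) (auto intro!: always_eventually)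
  qed
  have limb: "(\<lambda>n. LINT x|?M. b (w n) (partial i (w n)) x) \<longlonglongrightarrow> (LINT x|?M. b u (\<lambda>x. G x $ i) x)"
  proof (rule tendsto_L1_int[OF ia(2) ib0])
    define R where "R n = (\<integral>\<^sup>+x. ennreal (\<bar>h' (w n x) - h' (u x)\<bar> * \<bar>G x $ i\<bar>) \<partial>?M)" for n
    define C where "C = B * B * L"
    define C' where "C' = B * B"
    have C: "C \<ge> 0" "C' \<ge> 0" using B(1) L by (auto simp: C_def C'_def)
    have "R \<longlonglongrightarrow> (\<integral>\<^sup>+x. 0 \<partial>?M)"
      unfolding R_def
    proof (rule nn_integral_dominated_convergence[where w = "\<lambda>x. ennreal (2 * L * \<bar>G x $ i\<bar>)"])
      show "AE x in ?M. ennreal (\<bar>h' (w n x) - h' (u x)\<bar> * \<bar>G x $ i\<bar>) \<le> ennreal (2 * L * \<bar>G x $ i\<bar>)" for n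
        using ae
      proof eventually_elim
        case (elim x)
        have "\<bar>h' (w n x) - h' (u x)\<bar> \<le> 2 * L" using h(2)[OF w(2)[of n x]] h(2)[of "u x"] elim by linarith
        thus ?case by (intro ennreal_leI mult_right_mono) auto
      qed
      show "AE x in ?M. (\<lambda>n. ennreal (\<bar>h' (w n x) - h' (u x)\<bar> * \<bar>G x $ i\<bar>)) \<longlonglongrightarrow> 0"
        using ae
      proof eventually_elim
        case (elim x)
        have "(\<lambda>n. h' (w n x)) \<longlonglongrightarrow> h' (u x)"
          by (rule continuous_on_tendsto_compose[OF h'_cont]) (use elim w in auto)
        hence "(\<lambda>n. \<bar>h' (w n x) - h' (u x)\<bar> * \<bar>G x $ i\<bar>) \<longlonglongrightarrow> \<bar>h' (u x) - h' (u x)\<bar> * \<bar>G x $ i\<bar>"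
          by (intro tendsto_intros)
        thus ?case using tendsto_ennrealI[of _ 0] by simp
      qed
      have "integrable ?M (\<lambda>x. 2 * L * \<bar>G x $ i\<bar>)" using integrable_component[OF iu(2), of i] by simp
      thus "(\<integral>\<^sup>+x. ennreal (2 * L * \<bar>G x $ i\<bar>) \<partial>?M) < \<infinity>"
        using L by (subst nn_integral_eq_integral) auto
    qed measurable
    hence R0: "(\<lambda>n. ennreal C' * R n) \<longlonglongrightarrow> ennreal C' * 0" by (intro ennreal_tendsto_cmult) simp_all
    have bd: "(\<integral>\<^sup>+x. norm (b (w n) (partial i (w n)) x - b u (\<lambda>x. G x $ i) x) \<partial>?M) \<le>
      ennreal C * ennreal (1 / real (Suc n)) + ennreal C * ennreal (1 / real (Suc n)) + ennreal C' * R n" for n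
    proof -
      have "(\<integral>\<^sup>+x. norm (b (w n) (partial i (w n)) x - b u (\<lambda>x. G x $ i) x) \<partial>?M) \<le>
        (\<integral>\<^sup>+x. ennreal C * ennreal \<bar>w n x - u x\<bar> + ennreal C * ennreal \<bar>partial i (w n) x - G x $ i\<bar>
          + ennreal C' * ennreal (\<bar>h' (w n x) - h' (u x)\<bar> * \<bar>G x $ i\<bar>) \<partial>?M)"
      proof (rule nn_integral_mono_AE)
        show "AE x in ?M. ennreal (norm (b (w n) (partial i (w n)) x - b u (\<lambda>x. G x $ i) x)) \<le>
          ennreal C * ennreal \<bar>w n x - u x\<bar> + ennreal C * ennreal \<bar>partial i (w n) x - G x $ i\<bar>
          + ennreal C' * ennreal (\<bar>h' (w n x) - h' (u x)\<bar> * \<bar>G x $ i\<bar>)"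
          using ae
        proof eventually_elim
          case (elim x)
          let ?P = "(h (w n x) - h (u x)) * partial i g x"
          let ?Q = "g x * (h' (w n x) * (partial i (w n) x - G x $ i))"
          let ?R = "g x * ((h' (w n x) - h' (u x)) * G x $ i)"
          have "b (w n) (partial i (w n)) x - b u (\<lambda>x. G x $ i) x = (?P + ?Q + ?R) * \<phi> x"
            unfolding b_def by (simp add: algebra_simps)
          hence "norm (b (w n) (partial i (w n)) x - b u (\<lambda>x. G x $ i) x) = \<bar>?P + ?Q + ?R\<bar> * \<bar>\<phi> x\<bar>"
            by (simp add: abs_mult)
          also have "\<dots> \<le> (\<bar>?P\<bar> + \<bar>?Q\<bar> + \<bar>?R\<bar>) * B" using elim B by (intro mult_mono) auto
          also have "\<dots> \<le> (L * \<bar>w n x - u x\<bar> * B + B * (L * \<bar>partial i (w n) x - G x $ i\<bar>) + B * (\<bar>h' (w n x) - h' (u x)\<bar> * \<bar>G x $ i\<bar>)) * B"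
            unfolding abs_mult using elim B lipschitz_half_line[OF h w(2), of "u x" n x] L h(2)[OF w(2)[of n x]]
            by (intro mult_right_mono add_mono mult_mono) auto
          also have "\<dots> = C * \<bar>w n x - u x\<bar> + C * \<bar>partial i (w n) x - G x $ i\<bar> + C' * (\<bar>h' (w n x) - h' (u x)\<bar> * \<bar>G x $ i\<bar>)"
            by (simp add: C_def C'_def algebra_simps)
          finally have "ennreal (norm (b (w n) (partial i (w n)) x - b u (\<lambda>x. G x $ i) x)) \<le>
            ennreal (C * \<bar>w n x - u x\<bar> + C * \<bar>partial i (w n) x - G x $ i\<bar> + C' * (\<bar>h' (w n x) - h' (u x)\<bar> * \<bar>G x $ i\<bar>))"
            by (rule ennreal_leI)
          also have "\<dots> = ennreal C * ennreal \<bar>w n x - u x\<bar> + ennreal C * ennreal \<bar>partial i (w n) x - G x $ i\<bar>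
          + ennreal C' * ennreal (\<bar>h' (w n x) - h' (u x)\<bar> * \<bar>G x $ i\<bar>)"
            using C by (simp add: ennreal_mult')
          finally show ?case .
        qed
      qed
      also have "\<dots> = ennreal C * (\<integral>\<^sup>+x. ennreal \<bar>w n x - u x\<bar> \<partial>?M) + ennreal C * (\<integral>\<^sup>+x. ennreal \<bar>partial i (w n) x - G x $ i\<bar> \<partial>?M)
          + ennreal C' * R n"
        unfolding R_def by (simp add: nn_integral_add nn_integral_cmult)
      also have "\<dots> \<le> ennreal C * ennreal (1 / real (Suc n)) + ennreal C * ennreal (1 / real (Suc n)) + ennreal C' * R n"
        by (intro add_mono mult_left_mono wu wG) auto
      finally show ?thesis .
    qed
    have "(\<lambda>n. ennreal C * ennreal (1 / real (Suc n)) + ennreal C * ennreal (1 / real (Suc n)) + ennreal C' * R n)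
      \<longlonglongrightarrow> 0 + 0 + ennreal C' * 0"
      by (intro tendsto_add R0 tendsto_inverse_Suc_ennreal)
    hence lim0: "(\<lambda>n. ennreal C * ennreal (1 / real (Suc n)) + ennreal C * ennreal (1 / real (Suc n)) + ennreal C' * R n) \<longlonglongrightarrow> 0"
      by simp
    show "(\<lambda>n. \<integral>\<^sup>+x. norm (b (w n) (partial i (w n)) x - b u (\<lambda>x. G x $ i) x) \<partial>?M) \<longlonglongrightarrow> 0"
      by (rule tendsto_sandwich[OF _ _ tendsto_const lim0]) (use bd in \<open>auto intro!: always_eventually\<close>)
  qed
  have "(\<lambda>n. LINT x|?M. a (w n) x) \<longlonglongrightarrow> - (LINT x|?M. b u (\<lambda>x. G x $ i) x)"
    unfolding ibp by (intro tendsto_minus limb)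
  with lima have eq: "(LINT x|?M. a u x) = - (LINT x|?M. b u (\<lambda>x. G x $ i) x)" by (rule LIMSEQ_unique)
  have "(LINT x|lebesgue_on \<Omega>. g x * h (u x) * partial i \<phi> x) = (LINT x|?M. a u x)"
    unfolding a_def by (rule lebesgue_on_supported(1)[OF \<Omega>l Kl K(2)]) (simp add: pz)
  moreover have "(LINT x|lebesgue_on \<Omega>. (h (u x) *\<^sub>R grad g x + (g x * h' (u x)) *\<^sub>R G x) $ i * \<phi> x) = (LINT x|?M. b u (\<lambda>x. G x $ i) x)"
    unfolding b_def by (subst lebesgue_on_supported(1)[OF \<Omega>l Kl K(2)]) (simp_all add: K(3))
  ultimately show "(LINT x|lebesgue_on \<Omega>. g x * h (u x) * partial i \<phi> x) =
    - (LINT x|lebesgue_on \<Omega>. (h (u x) *\<^sub>R grad g x + (g x * h' (u x)) *\<^sub>R G x) $ i * \<phi> x)"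
    using eq by simp
qed

section \<open>The elliptic quadratic form and the flux\<close>

lemma has_weak_gradient_weak_grad:
  assumes "has_weak_gradient \<Omega> u G" shows "has_weak_gradient \<Omega> u (weak_grad \<Omega> u)"
  unfolding weak_grad_def by (rule someI[of "has_weak_gradient \<Omega> u", OF assms])

lemma borel_measurable_of_compacts:
  fixes u :: "'a::euclidean_space \<Rightarrow> 'b::euclidean_space"
  assumes \<Omega>: "open \<Omega>" and u: "\<And>K. compact K \<Longrightarrow> K \<subseteq> \<Omega> \<Longrightarrow> u \<in> borel_measurable (lebesgue_on K)"
  shows "u \<in> borel_measurable (lebesgue_on \<Omega>)"
proof -
  obtain C :: "nat \<Rightarrow> 'a set" where C: "\<And>n. compact (C n)" "\<And>n. C n \<subseteq> \<Omega>" "\<Union>(range C) = \<Omega>"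
    using open_Union_compact_subsets[OF \<Omega>] by metis
  show ?thesis
  proof (rule measurable_piecewise_restrict[of "range C"])
    show "X \<inter> space (lebesgue_on \<Omega>) \<in> sets (lebesgue_on \<Omega>)" if "X \<in> range C" for X
    proof -
      from that obtain n where X: "X = C n" by blast
      show ?thesis unfolding X
        using C(2)[of n] compact_imp_lebesgue[OF C(1)[of n]] open_imp_lebesgue[OF \<Omega>]
        by (simp add: sets_restrict_space_iff Int_absorb2)
    qed
    show "space (lebesgue_on \<Omega>) \<subseteq> \<Union>(range C)" using C(3) by simp
    show "u \<in> borel_measurable (restrict_space (lebesgue_on \<Omega>) X)" if "X \<in> range C" for X
    proof -
      from that obtain n where X: "X = C n" by blast
      have "restrict_space (lebesgue_on \<Omega>) X = lebesgue_on X"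
        using X C(2)[of n] open_imp_lebesgue[OF \<Omega>]
        by (subst restrict_restrict_space) (auto simp: compact_imp_lebesgue[OF C(1)] Int_absorb1)
      with u[OF C(1,2)[of n]] X show ?thesis by simp
    qed
  qed auto
qed

lemma has_weak_gradient_measurable:
  fixes u :: "real^'n::finite \<Rightarrow> real"
  assumes "open \<Omega>" "has_weak_gradient \<Omega> u G"
  shows "u \<in> borel_measurable (lebesgue_on \<Omega>)" "G \<in> borel_measurable (lebesgue_on \<Omega>)"
  using has_weak_gradient_integrable[OF assms(2)]
  by (auto intro!: borel_measurable_of_compacts[OF assms(1)])

lemma smooth_up_to_boundary_bounded:
  fixes f :: "real^'n::finite \<Rightarrow> real"
  assumes "bounded \<Omega>" "smooth_up_to_boundary \<Omega> f"
  obtains M where "M \<ge> 0" "\<And>x. x \<in> \<Omega> \<Longrightarrow> \<bar>f x\<bar> \<le> M"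
proof -
  have "\<exists>g. continuous_on (closure \<Omega>) g \<and> (\<forall>x\<in>\<Omega>. g x = iter_partial [] f x)"
    using assms(2) unfolding smooth_up_to_boundary_def by blast
  then obtain g where g: "continuous_on (closure \<Omega>) g" "\<And>x. x \<in> \<Omega> \<Longrightarrow> g x = f x" by auto
  have "compact (closure \<Omega>)" using assms(1) by simp
  from continuous_bounded_on_compact[OF this g(1)] obtain B where "B \<ge> 0" "\<And>x. x \<in> closure \<Omega> \<Longrightarrow> norm (g x) \<le> B"
    by blast
  thus ?thesis using that[of B] g(2) closure_subset by (metis real_norm_def subset_iff)
qed

lemma smooth_up_to_boundary_continuous:
  assumes "smooth_up_to_boundary \<Omega> f"
  shows "continuous_on \<Omega> f"
proof -
  have "\<forall>x\<in>\<Omega>. iter_partial [] f differentiable at x"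
    using assms unfolding smooth_up_to_boundary_def smooth_on_def by blast
  thus ?thesis by (auto intro!: continuous_at_imp_continuous_on differentiable_imp_continuous_within)
qed

lemma smooth_up_to_boundary_measurable:
  assumes "open \<Omega>" "smooth_up_to_boundary \<Omega> f" 
  shows "f \<in> borel_measurable (lebesgue_on \<Omega>)"
  using continuous_imp_measurable_on_sets_lebesgue[OF smooth_up_to_boundary_continuous[OF assms(2)] open_imp_lebesgue[OF assms(1)]] .

text \<open>A bounded open set with a smooth, symmetric and uniformly positive definite matrix field.\<close>

locale elliptic =
  fixes \<Omega> :: "(real^'n::finite) set" and A :: "real^'n \<Rightarrow> real^'n^'n"
  assumes open_\<Omega>: "open \<Omega>" and bounded_\<Omega>: "bounded \<Omega>" and admissible: "admissible_matrix \<Omega> A"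
begin

lemma domain_lebesgue: "\<Omega> \<in> sets lebesgue" by (rule open_imp_lebesgue[OF open_\<Omega>])

lemma A_coercive: obtains c where "c > 0" "\<And>x \<xi>. x \<in> \<Omega> \<Longrightarrow> c * (norm \<xi>)\<^sup>2 \<le> (A x *v \<xi>) \<bullet> \<xi>"
  using admissible unfolding admissible_matrix_def by blast

lemma A_nonneg: "x \<in> \<Omega> \<Longrightarrow> 0 \<le> (A x *v \<xi>) \<bullet> \<xi>"
  by (rule A_coercive) (meson less_imp_le mult_nonneg_nonneg order_trans zero_le_power2)

lemma A_symmetric: assumes "x \<in> \<Omega>" shows "(A x *v \<xi>) \<bullet> \<eta> = (A x *v \<eta>) \<bullet> \<xi>"
proof -
  have "transpose (A x) = A x" using admissible assms by (simp add: admissible_matrix_def)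
  hence "(A x *v \<xi>) \<bullet> \<eta> = (\<xi> v* A x) \<bullet> \<eta>" by (metis transpose_matrix_vector)
  also have "\<dots> = \<xi> \<bullet> (A x *v \<eta>)" by (rule dot_lmul_matrix)
  finally show ?thesis by (simp add: inner_commute)
qed

lemma A_norm_nonneg: "x \<in> \<Omega> \<Longrightarrow> 0 \<le> A_norm A x \<xi>"
  by (simp add: A_norm_def A_nonneg)

lemma A_norm_sq: "x \<in> \<Omega> \<Longrightarrow> A_norm A x \<xi> * A_norm A x \<xi> = (A x *v \<xi>) \<bullet> \<xi>"
  by (simp add: A_norm_def A_nonneg)

text \<open>The quadratic form is positive definite, so the usual proof by minimising it at \<open>\<xi> + t \<eta>\<close> over \<open>t\<close> applies.\<close>

lemma A_Cauchy_Schwarz: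
  assumes x: "x \<in> \<Omega>" shows "\<bar>(A x *v \<xi>) \<bullet> \<eta>\<bar> \<le> A_norm A x \<xi> * A_norm A x \<eta>"
proof (cases "\<eta> = 0")
  case False
  let ?a = "(A x *v \<xi>) \<bullet> \<xi>" and ?b = "(A x *v \<xi>) \<bullet> \<eta>" and ?c = "(A x *v \<eta>) \<bullet> \<eta>"
  obtain k where k: "k > 0" "\<And>\<xi>. k * (norm \<xi>)\<^sup>2 \<le> (A x *v \<xi>) \<bullet> \<xi>" using A_coercive x by metis
  have "0 < k * (norm \<eta>)\<^sup>2" using k False by simp
  hence c: "?c > 0" using k(2)[of \<eta>] by linarith
  let ?t = "- ?b / ?c"
  have "0 \<le> (A x *v (\<xi> + ?t *\<^sub>R \<eta>)) \<bullet> (\<xi> + ?t *\<^sub>R \<eta>)" by (rule A_nonneg[OF x])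
  also have "\<dots> = ?a + ?t * ?b + ?t * ((A x *v \<eta>) \<bullet> \<xi>) + ?t * ?t * ?c"
    by (simp add: matrix_vector_right_distrib matrix_vector_mult_scaleR inner_add_left inner_add_right algebra_simps)
  also have "(A x *v \<eta>) \<bullet> \<xi> = ?b" by (rule A_symmetric[OF x])
  also have "?a + ?t * ?b + ?t * ?b + ?t * ?t * ?c = ?a - ?b * ?b / ?c" using c by (simp add: field_simps)
  finally have "?b * ?b \<le> ?a * ?c" using c by (simp add: field_simps)
  hence "?b\<^sup>2 \<le> (A_norm A x \<xi> * A_norm A x \<eta>)\<^sup>2"
    by (simp add: power2_eq_square A_norm_sq[OF x, symmetric] mult_ac)
  hence "\<bar>?b\<bar> \<le> \<bar>A_norm A x \<xi> * A_norm A x \<eta>\<bar>" by (simp add: abs_le_square_iff)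
  thus ?thesis using A_norm_nonneg[OF x] by (simp add: abs_mult)
qed (simp add: A_norm_def)

lemma A_norm_triangle:
  assumes x: "x \<in> \<Omega>" shows "A_norm A x (\<xi> + \<eta>) \<le> A_norm A x \<xi> + A_norm A x \<eta>"
proof (rule power2_le_imp_le)
  have "(A_norm A x (\<xi> + \<eta>))\<^sup>2 = (A x *v \<xi>) \<bullet> \<xi> + 2 * ((A x *v \<xi>) \<bullet> \<eta>) + (A x *v \<eta>) \<bullet> \<eta>"
    using A_symmetric[OF x, of \<eta> \<xi>]
    by (simp add: power2_eq_square A_norm_sq[OF x] matrix_vector_right_distrib inner_add_left inner_add_right)
  also have "\<dots> \<le> (A x *v \<xi>) \<bullet> \<xi> + 2 * (A_norm A x \<xi> * A_norm A x \<eta>) + (A x *v \<eta>) \<bullet> \<eta>"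
    using A_Cauchy_Schwarz[OF x, of \<xi> \<eta>] by simp
  also have "\<dots> = (A_norm A x \<xi> + A_norm A x \<eta>)\<^sup>2"
    by (simp add: power2_eq_square A_norm_sq[OF x, symmetric] algebra_simps)
  finally show "(A_norm A x (\<xi> + \<eta>))\<^sup>2 \<le> (A_norm A x \<xi> + A_norm A x \<eta>)\<^sup>2" .
qed (use A_norm_nonneg[OF x] in auto)

lemma A_norm_scaleR: "A_norm A x (s *\<^sub>R \<xi>) = \<bar>s\<bar> * A_norm A x \<xi>"
proof -
  have "(A x *v (s *\<^sub>R \<xi>)) \<bullet> (s *\<^sub>R \<xi>) = s\<^sup>2 * ((A x *v \<xi>) \<bullet> \<xi>)"
    by (simp add: matrix_vector_mult_scaleR power2_eq_square)
  thus ?thesis by (simp add: A_norm_def real_sqrt_mult)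
qed

lemma A_form_eq: "(A x *v \<xi>) \<bullet> \<eta> = (\<Sum>i\<in>UNIV. \<Sum>j\<in>UNIV. A x $ i $ j * \<xi> $ j * \<eta> $ i)"
  by (simp add: inner_vec_def matrix_vector_mult_def sum_distrib_right)

lemma A_norm_bounded: obtains C where "C > 0" "\<And>x \<xi>. x \<in> \<Omega> \<Longrightarrow> A_norm A x \<xi> \<le> C * norm \<xi>"
proof -
  have "\<exists>M. \<forall>x\<in>\<Omega>. \<bar>A x $ i $ j\<bar> \<le> M" for i j
  proof -
    have "smooth_up_to_boundary \<Omega> (\<lambda>x. A x $ i $ j)" using admissible by (simp add: admissible_matrix_def)
    from smooth_up_to_boundary_bounded[OF bounded_\<Omega> this] show ?thesis by metis
  qed
  hence "\<exists>M. \<forall>i j. \<forall>x\<in>\<Omega>. \<bar>A x $ i $ j\<bar> \<le> M i j" by metis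
  then obtain M where M: "\<And>i j x. x \<in> \<Omega> \<Longrightarrow> \<bar>A x $ i $ j\<bar> \<le> M i j" by blast
  define S where "S = (\<Sum>i\<in>UNIV. \<Sum>j\<in>UNIV. \<bar>M i j\<bar>)"
  have S: "S \<ge> 0" unfolding S_def by (intro sum_nonneg) auto
  have "A_norm A x \<xi> \<le> (S + 1) * norm \<xi>" if x: "x \<in> \<Omega>" for x \<xi>
  proof -
    have "(A x *v \<xi>) \<bullet> \<xi> \<le> (\<Sum>i\<in>UNIV. \<Sum>j\<in>UNIV. \<bar>M i j\<bar> * (norm \<xi> * norm \<xi>))"
      unfolding A_form_eq
    proof (intro sum_mono)
      fix i j
      have "A x $ i $ j * \<xi> $ j * \<xi> $ i \<le> \<bar>A x $ i $ j\<bar> * (\<bar>\<xi> $ j\<bar> * \<bar>\<xi> $ i\<bar>)"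
        by (metis abs_ge_self abs_mult mult.assoc)
      also have "\<dots> \<le> \<bar>M i j\<bar> * (norm \<xi> * norm \<xi>)"
        using M[OF x, of i j] by (intro mult_mono component_le_norm_cart) auto
      finally show "A x $ i $ j * \<xi> $ j * \<xi> $ i \<le> \<bar>M i j\<bar> * (norm \<xi> * norm \<xi>)" .
    qed
    also have "\<dots> = S * (norm \<xi>)\<^sup>2" by (simp add: S_def sum_distrib_right power2_eq_square)
    also have "\<dots> \<le> (S + 1)\<^sup>2 * (norm \<xi>)\<^sup>2"
      using S by (intro mult_right_mono) (auto simp: power2_eq_square algebra_simps)
    finally have "A_norm A x \<xi> \<le> sqrt (((S + 1) * norm \<xi>)\<^sup>2)"
      unfolding A_norm_def by (intro real_sqrt_le_mono) (simp add: power_mult_distrib)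
    also have "\<dots> = (S + 1) * norm \<xi>" using S by simp
    finally show ?thesis .
  qed
  with that[of "S + 1"] S show ?thesis by simp
qed

lemma A_form_measurable:
  assumes S: "S \<in> sets lebesgue" "S \<subseteq> \<Omega>"
    and [measurable]: "G \<in> borel_measurable (lebesgue_on S)" "H \<in> borel_measurable (lebesgue_on S)"
  shows "(\<lambda>x. (A x *v G x) \<bullet> H x) \<in> borel_measurable (lebesgue_on S)"
proof -
  have [measurable]: "(\<lambda>x. A x $ i $ j) \<in> borel_measurable (lebesgue_on S)" for i j
  proof -
    have "smooth_up_to_boundary \<Omega> (\<lambda>x. A x $ i $ j)" using admissible by (simp add: admissible_matrix_def)
    from continuous_on_subset[OF smooth_up_to_boundary_continuous[OF this] S(2)]
    show ?thesis by (rule continuous_imp_measurable_on_sets_lebesgue[OF _ S(1)])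
  qed
  have [measurable]: "(\<lambda>x. G x $ i) \<in> borel_measurable (lebesgue_on S)" "(\<lambda>x. H x $ i) \<in> borel_measurable (lebesgue_on S)" for i
    by (intro measurable_component assms(3,4))+
  show ?thesis unfolding A_form_eq by measurable
qed

lemma A_norm_measurable:
  assumes "S \<in> sets lebesgue" "S \<subseteq> \<Omega>" "G \<in> borel_measurable (lebesgue_on S)"
  shows "(\<lambda>x. A_norm A x (G x)) \<in> borel_measurable (lebesgue_on S)"
  unfolding A_norm_def using A_form_measurable[OF assms(1,2,3,3)] by measurable

text \<open>The flux \<open>|G|\<^sub>A\<^sup>p\<^sup>-\<^sup>2 A G\<close> at \<open>x\<close>, paired with a vector \<open>\<xi>\<close>. It is \<open>0\<close> where \<open>G\<close> vanishes.\<close>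

definition flux :: "real \<Rightarrow> (real^'n \<Rightarrow> real^'n) \<Rightarrow> real^'n \<Rightarrow> real^'n \<Rightarrow> real" where
  "flux p G x \<xi> = A_norm A x (G x) powr (p - 2) * ((A x *v G x) \<bullet> \<xi>)"

lemma flux_le:
  assumes x: "x \<in> \<Omega>" shows "\<bar>flux p G x \<xi>\<bar> \<le> A_norm A x (G x) powr (p - 1) * A_norm A x \<xi>"
proof (cases "A_norm A x (G x) = 0")
  case False
  hence pos: "A_norm A x (G x) > 0" using A_norm_nonneg[OF x, of "G x"] by simp
  have "\<bar>flux p G x \<xi>\<bar> \<le> A_norm A x (G x) powr (p - 2) * (A_norm A x (G x) * A_norm A x \<xi>)"
    unfolding flux_def abs_mult by (intro mult_mono A_Cauchy_Schwarz x) auto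
  also have "\<dots> = (A_norm A x (G x) powr (p - 2) * A_norm A x (G x) powr 1) * A_norm A x \<xi>" using pos by simp
  also have "\<dots> = A_norm A x (G x) powr (p - 1) * A_norm A x \<xi>" unfolding powr_add[symmetric] by simp
  finally show ?thesis .
qed (simp add: flux_def)

lemma flux_self:
  assumes x: "x \<in> \<Omega>" shows "flux p G x (G x) = A_norm A x (G x) powr p"
proof (cases "A_norm A x (G x) = 0")
  case False
  hence pos: "A_norm A x (G x) > 0" using A_norm_nonneg[OF x, of "G x"] by simp
  have "flux p G x (G x) = A_norm A x (G x) powr (p - 2) * A_norm A x (G x) powr 1 * A_norm A x (G x) powr 1"
    using pos by (simp add: flux_def A_norm_sq[OF x, symmetric] mult_ac)
  also have "\<dots> = A_norm A x (G x) powr p" unfolding powr_add[symmetric] by simp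
  finally show ?thesis .
qed (simp add: flux_def)

lemma flux_add: "flux p G x (\<xi> + \<eta>) = flux p G x \<xi> + flux p G x \<eta>"
  by (simp add: flux_def inner_add_right algebra_simps)

lemma flux_diff: "flux p G x (\<xi> - \<eta>) = flux p G x \<xi> - flux p G x \<eta>"
  by (simp add: flux_def inner_diff_right algebra_simps)

lemma flux_scaleR: "flux p G x (s *\<^sub>R \<xi>) = s * flux p G x \<xi>"
  by (simp add: flux_def)

lemma flux_measurable:
  assumes "S \<in> sets lebesgue" "S \<subseteq> \<Omega>" "G \<in> borel_measurable (lebesgue_on S)" "H \<in> borel_measurable (lebesgue_on S)"
  shows "(\<lambda>x. flux p G x (H x)) \<in> borel_measurable (lebesgue_on S)"
  unfolding flux_def using A_form_measurable[OF assms] A_norm_measurable[OF assms(1-3)] by measurable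

end

section \<open>The weak equation for limits of test functions\<close>

text \<open>The weighted form of Young's inequality, by rescaling \<open>a\<close> and \<open>b\<close> so that their product \<open>a b\<^sup>p\<^sup>-\<^sup>1\<close> is unchanged.\<close>

lemma young_powr_eps:
  fixes a b p \<tau> :: real
  assumes p: "1 \<le> p" and ab: "0 \<le> a" "0 \<le> b" and \<tau>: "0 < \<tau>"
  shows "p * (a * b powr (p - 1)) \<le> \<tau> powr (1 - p) * a powr p + (p - 1) * (\<tau> * b powr p)"
proof -
  let ?a = "a * \<tau> powr (- (p - 1) / p)" and ?b = "b * \<tau> powr (1 / p)"
  have step: "p * (?a * ?b powr (p - 1)) \<le> ?a powr p + (p - 1) * ?b powr p"
    by (rule young_powr) (use assms in auto)
  have "?a * ?b powr (p - 1) = a * b powr (p - 1) * (\<tau> powr (- (p - 1) / p) * \<tau> powr ((p - 1) / p))"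
    using ab \<tau> by (simp add: powr_mult powr_powr)
  hence e1: "?a * ?b powr (p - 1) = a * b powr (p - 1)" using \<tau> by (simp add: powr_add[symmetric] diff_divide_distrib)
  have e2: "?a powr p = \<tau> powr (1 - p) * a powr p" using ab \<tau> p by (simp add: powr_mult powr_powr)
  have e3: "?b powr p = \<tau> * b powr p" using ab \<tau> p by (simp add: powr_mult powr_powr)
  show ?thesis using step unfolding e1 e2 e3 .
qed

lemma le_eps_add_powr:
  fixes t p \<tau> :: real
  assumes p: "1 \<le> p" and t: "0 \<le> t" and \<tau>: "0 < \<tau>"
  shows "t \<le> \<tau> + \<tau> powr (1 - p) * t powr p"
proof (cases "t \<le> \<tau>")
  case False
  hence "t = t powr (1 - p) * t powr p" using t \<tau> by (simp add: powr_add[symmetric])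
  also have "\<dots> \<le> \<tau> powr (1 - p) * t powr p"
    using False \<tau> p by (intro mult_right_mono powr_mono2') auto
  finally show ?thesis using \<tau> by simp
qed (use t in \<open>simp add: add_increasing2\<close>)

text \<open>A positive weak solution \<open>E\<close> of the equation with the smooth nonnegative right-hand side \<open>f\<close>. In this context
  \<open>G\<close> stands for the weak gradient of \<open>E\<close> and \<open>N\<close> for its length \<open>|\<nabla>E|\<^sub>A\<close>.\<close>

locale p_equation = elliptic \<Omega> A
  for \<Omega> :: "(real^'n::finite) set" and A :: "real^'n \<Rightarrow> real^'n^'n" +
  fixes f E :: "real^'n \<Rightarrow> real" and \<mu> :: "(real^'n) measure" and p :: real
  assumes p: "1 < p"
    and f_smooth: "smooth_up_to_boundary \<Omega> f" and f_nonneg: "\<And>x. x \<in> \<Omega> \<Longrightarrow> 0 \<le> f x"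
    and \<mu>_eq: "\<mu> = density (lebesgue_on \<Omega>) (\<lambda>x. ennreal (f x))"
    and solution: "weak_solution p A \<Omega> \<mu> E" and E_pos: "AE x in lebesgue_on \<Omega>. 0 < E x"
begin

definition G where "G = weak_grad \<Omega> E"

lemma G_weak: "has_weak_gradient \<Omega> E G"
  using solution has_weak_gradient_weak_grad unfolding weak_solution_def W1p_loc_def G_def by blast

lemma EG_Lp: "compact K \<Longrightarrow> K \<subseteq> \<Omega> \<Longrightarrow> E \<in> Lp p K" "compact K \<Longrightarrow> K \<subseteq> \<Omega> \<Longrightarrow> G \<in> Lp p K"
  using solution unfolding weak_solution_def W1p_loc_def G_def by auto

lemma E_measurable [measurable]: "E \<in> borel_measurable (lebesgue_on \<Omega>)"
  and G_measurable [measurable]: "G \<in> borel_measurable (lebesgue_on \<Omega>)"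
  using has_weak_gradient_measurable[OF open_\<Omega> G_weak] by auto

lemma f_measurable [measurable]: "f \<in> borel_measurable (lebesgue_on \<Omega>)"
  by (rule smooth_up_to_boundary_measurable[OF open_\<Omega> f_smooth])

abbreviation N where "N x \<equiv> A_norm A x (G x)"

lemma N_measurable [measurable]: "(\<lambda>x. N x) \<in> borel_measurable (lebesgue_on \<Omega>)"
  by (rule A_norm_measurable[OF domain_lebesgue]) auto

lemma E_nonneg: "AE x in lebesgue_on \<Omega>. 0 \<le> E x"
  using E_pos by eventually_elim simp

lemma integral_\<mu>:
  fixes g :: "real^'n \<Rightarrow> real"
  assumes "g \<in> borel_measurable (lebesgue_on \<Omega>)"
  shows "(LINT x|\<mu>. g x) = (LINT x|lebesgue_on \<Omega>. f x * g x)"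
  unfolding \<mu>_eq using f_nonneg by (subst integral_density[OF assms f_measurable]) auto

lemma nn_integral_\<mu>:
  assumes "g \<in> borel_measurable (lebesgue_on \<Omega>)"
  shows "(\<integral>\<^sup>+x. g x \<partial>\<mu>) = (\<integral>\<^sup>+x. ennreal (f x) * g x \<partial>lebesgue_on \<Omega>)"
  unfolding \<mu>_eq by (subst nn_integral_density) (use assms in auto)

lemma test_function_equation:
  assumes "\<phi> \<in> test_functions \<Omega>"
  shows "(LINT x|lebesgue_on \<Omega>. flux p G x (grad \<phi> x)) = (LINT x|lebesgue_on \<Omega>. f x * \<phi> x)"
proof -
  have "(LINT x|lebesgue_on \<Omega>. flux p G x (grad \<phi> x)) = (LINT x|\<mu>. \<phi> x)"
    using solution assms unfolding weak_solution_def flux_def G_def by simp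
  also have "\<dots> = (LINT x|lebesgue_on \<Omega>. f x * \<phi> x)"
    by (intro integral_\<mu> borel_imp_lebesgue_on C1_measurable smooth_imp_C1 test_function_smooth[OF assms])
  finally show ?thesis .
qed

lemma f_bounded: obtains M where "M \<ge> 0" "\<And>x. x \<in> \<Omega> \<Longrightarrow> \<bar>f x\<bar> \<le> M"
  using smooth_up_to_boundary_bounded[OF bounded_\<Omega> f_smooth] by blast

lemma finite_measure_\<Omega>: "finite_measure (lebesgue_on \<Omega>)"
proof -
  have "\<Omega> \<in> lmeasurable" using bounded_\<Omega> open_\<Omega> by (simp add: lmeasurable_open)
  thus ?thesis by (simp add: finite_measure_lebesgue_on)
qed

lemma integrable_const_\<Omega>: "integrable (lebesgue_on \<Omega>) (\<lambda>x. c :: real)"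
  using finite_measure.integrable_const[OF finite_measure_\<Omega>] .

text \<open>The weak equation holds for every pair \<open>(v, V)\<close> that is a limit in \<open>W\<^sup>1\<^sup>,\<^sup>p\<close> of test functions and their gradients,
  provided that \<open>\<nabla>E\<close> is in \<open>L\<^sup>p\<close> on a set \<open>S\<close> outside of which all these gradients vanish. For a compactly supported
  \<open>v\<close> one takes \<open>S\<close> compact; for a solution of finite energy \<open>S = \<Omega>\<close> is possible. Young's inequality with a weight \<open>\<tau>\<close>
  bounds the difference of the two sides of the equation in terms of the distance to a test function.\<close>

lemma limit_equation:
  assumes S: "S \<in> sets lebesgue" "S \<subseteq> \<Omega>" and GS: "G \<in> Lp p S"
    and v: "v \<in> borel_measurable (lebesgue_on \<Omega>)" and V: "V \<in> borel_measurable (lebesgue_on \<Omega>)"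
    and VS: "\<And>x. x \<in> \<Omega> \<Longrightarrow> x \<notin> S \<Longrightarrow> V x = 0"
    and approx: "\<And>e. e > 0 \<Longrightarrow> \<exists>\<phi>\<in>test_functions \<Omega>. (\<forall>x. x \<notin> S \<longrightarrow> grad \<phi> x = 0) \<and>
     (\<integral>\<^sup>+x. ennreal (\<bar>v x - \<phi> x\<bar> powr p) \<partial>lebesgue_on \<Omega>) < ennreal e \<and>
     (\<integral>\<^sup>+x. ennreal (norm (V x - grad \<phi> x) powr p) \<partial>lebesgue_on \<Omega>) < ennreal e"
  shows "integrable (lebesgue_on \<Omega>) (\<lambda>x. flux p G x (V x))" "integrable (lebesgue_on \<Omega>) (\<lambda>x. f x * v x)"
    "(LINT x|lebesgue_on \<Omega>. flux p G x (V x)) = (LINT x|lebesgue_on \<Omega>. f x * v x)"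
proof -
  let ?M = "lebesgue_on \<Omega>"
  note [measurable] = v V
  obtain C where C: "C > 0" "\<And>x \<xi>. x \<in> \<Omega> \<Longrightarrow> A_norm A x \<xi> \<le> C * norm \<xi>" using A_norm_bounded by blast
  obtain M where M: "M \<ge> 0" "\<And>x. x \<in> \<Omega> \<Longrightarrow> \<bar>f x\<bar> \<le> M" using f_bounded by blast
  define GS where "GS x = (if x \<in> S then norm (G x) powr p else 0)" for x
  have iGS: "integrable ?M GS"
  proof -
    have "integrable (lebesgue_on S) (\<lambda>x. norm (G x) powr p)" using GS by (simp add: Lp_def)
    hence "integrable (lebesgue_on S) GS" by (rule Bochner_Integration.integrable_cong[THEN iffD1, rotated -1]) (auto simp: GS_def)
    thus ?thesis using lebesgue_on_supported(2)[OF domain_lebesgue S, of GS] by (simp add: GS_def)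
  qed
  define I where "I = (LINT x|?M. GS x)"
  have I: "I \<ge> 0" unfolding I_def by (intro integral_nonneg_AE AE_I2) (simp add: GS_def)
  define m where "m = measure ?M (space ?M)"
  have flux_bd: "\<bar>flux p G x \<xi>\<bar> \<le> C powr p * (\<tau> powr (1 - p) * norm \<xi> powr p + (p - 1) * (\<tau> * GS x))"
    if x: "x \<in> \<Omega>" "x \<in> S \<or> \<xi> = 0" and \<tau>: "\<tau> > 0" for x \<xi> \<tau>
  proof (cases "x \<in> S")
    case True
    have "\<bar>flux p G x \<xi>\<bar> \<le> A_norm A x (G x) powr (p - 1) * A_norm A x \<xi>" by (rule flux_le[OF x(1)])
    also have "\<dots> \<le> (C * norm (G x)) powr (p - 1) * (C * norm \<xi>)"
      using p C x by (intro mult_mono powr_mono2 A_norm_nonneg) auto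
    also have "\<dots> = C powr p * (norm \<xi> * norm (G x) powr (p - 1))"
    proof -
      have "C powr p = C powr (p - 1) * C powr 1" unfolding powr_add[symmetric] by simp
      thus ?thesis using C(1) by (simp add: powr_mult)
    qed
    also have "\<dots> \<le> C powr p * (p * (norm \<xi> * norm (G x) powr (p - 1)))"
    proof (rule mult_left_mono)
      show "norm \<xi> * norm (G x) powr (p - 1) \<le> p * (norm \<xi> * norm (G x) powr (p - 1))"
        using p mult_right_mono[of 1 p "norm \<xi> * norm (G x) powr (p - 1)"] by simp
    qed simp
    also have "\<dots> \<le> C powr p * (\<tau> powr (1 - p) * norm \<xi> powr p + (p - 1) * (\<tau> * norm (G x) powr p))"
      using p \<tau> by (intro mult_left_mono young_powr_eps) auto
    finally show ?thesis using True by (simp add: GS_def)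
  qed (use x in \<open>simp add: flux_def GS_def\<close>)
  have real_approx: "\<exists>\<phi>\<in>test_functions \<Omega>. (\<forall>x. x \<notin> S \<longrightarrow> grad \<phi> x = 0) \<and>
     integrable ?M (\<lambda>x. \<bar>v x - \<phi> x\<bar> powr p) \<and> (LINT x|?M. \<bar>v x - \<phi> x\<bar> powr p) < e \<and>
     integrable ?M (\<lambda>x. norm (V x - grad \<phi> x) powr p) \<and> (LINT x|?M. norm (V x - grad \<phi> x) powr p) < e" if "e > 0" for e
  proof -
    from approx[OF that] obtain \<phi> where \<phi>: "\<phi> \<in> test_functions \<Omega>" "\<forall>x. x \<notin> S \<longrightarrow> grad \<phi> x = 0"
     "(\<integral>\<^sup>+x. ennreal (\<bar>v x - \<phi> x\<bar> powr p) \<partial>?M) < ennreal e"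
     "(\<integral>\<^sup>+x. ennreal (norm (V x - grad \<phi> x) powr p) \<partial>?M) < ennreal e" by blast
    have [measurable]: "\<phi> \<in> borel_measurable ?M" "grad \<phi> \<in> borel_measurable ?M"
      by (intro borel_imp_lebesgue_on C1_measurable C1_grad_measurable smooth_imp_C1 test_function_smooth[OF \<phi>(1)])+
    have i: "integrable ?M (\<lambda>x. \<bar>v x - \<phi> x\<bar> powr p)" "integrable ?M (\<lambda>x. norm (V x - grad \<phi> x) powr p)"
      by (rule integrableI_nonneg; use \<phi>(3,4) in \<open>auto intro: less_trans\<close>)+
    have "(LINT x|?M. \<bar>v x - \<phi> x\<bar> powr p) < e" "(LINT x|?M. norm (V x - grad \<phi> x) powr p) < e"
      using \<phi>(3,4) that by (simp_all add: nn_integral_eq_integral[OF i(1)] nn_integral_eq_integral[OF i(2)] ennreal_less_iff)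
    with i \<phi>(1,2) show ?thesis by blast
  qed
  have fm[measurable]: "(\<lambda>x. flux p G x (V x)) \<in> borel_measurable ?M"
    by (rule flux_measurable[OF domain_lebesgue]) auto
  have "integrable ?M (\<lambda>x. flux p G x (V x)) \<and> integrable ?M (\<lambda>x. f x * v x) \<and>
    \<bar>(LINT x|?M. flux p G x (V x)) - (LINT x|?M. f x * v x)\<bar> \<le> (C powr p * (1 + (p - 1) * I) + M * (m + 1)) * \<tau>"
    if \<tau>: "\<tau> > 0" for \<tau>
  proof -
    \<comment> \<open>The distance \<open>\<tau>\<^sup>p\<close> compensates the weight \<open>\<tau>\<^sup>1\<^sup>-\<^sup>p\<close> and leaves an error of order \<open>\<tau>\<close>.\<close>
    obtain \<phi> where \<phi>: "\<phi> \<in> test_functions \<Omega>" "\<And>x. x \<notin> S \<Longrightarrow> grad \<phi> x = 0"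
      "integrable ?M (\<lambda>x. \<bar>v x - \<phi> x\<bar> powr p)" "(LINT x|?M. \<bar>v x - \<phi> x\<bar> powr p) < \<tau> powr p"
      "integrable ?M (\<lambda>x. norm (V x - grad \<phi> x) powr p)" "(LINT x|?M. norm (V x - grad \<phi> x) powr p) < \<tau> powr p"
      using real_approx[of "\<tau> powr p"] \<tau> by auto
    obtain K where K: "compact K" "K \<subseteq> \<Omega>" "\<And>x. x \<notin> K \<Longrightarrow> \<phi> x = 0" "C1 \<phi>"
      using \<phi>(1) by (rule test_functionE) (rule that)
    have [measurable]: "\<phi> \<in> borel_measurable ?M" "grad \<phi> \<in> borel_measurable ?M"
      using K(4) by (auto intro!: borel_imp_lebesgue_on C1_measurable C1_grad_measurable)
    have [measurable]: "(\<lambda>x. flux p G x (grad \<phi> x)) \<in> borel_measurable ?M" 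
        "(\<lambda>x. flux p G x (V x - grad \<phi> x)) \<in> borel_measurable ?M"
      by (rule flux_measurable[OF domain_lebesgue]; simp)+
    have gp: "integrable ?M (\<lambda>x. norm (grad \<phi> x) powr p)"
    proof -
      have "integrable (lebesgue_on K) (\<lambda>x. norm (grad \<phi> x) powr p)"
        using p K(4) by (intro integrable_lebesgue_on_compact K(1) continuous_on_powr' continuous_intros C1_continuous_grad) auto
      moreover have "norm (grad \<phi> x) powr p = 0" if "x \<notin> K" for x
        using grad_zero_off[OF compact_imp_closed[OF K(1)] K(3) that] by simp
      ultimately show ?thesis using lebesgue_on_supported(2)[OF domain_lebesgue compact_imp_lebesgue[OF K(1)] K(2), of "\<lambda>x. norm (grad \<phi> x) powr p"] by simp
    qed
    have if\<phi>: "integrable ?M (\<lambda>x. f x * \<phi> x)"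
    proof -
      have "integrable (lebesgue_on K) \<phi>" by (intro integrable_lebesgue_on_compact K(1) C1_continuous K(4))
      hence "integrable ?M \<phi>" using lebesgue_on_supported(2)[OF domain_lebesgue compact_imp_lebesgue[OF K(1)] K(2), of \<phi>] K(3) by simp
      from integrable_mult_bounded_on_space[OF this f_measurable, of M] M(2) show ?thesis by (simp add: mult.commute)
    qed
    have if\<phi>': "integrable ?M (\<lambda>x. flux p G x (grad \<phi> x))"
    proof (rule Bochner_Integration.integrable_bound)
      show "integrable ?M (\<lambda>x. C powr p * (1 powr (1 - p) * norm (grad \<phi> x) powr p + (p - 1) * (1 * GS x)))"
        using gp iGS by simp
      show "AE x in ?M. norm (flux p G x (grad \<phi> x)) \<le> norm (C powr p * (1 powr (1 - p) * norm (grad \<phi> x) powr p + (p - 1) * (1 * GS x)))"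
      proof (rule AE_I2)
        fix x assume "x \<in> space ?M"
        thus "norm (flux p G x (grad \<phi> x)) \<le> norm (C powr p * (1 powr (1 - p) * norm (grad \<phi> x) powr p + (p - 1) * (1 * GS x)))"
          using flux_bd[of x "grad \<phi> x" 1] \<phi>(2)[of x] by (auto intro: order_trans[OF _ abs_ge_self])
      qed
    qed simp
    let ?B1 = "\<lambda>x. C powr p * (\<tau> powr (1 - p) * norm (V x - grad \<phi> x) powr p + (p - 1) * (\<tau> * GS x))"
    have iB1: "integrable ?M ?B1" using \<phi>(5) iGS by simp
    have bd1: "\<bar>flux p G x (V x - grad \<phi> x)\<bar> \<le> ?B1 x" if "x \<in> \<Omega>" for x
    proof -
      have c: "x \<in> S \<or> V x - grad \<phi> x = 0" using \<phi>(2)[of x] VS[of x] that by (cases "x \<in> S") simp_all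
      show ?thesis by (rule flux_bd[OF that c \<tau>])
    qed
    have id1: "integrable ?M (\<lambda>x. flux p G x (V x - grad \<phi> x))"
      by (rule Bochner_Integration.integrable_bound[OF iB1])
         (auto intro!: AE_I2 order_trans[OF bd1 abs_ge_self])
    have i1: "integrable ?M (\<lambda>x. flux p G x (V x))"
      using Bochner_Integration.integrable_add[OF id1 if\<phi>'] by (simp add: flux_diff)
    let ?B2 = "\<lambda>x. M * (\<tau> + \<tau> powr (1 - p) * \<bar>v x - \<phi> x\<bar> powr p)"
    have iB2: "integrable ?M ?B2" using \<phi>(3) integrable_const_\<Omega> by simp
    have bd2: "\<bar>f x * (v x - \<phi> x)\<bar> \<le> ?B2 x" if "x \<in> \<Omega>" for x
      unfolding abs_mult using M that p \<tau> by (intro mult_mono le_eps_add_powr) auto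
    have id2: "integrable ?M (\<lambda>x. f x * (v x - \<phi> x))"
      by (rule Bochner_Integration.integrable_bound[OF iB2])
         (auto intro!: AE_I2 order_trans[OF bd2 abs_ge_self])
    have i2: "integrable ?M (\<lambda>x. f x * v x)"
      using Bochner_Integration.integrable_add[OF id2 if\<phi>] by (simp add: algebra_simps)
    have tp: "\<tau> powr (1 - p) * \<tau> powr p = \<tau>" using \<tau> by (simp add: powr_add[symmetric])
    have d1: "\<bar>LINT x|?M. flux p G x (V x - grad \<phi> x)\<bar> \<le> C powr p * (1 + (p - 1) * I) * \<tau>"
    proof -
      have "\<bar>LINT x|?M. flux p G x (V x - grad \<phi> x)\<bar> \<le> (LINT x|?M. \<bar>flux p G x (V x - grad \<phi> x)\<bar>)" by (rule integral_abs_bound)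
      also have "\<dots> \<le> (LINT x|?M. ?B1 x)" by (intro integral_mono integrable_abs id1 iB1 bd1) simp
      also have "\<dots> = C powr p * (\<tau> powr (1 - p) * (LINT x|?M. norm (V x - grad \<phi> x) powr p) + (p - 1) * (\<tau> * I))"
        using \<phi>(5) iGS by (simp add: I_def)
      also have "\<dots> \<le> C powr p * (\<tau> powr (1 - p) * \<tau> powr p + (p - 1) * (\<tau> * I))"
        using \<phi>(6) by (intro mult_left_mono add_right_mono) auto
      also have "\<dots> = C powr p * (1 + (p - 1) * I) * \<tau>" unfolding tp by (simp add: algebra_simps)
      finally show ?thesis .
    qed
    have d2: "\<bar>LINT x|?M. f x * (v x - \<phi> x)\<bar> \<le> M * (m + 1) * \<tau>"
    proof -
      have "\<bar>LINT x|?M. f x * (v x - \<phi> x)\<bar> \<le> (LINT x|?M. \<bar>f x * (v x - \<phi> x)\<bar>)" by (rule integral_abs_bound)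
      also have "\<dots> \<le> (LINT x|?M. ?B2 x)" by (intro integral_mono integrable_abs id2 iB2 bd2) simp
      also have "\<dots> = M * (\<tau> * m + \<tau> powr (1 - p) * (LINT x|?M. \<bar>v x - \<phi> x\<bar> powr p))"
        using \<phi>(3) integrable_const_\<Omega> by (simp add: m_def)
      also have "\<dots> \<le> M * (\<tau> * m + \<tau> powr (1 - p) * \<tau> powr p)"
        using \<phi>(4) M by (intro mult_left_mono add_left_mono) auto
      also have "\<dots> = M * (m + 1) * \<tau>" unfolding tp by (simp add: algebra_simps)
      finally show ?thesis .
    qed
    have "(LINT x|?M. flux p G x (V x)) - (LINT x|?M. f x * v x) =
      (LINT x|?M. flux p G x (V x - grad \<phi> x)) - (LINT x|?M. f x * (v x - \<phi> x))"
      unfolding flux_diff right_diff_distrib using i1 i2 if\<phi> if\<phi>' test_function_equation[OF \<phi>(1)] by simp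
    with d1 d2 i1 i2 show ?thesis by (simp add: algebra_simps)
  qed
  note main = this
  from main[of 1] show "integrable ?M (\<lambda>x. flux p G x (V x))" "integrable ?M (\<lambda>x. f x * v x)" by simp_all
  define D where "D = \<bar>(LINT x|?M. flux p G x (V x)) - (LINT x|?M. f x * v x)\<bar>"
  define Q where "Q = C powr p * (1 + (p - 1) * I) + M * (m + 1)"
  have Q: "Q \<ge> 0" unfolding Q_def m_def using I M p by (intro add_nonneg_nonneg mult_nonneg_nonneg) auto
  have DQ: "D \<le> Q * \<tau>" if "\<tau> > 0" for \<tau> using main[OF that] by (simp add: D_def Q_def)
  have "D \<le> 0"
  proof (rule field_le_epsilon)
    fix e :: real assume "e > 0"
    have "D \<le> Q * (e / (Q + 1))" using \<open>e > 0\<close> Q by (intro DQ) auto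
    also have "\<dots> \<le> e" using \<open>e > 0\<close> Q by (simp add: field_simps)
    finally show "D \<le> 0 + e" by simp
  qed
  thus "(LINT x|?M. flux p G x (V x)) = (LINT x|?M. f x * v x)" by (simp add: D_def)
qed

end

section \<open>The closure of the test functions\<close>

lemma Lp_diff:
  fixes f g :: "real^'n::finite \<Rightarrow> 'b::euclidean_space"
  assumes p: "0 \<le> p" and "f \<in> Lp p S" "g \<in> Lp p S"
  shows "(\<lambda>x. f x - g x) \<in> Lp p S"
proof -
  from assms have [measurable]: "f \<in> borel_measurable (lebesgue_on S)" "g \<in> borel_measurable (lebesgue_on S)"
    and i: "integrable (lebesgue_on S) (\<lambda>x. 2 powr p * (norm (f x) powr p + norm (g x) powr p))"
    by (auto simp: Lp_def)
  have "integrable (lebesgue_on S) (\<lambda>x. norm (f x - g x) powr p)"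
  proof (rule Bochner_Integration.integrable_bound[OF i])
    have "norm (f x - g x) powr p \<le> 2 powr p * (norm (f x) powr p + norm (g x) powr p)" for x
      using powr_add_le[OF p, of "f x" "- g x"] by simp
    thus "AE x in lebesgue_on S. norm (norm (f x - g x) powr p) \<le> norm (2 powr p * (norm (f x) powr p + norm (g x) powr p))"
      by (auto intro!: AE_I2)
  qed measurable
  thus ?thesis by (simp add: Lp_def)
qed

lemma Lp_nn_integral:
  fixes f :: "real^'n::finite \<Rightarrow> 'b::euclidean_space"
  assumes "f \<in> Lp p S"
  shows "(\<integral>\<^sup>+x. ennreal (norm (f x) powr p) \<partial>lebesgue_on S) = ennreal (LINT x|lebesgue_on S. norm (f x) powr p)"
  using assms by (intro nn_integral_eq_integral) (auto simp: Lp_def)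

lemma LpI_nn_integral:
  fixes f :: "real^'n::finite \<Rightarrow> 'b::euclidean_space"
  assumes "f \<in> borel_measurable (lebesgue_on S)" "(\<integral>\<^sup>+x. ennreal (norm (f x) powr p) \<partial>lebesgue_on S) < \<infinity>"
  shows "f \<in> Lp p S"
  using assms by (auto simp: Lp_def intro!: integrableI_nonneg)

lemma test_function_Lp:
  fixes \<phi> :: "real^'n::finite \<Rightarrow> real"
  assumes \<Omega>: "open \<Omega>" and p: "0 < p" and \<phi>: "\<phi> \<in> test_functions \<Omega>"
  shows "\<phi> \<in> Lp p \<Omega>" "grad \<phi> \<in> Lp p \<Omega>"
proof -
  note \<Omega>l = open_imp_lebesgue[OF \<Omega>]
  obtain K where K: "compact K" "K \<subseteq> \<Omega>" "\<And>x. x \<notin> K \<Longrightarrow> \<phi> x = 0" "C1 \<phi>"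
    using \<phi> by (rule test_functionE) (rule that)
  note Kl = compact_imp_lebesgue[OF K(1)]
  have "integrable (lebesgue_on K) (\<lambda>x. \<bar>\<phi> x\<bar> powr p)" "integrable (lebesgue_on K) (\<lambda>x. norm (grad \<phi> x) powr p)"
    using p by (intro integrable_lebesgue_on_compact K(1) continuous_on_powr' continuous_intros C1_continuous C1_continuous_grad K(4); simp)+
  moreover have "norm (grad \<phi> x) powr p = 0" if "x \<notin> K" for x
    using grad_zero_off[OF compact_imp_closed[OF K(1)] K(3) that] by simp
  ultimately have "integrable (lebesgue_on \<Omega>) (\<lambda>x. \<bar>\<phi> x\<bar> powr p)" "integrable (lebesgue_on \<Omega>) (\<lambda>x. norm (grad \<phi> x) powr p)"
    using lebesgue_on_supported(2)[OF \<Omega>l Kl K(2), of "\<lambda>x. \<bar>\<phi> x\<bar> powr p"]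
      lebesgue_on_supported(2)[OF \<Omega>l Kl K(2), of "\<lambda>x. norm (grad \<phi> x) powr p"] K(3) by auto
  thus "\<phi> \<in> Lp p \<Omega>" "grad \<phi> \<in> Lp p \<Omega>"
    using C1_measurable[OF K(4)] C1_grad_measurable[OF K(4)] by (auto simp: Lp_def intro: borel_imp_lebesgue_on)
qed

text \<open>The pair \<open>(v, V)\<close> is a limit of test functions and their gradients in the \<open>W\<^sup>1\<^sup>,\<^sup>p\<close> norm. Nonnegative integrals are
  used, so that no integrability has to be known beforehand.\<close>

definition W_approximable :: "real \<Rightarrow> (real^'n::finite) set \<Rightarrow> (real^'n \<Rightarrow> real) \<Rightarrow> (real^'n \<Rightarrow> real^'n) \<Rightarrow> bool" where
  "W_approximable p \<Omega> v V \<longleftrightarrow> (\<forall>e>0. \<exists>\<phi>\<in>test_functions \<Omega>.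
     (\<integral>\<^sup>+x. ennreal (\<bar>v x - \<phi> x\<bar> powr p) \<partial>lebesgue_on \<Omega>) < ennreal e \<and>
     (\<integral>\<^sup>+x. ennreal (norm (V x - grad \<phi> x) powr p) \<partial>lebesgue_on \<Omega>) < ennreal e)"

lemma W01p_weak_gradient: "u \<in> W01p p \<Omega> \<Longrightarrow> has_weak_gradient \<Omega> u (weak_grad \<Omega> u)"
  by (auto simp: W01p_def W1p_def intro: has_weak_gradient_weak_grad)

lemma W01p_Lp: "u \<in> W01p p \<Omega> \<Longrightarrow> u \<in> Lp p \<Omega>" "u \<in> W01p p \<Omega> \<Longrightarrow> weak_grad \<Omega> u \<in> Lp p \<Omega>"
  by (auto simp: W01p_def W1p_def)

lemma W01p_approximable:
  assumes \<Omega>: "open \<Omega>" and p: "0 < p" and u: "u \<in> W01p p \<Omega>"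
  shows "W_approximable p \<Omega> u (weak_grad \<Omega> u)"
  unfolding W_approximable_def
proof (intro allI impI)
  fix e :: real assume "e > 0"
  then obtain \<phi> where \<phi>: "\<phi> \<in> test_functions \<Omega>" "(LINT x|lebesgue_on \<Omega>. \<bar>u x - \<phi> x\<bar> powr p) +
        (LINT x|lebesgue_on \<Omega>. norm (weak_grad \<Omega> u x - grad \<phi> x) powr p) < e"
    using u by (auto simp: W01p_def)
  have L: "(\<lambda>x. u x - \<phi> x) \<in> Lp p \<Omega>" "(\<lambda>x. weak_grad \<Omega> u x - grad \<phi> x) \<in> Lp p \<Omega>"
    using p by (intro Lp_diff W01p_Lp u test_function_Lp[OF \<Omega> p \<phi>(1)]; simp)+
  have nn: "0 \<le> (LINT x|lebesgue_on \<Omega>. \<bar>u x - \<phi> x\<bar> powr p)" "0 \<le> (LINT x|lebesgue_on \<Omega>. norm (weak_grad \<Omega> u x - grad \<phi> x) powr p)"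
    by (intro integral_nonneg_AE AE_I2; simp)+
  have "(\<integral>\<^sup>+x. ennreal (\<bar>u x - \<phi> x\<bar> powr p) \<partial>lebesgue_on \<Omega>) < ennreal e"
    "(\<integral>\<^sup>+x. ennreal (norm (weak_grad \<Omega> u x - grad \<phi> x) powr p) \<partial>lebesgue_on \<Omega>) < ennreal e"
  proof -
    have lt: "(LINT x|lebesgue_on \<Omega>. \<bar>u x - \<phi> x\<bar> powr p) < e" 
      "(LINT x|lebesgue_on \<Omega>. norm (weak_grad \<Omega> u x - grad \<phi> x) powr p) < e"
      using \<phi>(2) nn by linarith+
    show "(\<integral>\<^sup>+x. ennreal (\<bar>u x - \<phi> x\<bar> powr p) \<partial>lebesgue_on \<Omega>) < ennreal e"
      using Lp_nn_integral[OF L(1)] ennreal_lessI[OF \<open>e > 0\<close> lt(1)] by simp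
    show "(\<integral>\<^sup>+x. ennreal (norm (weak_grad \<Omega> u x - grad \<phi> x) powr p) \<partial>lebesgue_on \<Omega>) < ennreal e"
      unfolding Lp_nn_integral[OF L(2)] by (rule ennreal_lessI[OF \<open>e > 0\<close> lt(2)])
  qed
  with \<phi>(1) show "\<exists>\<phi>\<in>test_functions \<Omega>.
     (\<integral>\<^sup>+x. ennreal (\<bar>u x - \<phi> x\<bar> powr p) \<partial>lebesgue_on \<Omega>) < ennreal e \<and>
     (\<integral>\<^sup>+x. ennreal (norm (weak_grad \<Omega> u x - grad \<phi> x) powr p) \<partial>lebesgue_on \<Omega>) < ennreal e" by blast
qed

lemma W01pI:
  fixes u :: "real^'n::finite \<Rightarrow> real"
  assumes \<Omega>: "open \<Omega>" and p: "0 < p" and V: "has_weak_gradient \<Omega> u V" and L: "u \<in> Lp p \<Omega>" "V \<in> Lp p \<Omega>"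
    and approx: "W_approximable p \<Omega> u V"
  shows "u \<in> W01p p \<Omega>" "AE x in lebesgue_on \<Omega>. weak_grad \<Omega> u x = V x"
proof -
  note \<Omega>l = open_imp_lebesgue[OF \<Omega>]
  let ?W = "weak_grad \<Omega> u"
  have W: "has_weak_gradient \<Omega> u ?W" by (rule has_weak_gradient_weak_grad[OF V])
  show ae: "AE x in lebesgue_on \<Omega>. ?W x = V x" by (rule has_weak_gradient_unique[OF \<Omega> W V])
  have Wm: "?W \<in> borel_measurable (lebesgue_on \<Omega>)" by (rule has_weak_gradient_measurable(2)[OF \<Omega> W])
  have WL: "?W \<in> Lp p \<Omega>"
  proof (rule LpI_nn_integral[OF Wm])
    have "(\<integral>\<^sup>+x. ennreal (norm (?W x) powr p) \<partial>lebesgue_on \<Omega>) = (\<integral>\<^sup>+x. ennreal (norm (V x) powr p) \<partial>lebesgue_on \<Omega>)"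
      by (rule nn_integral_cong_AE) (use ae in \<open>auto elim: eventually_mono\<close>)
    also have "\<dots> < \<infinity>" unfolding Lp_nn_integral[OF L(2)] by simp
    finally show "(\<integral>\<^sup>+x. ennreal (norm (?W x) powr p) \<partial>lebesgue_on \<Omega>) < \<infinity>" .
  qed
  have "\<exists>\<phi>\<in>test_functions \<Omega>. (LINT x|lebesgue_on \<Omega>. \<bar>u x - \<phi> x\<bar> powr p) +
        (LINT x|lebesgue_on \<Omega>. norm (?W x - grad \<phi> x) powr p) < e" if e: "e > 0" for e
  proof -
    obtain \<phi> where \<phi>: "\<phi> \<in> test_functions \<Omega>"
      "(\<integral>\<^sup>+x. ennreal (\<bar>u x - \<phi> x\<bar> powr p) \<partial>lebesgue_on \<Omega>) < ennreal (e / 2)"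
      "(\<integral>\<^sup>+x. ennreal (norm (V x - grad \<phi> x) powr p) \<partial>lebesgue_on \<Omega>) < ennreal (e / 2)"
      using approx e unfolding W_approximable_def by (meson half_gt_zero)
    have D: "(\<lambda>x. u x - \<phi> x) \<in> Lp p \<Omega>" "(\<lambda>x. ?W x - grad \<phi> x) \<in> Lp p \<Omega>"
      using p by (intro Lp_diff L WL test_function_Lp[OF \<Omega> p \<phi>(1)]; simp)+
    have "(\<integral>\<^sup>+x. ennreal (norm (?W x - grad \<phi> x) powr p) \<partial>lebesgue_on \<Omega>) = (\<integral>\<^sup>+x. ennreal (norm (V x - grad \<phi> x) powr p) \<partial>lebesgue_on \<Omega>)"
      by (rule nn_integral_cong_AE) (use ae in \<open>auto elim: eventually_mono\<close>)
    hence "ennreal (LINT x|lebesgue_on \<Omega>. norm (?W x - grad \<phi> x) powr p) < ennreal (e / 2)"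
      using \<phi>(3) unfolding Lp_nn_integral[OF D(2)] by simp
    hence "(LINT x|lebesgue_on \<Omega>. norm (?W x - grad \<phi> x) powr p) < e / 2"
      by (subst (asm) ennreal_less_iff) (auto intro!: integral_nonneg_AE)
    moreover have "ennreal (LINT x|lebesgue_on \<Omega>. norm (u x - \<phi> x) powr p) < ennreal (e / 2)"
      using \<phi>(2) Lp_nn_integral[OF D(1)] by simp
    hence "(LINT x|lebesgue_on \<Omega>. norm (u x - \<phi> x) powr p) < e / 2"
      by (subst (asm) ennreal_less_iff) (auto intro!: integral_nonneg_AE)
    hence "(LINT x|lebesgue_on \<Omega>. \<bar>u x - \<phi> x\<bar> powr p) < e / 2" by simp
    ultimately have "(LINT x|lebesgue_on \<Omega>. \<bar>u x - \<phi> x\<bar> powr p) + (LINT x|lebesgue_on \<Omega>. norm (?W x - grad \<phi> x) powr p) < e"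
      by linarith
    with \<phi>(1) show ?thesis by (intro bexI[of _ \<phi>]) auto
  qed
  with V L(1) WL show "u \<in> W01p p \<Omega>" by (auto simp: W01p_def W1p_def)
qed

lemma W_approximable_sequence:
  assumes "W_approximable p \<Omega> v V"
  obtains \<phi> where "\<And>n. \<phi> n \<in> test_functions \<Omega>"
    "\<And>n. (\<integral>\<^sup>+x. ennreal (\<bar>v x - \<phi> n x\<bar> powr p) \<partial>lebesgue_on \<Omega>) < ennreal (1 / real (Suc n))"
    "\<And>n. (\<integral>\<^sup>+x. ennreal (norm (V x - grad (\<phi> n) x) powr p) \<partial>lebesgue_on \<Omega>) < ennreal (1 / real (Suc n))"
proof -
  have "\<exists>\<phi>. \<phi> \<in> test_functions \<Omega> \<and>
     (\<integral>\<^sup>+x. ennreal (\<bar>v x - \<phi> x\<bar> powr p) \<partial>lebesgue_on \<Omega>) < ennreal (1 / real (Suc n)) \<and>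
     (\<integral>\<^sup>+x. ennreal (norm (V x - grad \<phi> x) powr p) \<partial>lebesgue_on \<Omega>) < ennreal (1 / real (Suc n))" for n
  proof -
    have "0 < 1 / real (Suc n)" by simp
    with assms show ?thesis unfolding W_approximable_def by blast
  qed
  hence "\<exists>\<phi>. \<forall>n. \<phi> n \<in> test_functions \<Omega> \<and>
     (\<integral>\<^sup>+x. ennreal (\<bar>v x - \<phi> n x\<bar> powr p) \<partial>lebesgue_on \<Omega>) < ennreal (1 / real (Suc n)) \<and>
     (\<integral>\<^sup>+x. ennreal (norm (V x - grad (\<phi> n) x) powr p) \<partial>lebesgue_on \<Omega>) < ennreal (1 / real (Suc n))"
    by (intro choice allI)
  with that show ?thesis by blast
qed

lemma W_approximable_closed:
  fixes v :: "real^'n::finite \<Rightarrow> real"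
  assumes \<Omega>: "open \<Omega>" and p: "0 < p"
    and m: "v \<in> borel_measurable (lebesgue_on \<Omega>)" "V \<in> borel_measurable (lebesgue_on \<Omega>)"
    and close: "\<And>e. e > 0 \<Longrightarrow> \<exists>w W. w \<in> borel_measurable (lebesgue_on \<Omega>) \<and> W \<in> borel_measurable (lebesgue_on \<Omega>) \<and>
      W_approximable p \<Omega> w W \<and>
     (\<integral>\<^sup>+x. ennreal (\<bar>v x - w x\<bar> powr p) \<partial>lebesgue_on \<Omega>) < ennreal e \<and>
     (\<integral>\<^sup>+x. ennreal (norm (V x - W x) powr p) \<partial>lebesgue_on \<Omega>) < ennreal e"
  shows "W_approximable p \<Omega> v V"
  unfolding W_approximable_def
proof (intro allI impI)
  fix e :: real assume e: "e > 0"
  define e1 where "e1 = e / (2 * 2 powr p)"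
  have e1: "e1 > 0" using e by (simp add: e1_def)
  obtain w W where w: "w \<in> borel_measurable (lebesgue_on \<Omega>)" "W \<in> borel_measurable (lebesgue_on \<Omega>)"
      "W_approximable p \<Omega> w W"
     "(\<integral>\<^sup>+x. ennreal (\<bar>v x - w x\<bar> powr p) \<partial>lebesgue_on \<Omega>) < ennreal e1"
     "(\<integral>\<^sup>+x. ennreal (norm (V x - W x) powr p) \<partial>lebesgue_on \<Omega>) < ennreal e1" using close[OF e1] by blast
  obtain \<phi> where \<phi>: "\<phi> \<in> test_functions \<Omega>"
    "(\<integral>\<^sup>+x. ennreal (\<bar>w x - \<phi> x\<bar> powr p) \<partial>lebesgue_on \<Omega>) < ennreal e1"
    "(\<integral>\<^sup>+x. ennreal (norm (W x - grad \<phi> x) powr p) \<partial>lebesgue_on \<Omega>) < ennreal e1"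
    using w(3) e1 unfolding W_approximable_def by blast
  note [measurable] = m w(1,2)
  have [measurable]: "\<phi> \<in> borel_measurable (lebesgue_on \<Omega>)" "grad \<phi> \<in> borel_measurable (lebesgue_on \<Omega>)"
    by (intro borel_imp_lebesgue_on C1_measurable C1_grad_measurable smooth_imp_C1 test_function_smooth[OF \<phi>(1)])+
  have eq: "ennreal (2 powr p) * (ennreal e1 + ennreal e1) = ennreal e"
    using e by (simp add: e1_def flip: ennreal_plus ennreal_mult')
  have "(\<integral>\<^sup>+x. ennreal (\<bar>v x - \<phi> x\<bar> powr p) \<partial>lebesgue_on \<Omega>) < ennreal e"
  proof -
    have "(\<integral>\<^sup>+x. ennreal (norm ((v x - w x) + (w x - \<phi> x)) powr p) \<partial>lebesgue_on \<Omega>) \<le> ennreal (2 powr p) *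
      ((\<integral>\<^sup>+x. ennreal (norm (v x - w x) powr p) \<partial>lebesgue_on \<Omega>) + (\<integral>\<^sup>+x. ennreal (norm (w x - \<phi> x) powr p) \<partial>lebesgue_on \<Omega>))"
      by (rule nn_integral_powr_add_le) (use p in auto)
    also have "\<dots> < ennreal (2 powr p) * (ennreal e1 + ennreal e1)"
      using w(4) \<phi>(2) by (intro ennreal_mult_strict_left_mono add_strict_mono) auto
    finally show ?thesis by (simp add: eq)
  qed
  moreover have "(\<integral>\<^sup>+x. ennreal (norm (V x - grad \<phi> x) powr p) \<partial>lebesgue_on \<Omega>) < ennreal e"
  proof -
    have "(\<integral>\<^sup>+x. ennreal (norm ((V x - W x) + (W x - grad \<phi> x)) powr p) \<partial>lebesgue_on \<Omega>) \<le> ennreal (2 powr p) *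
      ((\<integral>\<^sup>+x. ennreal (norm (V x - W x) powr p) \<partial>lebesgue_on \<Omega>) + (\<integral>\<^sup>+x. ennreal (norm (W x - grad \<phi> x) powr p) \<partial>lebesgue_on \<Omega>))"
      by (rule nn_integral_powr_add_le) (use p in auto)
    also have "\<dots> < ennreal (2 powr p) * (ennreal e1 + ennreal e1)"
      using w(5) \<phi>(3) by (intro ennreal_mult_strict_left_mono add_strict_mono) auto
    finally show ?thesis by (simp add: eq)
  qed
  ultimately show "\<exists>\<phi>\<in>test_functions \<Omega>.
     (\<integral>\<^sup>+x. ennreal (\<bar>v x - \<phi> x\<bar> powr p) \<partial>lebesgue_on \<Omega>) < ennreal e \<and>
     (\<integral>\<^sup>+x. ennreal (norm (V x - grad \<phi> x) powr p) \<partial>lebesgue_on \<Omega>) < ennreal e" using \<phi>(1) by blast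
qed

section \<open>Powers and the pointwise Hardy inequality\<close>

text \<open>The power \<open>t\<^sub>+\<^sup>q\<close> of the positive part, which is continuously differentiable for \<open>q > 1\<close>.\<close>

definition ppow :: "real \<Rightarrow> real \<Rightarrow> real" where "ppow q t = max t 0 powr q"

lemma ppow_continuous: "0 < q \<Longrightarrow> continuous_on S (ppow q)"
  unfolding ppow_def by (intro continuous_on_powr' continuous_intros) auto

lemma ppow_measurable [measurable]: "ppow q \<in> borel_measurable borel"
  unfolding ppow_def by measurable

lemma ppow_has_real_derivative:
  assumes q: "1 < q" shows "(ppow q has_real_derivative q * ppow (q - 1) t) (at t)"
proof -
  consider "t > 0" | "t < 0" | "t = 0" by linarith
  then show ?thesis
  proof cases
    case 1
    have "((\<lambda>t. t powr q) has_real_derivative q * t powr (q - 1)) (at t)"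
      by (rule has_real_derivative_powr[OF 1])
    moreover have "\<forall>\<^sub>F x in nhds t. ppow q x = x powr q"
      using eventually_nhds_in_open[of "{0<..}" t] 1 by (auto elim!: eventually_mono simp: ppow_def max_def)
    ultimately show ?thesis using 1 by (subst DERIV_cong_ev[OF refl _ refl]) (auto simp: ppow_def)
  next
    case 2
    have "\<forall>\<^sub>F x in nhds t. ppow q x = 0"
      using eventually_nhds_in_open[of "{..<0}" t] 2 by (auto elim!: eventually_mono simp: ppow_def max_def)
    moreover have "q * ppow (q - 1) t = 0" using 2 by (simp add: ppow_def)
    ultimately show ?thesis by (subst DERIV_cong_ev[OF refl _ refl, where g = "\<lambda>_. 0"]) auto
  next
    case 3
    have "((\<lambda>x. ppow (q - 1) x) \<longlongrightarrow> ppow (q - 1) 0) (at 0)"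
      using ppow_continuous[of "q - 1" UNIV] q by (simp add: continuous_on_def)
    moreover have "ppow q x / x = ppow (q - 1) x" for x
      by (cases "x > 0") (auto simp: ppow_def max_def powr_diff)
    ultimately have "((\<lambda>x. ppow q x / x) \<longlongrightarrow> 0) (at 0)" using q by (simp add: ppow_def)
    thus ?thesis using 3 by (simp add: has_field_derivative_iff ppow_def)
  qed
qed

text \<open>The odd power \<open>|t|\<^sup>q sgn t\<close>.\<close>

definition spow :: "real \<Rightarrow> real \<Rightarrow> real" where "spow q t = ppow q t - ppow q (- t)"

lemma abs_spow: "\<bar>spow q t\<bar> = \<bar>t\<bar> powr q"
  by (cases "t \<ge> 0") (auto simp: spow_def ppow_def max_def)

lemma abs_powr_has_real_derivative:
  assumes q: "1 < q" shows "((\<lambda>t. \<bar>t\<bar> powr q) has_real_derivative q * spow (q - 1) t) (at t)"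
proof -
  have eq: "(\<lambda>t. \<bar>t\<bar> powr q) = (\<lambda>t. ppow q t + ppow q (- t))"
    using q by (auto simp: fun_eq_iff ppow_def max_def abs_if)
  have "((\<lambda>t. ppow q (- t)) has_real_derivative (q * ppow (q - 1) (- t)) * (- 1)) (at t)"
    by (rule DERIV_chain2[OF ppow_has_real_derivative[OF q]]) (auto intro!: derivative_eq_intros)
  from DERIV_add[OF ppow_has_real_derivative[OF q, of t] this]
  show ?thesis unfolding eq by (simp add: spow_def algebra_simps)
qed

lemma C1_abs_powr:
  assumes q: "1 < q" and w: "C1 w"
  shows "C1 (\<lambda>x. \<bar>w x\<bar> powr q)" "grad (\<lambda>x. \<bar>w x\<bar> powr q) x = (q * spow (q - 1) (w x)) *\<^sub>R grad w x"
proof -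
  have "continuous_on UNIV (\<lambda>t. q * spow (q - 1) t)" unfolding spow_def
    using q by (intro continuous_intros ppow_continuous continuous_on_compose2[OF ppow_continuous[of "q - 1" UNIV]]) auto
  thus "C1 (\<lambda>x. \<bar>w x\<bar> powr q)"
    by (rule C1_compose[OF w abs_powr_has_real_derivative[OF q]]) auto
  show "grad (\<lambda>x. \<bar>w x\<bar> powr q) x = (q * spow (q - 1) (w x)) *\<^sub>R grad w x"
    by (rule grad_compose[OF C1_differentiable[OF w] abs_powr_has_real_derivative[OF q]])
qed

text \<open>The pointwise inequality behind the Hardy inequality. With \<open>s = |\<phi>|\<close>, \<open>T = E + \<epsilon>\<close>, \<open>n = |\<nabla>E|\<^sub>A\<close>, \<open>a = |\<nabla>\<phi>|\<^sub>A\<close> and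
  \<open>y\<close> the flux paired with \<open>\<nabla>\<phi>\<close>, the bracket is the flux paired with the gradient of \<open>|\<phi>|\<^sup>p (E + \<epsilon>)\<^sup>1\<^sup>-\<^sup>p\<close>. It is Young's
  inequality applied to \<open>a\<close> and \<open>\<kappa> s n / T\<close> with \<open>\<kappa> = (p - 1)/p\<close>.\<close>

lemma hardy_pointwise:
  fixes p a n s T d y :: real
  assumes p: "1 < p" and nn: "0 \<le> a" "0 \<le> n" "0 \<le> s" and T: "0 < T" and d: "\<bar>d\<bar> = s powr (p - 1)"
    and y: "\<bar>y\<bar> \<le> n powr (p - 1) * a"
  shows "((p - 1) / p) powr (p - 1) * (T powr (1 - p) * ((p * d) * y) + s powr p * ((1 - p) * T powr (- p)) * n powr p)
    + ((p - 1) / p) powr p * (s powr p * (n / T) powr p) \<le> a powr p"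
proof -
  define \<kappa> where "\<kappa> = (p - 1) / p"
  define l where "l = \<kappa> powr (p - 1)"
  define b where "b = s * n / T"
  have \<kappa>: "0 < \<kappa>" using p by (simp add: \<kappa>_def)
  have b: "0 \<le> b" using nn T by (simp add: b_def)
  have c: "\<kappa> powr p = \<kappa> * l" using \<kappa> by (simp add: l_def powr_diff)
  have bp: "s powr p * (n / T) powr p = b powr p" using nn T by (simp add: b_def powr_mult[symmetric])
  have bp': "s powr p * ((1 - p) * T powr (- p)) * n powr p = (1 - p) * b powr p"
    using nn T by (simp add: b_def powr_mult powr_divide powr_minus_divide)
  have "d * y \<le> \<bar>d\<bar> * \<bar>y\<bar>" by (metis abs_ge_self abs_mult)
  also have "\<dots> \<le> s powr (p - 1) * (n powr (p - 1) * a)" using d y by (intro mult_mono) auto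
  finally have "T powr (1 - p) * (d * y) \<le> T powr (1 - p) * (s powr (p - 1) * (n powr (p - 1) * a))"
    by (intro mult_left_mono) auto
  also have "\<dots> = b powr (p - 1) * a"
  proof -
    have "T powr (1 - p) = 1 / T powr (p - 1)" using powr_minus_divide[of T "p - 1"] by simp
    thus ?thesis using nn T by (simp add: b_def powr_mult powr_divide)
  qed
  finally have 1: "T powr (1 - p) * (d * y) \<le> b powr (p - 1) * a" .
  have "p * (a * (\<kappa> * b) powr (p - 1)) \<le> a powr p + (p - 1) * (\<kappa> * b) powr p"
    by (rule young_powr) (use p nn \<kappa> b in auto)
  hence 2: "l * (p * (b powr (p - 1) * a)) \<le> a powr p + (p - 1) * (\<kappa> * l * b powr p)"
    using \<kappa> b by (simp add: powr_mult c l_def[symmetric] mult_ac)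
  have "l * (T powr (1 - p) * ((p * d) * y)) = l * p * (T powr (1 - p) * (d * y))" by simp
  also have "\<dots> \<le> l * p * (b powr (p - 1) * a)" using 1 p by (intro mult_left_mono) (auto simp: l_def)
  finally have 3: "l * (T powr (1 - p) * ((p * d) * y)) \<le> a powr p + (p - 1) * (\<kappa> * l * b powr p)" using 2 by simp
  have "p * \<kappa> = p - 1" using p by (simp add: \<kappa>_def)
  hence "p * \<kappa> * l * b powr p = (p - 1) * l * b powr p" by simp
  hence "l * ((1 - p) * b powr p) = - (p * \<kappa> * l * b powr p)" by (simp add: algebra_simps)
  with 3 show ?thesis
    unfolding \<kappa>_def[symmetric] l_def[symmetric] bp bp' c by (simp add: algebra_simps)
qed

lemma powr_add_convex:
  fixes x y p s :: real
  assumes p: "1 \<le> p" and xy: "0 \<le> x" "0 \<le> y" and s: "0 < s" "s < 1"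
  shows "(x + y) powr p \<le> (1 - s) powr (1 - p) * x powr p + s powr (1 - p) * y powr p"
proof -
  let ?z = "x + y"
  have A: "p * (v * ?z powr (p - 1)) \<le> r powr (1 - p) * v powr p + r * ((p - 1) * ?z powr p)" if "0 \<le> v" "0 < r" for v r
    using young_powr_eps[OF p that(1) _ that(2), of ?z] xy by (simp add: mult_ac)
  have "p * ?z powr p = p * (x * ?z powr (p - 1)) + p * (y * ?z powr (p - 1))"
  proof (cases "?z = 0")
    case False
    hence "?z powr p = ?z * ?z powr (p - 1)" using xy by (simp add: powr_diff)
    thus ?thesis by (simp add: algebra_simps)
  qed simp
  with A[OF xy(1), of "1 - s"] A[OF xy(2), of s] s
  show ?thesis by (simp add: algebra_simps)
qed

lemma fatou_AE:
  fixes F :: "nat \<Rightarrow> 'a \<Rightarrow> ennreal"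
  assumes [measurable]: "\<And>n. F n \<in> borel_measurable M" and lim: "AE x in M. (\<lambda>n. F n x) \<longlonglongrightarrow> F' x"
    and le: "\<And>n. (\<integral>\<^sup>+x. F n x \<partial>M) \<le> B n" and B: "B \<longlonglongrightarrow> b"
  shows "(\<integral>\<^sup>+x. F' x \<partial>M) \<le> b"
proof -
  have "(\<integral>\<^sup>+x. F' x \<partial>M) = (\<integral>\<^sup>+x. liminf (\<lambda>n. F n x) \<partial>M)"
    by (rule nn_integral_cong_AE) (use lim in \<open>auto elim!: eventually_mono dest: lim_imp_Liminf[OF sequentially_bot]\<close>)
  also have "\<dots> \<le> liminf (\<lambda>n. \<integral>\<^sup>+x. F n x \<partial>M)" by (rule nn_integral_liminf) measurable
  also have "\<dots> \<le> liminf B" by (rule Liminf_mono) (use le in auto)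
  also have "\<dots> = b" by (rule lim_imp_Liminf[OF sequentially_bot B])
  finally show ?thesis .
qed

section \<open>The Hardy inequality\<close>

context p_equation
begin

text \<open>The two constants of the theorem.\<close>

abbreviation "hardy_const \<equiv> ((p - 1) / p) powr p"
abbreviation "weight_const \<equiv> ((p - 1) / p) powr (p - 1)"

lemma compact_support_equation:
  assumes wV: "has_weak_gradient \<Omega> v V" and K: "compact K" "K \<subseteq> \<Omega>"
    and off: "\<And>x. x \<notin> K \<Longrightarrow> v x = 0" "\<And>x. x \<notin> K \<Longrightarrow> V x = 0"
    and L: "v \<in> Lp p K" "V \<in> Lp p K"
  shows "W_approximable p \<Omega> v V"
    "integrable (lebesgue_on \<Omega>) (\<lambda>x. flux p G x (V x))" "integrable (lebesgue_on \<Omega>) (\<lambda>x. f x * v x)"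
    "(LINT x|lebesgue_on \<Omega>. flux p G x (V x)) = (LINT x|lebesgue_on \<Omega>. f x * v x)"
proof -
  let ?M = "lebesgue_on \<Omega>"
  have vm[measurable]: "v \<in> borel_measurable ?M" and Vm[measurable]: "V \<in> borel_measurable ?M"
    using has_weak_gradient_measurable[OF open_\<Omega> wV] by auto
  obtain S' where S': "compact S'" "S' \<subseteq> \<Omega>" and appr: "\<And>e. e > 0 \<Longrightarrow> \<exists>\<phi>\<in>test_functions \<Omega>. (\<forall>x. x \<notin> S' \<longrightarrow> \<phi> x = 0) \<and>
     (\<integral>\<^sup>+x. ennreal (\<bar>v x - \<phi> x\<bar> powr p) \<partial>?M) < ennreal e \<and>
     (\<integral>\<^sup>+x. ennreal (norm (V x - grad \<phi> x) powr p) \<partial>?M) < ennreal e"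
    by (rule compact_support_approximation[OF open_\<Omega> wV K(1,2) off less_imp_le[OF p] L]) (assumption | rule that)+
  show "W_approximable p \<Omega> v V" unfolding W_approximable_def using appr by blast
  define S where "S = K \<union> S'"
  have S: "compact S" "S \<subseteq> \<Omega>" "S \<in> sets lebesgue" using K(1,2) S' by (auto simp: S_def compact_imp_lebesgue compact_Un)
  have approx: "\<exists>\<phi>\<in>test_functions \<Omega>. (\<forall>x. x \<notin> S \<longrightarrow> grad \<phi> x = 0) \<and>
     (\<integral>\<^sup>+x. ennreal (\<bar>v x - \<phi> x\<bar> powr p) \<partial>?M) < ennreal e \<and>
     (\<integral>\<^sup>+x. ennreal (norm (V x - grad \<phi> x) powr p) \<partial>?M) < ennreal e" if "e > 0" for e
  proof -
    from appr[OF that] obtain \<psi> where \<psi>: "\<psi> \<in> test_functions \<Omega>" "\<forall>x. x \<notin> S' \<longrightarrow> \<psi> x = 0"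
     "(\<integral>\<^sup>+x. ennreal (\<bar>v x - \<psi> x\<bar> powr p) \<partial>?M) < ennreal e"
     "(\<integral>\<^sup>+x. ennreal (norm (V x - grad \<psi> x) powr p) \<partial>?M) < ennreal e" by blast
    have "grad \<psi> x = 0" if "x \<notin> S" for x
      using \<psi>(2) that by (intro grad_zero_off[OF compact_imp_closed[OF S'(1)]]) (auto simp: S_def)
    with \<psi> show ?thesis by blast
  qed
  have VS: "V x = 0" if "x \<in> \<Omega>" "x \<notin> S" for x using that off(2)[of x] by (simp add: S_def)
  note eqn = limit_equation[OF S(3,2) EG_Lp(2)[OF S(1,2)] vm Vm VS approx]
  show "integrable ?M (\<lambda>x. flux p G x (V x))" by (rule eqn(1)) auto
  show "integrable ?M (\<lambda>x. f x * v x)" by (rule eqn(2)) auto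
  show "(LINT x|?M. flux p G x (V x)) = (LINT x|?M. f x * v x)" by (rule eqn(3)) auto
qed

text \<open>The equation is tested with \<open>|\<phi>|\<^sup>p (E + \<epsilon>)\<^sup>1\<^sup>-\<^sup>p\<close>, which is admissible although no positive lower bound for \<open>E\<close> is known.\<close>

lemma hardy_test_function:
  assumes \<phi>: "\<phi> \<in> test_functions \<Omega>" and \<epsilon>: "0 < \<epsilon>"
  shows "(\<integral>\<^sup>+x. ennreal (weight_const * (f x * (\<bar>\<phi> x\<bar> powr p * (E x + \<epsilon>) powr (1 - p))) + hardy_const * (\<bar>\<phi> x\<bar> powr p * (N x / (E x + \<epsilon>)) powr p)) \<partial>lebesgue_on \<Omega>)
    \<le> (\<integral>\<^sup>+x. ennreal (A_norm A x (grad \<phi> x) powr p) \<partial>lebesgue_on \<Omega>)"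
proof -
  let ?M = "lebesgue_on \<Omega>"
  obtain K where K: "compact K" "K \<subseteq> \<Omega>" "\<And>x. x \<notin> K \<Longrightarrow> \<phi> x = 0" "C1 \<phi>"
    using \<phi> by (rule test_functionE) (rule that)
  note Kl = compact_imp_lebesgue[OF K(1)]
  define g where "g x = \<bar>\<phi> x\<bar> powr p" for x
  define h where "h t = (t + \<epsilon>) powr (1 - p)" for t
  define h' where "h' t = (1 - p) * (t + \<epsilon>) powr (- p)" for t
  define L where "L = (p - 1) * \<epsilon> powr (- p)"
  have g: "C1 g" "\<And>x. grad g x = (p * spow (p - 1) (\<phi> x)) *\<^sub>R grad \<phi> x"
    unfolding g_def using C1_abs_powr[OF p K(4)] by auto
  have h: "(h has_real_derivative h' t) (at t)" if "0 \<le> t" for t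
  proof -
    have "((\<lambda>t. (t + \<epsilon>) powr (1 - p)) has_real_derivative ((1 - p) * (t + \<epsilon>) powr (1 - p - 1)) * 1) (at t)"
      by (rule DERIV_chain2[OF has_real_derivative_powr]) (use that \<epsilon> in \<open>auto intro!: derivative_eq_intros\<close>)
    thus ?thesis by (simp add: h_def[abs_def] h'_def)
  qed
  have h'b: "\<bar>h' t\<bar> \<le> L" if "0 \<le> t" for t
    unfolding h'_def L_def abs_mult using that \<epsilon> p by (intro mult_mono) (auto intro!: powr_mono2')
  have hb: "\<bar>h t\<bar> \<le> \<epsilon> powr (1 - p)" if "0 \<le> t" for t
    unfolding h_def using that \<epsilon> p by (auto intro!: powr_mono2')
  have h'c: "continuous_on {0..} h'"
    unfolding h'_def using \<epsilon> by (intro continuous_intros) auto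
  have hm: "h \<in> borel_measurable borel" "h' \<in> borel_measurable borel"
    unfolding h_def h'_def by measurable
  define v where "v x = g x * h (E x)" for x
  define V where "V x = h (E x) *\<^sub>R grad g x + (g x * h' (E x)) *\<^sub>R G x" for x
  have wV: "has_weak_gradient \<Omega> v V"
    unfolding v_def[abs_def] V_def[abs_def]
    by (rule chain_product_weak_gradient[OF open_\<Omega> G_weak E_nonneg g(1) h h'b h'c hm])
  have g0: "g x = 0" "grad g x = 0" if "x \<notin> K" for x
    using K(3)[OF that] p g(2)[of x] grad_zero_off[OF compact_imp_closed[OF K(1)] K(3) that] by (auto simp: g_def)
  have off: "v x = 0" "V x = 0" if "x \<notin> K" for x using g0[OF that] by (auto simp: v_def V_def)
  have vm[measurable]: "v \<in> borel_measurable ?M" and Vm[measurable]: "V \<in> borel_measurable ?M"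
    using has_weak_gradient_measurable[OF open_\<Omega> wV] by auto
  have vmK: "v \<in> borel_measurable (lebesgue_on K)" and VmK: "V \<in> borel_measurable (lebesgue_on K)"
    using has_weak_gradient_integrable[OF wV K(1,2)] by auto
  have EK: "AE x in lebesgue_on K. 0 \<le> E x"
    using E_nonneg K(2) by (auto simp: AE_restrict_space_iff Kl domain_lebesgue elim!: eventually_mono)
  obtain B1 where B1: "B1 \<ge> 0" "\<And>x. x \<in> K \<Longrightarrow> norm (g x) \<le> B1"
    using continuous_bounded_on_compact[OF K(1) C1_continuous[OF g(1)]] by blast
  obtain B2 where B2: "B2 \<ge> 0" "\<And>x. x \<in> K \<Longrightarrow> norm (grad g x) \<le> B2"
    using continuous_bounded_on_compact[OF K(1) C1_continuous_grad[OF g(1)]] by blast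
  have ci: "integrable (lebesgue_on K) (\<lambda>x. c::real)" for c by (rule integrable_lebesgue_on_compact[OF K(1)]) auto
  have vL: "v \<in> Lp p K"
  proof -
    have "integrable (lebesgue_on K) (\<lambda>x. norm (v x) powr p)"
    proof (rule Bochner_Integration.integrable_bound[OF ci[of "(B1 * \<epsilon> powr (1 - p)) powr p"]])
      show "AE x in lebesgue_on K. norm (norm (v x) powr p) \<le> norm ((B1 * \<epsilon> powr (1 - p)) powr p)"
        using EK AE_space
      proof eventually_elim
        case (elim x)
        hence "norm (v x) \<le> B1 * \<epsilon> powr (1 - p)"
          unfolding v_def norm_mult using B1 hb[of "E x"] by (intro mult_mono) auto
        thus ?case using p by (auto intro!: powr_mono2)
      qed
    qed (use vmK in measurable)
    with vmK show ?thesis by (simp add: Lp_def)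
  qed
  have VL: "V \<in> Lp p K"
  proof -
    have GK: "integrable (lebesgue_on K) (\<lambda>x. norm (G x) powr p)" using EG_Lp(2)[OF K(1,2)] by (simp add: Lp_def)
    let ?b = "\<lambda>x. 2 powr p * ((\<epsilon> powr (1 - p) * B2) powr p + (B1 * L) powr p * norm (G x) powr p)"
    have L0: "0 \<le> L" using p by (simp add: L_def)
    have "integrable (lebesgue_on K) (\<lambda>x. norm (V x) powr p)"
    proof (rule Bochner_Integration.integrable_bound[of _ ?b])
      show "integrable (lebesgue_on K) ?b"
        by (intro integrable_mult_right Bochner_Integration.integrable_add ci GK)
      show "AE x in lebesgue_on K. norm (norm (V x) powr p) \<le> norm (?b x)"
        using EK AE_space
      proof eventually_elim
        case (elim x)
        have "norm (V x) powr p \<le> 2 powr p * (norm (h (E x) *\<^sub>R grad g x) powr p + norm ((g x * h' (E x)) *\<^sub>R G x) powr p)"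
          unfolding V_def using p by (intro powr_add_le) auto
        also have "\<dots> \<le> 2 powr p * ((\<epsilon> powr (1 - p) * B2) powr p + (B1 * L * norm (G x)) powr p)"
          using elim B1 B2 hb[of "E x"] h'b[of "E x"] p L0
          by (intro mult_left_mono add_mono powr_mono2) (auto simp: abs_mult intro!: mult_mono)
        also have "\<dots> = ?b x" using B1 L0 by (simp add: powr_mult)
        finally show ?case by simp
      qed
    qed (use VmK in measurable)
    with VmK show ?thesis by (simp add: Lp_def)
  qed
  have i1: "integrable ?M (\<lambda>x. flux p G x (V x))" and i2: "integrable ?M (\<lambda>x. f x * v x)"
    and eq: "(LINT x|?M. flux p G x (V x)) = (LINT x|?M. f x * v x)"
    using compact_support_equation[OF wV K(1,2) off vL VL] by auto
  define a where "a x = A_norm A x (grad \<phi> x)" for x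
  define b where "b x = hardy_const * (\<bar>\<phi> x\<bar> powr p * (N x / (E x + \<epsilon>)) powr p)" for x
  have [measurable]: "grad \<phi> \<in> borel_measurable ?M" "\<phi> \<in> borel_measurable ?M"
    using K(4) by (auto intro!: borel_imp_lebesgue_on C1_grad_measurable C1_measurable)
  have [measurable]: "a \<in> borel_measurable ?M" unfolding a_def by (rule A_norm_measurable[OF domain_lebesgue]) auto
  have [measurable]: "b \<in> borel_measurable ?M" unfolding b_def by measurable
  \<comment> \<open>The pointwise inequality also shows that \<open>b\<close> is integrable, as \<open>b \<ge> 0\<close>.\<close>
  have pt: "AE x in ?M. weight_const * flux p G x (V x) + b x \<le> a x powr p"
    using E_nonneg AE_space
  proof eventually_elim
    case (elim x)
    hence x: "x \<in> \<Omega>" by simp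
    have fl: "flux p G x (V x) = (E x + \<epsilon>) powr (1 - p) * ((p * spow (p - 1) (\<phi> x)) * flux p G x (grad \<phi> x))
       + \<bar>\<phi> x\<bar> powr p * ((1 - p) * (E x + \<epsilon>) powr (- p)) * N x powr p"
      unfolding V_def flux_add flux_scaleR g(2) flux_self[OF x] by (simp add: h_def h'_def g_def)
    show ?case unfolding fl b_def a_def
      using elim \<epsilon> A_norm_nonneg[OF x] flux_le[OF x, of p G "grad \<phi> x"]
      by (intro hardy_pointwise p) (auto simp: abs_spow)
  qed
  have b0: "0 \<le> b x" for x by (simp add: b_def)
  have iap: "integrable ?M (\<lambda>x. a x powr p)"
  proof -
    obtain C where C: "C > 0" "\<And>x \<xi>. x \<in> \<Omega> \<Longrightarrow> A_norm A x \<xi> \<le> C * norm \<xi>" using A_norm_bounded by blast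
    have "integrable ?M (\<lambda>x. C powr p * norm (grad \<phi> x) powr p)"
      using test_function_Lp(2)[OF open_\<Omega> _ \<phi>, of p] p by (simp add: Lp_def)
    thus ?thesis
    proof (rule Bochner_Integration.integrable_bound)
      show "AE x in ?M. norm (a x powr p) \<le> norm (C powr p * norm (grad \<phi> x) powr p)"
      proof (rule AE_I2)
        fix x assume "x \<in> space ?M"
        hence x: "x \<in> \<Omega>" by simp
        have "a x powr p \<le> (C * norm (grad \<phi> x)) powr p"
          unfolding a_def using C(2)[OF x] A_norm_nonneg[OF x] p by (intro powr_mono2) auto
        thus "norm (a x powr p) \<le> norm (C powr p * norm (grad \<phi> x) powr p)" using C(1) by (simp add: powr_mult)
      qed
    qed measurable
  qed
  have ib: "integrable ?M b"
  proof (rule Bochner_Integration.integrable_bound[of _ "\<lambda>x. a x powr p - weight_const * flux p G x (V x)"])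
    show "integrable ?M (\<lambda>x. a x powr p - weight_const * flux p G x (V x))" using iap i1 by simp
    show "AE x in ?M. norm (b x) \<le> norm (a x powr p - weight_const * flux p G x (V x))"
      using pt by eventually_elim (use b0 in auto)
  qed measurable
  have v0: "AE x in ?M. 0 \<le> f x * v x"
    using AE_space by eventually_elim (use f_nonneg in \<open>auto simp: v_def g_def h_def\<close>)
  have "(\<integral>\<^sup>+x. ennreal (weight_const * (f x * v x) + b x) \<partial>?M) = ennreal (LINT x|?M. weight_const * (f x * v x) + b x)"
    by (rule nn_integral_eq_integral) (use i2 ib v0 b0 in \<open>auto elim: eventually_mono\<close>)
  also have "(LINT x|?M. weight_const * (f x * v x) + b x) = (LINT x|?M. weight_const * flux p G x (V x) + b x)"
    using i1 i2 ib eq by simp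
  also have "ennreal \<dots> \<le> ennreal (LINT x|?M. a x powr p)"
    by (intro ennreal_leI integral_mono_AE) (use i1 ib iap pt in auto)
  also have "\<dots> = (\<integral>\<^sup>+x. ennreal (a x powr p) \<partial>?M)"
    by (rule nn_integral_eq_integral[symmetric]) (use iap in auto)
  finally show ?thesis unfolding a_def b_def v_def g_def h_def .
qed

text \<open>Passage to the limit by Fatou's lemma, simultaneously in \<open>\<epsilon> \<rightarrow> 0\<close> and in the test functions converging to \<open>u\<close>.\<close>

theorem hardy_inequality:
  assumes u: "u \<in> W01p p \<Omega>"
  shows "(\<integral>\<^sup>+x. ennreal (weight_const * (f x * (\<bar>u x\<bar> powr p / E x powr (p - 1))) + hardy_const * (N x powr p / E x powr p * \<bar>u x\<bar> powr p)) \<partial>lebesgue_on \<Omega>)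
    \<le> (\<integral>\<^sup>+x. ennreal (A_norm A x (weak_grad \<Omega> u x) powr p) \<partial>lebesgue_on \<Omega>)"
proof -
  let ?M = "lebesgue_on \<Omega>"
  let ?U = "weak_grad \<Omega> u"
  have p0: "0 < p" using p by simp
  have Um[measurable]: "u \<in> borel_measurable ?M" "?U \<in> borel_measurable ?M"
    using has_weak_gradient_measurable[OF open_\<Omega> W01p_weak_gradient[OF u]] by auto
  obtain \<phi>0 where \<phi>0: "\<And>n. \<phi>0 n \<in> test_functions \<Omega>"
    "\<And>n. (\<integral>\<^sup>+x. ennreal (\<bar>u x - \<phi>0 n x\<bar> powr p) \<partial>?M) < ennreal (1 / real (Suc n))"
    "\<And>n. (\<integral>\<^sup>+x. ennreal (norm (?U x - grad (\<phi>0 n) x) powr p) \<partial>?M) < ennreal (1 / real (Suc n))"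
    by (rule W_approximable_sequence[OF W01p_approximable[OF open_\<Omega> p0 u]]) (rule that)
  have \<phi>0m: "\<phi>0 n \<in> borel_measurable ?M" "grad (\<phi>0 n) \<in> borel_measurable ?M" for n
    by (intro borel_imp_lebesgue_on C1_measurable C1_grad_measurable smooth_imp_C1 test_function_smooth[OF \<phi>0(1)])+
  obtain r :: "nat \<Rightarrow> nat" where r: "strict_mono r" "AE x in ?M. (\<lambda>n. u x - \<phi>0 (r n) x) \<longlonglongrightarrow> 0"
    "\<And>n. (\<integral>\<^sup>+x. ennreal (norm (u x - \<phi>0 (r n) x) powr p) \<partial>?M) < ennreal (1 / real (Suc n))"
    by (rule AE_subseq_of_Lp[of "\<lambda>n x. u x - \<phi>0 n x" ?M p]) (use \<phi>0m \<phi>0(2) p0 in auto)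
  define \<phi> where "\<phi> n = \<phi>0 (r n)" for n
  have \<phi>t: "\<phi> n \<in> test_functions \<Omega>" for n using \<phi>0(1) by (simp add: \<phi>_def)
  have [measurable]: "\<phi> n \<in> borel_measurable ?M" "grad (\<phi> n) \<in> borel_measurable ?M" for n
    using \<phi>0m by (auto simp: \<phi>_def)
  have \<phi>g: "(\<integral>\<^sup>+x. ennreal (norm (?U x - grad (\<phi> n) x) powr p) \<partial>?M) \<le> ennreal (1 / real (Suc n))" for n
  proof -
    have "ennreal (1 / real (Suc (r n))) \<le> ennreal (1 / real (Suc n))"
      using seq_suble[OF r(1), of n] by (intro ennreal_leI) (simp add: frac_le)
    thus ?thesis using less_imp_le[OF \<phi>0(3)[of "r n"]] unfolding \<phi>_def by (rule order_trans[rotated])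
  qed
  have lim: "AE x in ?M. 0 < E x \<and> x \<in> \<Omega> \<and> (\<lambda>n. \<phi> n x) \<longlonglongrightarrow> u x"
    using r(2) E_pos AE_space
  proof eventually_elim
    case (elim x)
    have "(\<lambda>n. u x - (u x - \<phi>0 (r n) x)) \<longlonglongrightarrow> u x - 0" by (intro tendsto_intros elim)
    thus ?case using elim by (simp add: \<phi>_def)
  qed
  obtain C where C: "C > 0" "\<And>x \<xi>. x \<in> \<Omega> \<Longrightarrow> A_norm A x \<xi> \<le> C * norm \<xi>" using A_norm_bounded by blast
  define R where "R = (\<integral>\<^sup>+x. ennreal (A_norm A x (?U x) powr p) \<partial>?M)"
  define e where "e n = 1 / real (Suc n)" for n
  have e0: "e \<longlonglongrightarrow> 0" unfolding e_def using LIMSEQ_inverse_real_of_nat by (simp add: inverse_eq_divide)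
  have ep: "e n > 0" for n by (simp add: e_def)
  define F where "F n x = ennreal (weight_const * (f x * (\<bar>\<phi> n x\<bar> powr p * (E x + e n) powr (1 - p))) + hardy_const * (\<bar>\<phi> n x\<bar> powr p * (N x / (E x + e n)) powr p))" for n x
  define F' where "F' x = ennreal (weight_const * (f x * (\<bar>u x\<bar> powr p / E x powr (p - 1))) + hardy_const * (N x powr p / E x powr p * \<bar>u x\<bar> powr p))" for x
  have Fm: "F n \<in> borel_measurable ?M" for n unfolding F_def by measurable
  have Flim: "AE x in ?M. (\<lambda>n. F n x) \<longlonglongrightarrow> F' x"
    using lim
  proof eventually_elim
    case (elim x)
    have Nx: "N x \<ge> 0" using elim by (auto intro: A_norm_nonneg)
    have "(\<lambda>n. weight_const * (f x * (\<bar>\<phi> n x\<bar> powr p * (E x + e n) powr (1 - p))) + hardy_const * (\<bar>\<phi> n x\<bar> powr p * (N x / (E x + e n)) powr p))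
      \<longlonglongrightarrow> weight_const * (f x * (\<bar>u x\<bar> powr p * (E x + 0) powr (1 - p))) + hardy_const * (\<bar>u x\<bar> powr p * (N x / (E x + 0)) powr p)"
      using elim p Nx ep less_imp_le[OF ep]
      by (intro tendsto_intros tendsto_powr' e0) (auto intro!: always_eventually divide_nonneg_pos add_pos_pos)
    moreover have "\<bar>u x\<bar> powr p * E x powr (1 - p) = \<bar>u x\<bar> powr p / E x powr (p - 1)"
      using powr_minus_divide[of "E x" "p - 1"] by simp
    moreover have "(N x / E x) powr p = N x powr p / E x powr p" using Nx elim by (simp add: powr_divide)
    ultimately show ?case unfolding F_def F'_def by (intro tendsto_ennrealI) (simp add: mult_ac)
  qed
  \<comment> \<open>The energies of the test functions are compared with that of \<open>u\<close> by convexity, with a factor that tends to \<open>1\<close> as \<open>s \<rightarrow> 0\<close>.\<close>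
  have main: "(\<integral>\<^sup>+x. F' x \<partial>?M) \<le> ennreal ((1 - s) powr (1 - p)) * R" if s: "0 < s" "s < 1" for s
  proof (rule fatou_AE[OF Fm Flim])
    define Q where "Q = s powr (1 - p) * C powr p"
    show "(\<integral>\<^sup>+x. F n x \<partial>?M) \<le> ennreal ((1 - s) powr (1 - p)) * R + ennreal Q * ennreal (1 / real (Suc n))" for n
    proof -
      have [measurable]: "(\<lambda>x. A_norm A x (?U x)) \<in> borel_measurable ?M" by (rule A_norm_measurable[OF domain_lebesgue]) auto
      have "(\<integral>\<^sup>+x. F n x \<partial>?M) \<le> (\<integral>\<^sup>+x. ennreal (A_norm A x (grad (\<phi> n) x) powr p) \<partial>?M)"
        unfolding F_def by (rule hardy_test_function[OF \<phi>t ep])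
      also have "\<dots> \<le> (\<integral>\<^sup>+x. ennreal ((1 - s) powr (1 - p)) * ennreal (A_norm A x (?U x) powr p) + ennreal Q * ennreal (norm (?U x - grad (\<phi> n) x) powr p) \<partial>?M)"
      proof (rule nn_integral_mono)
        fix x assume "x \<in> space ?M"
        hence x: "x \<in> \<Omega>" by simp
        let ?d = "grad (\<phi> n) x - ?U x"
        have "A_norm A x (?U x + ?d) powr p \<le> (A_norm A x (?U x) + A_norm A x ?d) powr p"
          using p A_norm_nonneg[OF x] A_norm_triangle[OF x, of "?U x" ?d] by (intro powr_mono2) auto
        also have "\<dots> \<le> (1 - s) powr (1 - p) * A_norm A x (?U x) powr p + s powr (1 - p) * A_norm A x ?d powr p"
          using p s by (intro powr_add_convex A_norm_nonneg[OF x]) auto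
        also have "\<dots> \<le> (1 - s) powr (1 - p) * A_norm A x (?U x) powr p + s powr (1 - p) * (C * norm ?d) powr p"
          using p C(2)[OF x] A_norm_nonneg[OF x] by (intro add_left_mono mult_left_mono powr_mono2) auto
        also have "\<dots> = (1 - s) powr (1 - p) * A_norm A x (?U x) powr p + Q * norm (?U x - grad (\<phi> n) x) powr p"
          using C(1) by (simp add: Q_def powr_mult norm_minus_commute)
        finally have "ennreal (A_norm A x (grad (\<phi> n) x) powr p) \<le> ennreal ((1 - s) powr (1 - p) * A_norm A x (?U x) powr p + Q * norm (?U x - grad (\<phi> n) x) powr p)"
          by (intro ennreal_leI) simp
        also have "\<dots> = ennreal ((1 - s) powr (1 - p)) * ennreal (A_norm A x (?U x) powr p) + ennreal Q * ennreal (norm (?U x - grad (\<phi> n) x) powr p)"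
          by (simp add: Q_def ennreal_mult')
        finally show "ennreal (A_norm A x (grad (\<phi> n) x) powr p) \<le> \<dots>" .
      qed
      also have "\<dots> = ennreal ((1 - s) powr (1 - p)) * R + ennreal Q * (\<integral>\<^sup>+x. ennreal (norm (?U x - grad (\<phi> n) x) powr p) \<partial>?M)"
        unfolding R_def by (simp add: nn_integral_add nn_integral_cmult)
      also have "\<dots> \<le> ennreal ((1 - s) powr (1 - p)) * R + ennreal Q * ennreal (1 / real (Suc n))"
        by (intro add_left_mono mult_left_mono \<phi>g) auto
      finally show ?thesis .
    qed
    show "(\<lambda>n. ennreal ((1 - s) powr (1 - p)) * R + ennreal Q * ennreal (1 / real (Suc n))) \<longlonglongrightarrow> ennreal ((1 - s) powr (1 - p)) * R"
      using tendsto_add[OF tendsto_const tendsto_inverse_Suc_ennreal, of "ennreal ((1 - s) powr (1 - p)) * R" Q] by simp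
  qed
  have "(\<lambda>n. ennreal ((1 - 1 / real (Suc (Suc n))) powr (1 - p)) * R) \<longlonglongrightarrow> ennreal 1 * R"
  proof (cases "R = top")
    case True
    have "ennreal ((1 - 1 / real (Suc (Suc n))) powr (1 - p)) * R = top" for n
      using True by (simp add: ennreal_mult_top)
    thus ?thesis using True by simp
  next
    case False
    have "(\<lambda>n. (1 - 1 / real (Suc (Suc n))) powr (1 - p)) \<longlonglongrightarrow> (1 - 0) powr (1 - p)"
    proof (intro tendsto_powr tendsto_diff tendsto_const)
      show "(\<lambda>n. 1 / real (Suc (Suc n))) \<longlonglongrightarrow> 0" using LIMSEQ_Suc[OF e0] by (simp add: e_def)
    qed auto
    hence "(\<lambda>n. ennreal ((1 - 1 / real (Suc (Suc n))) powr (1 - p))) \<longlonglongrightarrow> ennreal 1"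
      by (intro tendsto_ennrealI) simp
    from ennreal_tendsto_cmult[OF _ this, of R] show ?thesis
      using False by (simp add: top.not_eq_extremum mult.commute)
  qed
  hence "(\<integral>\<^sup>+x. F' x \<partial>?M) \<le> ennreal 1 * R"
    by (rule LIMSEQ_le_const) (use main in \<open>auto intro!: exI[of _ 0]\<close>)
  thus ?thesis by (simp add: F'_def R_def)
qed

end

section \<open>Functions of a solution that vanishes on the boundary\<close>

context p_equation
begin

text \<open>Chain rule for a function of the solution.\<close>

lemma solution_compose_weak_gradient:
  assumes h: "\<And>t. (h has_real_derivative h' t) (at t)" "\<And>t. \<bar>h' t\<bar> \<le> L" "continuous_on UNIV h'"
  shows "has_weak_gradient \<Omega> (\<lambda>x. h (E x)) (\<lambda>x. h' (E x) *\<^sub>R G x)"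
proof -
  have "continuous_on UNIV h" using h(1) by (intro DERIV_continuous_on) (auto intro: has_field_derivative_at_within)
  hence hm: "h \<in> borel_measurable borel" "h' \<in> borel_measurable borel"
    using h(3) by (auto intro: borel_measurable_continuous_onI)
  have g1: "grad (\<lambda>x::real^'n. 1) x = 0" for x by (rule grad_eqI) auto
  have "has_weak_gradient \<Omega> (\<lambda>x. 1 * h (E x)) (\<lambda>x. h (E x) *\<^sub>R grad (\<lambda>x. 1) x + (1 * h' (E x)) *\<^sub>R G x)"
    by (rule chain_product_weak_gradient[OF open_\<Omega> G_weak E_nonneg C1_const h(1,2) continuous_on_subset[OF h(3)] hm]) auto
  thus ?thesis by (simp add: g1)
qed

text \<open>Every frontier point has a ball on which \<open>|E| < \<epsilon>\<close> holds inside \<open>\<Omega>\<close>; removing these balls from the closure of \<open>\<Omega>\<close>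
  leaves a compact subset of \<open>\<Omega>\<close>.\<close>

lemma compact_superlevel:
  assumes lim: "\<forall>z\<in>frontier \<Omega>. (E \<longlongrightarrow> 0) (at z within \<Omega>)" and \<epsilon>: "0 < \<epsilon>"
  obtains K where "compact K" "K \<subseteq> \<Omega>" "\<And>x. x \<in> \<Omega> \<Longrightarrow> x \<notin> K \<Longrightarrow> \<bar>E x\<bar> < \<epsilon>"
proof -
  have "\<exists>d>0. \<forall>x\<in>\<Omega>. x \<noteq> z \<and> dist x z < d \<longrightarrow> \<bar>E x\<bar> < \<epsilon>" if "z \<in> frontier \<Omega>" for z
    using lim that \<epsilon> by (auto simp: tendsto_iff eventually_at dist_real_def)
  then obtain d where d: "\<And>z. z \<in> frontier \<Omega> \<Longrightarrow> 0 < d z"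
    "\<And>z x. z \<in> frontier \<Omega> \<Longrightarrow> x \<in> \<Omega> \<Longrightarrow> x \<noteq> z \<Longrightarrow> dist x z < d z \<Longrightarrow> \<bar>E x\<bar> < \<epsilon>" by metis
  define U where "U = (\<Union>z\<in>frontier \<Omega>. ball z (d z))"
  have "open U" by (auto simp: U_def)
  show ?thesis
  proof (rule that[of "closure \<Omega> - U"])
    show "compact (closure \<Omega> - U)" using bounded_\<Omega> \<open>open U\<close> by (intro compact_diff) auto
    show "closure \<Omega> - U \<subseteq> \<Omega>"
    proof
      fix x assume x: "x \<in> closure \<Omega> - U"
      have "x \<notin> frontier \<Omega>" using x d(1)[of x] by (force simp: U_def)
      with x show "x \<in> \<Omega>" using open_\<Omega> by (auto simp: frontier_def interior_open)
    qed
    fix x assume x: "x \<in> \<Omega>" "x \<notin> closure \<Omega> - U"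
    then obtain z where z: "z \<in> frontier \<Omega>" "dist z x < d z" using closure_subset by (auto simp: U_def)
    have "x \<noteq> z" using z(1) x(1) open_\<Omega> by (auto simp: frontier_def interior_open)
    thus "\<bar>E x\<bar> < \<epsilon>" using d(2)[OF z(1) x(1)] z(2) by (simp add: dist_commute)
  qed
qed

lemma E_Lp:
  assumes "zero_on_boundary p \<Omega> E" shows "E \<in> Lp p \<Omega>"
  using assms unfolding zero_on_boundary_def
proof
  assume "E \<in> W01p p \<Omega>" thus ?thesis by (rule W01p_Lp)
next
  assume lim: "\<forall>z\<in>frontier \<Omega>. (E \<longlongrightarrow> 0) (at z within \<Omega>)"
  obtain K where K: "compact K" "K \<subseteq> \<Omega>" "\<And>x. x \<in> \<Omega> \<Longrightarrow> x \<notin> K \<Longrightarrow> \<bar>E x\<bar> < 1"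
    by (rule compact_superlevel[OF lim zero_less_one]) (rule that)
  let ?e = "\<lambda>x. if x \<in> K then \<bar>E x\<bar> powr p else 0"
  have "integrable (lebesgue_on K) (\<lambda>x. \<bar>E x\<bar> powr p)" using EG_Lp(1)[OF K(1,2)] by (simp add: Lp_def)
  hence "integrable (lebesgue_on K) ?e" by (rule Bochner_Integration.integrable_cong[THEN iffD1, rotated -1]) auto
  hence "integrable (lebesgue_on \<Omega>) ?e"
    using lebesgue_on_supported(2)[OF domain_lebesgue compact_imp_lebesgue[OF K(1)] K(2), of ?e] by simp
  hence i: "integrable (lebesgue_on \<Omega>) (\<lambda>x. 1 + ?e x)" using integrable_const_\<Omega> by simp
  have "integrable (lebesgue_on \<Omega>) (\<lambda>x. \<bar>E x\<bar> powr p)"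
  proof (rule Bochner_Integration.integrable_bound[OF i])
    have bd: "\<bar>E x\<bar> powr p \<le> 1 + ?e x" if "x \<in> \<Omega>" for x
      using K(3)[OF that] p powr_mono2[of p "\<bar>E x\<bar>" 1] by auto
    have "norm (\<bar>E x\<bar> powr p) \<le> norm (1 + ?e x)" if "x \<in> \<Omega>" for x
    proof -
      have "norm (\<bar>E x\<bar> powr p) = \<bar>E x\<bar> powr p" by simp
      also have "\<dots> \<le> 1 + ?e x" by (rule bd[OF that])
      also have "\<dots> \<le> norm (1 + ?e x)" unfolding real_norm_def by (rule abs_ge_self)
      finally show ?thesis .
    qed
    thus "AE x in lebesgue_on \<Omega>. norm (\<bar>E x\<bar> powr p) \<le> norm (1 + ?e x)" by (intro AE_I2) simp
  qed measurable
  thus ?thesis by (simp add: Lp_def)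
qed

lemma tendsto_abs_powr_0:
  fixes F :: "nat \<Rightarrow> real"
  assumes "F \<longlonglongrightarrow> 0" shows "(\<lambda>n. \<bar>F n\<bar> powr p) \<longlonglongrightarrow> 0"
proof -
  have "(\<lambda>n. \<bar>F n\<bar> powr p) \<longlonglongrightarrow> \<bar>0\<bar> powr p" using assms p by (intro tendsto_powr' tendsto_intros) auto
  thus ?thesis by simp
qed

text \<open>If \<open>E\<close> vanishes on the boundary, then a \<open>C\<^sup>1\<close> function of \<open>E\<close> that vanishes for small values of \<open>E\<close> may be used to test
  the equation. When \<open>E\<close> tends to \<open>0\<close> pointwise, this function has compact support. When \<open>E\<close> belongs to \<open>W\<^sub>0\<^sup>1\<^sup>,\<^sup>p\<close>, it is the
  limit of \<open>h \<circ> \<phi>\<^sub>n\<close> for test functions \<open>\<phi>\<^sub>n\<close> converging to \<open>E\<close>.\<close>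

lemma cutoff_equation:
  assumes zero: "zero_on_boundary p \<Omega> E" and \<epsilon>: "0 < \<epsilon>"
    and h: "\<And>t. (h has_real_derivative h' t) (at t)" "\<And>t. \<bar>h' t\<bar> \<le> L" "continuous_on UNIV h'"
    and h0: "\<And>t. t \<le> \<epsilon> \<Longrightarrow> h t = 0" "\<And>t. t \<le> \<epsilon> \<Longrightarrow> h' t = 0"
  shows "W_approximable p \<Omega> (\<lambda>x. h (E x)) (\<lambda>x. h' (E x) *\<^sub>R G x)"
    "integrable (lebesgue_on \<Omega>) (\<lambda>x. h' (E x) * N x powr p)"
    "integrable (lebesgue_on \<Omega>) (\<lambda>x. f x * h (E x))"
    "(LINT x|lebesgue_on \<Omega>. h' (E x) * N x powr p) = (LINT x|lebesgue_on \<Omega>. f x * h (E x))"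
proof -
  let ?M = "lebesgue_on \<Omega>"
  let ?v = "\<lambda>x. h (E x)" and ?V = "\<lambda>x. h' (E x) *\<^sub>R G x"
  note wV = solution_compose_weak_gradient[OF h]
  have p0: "0 < p" using p by simp
  have L: "0 \<le> L" using h(2)[of 0] by simp
  have lip: "\<bar>h s - h t\<bar> \<le> L * \<bar>s - t\<bar>" for s t
    using field_differentiable_bound[of UNIV h h' L s t] h by simp
  have hL: "\<bar>h t\<bar> \<le> L * \<bar>t\<bar>" for t using lip[of t 0] h0(1)[of 0] \<epsilon> by simp
  have hcont: "continuous_on UNIV h" using h(1) by (intro DERIV_continuous_on) (auto intro: has_field_derivative_at_within)
  have [measurable]: "h \<in> borel_measurable borel" "h' \<in> borel_measurable borel"
    using h(3) hcont by (auto intro: borel_measurable_continuous_onI)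
  have "W_approximable p \<Omega> ?v ?V \<and> integrable ?M (\<lambda>x. flux p G x (?V x)) \<and> integrable ?M (\<lambda>x. f x * ?v x) \<and>
    (LINT x|?M. flux p G x (?V x)) = (LINT x|?M. f x * ?v x)"
    using zero unfolding zero_on_boundary_def
  proof
    assume lim: "\<forall>z\<in>frontier \<Omega>. (E \<longlongrightarrow> 0) (at z within \<Omega>)"
    obtain K where K: "compact K" "K \<subseteq> \<Omega>" "\<And>x. x \<in> \<Omega> \<Longrightarrow> x \<notin> K \<Longrightarrow> \<bar>E x\<bar> < \<epsilon>"
      by (rule compact_superlevel[OF lim \<epsilon>]) (rule that)
    \<comment> \<open>Outside \<open>\<Omega>\<close> the values of \<open>E\<close> are arbitrary and are replaced by \<open>0\<close>.\<close>
    define v where "v x = (if x \<in> \<Omega> then ?v x else 0)" for x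
    define V where "V x = (if x \<in> \<Omega> then ?V x else 0)" for x
    have wv: "has_weak_gradient \<Omega> v V"
    proof -
      have "?v absolutely_integrable_on S \<longleftrightarrow> v absolutely_integrable_on S" "?V absolutely_integrable_on S \<longleftrightarrow> V absolutely_integrable_on S"
        if "S \<subseteq> \<Omega>" for S
        using that unfolding set_integrable_def v_def V_def
        by (auto intro!: Bochner_Integration.integrable_cong simp: indicator_def)
      moreover have "(LINT x|?M. ?v x * g x) = (LINT x|?M. v x * g x)" "(LINT x|?M. ?V x $ i * g x) = (LINT x|?M. V x $ i * g x)" for g i
        by (auto intro!: Bochner_Integration.integral_cong simp: v_def V_def)
      ultimately show ?thesis using wV unfolding has_weak_gradient_def by auto
    qed
    have off: "v x = 0" "V x = 0" if "x \<notin> K" for x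
      using K(3)[of x] that h0[of "E x"] by (auto simp: v_def V_def)
    have mK: "v \<in> borel_measurable (lebesgue_on K)" "V \<in> borel_measurable (lebesgue_on K)"
      using has_weak_gradient_integrable[OF wv K(1,2)] by auto
    have LE: "integrable (lebesgue_on K) (\<lambda>x. L powr p * \<bar>E x\<bar> powr p)" "integrable (lebesgue_on K) (\<lambda>x. L powr p * norm (G x) powr p)"
      using EG_Lp[OF K(1,2)] by (auto simp: Lp_def)
    have "integrable (lebesgue_on K) (\<lambda>x. norm (v x) powr p)"
    proof (rule Bochner_Integration.integrable_bound[OF LE(1)])
      have "\<bar>v x\<bar> powr p \<le> (L * \<bar>E x\<bar>) powr p" for x
        using hL[of "E x"] p L by (intro powr_mono2) (auto simp: v_def)
      thus "AE x in lebesgue_on K. norm (norm (v x) powr p) \<le> norm (L powr p * \<bar>E x\<bar> powr p)"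
        using L by (simp add: powr_mult)
    qed (use mK in measurable)
    hence vL: "v \<in> Lp p K" using mK by (simp add: Lp_def)
    have "integrable (lebesgue_on K) (\<lambda>x. norm (V x) powr p)"
    proof (rule Bochner_Integration.integrable_bound[OF LE(2)])
      have "norm (V x) powr p \<le> (L * norm (G x)) powr p" for x
        using h(2)[of "E x"] p L by (intro powr_mono2) (auto simp: V_def intro!: mult_right_mono)
      thus "AE x in lebesgue_on K. norm (norm (V x) powr p) \<le> norm (L powr p * norm (G x) powr p)"
        using L by (simp add: powr_mult)
    qed (use mK in measurable)
    hence VL: "V \<in> Lp p K" using mK by (simp add: Lp_def)
    note eqn = compact_support_equation[OF wv K(1,2) off vL VL]
    have fl: "(LINT x|?M. flux p G x (V x)) = (LINT x|?M. flux p G x (?V x))" "(LINT x|?M. f x * v x) = (LINT x|?M. f x * ?v x)"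
      "integrable ?M (\<lambda>x. flux p G x (V x)) \<longleftrightarrow> integrable ?M (\<lambda>x. flux p G x (?V x))"
      "integrable ?M (\<lambda>x. f x * v x) \<longleftrightarrow> integrable ?M (\<lambda>x. f x * ?v x)"
      by (auto intro!: Bochner_Integration.integral_cong Bochner_Integration.integrable_cong simp: v_def V_def)
    have nn: "(\<integral>\<^sup>+x. ennreal (\<bar>v x - \<phi> x\<bar> powr p) \<partial>?M) = (\<integral>\<^sup>+x. ennreal (\<bar>?v x - \<phi> x\<bar> powr p) \<partial>?M)"
      "(\<integral>\<^sup>+x. ennreal (norm (V x - grad \<phi> x) powr p) \<partial>?M) = (\<integral>\<^sup>+x. ennreal (norm (?V x - grad \<phi> x) powr p) \<partial>?M)" for \<phi>
      by (auto intro!: nn_integral_cong simp: v_def V_def)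
    have "W_approximable p \<Omega> v V" by (rule eqn(1)) auto
    hence "W_approximable p \<Omega> ?v ?V" unfolding W_approximable_def nn .
    moreover have "integrable ?M (\<lambda>x. flux p G x (V x))" by (rule eqn(2)) auto
    moreover have "integrable ?M (\<lambda>x. f x * v x)" by (rule eqn(3)) auto
    moreover have "(LINT x|?M. flux p G x (V x)) = (LINT x|?M. f x * v x)" by (rule eqn(4)) auto
    ultimately show ?thesis unfolding fl by blast
  next
    assume E: "E \<in> W01p p \<Omega>"
    have GL: "G \<in> Lp p \<Omega>" unfolding G_def by (rule W01p_Lp(2)[OF E])
    have iG: "integrable ?M (\<lambda>x. norm (G x) powr p)" using GL by (simp add: Lp_def)
    have vm: "?v \<in> borel_measurable ?M" and Vm: "?V \<in> borel_measurable ?M" by measurable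
    obtain \<phi>0 where \<phi>0: "\<And>n. \<phi>0 n \<in> test_functions \<Omega>"
      "\<And>n. (\<integral>\<^sup>+x. ennreal (\<bar>E x - \<phi>0 n x\<bar> powr p) \<partial>?M) < ennreal (1 / real (Suc n))"
      "\<And>n. (\<integral>\<^sup>+x. ennreal (norm (G x - grad (\<phi>0 n) x) powr p) \<partial>?M) < ennreal (1 / real (Suc n))"
      by (rule W_approximable_sequence[OF W01p_approximable[OF open_\<Omega> p0 E]]) (rule that; simp only: G_def)
    have \<phi>0m: "\<phi>0 n \<in> borel_measurable ?M" "grad (\<phi>0 n) \<in> borel_measurable ?M" for n
      by (intro borel_imp_lebesgue_on C1_measurable C1_grad_measurable smooth_imp_C1 test_function_smooth[OF \<phi>0(1)])+
    obtain r :: "nat \<Rightarrow> nat" where r: "strict_mono r" "AE x in ?M. (\<lambda>n. E x - \<phi>0 (r n) x) \<longlonglongrightarrow> 0"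
      "\<And>n. (\<integral>\<^sup>+x. ennreal (norm (E x - \<phi>0 (r n) x) powr p) \<partial>?M) < ennreal (1 / real (Suc n))"
      by (rule AE_subseq_of_Lp[of "\<lambda>n x. E x - \<phi>0 n x" ?M p]) (use \<phi>0m \<phi>0(2) p0 in auto)
    define \<phi> where "\<phi> n = \<phi>0 (r n)" for n
    have \<phi>t: "\<phi> n \<in> test_functions \<Omega>" for n using \<phi>0(1) by (simp add: \<phi>_def)
    have C1\<phi>: "C1 (\<phi> n)" for n by (rule smooth_imp_C1[OF test_function_smooth[OF \<phi>t]])
    have [measurable]: "\<phi> n \<in> borel_measurable ?M" "grad (\<phi> n) \<in> borel_measurable ?M" for n
      using \<phi>0m by (auto simp: \<phi>_def)
    have \<phi>g: "(\<integral>\<^sup>+x. ennreal (norm (G x - grad (\<phi> n) x) powr p) \<partial>?M) \<le> ennreal (1 / real (Suc n))" for n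
    proof -
      have "ennreal (1 / real (Suc (r n))) \<le> ennreal (1 / real (Suc n))"
        using seq_suble[OF r(1), of n] by (intro ennreal_leI) (simp add: frac_le)
      thus ?thesis using less_imp_le[OF \<phi>0(3)[of "r n"]] unfolding \<phi>_def by (rule order_trans[rotated])
    qed
    have lim: "AE x in ?M. (\<lambda>n. \<phi> n x) \<longlonglongrightarrow> E x"
      using r(2)
    proof eventually_elim
      case (elim x)
      have "(\<lambda>n. E x - (E x - \<phi>0 (r n) x)) \<longlonglongrightarrow> E x - 0" by (intro tendsto_intros elim)
      thus ?case by (simp add: \<phi>_def)
    qed
    define w where "w n x = h (\<phi> n x)" for n x
    define W where "W n x = h' (\<phi> n x) *\<^sub>R grad (\<phi> n) x" for n x
    have wC1: "C1 (w n)" for n unfolding w_def[abs_def] by (rule C1_compose[OF C1\<phi> h(1,3)]) auto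
    have wgrad: "grad (w n) = W n" for n
      unfolding w_def[abs_def] W_def[abs_def] by (intro ext grad_compose C1_differentiable C1\<phi> h(1))
    have wm[measurable]: "w n \<in> borel_measurable ?M" "W n \<in> borel_measurable ?M" for n
      unfolding w_def[abs_def] W_def[abs_def] by measurable
    have wapp: "W_approximable p \<Omega> (w n) (W n)" for n
    proof -
      obtain K where K: "compact K" "K \<subseteq> \<Omega>" "\<And>x. x \<notin> K \<Longrightarrow> \<phi> n x = 0"
        by (rule test_functionE[OF \<phi>t[of n]]) (rule that)
      have off: "w n x = 0" "W n x = 0" if "x \<notin> K" for x
        using K(3)[OF that] h0[of 0] \<epsilon> by (auto simp: w_def W_def)
      have cwW: "continuous_on K (w n)" "continuous_on K (W n)"
        using C1_continuous[OF wC1[of n], where S = K] C1_continuous_grad[OF wC1[of n], where S = K] by (simp_all add: wgrad)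
      have "integrable (lebesgue_on K) (\<lambda>x. norm (w n x) powr p)"
        using p0 by (intro integrable_lebesgue_on_compact K(1) continuous_on_powr' continuous_on_norm continuous_on_const cwW) auto
      moreover have "integrable (lebesgue_on K) (\<lambda>x. norm (W n x) powr p)"
        using p0 by (intro integrable_lebesgue_on_compact K(1) continuous_on_powr' continuous_on_norm continuous_on_const cwW) auto
      ultimately have L: "w n \<in> Lp p K" "W n \<in> Lp p K"
        using C1_measurable[OF wC1] C1_grad_measurable[OF wC1, of n, unfolded wgrad] by (auto simp: Lp_def intro: borel_imp_lebesgue_on)
      have wk: "has_weak_gradient \<Omega> (w n) (W n)" using C1_has_weak_gradient[OF open_\<Omega> wC1] by (simp add: wgrad)
      show ?thesis by (rule compact_support_equation(1)[OF wk K(1,2) off L]) auto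
    qed
    have cw: "(\<lambda>n. \<integral>\<^sup>+x. ennreal (\<bar>?v x - w n x\<bar> powr p) \<partial>?M) \<longlonglongrightarrow> 0"
    proof (rule tendsto_sandwich[OF _ _ tendsto_const tendsto_inverse_Suc_ennreal[of "L powr p"]])
      have "(\<integral>\<^sup>+x. ennreal (\<bar>?v x - w n x\<bar> powr p) \<partial>?M) \<le> ennreal (L powr p) * ennreal (1 / real (Suc n))" for n
      proof -
        have "(\<integral>\<^sup>+x. ennreal (\<bar>?v x - w n x\<bar> powr p) \<partial>?M) \<le> (\<integral>\<^sup>+x. ennreal (L powr p) * ennreal (\<bar>E x - \<phi> n x\<bar> powr p) \<partial>?M)"
        proof (rule nn_integral_mono)
          fix x
          have "\<bar>?v x - w n x\<bar> powr p \<le> (L * \<bar>E x - \<phi> n x\<bar>) powr p"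
            unfolding w_def using lip p by (intro powr_mono2) auto
          thus "ennreal (\<bar>?v x - w n x\<bar> powr p) \<le> ennreal (L powr p) * ennreal (\<bar>E x - \<phi> n x\<bar> powr p)"
            using L by (simp add: powr_mult ennreal_mult'[symmetric] ennreal_leI)
        qed
        also have "\<dots> = ennreal (L powr p) * (\<integral>\<^sup>+x. ennreal (\<bar>E x - \<phi> n x\<bar> powr p) \<partial>?M)" by (rule nn_integral_cmult) measurable
        also have "\<dots> \<le> ennreal (L powr p) * ennreal (1 / real (Suc n))"
          using less_imp_le[OF r(3)[of n]] by (intro mult_left_mono) (auto simp: \<phi>_def)
        finally show ?thesis .
      qed
      thus "\<forall>\<^sub>F n in sequentially. (\<integral>\<^sup>+x. ennreal (\<bar>?v x - w n x\<bar> powr p) \<partial>?M) \<le> ennreal (L powr p) * ennreal (1 / real (Suc n))"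
        by simp
    qed auto
    have cW: "(\<lambda>n. \<integral>\<^sup>+x. ennreal (norm (?V x - W n x) powr p) \<partial>?M) \<longlonglongrightarrow> 0"
    proof -
      define R where "R n = (\<integral>\<^sup>+x. ennreal (norm ((h' (E x) - h' (\<phi> n x)) *\<^sub>R G x) powr p) \<partial>?M)" for n
      have R: "R \<longlonglongrightarrow> (\<integral>\<^sup>+x. 0 \<partial>?M)" unfolding R_def
      proof (rule nn_integral_dominated_convergence[where w = "\<lambda>x. ennreal ((2 * L) powr p * norm (G x) powr p)"])
        have "norm ((h' (E x) - h' (\<phi> n x)) *\<^sub>R G x) powr p \<le> (2 * L) powr p * norm (G x) powr p" for n x
        proof -
          have "\<bar>h' (E x) - h' (\<phi> n x)\<bar> \<le> 2 * L" using h(2)[of "E x"] h(2)[of "\<phi> n x"] by linarith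
          hence "norm ((h' (E x) - h' (\<phi> n x)) *\<^sub>R G x) powr p \<le> (2 * L * norm (G x)) powr p"
            using p by (intro powr_mono2) (auto intro!: mult_right_mono)
          thus ?thesis using L by (simp add: powr_mult)
        qed
        thus "AE x in ?M. ennreal (norm ((h' (E x) - h' (\<phi> n x)) *\<^sub>R G x) powr p) \<le> ennreal ((2 * L) powr p * norm (G x) powr p)" for n
          by (intro AE_I2 ennreal_leI)
        show "AE x in ?M. (\<lambda>n. ennreal (norm ((h' (E x) - h' (\<phi> n x)) *\<^sub>R G x) powr p)) \<longlonglongrightarrow> 0"
          using lim
        proof eventually_elim
          case (elim x)
          have "(\<lambda>n. h' (\<phi> n x)) \<longlonglongrightarrow> h' (E x)"
            by (rule continuous_on_tendsto_compose[OF h(3) elim]) auto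
          hence "(\<lambda>n. (h' (E x) - h' (\<phi> n x)) * norm (G x)) \<longlonglongrightarrow> (h' (E x) - h' (E x)) * norm (G x)" by (intro tendsto_intros)
          from tendsto_abs_powr_0[OF this[simplified]] 
          have "(\<lambda>n. norm ((h' (E x) - h' (\<phi> n x)) *\<^sub>R G x) powr p) \<longlonglongrightarrow> 0" by (simp add: abs_mult)
          thus ?case using tendsto_ennrealI[of _ 0] by simp
        qed
        have "integrable ?M (\<lambda>x. (2 * L) powr p * norm (G x) powr p)" using iG by simp
        thus "(\<integral>\<^sup>+x. ennreal ((2 * L) powr p * norm (G x) powr p) \<partial>?M) < \<infinity>" by (subst nn_integral_eq_integral) auto
      qed measurable
      have bd: "(\<integral>\<^sup>+x. ennreal (norm (?V x - W n x) powr p) \<partial>?M) \<le> ennreal (2 powr p) * R n + ennreal (2 powr p * L powr p) * ennreal (1 / real (Suc n))" for n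
      proof -
        have "(\<integral>\<^sup>+x. ennreal (norm (?V x - W n x) powr p) \<partial>?M) =
          (\<integral>\<^sup>+x. ennreal (norm ((h' (E x) - h' (\<phi> n x)) *\<^sub>R G x + h' (\<phi> n x) *\<^sub>R (G x - grad (\<phi> n) x)) powr p) \<partial>?M)"
          by (simp add: W_def algebra_simps)
        also have "\<dots> \<le> ennreal (2 powr p) * (R n + (\<integral>\<^sup>+x. ennreal (norm (h' (\<phi> n x) *\<^sub>R (G x - grad (\<phi> n) x)) powr p) \<partial>?M))"
          unfolding R_def by (rule nn_integral_powr_add_le) (use p0 in auto)
        also have "\<dots> \<le> ennreal (2 powr p) * (R n + ennreal (L powr p) * ennreal (1 / real (Suc n)))"
        proof (intro mult_left_mono add_left_mono)
          have "(\<integral>\<^sup>+x. ennreal (norm (h' (\<phi> n x) *\<^sub>R (G x - grad (\<phi> n) x)) powr p) \<partial>?M) \<le>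
            (\<integral>\<^sup>+x. ennreal (L powr p) * ennreal (norm (G x - grad (\<phi> n) x) powr p) \<partial>?M)"
          proof (rule nn_integral_mono)
            fix x
            have "norm (h' (\<phi> n x) *\<^sub>R (G x - grad (\<phi> n) x)) powr p \<le> (L * norm (G x - grad (\<phi> n) x)) powr p"
              using p h(2) by (intro powr_mono2) (auto intro!: mult_right_mono)
            thus "ennreal (norm (h' (\<phi> n x) *\<^sub>R (G x - grad (\<phi> n) x)) powr p) \<le> ennreal (L powr p) * ennreal (norm (G x - grad (\<phi> n) x) powr p)"
              using L by (simp add: powr_mult ennreal_mult'[symmetric] ennreal_leI)
          qed
          also have "\<dots> = ennreal (L powr p) * (\<integral>\<^sup>+x. ennreal (norm (G x - grad (\<phi> n) x) powr p) \<partial>?M)" by (rule nn_integral_cmult) measurable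
          also have "\<dots> \<le> ennreal (L powr p) * ennreal (1 / real (Suc n))" by (intro mult_left_mono \<phi>g) auto
          finally show "(\<integral>\<^sup>+x. ennreal (norm (h' (\<phi> n x) *\<^sub>R (G x - grad (\<phi> n) x)) powr p) \<partial>?M) \<le> ennreal (L powr p) * ennreal (1 / real (Suc n))" .
        qed auto
        also have "\<dots> = ennreal (2 powr p) * R n + ennreal (2 powr p * L powr p) * ennreal (1 / real (Suc n))"
          by (simp add: distrib_left ennreal_mult' mult.assoc)
        finally show ?thesis .
      qed
      have "(\<lambda>n. ennreal (2 powr p) * R n + ennreal (2 powr p * L powr p) * ennreal (1 / real (Suc n))) \<longlonglongrightarrow> ennreal (2 powr p) * 0 + 0"
        using R by (intro tendsto_add ennreal_tendsto_cmult tendsto_inverse_Suc_ennreal) auto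
      hence l0: "(\<lambda>n. ennreal (2 powr p) * R n + ennreal (2 powr p * L powr p) * ennreal (1 / real (Suc n))) \<longlonglongrightarrow> 0" by simp
      show ?thesis by (rule tendsto_sandwich[OF _ _ tendsto_const l0]) (use bd in \<open>auto intro!: always_eventually\<close>)
    qed
    have app: "W_approximable p \<Omega> ?v ?V"
    proof (rule W_approximable_closed[OF open_\<Omega> p0 vm Vm])
      fix e :: real assume "e > 0"
      hence "\<forall>\<^sub>F n in sequentially. (\<integral>\<^sup>+x. ennreal (\<bar>?v x - w n x\<bar> powr p) \<partial>?M) < ennreal e"
        "\<forall>\<^sub>F n in sequentially. (\<integral>\<^sup>+x. ennreal (norm (?V x - W n x) powr p) \<partial>?M) < ennreal e"
        using cw cW by (auto intro!: order_tendstoD)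
      hence "\<forall>\<^sub>F n in sequentially. (\<integral>\<^sup>+x. ennreal (\<bar>?v x - w n x\<bar> powr p) \<partial>?M) < ennreal e \<and>
        (\<integral>\<^sup>+x. ennreal (norm (?V x - W n x) powr p) \<partial>?M) < ennreal e" by eventually_elim auto
      then obtain n where "(\<integral>\<^sup>+x. ennreal (\<bar>?v x - w n x\<bar> powr p) \<partial>?M) < ennreal e"
        "(\<integral>\<^sup>+x. ennreal (norm (?V x - W n x) powr p) \<partial>?M) < ennreal e" unfolding eventually_sequentially by blast
      with wm[of n] wapp[of n]
      show "\<exists>w W. w \<in> borel_measurable ?M \<and> W \<in> borel_measurable ?M \<and> W_approximable p \<Omega> w W \<and>
        (\<integral>\<^sup>+x. ennreal (\<bar>?v x - w x\<bar> powr p) \<partial>?M) < ennreal e \<and>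
        (\<integral>\<^sup>+x. ennreal (norm (?V x - W x) powr p) \<partial>?M) < ennreal e" by (intro exI[of _ "w n"] exI[of _ "W n"]) auto
    qed
    have ap: "\<exists>\<phi>\<in>test_functions \<Omega>. (\<forall>x. x \<notin> \<Omega> \<longrightarrow> grad \<phi> x = 0) \<and>
     (\<integral>\<^sup>+x. ennreal (\<bar>?v x - \<phi> x\<bar> powr p) \<partial>?M) < ennreal e \<and>
     (\<integral>\<^sup>+x. ennreal (norm (?V x - grad \<phi> x) powr p) \<partial>?M) < ennreal e" if "e > 0" for e
    proof -
      obtain \<psi> where \<psi>: "\<psi> \<in> test_functions \<Omega>" "(\<integral>\<^sup>+x. ennreal (\<bar>?v x - \<psi> x\<bar> powr p) \<partial>?M) < ennreal e"
        "(\<integral>\<^sup>+x. ennreal (norm (?V x - grad \<psi> x) powr p) \<partial>?M) < ennreal e"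
        using app \<open>e > 0\<close> unfolding W_approximable_def by blast
      obtain K where K: "compact K" "K \<subseteq> \<Omega>" "\<And>x. x \<notin> K \<Longrightarrow> \<psi> x = 0"
        by (rule test_functionE[OF \<psi>(1)]) (rule that)
      have "grad \<psi> x = 0" if "x \<notin> \<Omega>" for x
        by (rule grad_zero_off[OF compact_imp_closed[OF K(1)] K(3)]) (use that K(2) in auto)
      with \<psi> show ?thesis by blast
    qed
    note eqn = limit_equation[OF domain_lebesgue order_refl GL vm Vm _ ap]
    show ?thesis using app eqn by auto
  qed
  note main = this
  have fl: "flux p G x (?V x) = h' (E x) * N x powr p" if "x \<in> \<Omega>" for x
    using flux_self[OF that] by (simp add: flux_scaleR)
  have c: "(LINT x|?M. flux p G x (?V x)) = (LINT x|?M. h' (E x) * N x powr p)"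
    "integrable ?M (\<lambda>x. flux p G x (?V x)) \<longleftrightarrow> integrable ?M (\<lambda>x. h' (E x) * N x powr p)"
    by (auto intro!: Bochner_Integration.integral_cong Bochner_Integration.integrable_cong simp: fl)
  show "W_approximable p \<Omega> ?v ?V" "integrable ?M (\<lambda>x. h' (E x) * N x powr p)" "integrable ?M (\<lambda>x. f x * h (E x))"
    "(LINT x|?M. h' (E x) * N x powr p) = (LINT x|?M. f x * h (E x))"
    using main unfolding c by auto
qed

end

section \<open>Cut-off powers\<close>

text \<open>The \<open>C\<^sup>1\<close> approximation \<open>t\<^sup>a (1 - \<epsilon>/t)\<^sub>+\<^sup>2\<close> of the power \<open>t\<^sup>a\<close>, which vanishes for \<open>t \<le> \<epsilon>\<close>, and its derivative. The
  maximum in the base keeps the expressions continuous on the whole line and changes no value, as the other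
  factor vanishes for \<open>t \<le> \<epsilon>\<close>.\<close>

definition cut :: "real \<Rightarrow> real \<Rightarrow> real \<Rightarrow> real" where
  "cut a \<epsilon> t = ppow 2 (t - \<epsilon>) * max t \<epsilon> powr (a - 2)"

definition cut' :: "real \<Rightarrow> real \<Rightarrow> real \<Rightarrow> real" where
  "cut' a \<epsilon> t = 2 * ppow 1 (t - \<epsilon>) * max t \<epsilon> powr (a - 2) + (a - 2) * ppow 2 (t - \<epsilon>) * max t \<epsilon> powr (a - 3)"

lemma cut_zero: "t \<le> \<epsilon> \<Longrightarrow> cut a \<epsilon> t = 0" "t \<le> \<epsilon> \<Longrightarrow> cut' a \<epsilon> t = 0"
  by (simp_all add: cut_def cut'_def ppow_def max_def)

lemma cut_has_real_derivative:
  assumes \<epsilon>: "0 < \<epsilon>" shows "(cut a \<epsilon> has_real_derivative cut' a \<epsilon> t) (at t)"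
proof (cases "t < \<epsilon>")
  case True
  have "\<forall>\<^sub>F x in nhds t. cut a \<epsilon> x = 0"
    using eventually_nhds_in_open[of "{..<\<epsilon>}" t] True by (auto elim!: eventually_mono simp: cut_zero)
  moreover have "cut' a \<epsilon> t = 0" using True by (simp add: cut_zero)
  ultimately show ?thesis by (subst DERIV_cong_ev[OF refl _ refl, where g = "\<lambda>_. 0"]) auto
next
  case False
  hence t: "0 < t" "max t \<epsilon> = t" using \<epsilon> by auto
  have d1: "((\<lambda>x. ppow 2 (x - \<epsilon>)) has_real_derivative (2 * ppow 1 (t - \<epsilon>))) (at t)"
  proof -
    have "((\<lambda>x. ppow 2 (x - \<epsilon>)) has_real_derivative (2 * ppow (2 - 1) (t - \<epsilon>)) * 1) (at t)"
      by (rule DERIV_chain2[OF ppow_has_real_derivative]) (auto intro!: derivative_eq_intros)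
    thus ?thesis by simp
  qed
  have d2: "((\<lambda>x. x powr (a - 2)) has_real_derivative (a - 2) * t powr (a - 3)) (at t)"
    using has_real_derivative_powr[OF t(1), of "a - 2"] by simp
  have "cut' a \<epsilon> t = 2 * ppow 1 (t - \<epsilon>) * t powr (a - 2) + (a - 2) * t powr (a - 3) * ppow 2 (t - \<epsilon>)"
    unfolding cut'_def t(2) by (simp add: mult_ac)
  with DERIV_mult[OF d1 d2] have "((\<lambda>x. ppow 2 (x - \<epsilon>) * x powr (a - 2)) has_real_derivative cut' a \<epsilon> t) (at t)"
    by simp
  moreover have "\<forall>\<^sub>F x in nhds t. cut a \<epsilon> x = ppow 2 (x - \<epsilon>) * x powr (a - 2)"
    using eventually_nhds_in_open[of "{0<..}" t] t(1)
    by (auto elim!: eventually_mono simp: cut_def ppow_def max_def)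
  ultimately show ?thesis by (subst DERIV_cong_ev[OF refl _ refl]) auto
qed

lemma cut'_continuous: assumes "0 < \<epsilon>" shows "continuous_on UNIV (cut' a \<epsilon>)"
proof -
  have c1: "continuous_on UNIV (\<lambda>t. ppow q (t - \<epsilon>))" if "0 < q" for q
    by (rule continuous_on_compose2[OF ppow_continuous[OF that, of UNIV]]) (auto intro!: continuous_intros)
  have c2: "continuous_on UNIV (\<lambda>t. max t \<epsilon> powr b)" for b
  proof (rule continuous_on_powr)
    show "\<forall>t\<in>UNIV. max t \<epsilon> \<noteq> 0" using assms by (auto simp: max_def)
  qed (auto intro!: continuous_intros)
  show ?thesis unfolding cut'_def by (intro continuous_on_add continuous_on_mult continuous_on_const c1 c2) auto
qed

lemma cut_formula:
  assumes "0 < \<epsilon>" "0 < t"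
  shows "cut a \<epsilon> t = t powr a * (max (t - \<epsilon>) 0 / t)\<^sup>2"
    "cut' a \<epsilon> t = t powr (a - 1) * (2 * (max (t - \<epsilon>) 0 / t) + (a - 2) * (max (t - \<epsilon>) 0 / t)\<^sup>2)"
proof -
  define y where "y = max (t - \<epsilon>) 0"
  have pp: "ppow 2 (t - \<epsilon>) = y\<^sup>2" "ppow 1 (t - \<epsilon>) = y"
    unfolding ppow_def y_def using powr_realpow'[of "max (t - \<epsilon>) 0" 2] by auto
  have e: "t powr (a - 2) = t powr a / t\<^sup>2" "t powr (a - 2) = t powr (a - 1) / t" "t powr (a - 3) = t powr (a - 1) / t\<^sup>2"
    using assms(2) powr_realpow[of t 2] powr_diff[of t a 2] powr_diff[of t "a - 1" 1] powr_diff[of t "a - 1" 2] by auto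
  have "cut a \<epsilon> t = t powr a * (y / t)\<^sup>2 \<and> cut' a \<epsilon> t = t powr (a - 1) * (2 * (y / t) + (a - 2) * (y / t)\<^sup>2)"
  proof (cases "y = 0")
    case False
    hence m: "max t \<epsilon> = t" by (auto simp: y_def max_def split: if_splits)
    have "cut a \<epsilon> t = t powr a * (y / t)\<^sup>2" unfolding cut_def pp m e(1) by (simp add: power_divide)
    moreover have "cut' a \<epsilon> t = t powr (a - 1) * (2 * (y / t) + (a - 2) * (y / t)\<^sup>2)"
      unfolding cut'_def pp m e(2,3) by (simp add: power_divide distrib_left mult_ac)
    ultimately show ?thesis by simp
  qed (simp add: cut_def cut'_def pp)
  thus "cut a \<epsilon> t = t powr a * (max (t - \<epsilon>) 0 / t)\<^sup>2"
    "cut' a \<epsilon> t = t powr (a - 1) * (2 * (max (t - \<epsilon>) 0 / t) + (a - 2) * (max (t - \<epsilon>) 0 / t)\<^sup>2)"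
    by (simp_all add: y_def)
qed

text \<open>Domination by the power and its derivative, uniformly in \<open>\<epsilon>\<close>.\<close>

lemma cut_bounds:
  assumes \<epsilon>: "0 < \<epsilon>" and t: "0 < t" and a: "0 < a" "a \<le> 1"
  shows "0 \<le> cut a \<epsilon> t" "cut a \<epsilon> t \<le> t powr a" "0 \<le> cut' a \<epsilon> t" "cut' a \<epsilon> t \<le> 2 * t powr (a - 1)"
proof -
  define r where "r = max (t - \<epsilon>) 0 / t"
  have r: "0 \<le> r" "r \<le> 1" using \<epsilon> t by (auto simp: r_def)
  hence r2: "0 \<le> r\<^sup>2" "r\<^sup>2 \<le> r" "r\<^sup>2 \<le> 1" by (auto simp: power2_eq_square mult_left_le mult_le_one)
  show "0 \<le> cut a \<epsilon> t" by (simp add: cut_formula[OF \<epsilon> t])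
  show "cut a \<epsilon> t \<le> t powr a"
    unfolding cut_formula[OF \<epsilon> t] r_def[symmetric] using r2 by (simp add: mult_left_le)
  have "(2 - a) * r\<^sup>2 \<le> 2 * r" using r2 r a by (intro mult_mono) auto
  hence "0 \<le> 2 * r + (a - 2) * r\<^sup>2" by (simp add: algebra_simps)
  thus "0 \<le> cut' a \<epsilon> t" unfolding cut_formula[OF \<epsilon> t] r_def[symmetric] by simp
  have "(a - 2) * r\<^sup>2 \<le> 0" using a r2 by (intro mult_nonpos_nonneg) auto
  hence "2 * r + (a - 2) * r\<^sup>2 \<le> 2" using r by linarith
  from mult_left_mono[OF this, of "t powr (a - 1)"]
  show "cut' a \<epsilon> t \<le> 2 * t powr (a - 1)" unfolding cut_formula[OF \<epsilon> t] r_def[symmetric] by (simp add: mult.commute)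
qed

lemma cut'_bounded:
  assumes \<epsilon>: "0 < \<epsilon>" and a: "0 < a" "a \<le> 1"
  shows "\<bar>cut' a \<epsilon> t\<bar> \<le> 2 * \<epsilon> powr (a - 1)"
proof (cases "t \<le> \<epsilon>")
  case False
  hence t: "0 < t" "\<epsilon> \<le> t" using \<epsilon> by auto
  have "t powr (a - 1) \<le> \<epsilon> powr (a - 1)" using t \<epsilon> a by (intro powr_mono2') auto
  thus ?thesis using cut_bounds(3,4)[OF \<epsilon> t(1) a] by simp
qed (simp add: cut_zero)

lemma cut_tendsto:
  assumes t: "0 < t"
  shows "(\<lambda>n. cut a (1 / real (Suc n)) t) \<longlonglongrightarrow> t powr a"
    "(\<lambda>n. cut' a (1 / real (Suc n)) t) \<longlonglongrightarrow> a * t powr (a - 1)"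
proof -
  have e0: "(\<lambda>n. 1 / real (Suc n)) \<longlonglongrightarrow> 0" using LIMSEQ_inverse_real_of_nat by (simp add: inverse_eq_divide)
  have "(\<lambda>n. max (t - 1 / real (Suc n)) 0 / t) \<longlonglongrightarrow> max (t - 0) 0 / t"
    using t by (intro tendsto_intros e0) auto
  hence r: "(\<lambda>n. max (t - 1 / real (Suc n)) 0 / t) \<longlonglongrightarrow> 1" using t by simp
  have ep: "0 < 1 / real (Suc n)" for n by simp
  have "(\<lambda>n. t powr a * (max (t - 1 / real (Suc n)) 0 / t)\<^sup>2) \<longlonglongrightarrow> t powr a * 1\<^sup>2" by (intro tendsto_intros r)
  thus "(\<lambda>n. cut a (1 / real (Suc n)) t) \<longlonglongrightarrow> t powr a" unfolding cut_formula[OF ep t] by simp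
  have "(\<lambda>n. t powr (a - 1) * (2 * (max (t - 1 / real (Suc n)) 0 / t) + (a - 2) * (max (t - 1 / real (Suc n)) 0 / t)\<^sup>2))
     \<longlonglongrightarrow> t powr (a - 1) * (2 * 1 + (a - 2) * 1\<^sup>2)" by (intro tendsto_intros r)
  thus "(\<lambda>n. cut' a (1 / real (Suc n)) t) \<longlonglongrightarrow> a * t powr (a - 1)"
    unfolding cut_formula[OF ep t] by (simp add: mult.commute)
qed

lemma cut_measurable [measurable]: "cut a \<epsilon> \<in> borel_measurable borel" "cut' a \<epsilon> \<in> borel_measurable borel"
  unfolding cut_def[abs_def] cut'_def[abs_def] by measurable

section \<open>Powers of the solution\<close>

context elliptic
begin

lemma A_norm_coercive: obtains k where "k > 0" "\<And>x \<xi>. x \<in> \<Omega> \<Longrightarrow> k * norm \<xi> \<le> A_norm A x \<xi>"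
proof -
  obtain c where c: "c > 0" "\<And>x \<xi>. x \<in> \<Omega> \<Longrightarrow> c * (norm \<xi>)\<^sup>2 \<le> (A x *v \<xi>) \<bullet> \<xi>" using A_coercive by blast
  have "sqrt c * norm \<xi> \<le> A_norm A x \<xi>" if "x \<in> \<Omega>" for x \<xi>
  proof -
    have "sqrt (c * (norm \<xi>)\<^sup>2) \<le> A_norm A x \<xi>" unfolding A_norm_def by (rule real_sqrt_le_mono[OF c(2)[OF that]])
    thus ?thesis by (simp add: real_sqrt_mult)
  qed
  with that[of "sqrt c"] c(1) show ?thesis by simp
qed

end

context p_equation
begin

lemma powr_le_one_add_powr: "0 < t \<Longrightarrow> b \<le> p \<Longrightarrow> 0 \<le> b \<Longrightarrow> t powr b \<le> 1 + t powr p" for t b :: real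
proof -
  assume t: "0 < t" "b \<le> p" "0 \<le> b"
  show ?thesis
  proof (cases "t \<le> 1")
    case True
    hence "t powr b \<le> 1" using t powr_mono2[of b t 1] by simp
    thus ?thesis by (simp add: add_increasing2)
  next
    case False
    hence "t powr b \<le> t powr p" using powr_mono[OF t(2), of t] by simp
    thus ?thesis by simp
  qed
qed

lemma E_powr_integrable:
  assumes "zero_on_boundary p \<Omega> E" "0 \<le> b" "b \<le> p"
  shows "integrable (lebesgue_on \<Omega>) (\<lambda>x. E x powr b)"
proof -
  have i: "integrable (lebesgue_on \<Omega>) (\<lambda>x. 1 + \<bar>E x\<bar> powr p)"
    using E_Lp[OF assms(1)] integrable_const_\<Omega> by (simp add: Lp_def)
  show ?thesis
  proof (rule Bochner_Integration.integrable_bound[OF i])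
    show "AE x in lebesgue_on \<Omega>. norm (E x powr b) \<le> norm (1 + \<bar>E x\<bar> powr p)"
      using E_pos by eventually_elim (use powr_le_one_add_powr assms in auto)
  qed measurable
qed

lemma f_E_powr_integrable:
  assumes "zero_on_boundary p \<Omega> E" "0 \<le> b" "b \<le> p"
  shows "integrable (lebesgue_on \<Omega>) (\<lambda>x. f x * E x powr b)"
proof -
  obtain M where M: "M \<ge> 0" "\<And>x. x \<in> \<Omega> \<Longrightarrow> \<bar>f x\<bar> \<le> M" using f_bounded by blast
  from integrable_mult_bounded_on_space[OF E_powr_integrable[OF assms] f_measurable, of M] M(2)
  show ?thesis by (simp add: mult.commute)
qed

text \<open>Testing the equation with \<open>E\<^sup>\<beta>\<close>, as a limit of cut-off powers: Fatou's lemma gives the integrability, dominated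
  convergence the identity.\<close>

lemma power_identity:
  assumes zero: "zero_on_boundary p \<Omega> E" and \<beta>: "0 < \<beta>" "\<beta> \<le> 1"
  shows "integrable (lebesgue_on \<Omega>) (\<lambda>x. E x powr (\<beta> - 1) * N x powr p)"
    "\<beta> * (LINT x|lebesgue_on \<Omega>. E x powr (\<beta> - 1) * N x powr p) = (LINT x|lebesgue_on \<Omega>. f x * E x powr \<beta>)"
proof -
  let ?M = "lebesgue_on \<Omega>"
  define \<epsilon> where "\<epsilon> n = 1 / real (Suc n)" for n
  have \<epsilon>: "0 < \<epsilon> n" for n by (simp add: \<epsilon>_def)
  note eqn = cutoff_equation[OF zero \<epsilon> cut_has_real_derivative[OF \<epsilon>] cut'_bounded[OF \<epsilon> \<beta>] cut'_continuous[OF \<epsilon>] cut_zero]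
  have i1: "integrable ?M (\<lambda>x. cut' \<beta> (\<epsilon> n) (E x) * N x powr p)" for n by (rule eqn(2)) auto
  have i2: "integrable ?M (\<lambda>x. f x * cut \<beta> (\<epsilon> n) (E x))" for n by (rule eqn(3)) auto
  have eq: "(LINT x|?M. cut' \<beta> (\<epsilon> n) (E x) * N x powr p) = (LINT x|?M. f x * cut \<beta> (\<epsilon> n) (E x))" for n by (rule eqn(4)) auto
  have if\<beta>: "integrable ?M (\<lambda>x. f x * E x powr \<beta>)" using f_E_powr_integrable[OF zero] \<beta> p by simp
  let ?J = "LINT x|?M. f x * E x powr \<beta>"
  have good: "AE x in ?M. 0 < E x \<and> 0 \<le> f x" using E_pos AE_space by eventually_elim (use f_nonneg in auto)
  have le: "(LINT x|?M. f x * cut \<beta> (\<epsilon> n) (E x)) \<le> ?J" for n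
  proof (rule integral_mono_AE[OF i2 if\<beta>])
    show "AE x in ?M. f x * cut \<beta> (\<epsilon> n) (E x) \<le> f x * E x powr \<beta>"
      using good by eventually_elim (use cut_bounds[OF \<epsilon> _ \<beta>] in \<open>auto intro!: mult_left_mono\<close>)
  qed
  have "(\<integral>\<^sup>+x. ennreal (\<beta> * E x powr (\<beta> - 1) * N x powr p) \<partial>?M) \<le> ennreal ?J"
  proof (rule fatou_AE[where B = "\<lambda>n. ennreal ?J" and F = "\<lambda>n x. ennreal (cut' \<beta> (\<epsilon> n) (E x) * N x powr p)"])
    show "(\<lambda>x. ennreal (cut' \<beta> (\<epsilon> n) (E x) * N x powr p)) \<in> borel_measurable ?M" for n by measurable
    show "AE x in ?M. (\<lambda>n. ennreal (cut' \<beta> (\<epsilon> n) (E x) * N x powr p)) \<longlonglongrightarrow> ennreal (\<beta> * E x powr (\<beta> - 1) * N x powr p)"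
      using good by eventually_elim (auto intro!: tendsto_ennrealI tendsto_mult_right cut_tendsto[folded \<epsilon>_def])
    show "(\<integral>\<^sup>+x. ennreal (cut' \<beta> (\<epsilon> n) (E x) * N x powr p) \<partial>?M) \<le> ennreal ?J" for n
    proof -
      have "(\<integral>\<^sup>+x. ennreal (cut' \<beta> (\<epsilon> n) (E x) * N x powr p) \<partial>?M) = ennreal (LINT x|?M. cut' \<beta> (\<epsilon> n) (E x) * N x powr p)"
      proof (rule nn_integral_eq_integral[OF i1])
        show "AE x in ?M. 0 \<le> cut' \<beta> (\<epsilon> n) (E x) * N x powr p"
          using good by eventually_elim (use cut_bounds[OF \<epsilon> _ \<beta>] in auto)
      qed
      thus ?thesis using le[of n] by (simp add: eq ennreal_leI)
    qed
  qed auto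
  hence "(\<integral>\<^sup>+x. ennreal (\<beta> * E x powr (\<beta> - 1) * N x powr p) \<partial>?M) < \<infinity>" by (rule le_less_trans) simp
  hence "integrable ?M (\<lambda>x. \<beta> * E x powr (\<beta> - 1) * N x powr p)"
    using \<beta> by (intro integrableI_nonneg) auto
  from integrable_mult_right[OF this, of "1 / \<beta>"] show i: "integrable ?M (\<lambda>x. E x powr (\<beta> - 1) * N x powr p)"
    using \<beta> by simp
  have "(\<lambda>n. LINT x|?M. cut' \<beta> (\<epsilon> n) (E x) * N x powr p) \<longlonglongrightarrow> (LINT x|?M. \<beta> * E x powr (\<beta> - 1) * N x powr p)"
  proof (rule integral_dominated_convergence[where w = "\<lambda>x. 2 * (E x powr (\<beta> - 1) * N x powr p)"])
    show "AE x in ?M. (\<lambda>n. cut' \<beta> (\<epsilon> n) (E x) * N x powr p) \<longlonglongrightarrow> \<beta> * E x powr (\<beta> - 1) * N x powr p"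
      using good by eventually_elim (auto intro!: tendsto_mult_right cut_tendsto[folded \<epsilon>_def])
    show "AE x in ?M. norm (cut' \<beta> (\<epsilon> n) (E x) * N x powr p) \<le> 2 * (E x powr (\<beta> - 1) * N x powr p)" for n
      using good
    proof eventually_elim
      case (elim x)
      have "\<bar>cut' \<beta> (\<epsilon> n) (E x)\<bar> * N x powr p \<le> 2 * E x powr (\<beta> - 1) * N x powr p"
        using cut_bounds[OF \<epsilon> _ \<beta>, of "E x" n] elim by (intro mult_right_mono) auto
      thus ?case by (simp add: abs_mult)
    qed
  qed (use i in auto)
  moreover have "(\<lambda>n. LINT x|?M. f x * cut \<beta> (\<epsilon> n) (E x)) \<longlonglongrightarrow> ?J"
  proof (rule integral_dominated_convergence[where w = "\<lambda>x. f x * E x powr \<beta>"])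
    show "AE x in ?M. (\<lambda>n. f x * cut \<beta> (\<epsilon> n) (E x)) \<longlonglongrightarrow> f x * E x powr \<beta>"
      using good by eventually_elim (auto intro!: tendsto_mult_left cut_tendsto[folded \<epsilon>_def])
    show "AE x in ?M. norm (f x * cut \<beta> (\<epsilon> n) (E x)) \<le> f x * E x powr \<beta>" for n
      using good by eventually_elim (use cut_bounds[OF \<epsilon> _ \<beta>] in \<open>auto simp: abs_mult intro!: mult_left_mono\<close>)
  qed (use if\<beta> in auto)
  ultimately have "(LINT x|?M. \<beta> * E x powr (\<beta> - 1) * N x powr p) = ?J" unfolding eq by (rule LIMSEQ_unique)
  thus "\<beta> * (LINT x|?M. E x powr (\<beta> - 1) * N x powr p) = ?J" by (simp add: mult.assoc)
qed

text \<open>A continuous \<open>f \<ge> 0\<close> that is nonzero at one point is positive on a nonempty open set, where \<open>E > 0\<close> almost everywhere.\<close>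

lemma f_E_powr_pos:
  assumes zero: "zero_on_boundary p \<Omega> E" and b: "0 \<le> b" "b \<le> p" and f: "\<exists>x\<in>\<Omega>. f x \<noteq> 0"
  shows "0 < (LINT x|lebesgue_on \<Omega>. f x * E x powr b)"
proof -
  let ?M = "lebesgue_on \<Omega>"
  note i = f_E_powr_integrable[OF zero b]
  have nn: "AE x in ?M. 0 \<le> f x * E x powr b" using AE_space by eventually_elim (use f_nonneg in auto)
  have "(LINT x|?M. f x * E x powr b) \<noteq> 0"
  proof
    assume "(LINT x|?M. f x * E x powr b) = 0"
    hence "AE x in ?M. f x * E x powr b = 0" using integral_nonneg_eq_0_iff_AE[OF i nn] by simp
    hence "AE x in ?M. f x = 0" using E_pos by eventually_elim auto
    hence "AE x in lebesgue. x \<in> \<Omega> \<longrightarrow> f x = 0" by (simp add: AE_restrict_space_iff domain_lebesgue)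
    hence "negligible {x. \<not> (x \<in> \<Omega> \<longrightarrow> f x = 0)}"
      unfolding eventually_ae_filter_negligible using negligible_subset by blast
    moreover have "{x. \<not> (x \<in> \<Omega> \<longrightarrow> f x = 0)} = {x \<in> \<Omega>. f x \<in> - {0}}" by auto
    moreover have "open {x \<in> \<Omega>. f x \<in> - {0}}"
      using continuous_open_preimage[OF smooth_up_to_boundary_continuous[OF f_smooth] open_\<Omega> open_Compl[OF closed_singleton[of 0]]]
      by (simp add: vimage_def Int_def)
    ultimately show False using open_not_negligible f by auto
  qed
  moreover have "0 \<le> (LINT x|?M. f x * E x powr b)" by (rule integral_nonneg_AE[OF nn])
  ultimately show ?thesis by simp
qed

lemma Lp_integrable:
  fixes u :: "real^'n \<Rightarrow> 'b::euclidean_space"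
  assumes "u \<in> Lp p \<Omega>" shows "integrable (lebesgue_on \<Omega>) u"
proof (rule Bochner_Integration.integrable_bound[of _ "\<lambda>x. 1 + norm (u x) powr p"])
  show "integrable (lebesgue_on \<Omega>) (\<lambda>x. 1 + norm (u x) powr p)" "u \<in> borel_measurable (lebesgue_on \<Omega>)"
    using assms integrable_const_\<Omega> by (auto simp: Lp_def)
  have "norm (u x) \<le> norm (1 + norm (u x) powr p)" for x
    using le_one_add_powr[of "norm (u x)" p] p by (auto intro: order_trans[OF _ abs_ge_self])
  thus "AE x in lebesgue_on \<Omega>. norm (u x) \<le> norm (1 + norm (u x) powr p)" by simp
qed

text \<open>The exponent is chosen so that \<open>(\<alpha> - 1) p = \<beta> - 1\<close>; then the energy of \<open>E\<^sup>\<alpha>\<close> is finite by the identity for \<open>E\<^sup>\<beta>\<close>.\<close>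

lemma power_in_W01p:
  assumes zero: "zero_on_boundary p \<Omega> E" and \<beta>: "0 < \<beta>" "\<beta> \<le> 1"
  defines "\<alpha> \<equiv> (p - 1 + \<beta>) / p"
  shows "(\<lambda>x. E x powr \<alpha>) \<in> W01p p \<Omega>"
    "AE x in lebesgue_on \<Omega>. weak_grad \<Omega> (\<lambda>x. E x powr \<alpha>) x = (\<alpha> * E x powr (\<alpha> - 1)) *\<^sub>R G x"
proof -
  let ?M = "lebesgue_on \<Omega>"
  let ?u = "\<lambda>x. E x powr \<alpha>" and ?V = "\<lambda>x. (\<alpha> * E x powr (\<alpha> - 1)) *\<^sub>R G x"
  have p0: "0 < p" using p by simp
  have \<alpha>: "0 < \<alpha>" "\<alpha> \<le> 1" using p \<beta> by (auto simp: \<alpha>_def field_simps)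
  have \<alpha>p: "\<alpha> * p = p - 1 + \<beta>" "(\<alpha> - 1) * p = \<beta> - 1" using p by (auto simp: \<alpha>_def field_simps)
  define \<epsilon> where "\<epsilon> n = 1 / real (Suc n)" for n
  have \<epsilon>: "0 < \<epsilon> n" for n by (simp add: \<epsilon>_def)
  define u where "u n x = cut \<alpha> (\<epsilon> n) (E x)" for n x
  define V where "V n x = cut' \<alpha> (\<epsilon> n) (E x) *\<^sub>R G x" for n x
  have um[measurable]: "u n \<in> borel_measurable ?M" "V n \<in> borel_measurable ?M" for n
    unfolding u_def[abs_def] V_def[abs_def] by measurable
  have um0[measurable]: "?u \<in> borel_measurable ?M" "?V \<in> borel_measurable ?M" by measurable
  have wV: "has_weak_gradient \<Omega> (u n) (V n)" for n
    unfolding u_def[abs_def] V_def[abs_def]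
    by (rule solution_compose_weak_gradient[OF cut_has_real_derivative[OF \<epsilon>] cut'_bounded[OF \<epsilon> \<alpha>] cut'_continuous[OF \<epsilon>]])
  have app: "W_approximable p \<Omega> (u n) (V n)" for n
    unfolding u_def[abs_def] V_def[abs_def]
    by (rule cutoff_equation(1)[OF zero \<epsilon> cut_has_real_derivative[OF \<epsilon>] cut'_bounded[OF \<epsilon> \<alpha>] cut'_continuous[OF \<epsilon>] cut_zero])
  have iu: "integrable ?M (\<lambda>x. (E x powr \<alpha>) powr p)"
    using E_powr_integrable[OF zero, of "p - 1 + \<beta>"] \<beta> p by (simp add: powr_powr \<alpha>p)
  obtain k where k: "k > 0" "\<And>x \<xi>. x \<in> \<Omega> \<Longrightarrow> k * norm \<xi> \<le> A_norm A x \<xi>" using A_norm_coercive by blast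
  have iG: "integrable ?M (\<lambda>x. (E x powr (\<alpha> - 1) * norm (G x)) powr p)"
  proof (rule Bochner_Integration.integrable_bound[OF integrable_mult_right[OF power_identity(1)[OF zero \<beta>], of "(1 / k) powr p"]])
    show "AE x in ?M. norm ((E x powr (\<alpha> - 1) * norm (G x)) powr p) \<le> norm ((1 / k) powr p * (E x powr (\<beta> - 1) * N x powr p))"
    proof (rule AE_I2)
      fix x assume "x \<in> space ?M"
      hence x: "x \<in> \<Omega>" by simp
      have "norm (G x) \<le> 1 / k * N x" using k(2)[OF x, of "G x"] k(1) by (simp add: field_simps)
      hence "norm (G x) powr p \<le> (1 / k * N x) powr p" using p by (intro powr_mono2) auto
      also have "\<dots> = (1 / k) powr p * N x powr p" by (rule powr_mult)
      finally have "E x powr (\<beta> - 1) * norm (G x) powr p \<le> E x powr (\<beta> - 1) * ((1 / k) powr p * N x powr p)"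
        by (intro mult_left_mono) auto
      thus "norm ((E x powr (\<alpha> - 1) * norm (G x)) powr p) \<le> norm ((1 / k) powr p * (E x powr (\<beta> - 1) * N x powr p))"
      proof -
        assume le: "E x powr (\<beta> - 1) * norm (G x) powr p \<le> E x powr (\<beta> - 1) * ((1 / k) powr p * N x powr p)"
        have "(E x powr (\<alpha> - 1) * norm (G x)) powr p = E x powr (\<beta> - 1) * norm (G x) powr p"
          unfolding powr_mult powr_powr \<alpha>p(2) ..
        with le show ?thesis by (simp add: mult.left_commute)
      qed
    qed
  qed measurable
  have uL: "?u \<in> Lp p \<Omega>" using iu by (simp add: Lp_def)
  have VL: "?V \<in> Lp p \<Omega>"
  proof -
    have "norm (?V x) powr p = \<alpha> powr p * (E x powr (\<alpha> - 1) * norm (G x)) powr p" for x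
      using \<alpha> by (simp add: powr_mult mult.assoc)
    thus ?thesis using iG by (simp add: Lp_def)
  qed
  have iG1: "integrable ?M (\<lambda>x. E x powr (\<alpha> - 1) * norm (G x))"
    by (rule Lp_integrable) (use iG in \<open>simp add: Lp_def\<close>)
  have iu1: "integrable ?M ?u" by (rule Lp_integrable[OF uL])
  have ub: "AE x in ?M. \<bar>u n x\<bar> \<le> E x powr \<alpha> \<and> norm (V n x) \<le> 2 * (E x powr (\<alpha> - 1) * norm (G x))" for n
    using E_pos
  proof eventually_elim
    case (elim x)
    note b = cut_bounds[OF \<epsilon> elim \<alpha>, of n]
    have "\<bar>cut' \<alpha> (\<epsilon> n) (E x)\<bar> * norm (G x) \<le> 2 * E x powr (\<alpha> - 1) * norm (G x)" using b by (intro mult_right_mono) auto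
    thus ?case using b by (simp add: u_def V_def)
  qed
  have ulim: "AE x in ?M. (\<lambda>n. u n x) \<longlonglongrightarrow> ?u x \<and> (\<lambda>n. V n x) \<longlonglongrightarrow> ?V x"
    using E_pos
  proof eventually_elim
    case (elim x)
    show ?case unfolding u_def V_def \<epsilon>_def by (intro conjI tendsto_scaleR tendsto_const cut_tendsto elim)
  qed
  have wu: "has_weak_gradient \<Omega> ?u ?V"
    unfolding has_weak_gradient_def
  proof (intro conjI allI impI ballI)
    fix K assume K: "compact K \<and> K \<subseteq> \<Omega>"
    hence Kl: "K \<in> sets lebesgue" by (simp add: compact_imp_lebesgue)
    have "restrict_space ?M K = lebesgue_on K" using K Kl domain_lebesgue by (subst restrict_restrict_space) (auto simp: Int_absorb1)
    hence "integrable (lebesgue_on K) w" if "integrable ?M w" for w :: "real^'n \<Rightarrow> 'b::euclidean_space"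
      using integrable_mult_indicator[of K ?M w] that K Kl domain_lebesgue
      by (subst \<open>restrict_space ?M K = lebesgue_on K\<close>[symmetric], subst integrable_restrict_space)
         (auto simp: sets_restrict_space_iff Int_absorb2)
    thus "?u absolutely_integrable_on K" "?V absolutely_integrable_on K"
      using Lp_integrable[OF uL] Lp_integrable[OF VL] by (auto simp: absolutely_integrable_on_iff[OF Kl])
  next
    fix \<phi> :: "real^'n \<Rightarrow> real" and i assume \<phi>: "\<phi> \<in> test_functions \<Omega>"
    obtain K where K: "compact K" "K \<subseteq> \<Omega>" "\<And>x. x \<notin> K \<Longrightarrow> \<phi> x = 0" "C1 \<phi>" by (rule test_functionE[OF \<phi>]) (rule that)
    have pz: "partial i \<phi> x = 0" if "x \<notin> K" for x
      by (rule partial_zero_off[OF compact_imp_closed[OF K(1)] K(3) that])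
    obtain B1 where B1: "B1 > 0" "\<And>x. norm (\<phi> x) \<le> B1"
      using continuous_compact_support_bounded[OF C1_continuous[OF K(4)] K(1,3)] by blast
    obtain B2 where B2: "B2 > 0" "\<And>x. norm (partial i \<phi> x) \<le> B2"
      using continuous_compact_support_bounded[OF C1_continuous_partial[OF K(4)] K(1) pz] by blast
    have [measurable]: "\<phi> \<in> borel_measurable ?M" "partial i \<phi> \<in> borel_measurable ?M"
      using K(4) by (auto intro!: borel_imp_lebesgue_on C1_measurable C1_partial_measurable)
    have [measurable]: "(\<lambda>x. V n x $ i) \<in> borel_measurable ?M" "(\<lambda>x. ?V x $ i) \<in> borel_measurable ?M" for n
      by (intro measurable_component um um0)+
    have 1: "(\<lambda>n. LINT x|?M. u n x * partial i \<phi> x) \<longlonglongrightarrow> (LINT x|?M. ?u x * partial i \<phi> x)"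
    proof (rule integral_dominated_convergence[where w = "\<lambda>x. E x powr \<alpha> * B2"])
      show "AE x in ?M. (\<lambda>n. u n x * partial i \<phi> x) \<longlonglongrightarrow> ?u x * partial i \<phi> x"
        using ulim by eventually_elim (auto intro!: tendsto_mult_right)
      show "AE x in ?M. norm (u n x * partial i \<phi> x) \<le> E x powr \<alpha> * B2" for n
        using ub[of n] by eventually_elim (use B2 in \<open>auto simp: abs_mult intro!: mult_mono\<close>)
    qed (use iu1 in auto)
    have 2: "(\<lambda>n. LINT x|?M. V n x $ i * \<phi> x) \<longlonglongrightarrow> (LINT x|?M. ?V x $ i * \<phi> x)"
    proof (rule integral_dominated_convergence[where w = "\<lambda>x. 2 * (E x powr (\<alpha> - 1) * norm (G x)) * B1"])
      show "AE x in ?M. (\<lambda>n. V n x $ i * \<phi> x) \<longlonglongrightarrow> ?V x $ i * \<phi> x"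
        using ulim by eventually_elim (intro tendsto_mult_right tendsto_vec_nth; blast)
      show "AE x in ?M. norm (V n x $ i * \<phi> x) \<le> 2 * (E x powr (\<alpha> - 1) * norm (G x)) * B1" for n
        using ub[of n]
      proof eventually_elim
        case (elim x)
        have "\<bar>V n x $ i\<bar> \<le> 2 * (E x powr (\<alpha> - 1) * norm (G x))"
          using order_trans[OF component_le_norm_cart] elim by blast
        thus ?case unfolding norm_mult using B1(2)[of x] by (intro mult_mono) auto
      qed
      show "(\<lambda>x. ?V x $ i * \<phi> x) \<in> borel_measurable ?M" "(\<lambda>x. V n x $ i * \<phi> x) \<in> borel_measurable ?M" for n
        by (rule borel_measurable_times[OF measurable_component[OF um0(2)]], measurable)
      show "integrable ?M (\<lambda>x. 2 * (E x powr (\<alpha> - 1) * norm (G x)) * B1)" using iG1 by simp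
    qed
    have "(\<lambda>n. LINT x|?M. u n x * partial i \<phi> x) \<longlonglongrightarrow> - (LINT x|?M. ?V x $ i * \<phi> x)"
      unfolding has_weak_gradient_test[OF wV \<phi>] by (intro tendsto_minus 2)
    with 1 show "(LINT x|?M. ?u x * partial i \<phi> x) = - (LINT x|?M. ?V x $ i * \<phi> x)" by (rule LIMSEQ_unique)
  qed
  have cu: "(\<lambda>n. \<integral>\<^sup>+x. ennreal (\<bar>?u x - u n x\<bar> powr p) \<partial>?M) \<longlonglongrightarrow> (\<integral>\<^sup>+x. 0 \<partial>?M)"
  proof (rule nn_integral_dominated_convergence[where w = "\<lambda>x. ennreal (2 powr p * (E x powr \<alpha>) powr p)"])
    show "AE x in ?M. ennreal (\<bar>?u x - u n x\<bar> powr p) \<le> ennreal (2 powr p * (E x powr \<alpha>) powr p)" for n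
      using ub[of n]
    proof eventually_elim
      case (elim x)
      hence "\<bar>?u x - u n x\<bar> \<le> 2 * E x powr \<alpha>" using powr_ge_zero[of "E x" \<alpha>] by linarith
      hence "\<bar>?u x - u n x\<bar> powr p \<le> (2 * E x powr \<alpha>) powr p" using p by (intro powr_mono2) auto
      thus ?case by (intro ennreal_leI) (simp add: powr_mult)
    qed
    show "AE x in ?M. (\<lambda>n. ennreal (\<bar>?u x - u n x\<bar> powr p)) \<longlonglongrightarrow> 0"
      using ulim
    proof eventually_elim
      case (elim x)
      have "(\<lambda>n. ?u x - u n x) \<longlonglongrightarrow> ?u x - ?u x" using elim by (intro tendsto_intros) auto
      hence "(\<lambda>n. \<bar>?u x - u n x\<bar> powr p) \<longlonglongrightarrow> 0" by (intro tendsto_abs_powr_0) simp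
      thus ?case using tendsto_ennrealI[of _ 0] by simp
    qed
    have "integrable ?M (\<lambda>x. 2 powr p * (E x powr \<alpha>) powr p)" using iu by simp
    thus "(\<integral>\<^sup>+x. ennreal (2 powr p * (E x powr \<alpha>) powr p) \<partial>?M) < \<infinity>" by (subst nn_integral_eq_integral) auto
  qed measurable
  have cV: "(\<lambda>n. \<integral>\<^sup>+x. ennreal (norm (?V x - V n x) powr p) \<partial>?M) \<longlonglongrightarrow> (\<integral>\<^sup>+x. 0 \<partial>?M)"
  proof (rule nn_integral_dominated_convergence[where w = "\<lambda>x. ennreal (3 powr p * (E x powr (\<alpha> - 1) * norm (G x)) powr p)"])
    show "AE x in ?M. ennreal (norm (?V x - V n x) powr p) \<le> ennreal (3 powr p * (E x powr (\<alpha> - 1) * norm (G x)) powr p)" for n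
      using ub[of n]
    proof eventually_elim
      case (elim x)
      have "norm (?V x) = \<alpha> * (E x powr (\<alpha> - 1) * norm (G x))" using \<alpha> by (simp add: abs_mult)
      also have "\<dots> \<le> 1 * (E x powr (\<alpha> - 1) * norm (G x))" using \<alpha> by (intro mult_right_mono) auto
      finally have "norm (?V x - V n x) \<le> 3 * (E x powr (\<alpha> - 1) * norm (G x))"
        using elim norm_triangle_ineq4[of "?V x" "V n x"] by linarith
      hence "norm (?V x - V n x) powr p \<le> (3 * (E x powr (\<alpha> - 1) * norm (G x))) powr p" using p by (intro powr_mono2) auto
      thus ?case by (intro ennreal_leI) (simp add: powr_mult)
    qed
    show "AE x in ?M. (\<lambda>n. ennreal (norm (?V x - V n x) powr p)) \<longlonglongrightarrow> 0"
      using ulim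
    proof eventually_elim
      case (elim x)
      have "(\<lambda>n. norm (?V x - V n x)) \<longlonglongrightarrow> norm (?V x - ?V x)" using elim by (intro tendsto_intros) auto
      hence "(\<lambda>n. \<bar>norm (?V x - V n x)\<bar> powr p) \<longlonglongrightarrow> 0" by (intro tendsto_abs_powr_0) simp
      thus ?case using tendsto_ennrealI[of _ 0] by simp
    qed
    have "integrable ?M (\<lambda>x. 3 powr p * (E x powr (\<alpha> - 1) * norm (G x)) powr p)" using iG by simp
    thus "(\<integral>\<^sup>+x. ennreal (3 powr p * (E x powr (\<alpha> - 1) * norm (G x)) powr p) \<partial>?M) < \<infinity>" by (subst nn_integral_eq_integral) auto
  qed measurable
  have uapp: "W_approximable p \<Omega> ?u ?V"
  proof (rule W_approximable_closed[OF open_\<Omega> p0 um0])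
    fix e :: real assume "e > 0"
    hence "\<forall>\<^sub>F n in sequentially. (\<integral>\<^sup>+x. ennreal (\<bar>?u x - u n x\<bar> powr p) \<partial>?M) < ennreal e"
      "\<forall>\<^sub>F n in sequentially. (\<integral>\<^sup>+x. ennreal (norm (?V x - V n x) powr p) \<partial>?M) < ennreal e"
      using cu cV by (auto intro!: order_tendstoD)
    hence "\<forall>\<^sub>F n in sequentially. (\<integral>\<^sup>+x. ennreal (\<bar>?u x - u n x\<bar> powr p) \<partial>?M) < ennreal e \<and>
      (\<integral>\<^sup>+x. ennreal (norm (?V x - V n x) powr p) \<partial>?M) < ennreal e" by eventually_elim auto
    then obtain n where "(\<integral>\<^sup>+x. ennreal (\<bar>?u x - u n x\<bar> powr p) \<partial>?M) < ennreal e"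
      "(\<integral>\<^sup>+x. ennreal (norm (?V x - V n x) powr p) \<partial>?M) < ennreal e" unfolding eventually_sequentially by blast
    with um[of n] app[of n]
    show "\<exists>w W. w \<in> borel_measurable ?M \<and> W \<in> borel_measurable ?M \<and> W_approximable p \<Omega> w W \<and>
      (\<integral>\<^sup>+x. ennreal (\<bar>?u x - w x\<bar> powr p) \<partial>?M) < ennreal e \<and>
      (\<integral>\<^sup>+x. ennreal (norm (?V x - W x) powr p) \<partial>?M) < ennreal e" by (intro exI[of _ "u n"] exI[of _ "V n"]) auto
  qed
  show "?u \<in> W01p p \<Omega>" "AE x in ?M. weak_grad \<Omega> ?u x = ?V x"
    using W01pI[OF open_\<Omega> p0 wu uL VL uapp] by auto
qed

text \<open>For \<open>u = E\<^sup>\<alpha>\<close> all three integrals are multiples of one number \<open>T = \<integral> E\<^sup>\<beta>\<^sup>-\<^sup>1 |\<nabla>E|\<^sub>A\<^sup>p\<close>.\<close>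

lemma near_optimal_function:
  assumes zero: "zero_on_boundary p \<Omega> E" and f: "\<exists>x\<in>\<Omega>. f x \<noteq> 0" and \<beta>: "0 < \<beta>" "\<beta> \<le> 1"
  obtains u T where "u \<in> W01p p \<Omega>" "0 < T"
    "has_bochner_integral (lebesgue_on \<Omega>) (\<lambda>x. A_norm A x (weak_grad \<Omega> u x) powr p) (((p - 1 + \<beta>) / p) powr p * T)"
    "has_bochner_integral (lebesgue_on \<Omega>) (\<lambda>x. N x powr p / E x powr p * \<bar>u x\<bar> powr p) T"
    "(LINT x|\<mu>. \<bar>u x\<bar> powr p / E x powr (p - 1)) = \<beta> * T"
proof -
  let ?M = "lebesgue_on \<Omega>"
  define \<alpha> where "\<alpha> = (p - 1 + \<beta>) / p"
  have p0: "0 < p" using p by simp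
  have \<alpha>: "0 < \<alpha>" using p \<beta> by (auto simp: \<alpha>_def field_simps)
  have \<alpha>p: "\<alpha> * p = p - 1 + \<beta>" "(\<alpha> - 1) * p = \<beta> - 1" using p by (auto simp: \<alpha>_def field_simps)
  define u where "u x = E x powr \<alpha>" for x
  have u: "u \<in> W01p p \<Omega>" "AE x in ?M. weak_grad \<Omega> u x = (\<alpha> * E x powr (\<alpha> - 1)) *\<^sub>R G x"
    using power_in_W01p[OF zero \<beta>] unfolding u_def[abs_def] \<alpha>_def by auto
  have Um[measurable]: "u \<in> borel_measurable ?M" "weak_grad \<Omega> u \<in> borel_measurable ?M"
    using has_weak_gradient_measurable[OF open_\<Omega> W01p_weak_gradient[OF u(1)]] by auto
  have [measurable]: "(\<lambda>x. A_norm A x (weak_grad \<Omega> u x)) \<in> borel_measurable ?M" by (rule A_norm_measurable[OF domain_lebesgue]) auto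
  define T where "T = (LINT x|?M. E x powr (\<beta> - 1) * N x powr p)"
  note id = power_identity[OF zero \<beta>]
  have bT: "has_bochner_integral ?M (\<lambda>x. E x powr (\<beta> - 1) * N x powr p) T" using id(1) by (simp add: has_bochner_integral_iff T_def)
  have T\<beta>: "\<beta> * T = (LINT x|?M. f x * E x powr \<beta>)" unfolding T_def by (rule id(2))
  have "0 < \<beta> * T" unfolding T\<beta> by (rule f_E_powr_pos[OF zero _ _ f]) (use \<beta> p in auto)
  hence T: "0 < T" using \<beta> by (simp add: zero_less_mult_iff)
  have 1: "has_bochner_integral ?M (\<lambda>x. A_norm A x (weak_grad \<Omega> u x) powr p) (\<alpha> powr p * T)"
  proof (rule has_bochner_integral_cong_AE[THEN iffD1, OF _ _ _ has_bochner_integral_mult_right[OF bT, of "\<alpha> powr p"]])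
    show "AE x in ?M. \<alpha> powr p * (E x powr (\<beta> - 1) * N x powr p) = A_norm A x (weak_grad \<Omega> u x) powr p"
      using u(2) AE_space
    proof eventually_elim
      case (elim x)
      thus ?case using \<alpha> A_norm_nonneg[of x] by (simp add: A_norm_scaleR powr_mult powr_powr \<alpha>p abs_mult)
    qed
  qed auto
  have 2: "has_bochner_integral ?M (\<lambda>x. N x powr p / E x powr p * \<bar>u x\<bar> powr p) T"
  proof (rule has_bochner_integral_cong_AE[THEN iffD1, OF _ _ _ bT])
    show "AE x in ?M. E x powr (\<beta> - 1) * N x powr p = N x powr p / E x powr p * \<bar>u x\<bar> powr p"
      using E_pos
    proof eventually_elim
      case (elim x)
      have "\<bar>u x\<bar> powr p / E x powr p = E x powr (p - 1 + \<beta> - p)"         unfolding powr_diff[of "E x" "p - 1 + \<beta>" p] using elim by (simp add: u_def powr_powr \<alpha>p)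
      hence "N x powr p * (\<bar>u x\<bar> powr p / E x powr p) = N x powr p * E x powr (\<beta> - 1)" by simp
      thus ?case by (simp only: times_divide_eq_right times_divide_eq_left mult.commute)
    qed
  qed auto
  have "(LINT x|\<mu>. \<bar>u x\<bar> powr p / E x powr (p - 1)) = (LINT x|?M. f x * (\<bar>u x\<bar> powr p / E x powr (p - 1)))"
    by (rule integral_\<mu>) measurable
  also have "\<dots> = (LINT x|?M. f x * E x powr \<beta>)"
  proof (rule integral_cong_AE)
    show "AE x in ?M. f x * (\<bar>u x\<bar> powr p / E x powr (p - 1)) = f x * E x powr \<beta>"
      using E_pos
    proof eventually_elim
      case (elim x)
      have "\<bar>u x\<bar> powr p / E x powr (p - 1) = E x powr (p - 1 + \<beta> - (p - 1))"
        unfolding powr_diff[of "E x" "p - 1 + \<beta>" "p - 1"] using elim by (simp add: u_def powr_powr \<alpha>p)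
      thus ?case by simp
    qed
  qed measurable
  finally have 3: "(LINT x|\<mu>. \<bar>u x\<bar> powr p / E x powr (p - 1)) = \<beta> * T" by (simp add: T\<beta>)
  show ?thesis using that[OF u(1) T 1[unfolded \<alpha>_def] 2 3] .
qed

lemma hardy_lower_bound:
  assumes u: "u \<in> W01p p \<Omega>" and nz: "(LINT x|\<mu>. \<bar>u x\<bar> powr p / E x powr (p - 1)) \<noteq> 0"
  shows "weight_const \<le> ((LINT x|lebesgue_on \<Omega>. A_norm A x (weak_grad \<Omega> u x) powr p)
      - hardy_const * (LINT x|lebesgue_on \<Omega>. N x powr p / E x powr p * \<bar>u x\<bar> powr p)) / (LINT x|\<mu>. \<bar>u x\<bar> powr p / E x powr (p - 1))"
proof -
  let ?M = "lebesgue_on \<Omega>"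
  let ?X = "\<lambda>x. N x powr p / E x powr p * \<bar>u x\<bar> powr p"
  let ?Y = "\<lambda>x. f x * (\<bar>u x\<bar> powr p / E x powr (p - 1))"
  let ?U = "weak_grad \<Omega> u"
  have Um[measurable]: "u \<in> borel_measurable ?M" "?U \<in> borel_measurable ?M"
    using has_weak_gradient_measurable[OF open_\<Omega> W01p_weak_gradient[OF u]] by auto
  have [measurable]: "(\<lambda>x. A_norm A x (?U x)) \<in> borel_measurable ?M" by (rule A_norm_measurable[OF domain_lebesgue]) auto
  have hcl: "0 < hardy_const" "0 < weight_const" using p by auto
  obtain C where C: "C > 0" "\<And>x \<xi>. x \<in> \<Omega> \<Longrightarrow> A_norm A x \<xi> \<le> C * norm \<xi>" using A_norm_bounded by blast
  have iA: "integrable ?M (\<lambda>x. A_norm A x (?U x) powr p)"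
  proof (rule Bochner_Integration.integrable_bound[of _ "\<lambda>x. C powr p * norm (?U x) powr p"])
    show "integrable ?M (\<lambda>x. C powr p * norm (?U x) powr p)" using W01p_Lp(2)[OF u] by (simp add: Lp_def)
    show "AE x in ?M. norm (A_norm A x (?U x) powr p) \<le> norm (C powr p * norm (?U x) powr p)"
    proof (rule AE_I2)
      fix x assume "x \<in> space ?M"
      hence x: "x \<in> \<Omega>" by simp
      have "A_norm A x (?U x) powr p \<le> (C * norm (?U x)) powr p"
        using C(2)[OF x] A_norm_nonneg[OF x] p by (intro powr_mono2) auto
      thus "norm (A_norm A x (?U x) powr p) \<le> norm (C powr p * norm (?U x) powr p)" using C(1) by (simp add: powr_mult)
    qed
  qed measurable
  have Y0: "AE x in ?M. 0 \<le> ?Y x" using AE_space by eventually_elim (use f_nonneg in auto)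
  have X0: "0 \<le> ?X x" for x by simp
  have nnA: "(\<integral>\<^sup>+x. ennreal (A_norm A x (?U x) powr p) \<partial>?M) = ennreal (LINT x|?M. A_norm A x (?U x) powr p)"
    by (rule nn_integral_eq_integral[OF iA]) auto
  have H: "(\<integral>\<^sup>+x. ennreal (weight_const * ?Y x + hardy_const * ?X x) \<partial>?M) \<le> ennreal (LINT x|?M. A_norm A x (?U x) powr p)"
    using hardy_inequality[OF u] unfolding nnA .
  have hX0: "0 \<le> hardy_const * ?X x" for x by (intro mult_nonneg_nonneg X0) simp
  have hY0: "AE x in ?M. 0 \<le> weight_const * ?Y x"
    using Y0 by eventually_elim (rule mult_nonneg_nonneg[OF less_imp_le[OF hcl(2)]])
  have Z0: "AE x in ?M. 0 \<le> weight_const * ?Y x + hardy_const * ?X x"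
    using hY0 by eventually_elim (rule add_nonneg_nonneg[OF _ hX0])
  have iZ: "integrable ?M (\<lambda>x. weight_const * ?Y x + hardy_const * ?X x)"
    by (rule integrableI_nonneg) (use Z0 H in \<open>auto intro: le_less_trans\<close>)
  have iX: "integrable ?M (\<lambda>x. hardy_const * ?X x)"
  proof (rule Bochner_Integration.integrable_bound[OF iZ])
    show "AE x in ?M. norm (hardy_const * ?X x) \<le> norm (weight_const * ?Y x + hardy_const * ?X x)"
      using hY0
    proof eventually_elim
      case (elim x)
      have "norm (hardy_const * ?X x) = hardy_const * ?X x" unfolding real_norm_def by (rule abs_of_nonneg[OF hX0])
      also have "\<dots> \<le> weight_const * ?Y x + hardy_const * ?X x" using elim by simp
      also have "\<dots> \<le> norm (weight_const * ?Y x + hardy_const * ?X x)" unfolding real_norm_def by (rule abs_ge_self)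
      finally show ?case .
    qed
  qed measurable
  have iY: "integrable ?M (\<lambda>x. weight_const * ?Y x)" using Bochner_Integration.integrable_diff[OF iZ iX] by simp
  have "ennreal (LINT x|?M. weight_const * ?Y x + hardy_const * ?X x) \<le> ennreal (LINT x|?M. A_norm A x (?U x) powr p)"
    using H by (subst (asm) nn_integral_eq_integral[OF iZ Z0])
  hence "(LINT x|?M. weight_const * ?Y x + hardy_const * ?X x) \<le> (LINT x|?M. A_norm A x (?U x) powr p)"
    by (subst (asm) ennreal_le_iff) (auto intro!: integral_nonneg_AE)
  hence le: "weight_const * (LINT x|?M. ?Y x) \<le> (LINT x|?M. A_norm A x (?U x) powr p) - hardy_const * (LINT x|?M. ?X x)"
    unfolding Bochner_Integration.integral_add[OF iY iX] by (simp only: integral_mult_right_zero le_diff_eq)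
  have D: "(LINT x|\<mu>. \<bar>u x\<bar> powr p / E x powr (p - 1)) = (LINT x|?M. ?Y x)" by (rule integral_\<mu>) measurable
  have "0 \<le> (LINT x|?M. ?Y x)" by (rule integral_nonneg_AE[OF Y0])
  hence "0 < (LINT x|?M. ?Y x)" using nz unfolding D by simp
  thus ?thesis unfolding D using le by (simp add: field_simps)
qed

end

section \<open>Optimality of the constants\<close>

text \<open>The first limit is the derivative of \<open>\<beta> \<mapsto> ((p - 1 + \<beta>)/p)\<^sup>p\<close> at \<open>0\<close>.\<close>

lemma power_quotient_tendsto:
  fixes p :: real assumes p: "1 < p"
  shows "(\<lambda>n. (((p - 1 + 1 / real (Suc n)) / p) powr p - ((p - 1) / p) powr p) / (1 / real (Suc n))) \<longlonglongrightarrow> ((p - 1) / p) powr (p - 1)"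
    "(\<lambda>n. ((p - 1 + 1 / real (Suc n)) / p) powr p) \<longlonglongrightarrow> ((p - 1) / p) powr p"
proof -
  let ?g = "\<lambda>b. ((p - 1 + b) / p) powr p"
  have e0: "(\<lambda>n. 1 / real (Suc n)) \<longlonglongrightarrow> 0" using LIMSEQ_inverse_real_of_nat by (simp add: inverse_eq_divide)
  have "(?g has_real_derivative (p * ((p - 1 + 0) / p) powr (p - 1)) * (1 / p)) (at 0)"
    by (rule DERIV_chain2[OF has_real_derivative_powr]) (use p in \<open>auto intro!: derivative_eq_intros\<close>)
  hence D: "(?g has_real_derivative ((p - 1) / p) powr (p - 1)) (at 0)" using p by simp
  hence "((\<lambda>b. (?g b - ?g 0) / (b - 0)) \<longlongrightarrow> ((p - 1) / p) powr (p - 1)) (at 0)"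
    unfolding has_field_derivative_iff .
  moreover have "filterlim (\<lambda>n. 1 / real (Suc n)) (at 0) sequentially"
    using e0 by (simp add: filterlim_at)
  ultimately have "(\<lambda>n. (?g (1 / real (Suc n)) - ?g 0) / (1 / real (Suc n) - 0)) \<longlonglongrightarrow> ((p - 1) / p) powr (p - 1)"
    by (rule filterlim_compose)
  thus "(\<lambda>n. (?g (1 / real (Suc n)) - ((p - 1) / p) powr p) / (1 / real (Suc n))) \<longlonglongrightarrow> ((p - 1) / p) powr (p - 1)" by simp
  have "(\<lambda>n. ?g (1 / real (Suc n))) \<longlonglongrightarrow> ((p - 1 + 0) / p) powr p"
    using p by (intro tendsto_intros e0) auto
  thus "(\<lambda>n. ?g (1 / real (Suc n))) \<longlonglongrightarrow> ((p - 1) / p) powr p" by simp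
qed

lemma nn_integral_has_bochner_integral:
  fixes g :: "'a \<Rightarrow> real"
  assumes "has_bochner_integral M g v" "\<And>x. 0 \<le> g x"
  shows "(\<integral>\<^sup>+x. ennreal (g x) \<partial>M) = ennreal v"
  using assms by (simp add: has_bochner_integral_iff nn_integral_eq_integral)

theorem theorem2p19:
  fixes \<Omega> :: "(real^'n::finite) set" and A :: "real^'n \<Rightarrow> real^'n^'n"
    and f E :: "real^'n \<Rightarrow> real" and \<mu> :: "(real^'n) measure" and p :: real
  assumes "open \<Omega>" and "connected \<Omega>" and "bounded \<Omega>" and "smooth_boundary \<Omega>"
    and "admissible_matrix \<Omega> A"
    and "1 < p" and "p \<le> real CARD('n)"
    and "smooth_up_to_boundary \<Omega> f" and "\<forall>x\<in>\<Omega>. 0 \<le> f x" and "\<exists>x\<in>\<Omega>. f x \<noteq> 0"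
    and "\<mu> = density (lebesgue_on \<Omega>) (\<lambda>x. ennreal (f x))"
    and "weak_solution p A \<Omega> \<mu> E" and "AE x in lebesgue_on \<Omega>. 0 < E x"
  shows
    "(\<forall>u\<in>W01p p \<Omega>.
        ennreal (((p - 1) / p) powr p) *
          (\<integral>\<^sup>+x. ennreal (A_norm A x (weak_grad \<Omega> E x) powr p / E x powr p * \<bar>u x\<bar> powr p) \<partial>lebesgue_on \<Omega>)
        + ennreal (((p - 1) / p) powr (p - 1)) *
          (\<integral>\<^sup>+x. ennreal (\<bar>u x\<bar> powr p / E x powr (p - 1)) \<partial>\<mu>)
        \<le> (\<integral>\<^sup>+x. ennreal (A_norm A x (weak_grad \<Omega> u x) powr p) \<partial>lebesgue_on \<Omega>))
     \<and> (\<forall>u\<in>W01p p \<Omega>.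
        ennreal (((p - 1) / p) powr p) *
          (\<integral>\<^sup>+x. ennreal (A_norm A x (weak_grad \<Omega> E x) powr p / E x powr p * \<bar>u x\<bar> powr p) \<partial>lebesgue_on \<Omega>)
        \<le> (\<integral>\<^sup>+x. ennreal (A_norm A x (weak_grad \<Omega> u x) powr p) \<partial>lebesgue_on \<Omega>))
     \<and> (zero_on_boundary p \<Omega> E \<longrightarrow>
        (\<forall>C::real. C > ((p - 1) / p) powr p \<longrightarrow>
          \<not> (\<forall>u\<in>W01p p \<Omega>.
            ennreal C *
              (\<integral>\<^sup>+x. ennreal (A_norm A x (weak_grad \<Omega> E x) powr p / E x powr p * \<bar>u x\<bar> powr p) \<partial>lebesgue_on \<Omega>)
            \<le> (\<integral>\<^sup>+x. ennreal (A_norm A x (weak_grad \<Omega> u x) powr p) \<partial>lebesgue_on \<Omega>))))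
     \<and> (zero_on_boundary p \<Omega> E \<longrightarrow>
        (INF u \<in> {u \<in> W01p p \<Omega>. \<not> (AE x in lebesgue_on \<Omega>. u x = 0) \<and>
                     (LINT x|\<mu>. \<bar>u x\<bar> powr p / E x powr (p - 1)) \<noteq> 0}.
          ereal (((LINT x|lebesgue_on \<Omega>. A_norm A x (weak_grad \<Omega> u x) powr p)
                  - ((p - 1) / p) powr p *
                    (LINT x|lebesgue_on \<Omega>. A_norm A x (weak_grad \<Omega> E x) powr p / E x powr p * \<bar>u x\<bar> powr p))
                 / (LINT x|\<mu>. \<bar>u x\<bar> powr p / E x powr (p - 1))))
        = ereal (((p - 1) / p) powr (p - 1)))"
proof -
  interpret p_equation \<Omega> A f E \<mu> p
    by unfold_locales (use assms in auto)
  let ?M = "lebesgue_on \<Omega>"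
  let ?X = "\<lambda>u x. A_norm A x (weak_grad \<Omega> E x) powr p / E x powr p * \<bar>u x\<bar> powr p"
  let ?Y = "\<lambda>u x. \<bar>u x\<bar> powr p / E x powr (p - 1)"
  let ?A = "\<lambda>u x. A_norm A x (weak_grad \<Omega> u x) powr p"
  let ?Q = "\<lambda>u. ((LINT x|?M. ?A u x) - hardy_const * (LINT x|?M. ?X u x)) / (LINT x|\<mu>. ?Y u x)"
  have i: "ennreal hardy_const * (\<integral>\<^sup>+x. ennreal (?X u x) \<partial>?M) + ennreal weight_const * (\<integral>\<^sup>+x. ennreal (?Y u x) \<partial>\<mu>)
      \<le> (\<integral>\<^sup>+x. ennreal (?A u x) \<partial>?M)" if u: "u \<in> W01p p \<Omega>" for u
  proof -
    have [measurable]: "u \<in> borel_measurable ?M"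
      using has_weak_gradient_measurable[OF open_\<Omega> W01p_weak_gradient[OF u]] by auto
    have [measurable]: "(\<lambda>x. A_norm A x (weak_grad \<Omega> E x)) \<in> borel_measurable ?M" using N_measurable unfolding G_def .
    have "(\<integral>\<^sup>+x. ennreal (?Y u x) \<partial>\<mu>) = (\<integral>\<^sup>+x. ennreal (f x) * ennreal (?Y u x) \<partial>?M)"
      by (rule nn_integral_\<mu>) measurable
    hence "ennreal hardy_const * (\<integral>\<^sup>+x. ennreal (?X u x) \<partial>?M) + ennreal weight_const * (\<integral>\<^sup>+x. ennreal (?Y u x) \<partial>\<mu>)
      = (\<integral>\<^sup>+x. ennreal weight_const * (ennreal (f x) * ennreal (?Y u x)) + ennreal hardy_const * ennreal (?X u x) \<partial>?M)"
      by (simp add: nn_integral_add nn_integral_cmult add.commute)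
    also have "\<dots> = (\<integral>\<^sup>+x. ennreal (weight_const * (f x * ?Y u x) + hardy_const * ?X u x) \<partial>?M)"
    proof (rule nn_integral_cong)
      fix x assume "x \<in> space ?M"
      hence fx: "0 \<le> f x" using f_nonneg by simp
      have gen: "ennreal weight_const * (ennreal a * ennreal b) + ennreal hardy_const * ennreal c = ennreal (weight_const * (a * b) + hardy_const * c)"
        if "0 \<le> a" "0 \<le> b" "0 \<le> c" for a b c :: real
        using that by (simp add: ennreal_mult')
      show "ennreal weight_const * (ennreal (f x) * ennreal (?Y u x)) + ennreal hardy_const * ennreal (?X u x) = ennreal (weight_const * (f x * ?Y u x) + hardy_const * ?X u x)"
        by (rule gen[OF fx]) auto
    qed
    also have "\<dots> \<le> (\<integral>\<^sup>+x. ennreal (?A u x) \<partial>?M)" using hardy_inequality[OF u] unfolding G_def .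
    finally show ?thesis .
  qed
  have ii: "ennreal hardy_const * (\<integral>\<^sup>+x. ennreal (?X u x) \<partial>?M) \<le> (\<integral>\<^sup>+x. ennreal (?A u x) \<partial>?M)" if "u \<in> W01p p \<Omega>" for u
    using i[OF that] by (rule order_trans[rotated]) simp
  have opt: "\<exists>u T. u \<in> W01p p \<Omega> \<and> 0 < T \<and> has_bochner_integral ?M (?A u) (((p - 1 + \<beta>) / p) powr p * T) \<and>
      has_bochner_integral ?M (?X u) T \<and> (LINT x|\<mu>. ?Y u x) = \<beta> * T"
    if z: "zero_on_boundary p \<Omega> E" and \<beta>: "0 < \<beta>" "\<beta> \<le> 1" for \<beta>
    by (rule near_optimal_function[OF z assms(10) \<beta>, unfolded G_def]) blast
  have iii: "\<not> (\<forall>u\<in>W01p p \<Omega>. ennreal C * (\<integral>\<^sup>+x. ennreal (?X u x) \<partial>?M) \<le> (\<integral>\<^sup>+x. ennreal (?A u x) \<partial>?M))"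
    if z: "zero_on_boundary p \<Omega> E" and C: "C > hardy_const" for C
  proof
    assume H: "\<forall>u\<in>W01p p \<Omega>. ennreal C * (\<integral>\<^sup>+x. ennreal (?X u x) \<partial>?M) \<le> (\<integral>\<^sup>+x. ennreal (?A u x) \<partial>?M)"
    have C0: "0 \<le> C" using C powr_ge_zero[of "(p - 1) / p" p] by linarith
    have "C \<le> ((p - 1 + 1 / real (Suc n)) / p) powr p" for n
    proof -
      define b where "b = 1 / real (Suc n)"
      have b: "0 < b" "b \<le> 1" by (auto simp: b_def)
      obtain u T where u: "u \<in> W01p p \<Omega>" "0 < T" "has_bochner_integral ?M (?A u) (((p - 1 + b) / p) powr p * T)"
        "has_bochner_integral ?M (?X u) T"
        using opt[OF z b] by blast
      have "ennreal C * (\<integral>\<^sup>+x. ennreal (?X u x) \<partial>?M) \<le> (\<integral>\<^sup>+x. ennreal (?A u x) \<partial>?M)" by (rule bspec[OF H u(1)])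
      hence "ennreal C * ennreal T \<le> ennreal (((p - 1 + b) / p) powr p * T)"
        by (subst (asm) nn_integral_has_bochner_integral[OF u(3)], simp)
           (subst (asm) nn_integral_has_bochner_integral[OF u(4)], simp)
      hence "ennreal (C * T) \<le> ennreal (((p - 1 + b) / p) powr p * T)" using C0 by (simp only: ennreal_mult')
      hence "C * T \<le> ((p - 1 + b) / p) powr p * T" using u(2) by (subst (asm) ennreal_le_iff) auto
      hence "C \<le> ((p - 1 + b) / p) powr p" using u(2) by (simp only: mult_le_cancel_right_pos)
      thus ?thesis by (simp only: b_def)
    qed
    hence "C \<le> hardy_const" by (intro LIMSEQ_le_const[OF power_quotient_tendsto(2)[OF p]]) auto
    with C show False by simp
  qed
  have iv: "(INF u \<in> {u \<in> W01p p \<Omega>. \<not> (AE x in ?M. u x = 0) \<and> (LINT x|\<mu>. ?Y u x) \<noteq> 0}. ereal (?Q u)) = ereal weight_const"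
    if z: "zero_on_boundary p \<Omega> E"
  proof (rule antisym)
    let ?S = "{u \<in> W01p p \<Omega>. \<not> (AE x in ?M. u x = 0) \<and> (LINT x|\<mu>. ?Y u x) \<noteq> 0}"
    show "ereal weight_const \<le> (INF u \<in> ?S. ereal (?Q u))"
    proof (rule INF_greatest)
      fix u assume "u \<in> ?S"
      thus "ereal weight_const \<le> ereal (?Q u)" using hardy_lower_bound[of u, unfolded G_def] by simp
    qed
    have le: "(INF u \<in> ?S. ereal (?Q u)) \<le> ereal ((((p - 1 + 1 / real (Suc n)) / p) powr p - hardy_const) / (1 / real (Suc n)))" for n
    proof -
      define b where "b = 1 / real (Suc n)"
      have b: "0 < b" "b \<le> 1" by (auto simp: b_def)
      obtain u T where u: "u \<in> W01p p \<Omega>" "0 < T" "has_bochner_integral ?M (?A u) (((p - 1 + b) / p) powr p * T)"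
        "has_bochner_integral ?M (?X u) T" "(LINT x|\<mu>. ?Y u x) = b * T"
        using opt[OF z b] by blast
      have nz: "(LINT x|\<mu>. ?Y u x) \<noteq> 0" using u(2,5) b by simp
      have "\<not> (AE x in ?M. u x = 0)"
      proof
        assume ae: "AE x in ?M. u x = 0"
        have "AE x in ?M. ?X u x = 0" using ae by eventually_elim (use p in simp)
        hence "(LINT x|?M. ?X u x) = 0" by (rule integral_eq_zero_AE)
        with u(2,4) show False by (simp add: has_bochner_integral_iff)
      qed
      hence "u \<in> ?S" using u(1) nz by simp
      hence "(INF u \<in> ?S. ereal (?Q u)) \<le> ereal (?Q u)" by (rule INF_lower)
      also have "?Q u = (((p - 1 + b) / p) powr p * T - hardy_const * T) / (b * T)"
        using u(3-5) by (simp add: has_bochner_integral_iff)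
      also have "\<dots> = (((p - 1 + b) / p) powr p - hardy_const) / b" using u(2) b by (simp add: left_diff_distrib[symmetric])
      finally show ?thesis unfolding b_def .
    qed
    have "(\<lambda>n. ereal ((((p - 1 + 1 / real (Suc n)) / p) powr p - hardy_const) / (1 / real (Suc n)))) \<longlonglongrightarrow> ereal weight_const"
      using power_quotient_tendsto(1)[OF p] by (intro tendsto_intros)
    thus "(INF u \<in> ?S. ereal (?Q u)) \<le> ereal weight_const" by (rule LIMSEQ_le_const) (use le in blast)
  qed
  show ?thesis using i ii iii iv by blast
qed

end
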